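(* Let $\alpha$ be a regular cardinal, let $\mathcal T$ be an $\alpha$-compactly generated triangulated category, and take $\mathcal C=\mathcal T^\alpha$. Then $\mathcal T$ satisfies $\mathrm{ARM}_\alpha$ if and only if $S_\alpha(X)$ has projective dimension $\le1$ in $\mathrm{Mod}_\alpha(\mathcal T^\alpha)$ for all $X$ in $\mathcal T$.
   Context: In a triangulated category $\mathcal T$ with coproducts, an object $S$ is $\alpha$-small if any morphism $S\to\coprod_{i\in I}X_i$ factors through $\coprod_{i\in I'}X_i$ for some $I'\subset I$ with $\mathrm{card}\,I'<\alpha$. $\mathcal T$ is $\alpha$-compactly generated if there is a set $\mathcal S$ of $\alpha$-small objects such that (a) $X=0$ if and only if $\mathcal T(S,X)=0$ for all $S\in\mathcal S$, and (b) for every set $\{f_i\colon X_i\to Y_i\}_{i\in I}$ of morphisms such that $\mathcal T(S,f_i)$ is surjective for all $i\in I$, $S\in\mathcal S$, the map $\mathcal T(S,\coprod_if_i)$ is surjective for all $S\in\mathcal S$. $\mathcal T^\alpha$ is the unique maximal full subcategory formed by $\alpha$-small objects such that any morphism $S\to\coprod_{i\in I}X_i$ with $S\in\mathcal T^\alpha$ factors through a coproduct $\coprod_if_i\colon\coprod_iS_i\to\coprod_iX_i$ with all $S_i\in\mathcal T^\alpha$; it is an essentially small triangulated subcategory closed under coproducts of $<\alpha$ objects. Throughout $\mathcal T\neq0$. $\mathrm{Mod}_\alpha(\mathcal T^\alpha)$ is the abelian category of functors $(\mathcal T^\alpha)^{\mathrm{op}}\to\mathrm{Ab}$ preserving products of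 fewer than $\alpha$ objects, and $S_\alpha\colon\mathcal T\to\mathrm{Mod}_\alpha(\mathcal T^\alpha)$ is $S_\alpha(X)=\mathcal T(-,X)|_{\mathcal T^\alpha}$. $\mathrm{ARM}_\alpha$: any natural transformation $\tau\colon\mathcal T(-,X)|_{\mathcal T^\alpha}\to\mathcal T(-,Y)|_{\mathcal T^\alpha}$ is of the form $\mathcal T(-,f)|_{\mathcal T^\alpha}$ for some $f\colon X\to Y$ in $\mathcal T$. *)

theory Defs
  imports "HOL-Algebra.Product_Groups"
begin

unbundle cardinal_syntax

section \<open>Smallness\<close>

text \<open>
  The distinction between sets and classes is rendered by a universe: a type \<^typ>\<open>'u\<close> whose
  cardinality is strongly inaccessible. A set of any type is small if it has fewer elements
  than \<^typ>\<open>'u\<close>. Up to bijection every small set is a subset of \<^typ>\<open>'u\<close>, so small families are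
  indexed by small sets of type \<^typ>\<open>'u set\<close>, and a small cardinal is a relation on \<^typ>\<open>'u\<close>.
\<close>

definition small :: "'u itself \<Rightarrow> 'a set \<Rightarrow> bool" where
  "small U A \<longleftrightarrow> |A| <o |UNIV :: 'u set|"

definition universe :: "'u itself \<Rightarrow> bool" where
  "universe U \<longleftrightarrow>
     natLeq <o |UNIV :: 'u set| \<and>
     regularCard |UNIV :: 'u set| \<and>
     (\<forall>A :: 'u set. small U A \<longrightarrow> small U (Pow A))"

definition regular_cardinal :: "'u rel \<Rightarrow> bool" where
  "regular_cardinal \<alpha> \<longleftrightarrow> Card_order \<alpha> \<and> cinfinite \<alpha> \<and> regularCard \<alpha>"


section \<open>Categories\<close>

text \<open>
  The morphism sets between objects are disjoint; \<open>Cmp C g f\<close> is composition in the usual order.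
\<close>

record ('o, 'm) category =
  Ob :: "'o set"
  Hom :: "'o \<Rightarrow> 'o \<Rightarrow> 'm set"
  Idt :: "'o \<Rightarrow> 'm"
  Cmp :: "'m \<Rightarrow> 'm \<Rightarrow> 'm"  (infixr \<open>\<cdot>\<index>\<close> 75)

locale category =
  fixes C :: "('o, 'm, 'z) category_scheme" (structure)
  assumes Hom_disjoint:
    "\<lbrakk>X \<in> Ob C; Y \<in> Ob C; X' \<in> Ob C; Y' \<in> Ob C; f \<in> Hom C X Y; f \<in> Hom C X' Y'\<rbrakk>
       \<Longrightarrow> X = X' \<and> Y = Y'"
  assumes Idt_closed: "X \<in> Ob C \<Longrightarrow> Idt C X \<in> Hom C X X"
  assumes Cmp_closed:
    "\<lbrakk>X \<in> Ob C; Y \<in> Ob C; Z \<in> Ob C; f \<in> Hom C X Y; g \<in> Hom C Y Z\<rbrakk> \<Longrightarrow> g \<cdot> f \<in> Hom C X Z"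
  assumes Cmp_assoc:
    "\<lbrakk>W \<in> Ob C; X \<in> Ob C; Y \<in> Ob C; Z \<in> Ob C; f \<in> Hom C W X; g \<in> Hom C X Y; h \<in> Hom C Y Z\<rbrakk>
       \<Longrightarrow> (h \<cdot> g) \<cdot> f = h \<cdot> (g \<cdot> f)"
  assumes Cmp_Idt_left: "\<lbrakk>X \<in> Ob C; Y \<in> Ob C; f \<in> Hom C X Y\<rbrakk> \<Longrightarrow> Idt C Y \<cdot> f = f"
  assumes Cmp_Idt_right: "\<lbrakk>X \<in> Ob C; Y \<in> Ob C; f \<in> Hom C X Y\<rbrakk> \<Longrightarrow> f \<cdot> Idt C X = f"

definition locally_small :: "'u itself \<Rightarrow> ('o, 'm, 'z) category_scheme \<Rightarrow> bool" where
  "locally_small U C \<longleftrightarrow> (\<forall>X\<in>Ob C. \<forall>Y\<in>Ob C. small U (Hom C X Y))"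

definition full_subcategory ::
    "('o, 'm, 'z) category_scheme \<Rightarrow> 'o set \<Rightarrow> ('o, 'm, 'z) category_scheme" where
  "full_subcategory C P = C\<lparr>Ob := P\<rparr>"

definition is_iso :: "('o, 'm, 'z) category_scheme \<Rightarrow> 'o \<Rightarrow> 'o \<Rightarrow> 'm \<Rightarrow> bool" where
  "is_iso C X Y f \<longleftrightarrow> f \<in> Hom C X Y \<and>
     (\<exists>g\<in>Hom C Y X. g \<cdot>\<^bsub>C\<^esub> f = Idt C X \<and> f \<cdot>\<^bsub>C\<^esub> g = Idt C Y)"

definition is_epi :: "('o, 'm, 'z) category_scheme \<Rightarrow> 'o \<Rightarrow> 'o \<Rightarrow> 'm \<Rightarrow> bool" where
  "is_epi C X Y e \<longleftrightarrow> e \<in> Hom C X Y \<and>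
     (\<forall>Z\<in>Ob C. \<forall>g\<in>Hom C Y Z. \<forall>h\<in>Hom C Y Z. g \<cdot>\<^bsub>C\<^esub> e = h \<cdot>\<^bsub>C\<^esub> e \<longrightarrow> g = h)"

definition is_zero_object :: "('o, 'm, 'z) category_scheme \<Rightarrow> 'o \<Rightarrow> bool" where
  "is_zero_object C Z \<longleftrightarrow> Z \<in> Ob C \<and>
     (\<forall>X\<in>Ob C. (\<exists>!f. f \<in> Hom C X Z) \<and> (\<exists>!f. f \<in> Hom C Z X))"

text \<open>\<open>is_coproduct C I X Q \<iota>\<close>: \<open>Q\<close> with the maps \<open>\<iota> i : X i \<rightarrow> Q\<close> is a coproduct of \<open>X i\<close>, \<open>i \<in> I\<close>.\<close>

definition is_coproduct ::
    "('o, 'm, 'z) category_scheme \<Rightarrow> 'i set \<Rightarrow> ('i \<Rightarrow> 'o) \<Rightarrow> 'o \<Rightarrow> ('i \<Rightarrow> 'm) \<Rightarrow> bool" where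
  "is_coproduct C I X Q \<iota> \<longleftrightarrow> Q \<in> Ob C \<and> (\<forall>i\<in>I. X i \<in> Ob C \<and> \<iota> i \<in> Hom C (X i) Q) \<and>
     (\<forall>Z\<in>Ob C. \<forall>t. (\<forall>i\<in>I. t i \<in> Hom C (X i) Z) \<longrightarrow>
        (\<exists>!h. h \<in> Hom C Q Z \<and> (\<forall>i\<in>I. h \<cdot>\<^bsub>C\<^esub> \<iota> i = t i)))"

text \<open>
  For coproducts \<open>(P, \<iota>)\<close> of \<open>X i\<close> and \<open>(Q, \<kappa>)\<close> of \<open>Y i\<close>, \<open>i \<in> I\<close>, the unique \<open>m\<close> with
  \<open>is_coproduct_map C I P \<iota> Q \<kappa> f m\<close> is the coproduct of the maps \<open>f i : X i \<rightarrow> Y i\<close>.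
\<close>

definition is_coproduct_map ::
    "('o, 'm, 'z) category_scheme \<Rightarrow> 'i set \<Rightarrow> 'o \<Rightarrow> ('i \<Rightarrow> 'm) \<Rightarrow> 'o \<Rightarrow> ('i \<Rightarrow> 'm) \<Rightarrow>
       ('i \<Rightarrow> 'm) \<Rightarrow> 'm \<Rightarrow> bool" where
  "is_coproduct_map C I P \<iota> Q \<kappa> f m \<longleftrightarrow>
     m \<in> Hom C P Q \<and> (\<forall>i\<in>I. m \<cdot>\<^bsub>C\<^esub> \<iota> i = \<kappa> i \<cdot>\<^bsub>C\<^esub> f i)"

definition has_small_coproducts :: "'u itself \<Rightarrow> ('o, 'm, 'z) category_scheme \<Rightarrow> bool" where
  "has_small_coproducts U C \<longleftrightarrow>
     (\<forall>(I :: 'u set) X. small U I \<longrightarrow> (\<forall>i\<in>I. X i \<in> Ob C) \<longrightarrow> (\<exists>Q \<iota>. is_coproduct C I X Q \<iota>))"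


section \<open>Additive categories\<close>

record ('o, 'm) preadditive = "('o, 'm) category" +
  Add :: "'m \<Rightarrow> 'm \<Rightarrow> 'm"
  Zero :: "'o \<Rightarrow> 'o \<Rightarrow> 'm"

definition hom_group :: "('o, 'm, 'z) preadditive_scheme \<Rightarrow> 'o \<Rightarrow> 'o \<Rightarrow> 'm monoid" where
  "hom_group C X Y = \<lparr>carrier = Hom C X Y, monoid.mult = Add C, one = Zero C X Y\<rparr>"

definition neg :: "('o, 'm, 'z) preadditive_scheme \<Rightarrow> 'o \<Rightarrow> 'o \<Rightarrow> 'm \<Rightarrow> 'm" where
  "neg C X Y f = inv\<^bsub>hom_group C X Y\<^esub> f"

locale preadditive = category C for C :: "('o, 'm, 'z) preadditive_scheme" (structure) +
  assumes hom_group: "\<lbrakk>X \<in> Ob C; Y \<in> Ob C\<rbrakk> \<Longrightarrow> comm_group (hom_group C X Y)"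
  assumes Cmp_Add_left:
    "\<lbrakk>X \<in> Ob C; Y \<in> Ob C; Z \<in> Ob C; f \<in> Hom C X Y; g \<in> Hom C Y Z; g' \<in> Hom C Y Z\<rbrakk>
       \<Longrightarrow> Add C g g' \<cdot> f = Add C (g \<cdot> f) (g' \<cdot> f)"
  assumes Cmp_Add_right:
    "\<lbrakk>X \<in> Ob C; Y \<in> Ob C; Z \<in> Ob C; f \<in> Hom C X Y; f' \<in> Hom C X Y; g \<in> Hom C Y Z\<rbrakk>
       \<Longrightarrow> g \<cdot> Add C f f' = Add C (g \<cdot> f) (g \<cdot> f')"

locale additive = preadditive +
  assumes zero_object: "\<exists>Z. is_zero_object C Z"
  assumes binary_coproduct: "\<lbrakk>X \<in> Ob C; Y \<in> Ob C\<rbrakk>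
    \<Longrightarrow> \<exists>Q \<iota>. is_coproduct C (UNIV :: bool set) (\<lambda>b. if b then X else Y) Q \<iota>"

definition is_kernel ::
    "('o, 'm, 'z) preadditive_scheme \<Rightarrow> 'o \<Rightarrow> 'm \<Rightarrow> 'o \<Rightarrow> 'm \<Rightarrow> 'o \<Rightarrow> bool" where
  "is_kernel C K k X f Y \<longleftrightarrow>
     K \<in> Ob C \<and> k \<in> Hom C K X \<and> f \<in> Hom C X Y \<and> f \<cdot>\<^bsub>C\<^esub> k = Zero C K Y \<and>
     (\<forall>W\<in>Ob C. \<forall>g\<in>Hom C W X. f \<cdot>\<^bsub>C\<^esub> g = Zero C W Y \<longrightarrow> (\<exists>!h. h \<in> Hom C W K \<and> k \<cdot>\<^bsub>C\<^esub> h = g))"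

definition is_cokernel ::
    "('o, 'm, 'z) preadditive_scheme \<Rightarrow> 'o \<Rightarrow> 'm \<Rightarrow> 'o \<Rightarrow> 'm \<Rightarrow> 'o \<Rightarrow> bool" where
  "is_cokernel C X f Y q Q \<longleftrightarrow>
     Q \<in> Ob C \<and> f \<in> Hom C X Y \<and> q \<in> Hom C Y Q \<and> q \<cdot>\<^bsub>C\<^esub> f = Zero C X Q \<and>
     (\<forall>W\<in>Ob C. \<forall>g\<in>Hom C Y W. g \<cdot>\<^bsub>C\<^esub> f = Zero C X W \<longrightarrow> (\<exists>!h. h \<in> Hom C Q W \<and> h \<cdot>\<^bsub>C\<^esub> q = g))"

definition short_exact ::
    "('o, 'm, 'z) preadditive_scheme \<Rightarrow> 'o \<Rightarrow> 'm \<Rightarrow> 'o \<Rightarrow> 'm \<Rightarrow> 'o \<Rightarrow> bool" where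
  "short_exact A K i P p M \<longleftrightarrow> is_kernel A K i P p M \<and> is_cokernel A K i P p M"

definition projective :: "('o, 'm, 'z) category_scheme \<Rightarrow> 'o \<Rightarrow> bool" where
  "projective A P \<longleftrightarrow> P \<in> Ob A \<and>
     (\<forall>M\<in>Ob A. \<forall>N\<in>Ob A. \<forall>e f. is_epi A M N e \<longrightarrow> f \<in> Hom A P N \<longrightarrow>
        (\<exists>g\<in>Hom A P M. e \<cdot>\<^bsub>A\<^esub> g = f))"

text \<open>
  \<open>projdim_le A n M\<close>: \<open>M\<close> has a projective resolution \<open>0 \<rightarrow> P\<^sub>n \<rightarrow> \<dots> \<rightarrow> P\<^sub>0 \<rightarrow> M \<rightarrow> 0\<close>, cut into short
  exact sequences. This is meant for abelian categories \<open>A\<close>.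
\<close>

primrec projdim_le :: "('o, 'm, 'z) preadditive_scheme \<Rightarrow> nat \<Rightarrow> 'o \<Rightarrow> bool" where
  "projdim_le A 0 M \<longleftrightarrow> projective A M"
| "projdim_le A (Suc n) M \<longleftrightarrow>
     M \<in> Ob A \<and> (\<exists>P K i p. projective A P \<and> short_exact A K i P p M \<and> projdim_le A n K)"


section \<open>Triangulated categories\<close>

text \<open>
  The suspension is an additive self-equivalence, given by \<open>ShO\<close> on objects and \<open>ShA\<close> on morphisms.
  \<open>Tri T f g h\<close> says that \<open>X \<rightarrow> Y \<rightarrow> Z \<rightarrow> \<Sigma>X\<close> with these morphisms is an exact triangle; the
  objects are determined by the morphisms.
\<close>

record ('o, 'm) triangulated = "('o, 'm) preadditive" +
  ShO :: "'o \<Rightarrow> 'o"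
  ShA :: "'m \<Rightarrow> 'm"
  Tri :: "'m \<Rightarrow> 'm \<Rightarrow> 'm \<Rightarrow> bool"

definition candidate_triangle ::
    "('o, 'm, 'z) triangulated_scheme \<Rightarrow> 'o \<Rightarrow> 'o \<Rightarrow> 'o \<Rightarrow> 'm \<Rightarrow> 'm \<Rightarrow> 'm \<Rightarrow> bool" where
  "candidate_triangle T X Y Z f g h \<longleftrightarrow> X \<in> Ob T \<and> Y \<in> Ob T \<and> Z \<in> Ob T \<and>
     f \<in> Hom T X Y \<and> g \<in> Hom T Y Z \<and> h \<in> Hom T Z (ShO T X)"

definition exact_triangle ::
    "('o, 'm, 'z) triangulated_scheme \<Rightarrow> 'o \<Rightarrow> 'o \<Rightarrow> 'o \<Rightarrow> 'm \<Rightarrow> 'm \<Rightarrow> 'm \<Rightarrow> bool" where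
  "exact_triangle T X Y Z f g h \<longleftrightarrow> candidate_triangle T X Y Z f g h \<and> Tri T f g h"

locale triangulated = additive T for T :: "('o, 'm, 'z) triangulated_scheme" (structure) +
  assumes ShO_closed: "X \<in> Ob T \<Longrightarrow> ShO T X \<in> Ob T"
  assumes ShA_Idt: "X \<in> Ob T \<Longrightarrow> ShA T (Idt T X) = Idt T (ShO T X)"
  assumes ShA_Cmp:
    "\<lbrakk>X \<in> Ob T; Y \<in> Ob T; Z \<in> Ob T; f \<in> Hom T X Y; g \<in> Hom T Y Z\<rbrakk>
       \<Longrightarrow> ShA T (g \<cdot> f) = ShA T g \<cdot> ShA T f"
  assumes ShA_Add:
    "\<lbrakk>X \<in> Ob T; Y \<in> Ob T; f \<in> Hom T X Y; f' \<in> Hom T X Y\<rbrakk>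
       \<Longrightarrow> ShA T (Add T f f') = Add T (ShA T f) (ShA T f')"
  assumes ShA_fully_faithful:
    "\<lbrakk>X \<in> Ob T; Y \<in> Ob T\<rbrakk> \<Longrightarrow> bij_betw (ShA T) (Hom T X Y) (Hom T (ShO T X) (ShO T Y))"
  assumes ShO_essentially_surjective:
    "Y \<in> Ob T \<Longrightarrow> \<exists>X\<in>Ob T. \<exists>f. is_iso T (ShO T X) Y f"
  assumes triangle_iso:
    "\<lbrakk>exact_triangle T X Y Z f g h; candidate_triangle T X' Y' Z' f' g' h';
      is_iso T X X' a; is_iso T Y Y' b; is_iso T Z Z' c;
      b \<cdot> f = f' \<cdot> a; c \<cdot> g = g' \<cdot> b; ShA T a \<cdot> h = h' \<cdot> c\<rbrakk>
       \<Longrightarrow> exact_triangle T X' Y' Z' f' g' h'"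
  assumes triangle_Idt:
    "\<lbrakk>X \<in> Ob T; is_zero_object T Z\<rbrakk>
       \<Longrightarrow> exact_triangle T X X Z (Idt T X) (Zero T X Z) (Zero T Z (ShO T X))"
  assumes triangle_exists:
    "\<lbrakk>X \<in> Ob T; Y \<in> Ob T; f \<in> Hom T X Y\<rbrakk> \<Longrightarrow> \<exists>Z g h. exact_triangle T X Y Z f g h"
  assumes triangle_rotate:
    "candidate_triangle T X Y Z f g h \<Longrightarrow>
       exact_triangle T X Y Z f g h \<longleftrightarrow>
       exact_triangle T Y Z (ShO T X) g h (neg T (ShO T X) (ShO T Y) (ShA T f))"
  assumes triangle_fill:
    "\<lbrakk>exact_triangle T X Y Z f g h; exact_triangle T X' Y' Z' f' g' h';
      a \<in> Hom T X X'; b \<in> Hom T Y Y'; b \<cdot> f = f' \<cdot> a\<rbrakk>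
       \<Longrightarrow> \<exists>c\<in>Hom T Z Z'. c \<cdot> g = g' \<cdot> b \<and> ShA T a \<cdot> h = h' \<cdot> c"
  assumes octahedral:
    "\<lbrakk>exact_triangle T X Y A f u v; exact_triangle T Y Z B g u' v';
      exact_triangle T X Z C (g \<cdot> f) u'' v''\<rbrakk>
       \<Longrightarrow> \<exists>a b. exact_triangle T A C B a b (ShA T u \<cdot> v') \<and>
             a \<cdot> u = u'' \<cdot> g \<and> v'' \<cdot> a = v \<and> b \<cdot> u'' = u' \<and> v' \<cdot> b = ShA T f \<cdot> v''"


section \<open>Well generation\<close>

definition alpha_small :: "'u rel \<Rightarrow> ('o, 'm, 'z) category_scheme \<Rightarrow> 'o \<Rightarrow> bool" where
  "alpha_small \<alpha> T S \<longleftrightarrow> S \<in> Ob T \<and>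
     (\<forall>(I :: 'u set) X Q \<iota> f. small TYPE('u) I \<longrightarrow> is_coproduct T I X Q \<iota> \<longrightarrow> f \<in> Hom T S Q \<longrightarrow>
        (\<exists>J Q' \<kappa> m g. J \<subseteq> I \<and> |J| <o \<alpha> \<and> is_coproduct T J X Q' \<kappa> \<and>
           m \<in> Hom T Q' Q \<and> (\<forall>i\<in>J. m \<cdot>\<^bsub>T\<^esub> \<kappa> i = \<iota> i) \<and> g \<in> Hom T S Q' \<and> f = m \<cdot>\<^bsub>T\<^esub> g))"

definition hom_surjective :: "('o, 'm, 'z) category_scheme \<Rightarrow> 'o \<Rightarrow> 'o \<Rightarrow> 'o \<Rightarrow> 'm \<Rightarrow> bool" where
  "hom_surjective T S X Y f \<longleftrightarrow> (\<lambda>h. f \<cdot>\<^bsub>T\<^esub> h) ` Hom T S X = Hom T S Y"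

definition alpha_compactly_generated ::
    "'u rel \<Rightarrow> ('o, 'm, 'z) preadditive_scheme \<Rightarrow> bool" where
  "alpha_compactly_generated \<alpha> T \<longleftrightarrow>
     (\<exists>\<S>. small TYPE('u) \<S> \<and> (\<forall>S\<in>\<S>. alpha_small \<alpha> T S) \<and>
        (\<forall>X\<in>Ob T. is_zero_object T X \<longleftrightarrow> (\<forall>S\<in>\<S>. Hom T S X = {Zero T S X})) \<and>
        (\<forall>(I :: 'u set) X Y f P \<iota> Q \<kappa> m.
           small TYPE('u) I \<longrightarrow> (\<forall>i\<in>I. f i \<in> Hom T (X i) (Y i)) \<longrightarrow>
           is_coproduct T I X P \<iota> \<longrightarrow> is_coproduct T I Y Q \<kappa> \<longrightarrow>
           is_coproduct_map T I P \<iota> Q \<kappa> f m \<longrightarrow>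
           (\<forall>S\<in>\<S>. \<forall>i\<in>I. hom_surjective T S (X i) (Y i) (f i)) \<longrightarrow>
           (\<forall>S\<in>\<S>. hom_surjective T S P Q m)))"

definition alpha_perfect_class :: "'u rel \<Rightarrow> ('o, 'm, 'z) category_scheme \<Rightarrow> 'o set \<Rightarrow> bool" where
  "alpha_perfect_class \<alpha> T P \<longleftrightarrow> (\<forall>S\<in>P. alpha_small \<alpha> T S) \<and>
     (\<forall>S\<in>P. \<forall>(I :: 'u set) X Q \<iota> g.
        small TYPE('u) I \<longrightarrow> is_coproduct T I X Q \<iota> \<longrightarrow> g \<in> Hom T S Q \<longrightarrow>
        (\<exists>Y f Q' \<kappa> m h. (\<forall>i\<in>I. Y i \<in> P \<and> f i \<in> Hom T (Y i) (X i)) \<and>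
           is_coproduct T I Y Q' \<kappa> \<and> is_coproduct_map T I Q' \<kappa> Q \<iota> f m \<and>
           h \<in> Hom T S Q' \<and> g = m \<cdot>\<^bsub>T\<^esub> h))"

text \<open>The objects of \<open>T\<^sup>\<alpha>\<close>.\<close>

definition alpha_objects :: "'u rel \<Rightarrow> ('o, 'm, 'z) category_scheme \<Rightarrow> 'o set" where
  "alpha_objects \<alpha> T = \<Union> {P. alpha_perfect_class \<alpha> T P}"

lemma alpha_objects_perfect: "alpha_perfect_class \<alpha> T (alpha_objects \<alpha> T)"
proof -
  have 1: "P \<subseteq> alpha_objects \<alpha> T" if "alpha_perfect_class \<alpha> T P" for P
    using that by (auto simp: alpha_objects_def)
  show ?thesis
    unfolding alpha_perfect_class_def
  proof (intro conjI ballI allI impI)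
    fix S assume "S \<in> alpha_objects \<alpha> T"
    then show "alpha_small \<alpha> T S"
      by (auto simp: alpha_objects_def alpha_perfect_class_def)
  next
    fix S and I :: "'a set" and X Q \<iota> g
    assume S: "S \<in> alpha_objects \<alpha> T"
      and I: "small TYPE('a) I" "is_coproduct T I X Q \<iota>" "g \<in> Hom T S Q"
    from S obtain P where P: "S \<in> P" "alpha_perfect_class \<alpha> T P"
      by (auto simp: alpha_objects_def)
    from P I obtain Y f Q' \<kappa> m h where "\<forall>i\<in>I. Y i \<in> P \<and> f i \<in> Hom T (Y i) (X i)"
        and Q': "is_coproduct T I Y Q' \<kappa>" "is_coproduct_map T I Q' \<kappa> Q \<iota> f m"
          "h \<in> Hom T S Q'" "g = m \<cdot>\<^bsub>T\<^esub> h"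
      unfolding alpha_perfect_class_def by metis
    then have "\<forall>i\<in>I. Y i \<in> alpha_objects \<alpha> T \<and> f i \<in> Hom T (Y i) (X i)"
      using 1[OF P(2)] by blast
    with Q' show "\<exists>Y f Q' \<kappa> m h. (\<forall>i\<in>I. Y i \<in> alpha_objects \<alpha> T \<and> f i \<in> Hom T (Y i) (X i)) \<and>
           is_coproduct T I Y Q' \<kappa> \<and> is_coproduct_map T I Q' \<kappa> Q \<iota> f m \<and>
           h \<in> Hom T S Q' \<and> g = m \<cdot>\<^bsub>T\<^esub> h"
      by blast
  qed
qed

lemma alpha_objects_greatest:
  "alpha_perfect_class \<alpha> T P \<Longrightarrow> P \<subseteq> alpha_objects \<alpha> T"
  by (auto simp: alpha_objects_def)

definition alpha_subcategory ::
    "'u rel \<Rightarrow> ('o, 'm, 'z) category_scheme \<Rightarrow> ('o, 'm, 'z) category_scheme" where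
  "alpha_subcategory \<alpha> T = full_subcategory T (alpha_objects \<alpha> T)"


section \<open>Modules\<close>

text \<open>
  Small abelian groups are represented by those with a small carrier of type \<^typ>\<open>'m set\<close>, where
  \<^typ>\<open>'m\<close> is the type of morphisms, so that \<open>T(-,X)\<close> needs no transport. This loses nothing:
  in a category with small coproducts and a nonzero object there are at least as many morphisms as
  elements of \<^typ>\<open>'u\<close>, so every small abelian group is isomorphic to one of these.
\<close>

record ('o, 'm) presheaf =
  PO :: "'o \<Rightarrow> 'm monoid"
  PA :: "'m \<Rightarrow> 'm \<Rightarrow> 'm"

definition ab_presheaf ::
    "'u itself \<Rightarrow> ('o, 'm, 'z) category_scheme \<Rightarrow> ('o, 'm) presheaf \<Rightarrow> bool" where
  "ab_presheaf U C F \<longleftrightarrow>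
     (\<forall>X\<in>Ob C. comm_group (PO F X) \<and> small U (carrier (PO F X))) \<and>
     (\<forall>X\<in>Ob C. \<forall>Y\<in>Ob C. \<forall>f\<in>Hom C X Y. PA F f \<in> hom (PO F Y) (PO F X)) \<and>
     (\<forall>X\<in>Ob C. \<forall>x\<in>carrier (PO F X). PA F (Idt C X) x = x) \<and>
     (\<forall>X\<in>Ob C. \<forall>Y\<in>Ob C. \<forall>Z\<in>Ob C. \<forall>f\<in>Hom C X Y. \<forall>g\<in>Hom C Y Z. \<forall>x\<in>carrier (PO F Z).
        PA F (g \<cdot>\<^bsub>C\<^esub> f) x = PA F f (PA F g x))"

text \<open>Products in the opposite category are coproducts in \<open>C\<close>.\<close>

definition preserves_alpha_products ::
    "'u rel \<Rightarrow> ('o, 'm, 'z) category_scheme \<Rightarrow> ('o, 'm) presheaf \<Rightarrow> bool" where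
  "preserves_alpha_products \<alpha> C F \<longleftrightarrow>
     (\<forall>(I :: 'u set) X Q \<iota>. |I| <o \<alpha> \<longrightarrow> is_coproduct C I X Q \<iota> \<longrightarrow>
        (\<lambda>x. \<lambda>i\<in>I. PA F (\<iota> i) x) \<in> iso (PO F Q) (product_group I (\<lambda>i. PO F (X i))))"

text \<open>
  Morphisms carry their source and target. Only the values of presheaves on objects and morphisms
  of \<open>C\<close>, and of natural transformations on objects of \<open>C\<close>, matter; the latter are extensional.
\<close>

type_synonym ('o, 'm) presheaf_map =
  "('o, 'm) presheaf \<times> ('o \<Rightarrow> 'm \<Rightarrow> 'm) \<times> ('o, 'm) presheaf"

definition presheaf_Hom ::
    "('o, 'm, 'z) category_scheme \<Rightarrow> ('o, 'm) presheaf \<Rightarrow> ('o, 'm) presheaf \<Rightarrow>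
       ('o, 'm) presheaf_map set" where
  "presheaf_Hom C F G = {(F, \<tau>, G) | \<tau>.
     \<tau> \<in> (\<Pi>\<^sub>E X\<in>Ob C. hom (PO F X) (PO G X) \<inter> extensional (carrier (PO F X))) \<and>
     (\<forall>X\<in>Ob C. \<forall>Y\<in>Ob C. \<forall>f\<in>Hom C X Y. \<forall>x\<in>carrier (PO F Y).
        \<tau> X (PA F f x) = PA G f (\<tau> Y x))}"

definition Mod_alpha ::
    "'u rel \<Rightarrow> ('o, 'm, 'z) category_scheme \<Rightarrow>
       (('o, 'm) presheaf, ('o, 'm) presheaf_map) preadditive" where
  "Mod_alpha \<alpha> C = \<lparr>
     Ob = {F. ab_presheaf TYPE('u) C F \<and> preserves_alpha_products \<alpha> C F},
     Hom = presheaf_Hom C,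
     Idt = (\<lambda>F. (F, \<lambda>X\<in>Ob C. \<lambda>x\<in>carrier (PO F X). x, F)),
     Cmp = (\<lambda>(_, \<sigma>, H) (F, \<tau>, _). (F, \<lambda>X\<in>Ob C. \<lambda>x\<in>carrier (PO F X). \<sigma> X (\<tau> X x), H)),
     Add = (\<lambda>(F, \<sigma>, G) (_, \<tau>, _).
              (F, \<lambda>X\<in>Ob C. \<lambda>x\<in>carrier (PO F X). \<sigma> X x \<otimes>\<^bsub>PO G X\<^esub> \<tau> X x, G)),
     Zero = (\<lambda>F G. (F, \<lambda>X\<in>Ob C. \<lambda>x\<in>carrier (PO F X). \<one>\<^bsub>PO G X\<^esub>, G))\<rparr>"

text \<open>
  The functor \<open>S\<^sub>\<alpha>\<close> on objects and morphisms. The restriction to \<open>T\<^sup>\<alpha>\<close> is made by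
  \<^const>\<open>Mod_alpha\<close>, which sees only the values on \<open>T\<^sup>\<alpha>\<close>.
\<close>

definition S_alpha :: "('o, 'm, 'z) preadditive_scheme \<Rightarrow> 'o \<Rightarrow> ('o, 'm) presheaf" where
  "S_alpha T X = \<lparr>PO = (\<lambda>S. hom_group T S X), PA = (\<lambda>f h. h \<cdot>\<^bsub>T\<^esub> f)\<rparr>"

definition S_alpha_map ::
    "'u rel \<Rightarrow> ('o, 'm, 'z) preadditive_scheme \<Rightarrow> 'o \<Rightarrow> 'o \<Rightarrow> 'm \<Rightarrow> ('o, 'm) presheaf_map" where
  "S_alpha_map \<alpha> T X Y f =
     (S_alpha T X, \<lambda>S\<in>alpha_objects \<alpha> T. \<lambda>h\<in>Hom T S X. f \<cdot>\<^bsub>T\<^esub> h, S_alpha T Y)"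

definition ARM :: "'u rel \<Rightarrow> ('o, 'm, 'z) preadditive_scheme \<Rightarrow> bool" where
  "ARM \<alpha> T \<longleftrightarrow>
     (\<forall>X\<in>Ob T. \<forall>Y\<in>Ob T. \<forall>\<tau>\<in>presheaf_Hom (alpha_subcategory \<alpha> T) (S_alpha T X) (S_alpha T Y).
        \<exists>f\<in>Hom T X Y. \<tau> = S_alpha_map \<alpha> T X Y f)"

end

theory Submission
  imports Defs
begin

text \<open>
  Write \<open>S\<close> for \<open>S\<^sub>\<alpha>\<close> and call an object cellular if it is a small coproduct of objects of \<open>T\<^sup>\<alpha>\<close>. A map is
  phantom if \<open>S\<close> annihilates it. Three facts carry the proof.

  First, every \<open>X\<close> has a cellular cover: a map \<open>P \<rightarrow> X\<close> with \<open>P\<close> cellular through which all maps from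
  \<open>T\<^sup>\<alpha>\<close> to \<open>X\<close> factor (lemma \<open>cellular_cover\<close>). The coproduct of all objects of \<open>T\<^sup>\<alpha>\<close> over \<open>X\<close> need not be
  small, so one must show that the maps from \<open>T\<^sup>\<alpha>\<close> to \<open>X\<close> factor through a small set of objects of \<open>T\<^sup>\<alpha>\<close>.
  The maximality of \<open>T\<^sup>\<alpha>\<close> makes it closed under suspensions, coproducts of fewer than \<open>\<alpha>\<close> objects and cones
  (\<open>A_criterion\<close>, \<open>A_coproduct\<close>, \<open>A_cone\<close>), hence the objects \<open>X\<close> with such a solution set
  are closed under cones and small coproducts. A tower that starts at an arbitrary \<open>X\<close> and kills all maps
  from the generators exhibits \<open>X\<close> as a retract of an object built in this way (\<open>approximable_all\<close>).

  Secondly, \<open>S P\<close> is projective for cellular \<open>P\<close>, and \<open>T(P,Y) \<rightarrow> Hom(S P, S Y)\<close> is bijective for all \<open>Y\<close>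
  (\<open>cellular_extend\<close>, \<open>cellular_projective\<close>, \<open>cellular_full\<close>, \<open>phantom_cellular\<close>). In particular a phantom
  out of a cellular object is zero.

  Thirdly, the fibre \<open>K\<close> of a map \<open>P \<rightarrow> X\<close> through which all maps from \<open>T\<^sup>\<alpha>\<close> factor gives a short exact
  sequence \<open>0 \<rightarrow> S K \<rightarrow> S P \<rightarrow> S X \<rightarrow> 0\<close> (\<open>S_short_exact\<close>).

  Choose cellular covers \<open>p : P\<^sub>1 \<rightarrow> X\<close> and \<open>\<pi> : P\<^sub>2 \<rightarrow> K\<close> of \<open>X\<close> and of the fibre \<open>K\<close> of \<open>p\<close>. Both sides of the
  equivalence amount to the splitting of \<open>\<pi>\<close> for all \<open>X\<close>. If \<open>S\<close> is full, a map out of \<open>P\<^sub>1\<close> that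
  kills \<open>S K\<close> extends along \<open>p\<close>; applied twice, this shows that the phantom \<open>K \<rightarrow> \<Sigma>L\<close> in the triangle of
  \<open>\<pi>\<close> is zero (\<open>full_section\<close>), and then \<open>S K\<close> is a retract of the projective \<open>S P\<^sub>2\<close>. If \<open>S X\<close> has
  projective dimension at most one, Schanuel's lemma splits \<open>S \<pi>\<close>; the corresponding idempotent of \<open>P\<^sub>2\<close>
  splits in \<open>T\<close>, and its image is isomorphic to \<open>K\<close> (\<open>projdim_section\<close>). Once \<open>\<pi>\<close> splits, phantoms out
  of \<open>K\<close> vanish, and this is what is needed to descend to \<open>X\<close> the map \<open>P\<^sub>1 \<rightarrow> Y\<close> that lifts a given
  transformation \<open>S X \<rightarrow> S Y\<close> (\<open>projdim_imp_full\<close>).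
\<close>

section \<open>Small sets and regular cardinals\<close>

lemma small_ordLeq: "|A| \<le>o |B| \<Longrightarrow> small U B \<Longrightarrow> small U A"
  unfolding small_def by (rule ordLeq_ordLess_trans)

lemma small_subset: "small U B \<Longrightarrow> A \<subseteq> B \<Longrightarrow> small U A"
  by (meson card_of_mono1 small_ordLeq)

lemma small_image: "small U A \<Longrightarrow> small U (f ` A)"
  by (meson card_of_image small_ordLeq)

lemma universe_Cinfinite:
  assumes "universe TYPE('u)"
  shows "Cinfinite |UNIV :: 'u set|" and "infinite (UNIV :: 'u set)"
proof -
  have "natLeq \<le>o |UNIV :: 'u set|"
    using assms ordLess_imp_ordLeq by (auto simp: universe_def)
  then show inf: "infinite (UNIV :: 'u set)"
    using infinite_iff_natLeq_ordLeq by blast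
  then show "Cinfinite |UNIV :: 'u set|"
    by (metis Field_card_of card_of_Card_order cinfinite_def)
qed

lemma small_countable:
  assumes "universe TYPE('u)" and "countable A"
  shows "small TYPE('u) A"
proof -
  obtain f :: "_ \<Rightarrow> nat" where "inj_on f A"
    using assms(2) by (rule countableE)
  then have "|A| \<le>o natLeq"
    by (metis (no_types) card_of_nat card_of_ordLeq ordLeq_ordIso_trans subset_UNIV)
  then show ?thesis
    using assms(1) ordLeq_ordLess_trans by (auto simp: small_def universe_def)
qed

lemma small_finite: "universe TYPE('u) \<Longrightarrow> finite A \<Longrightarrow> small TYPE('u) A"
  by (simp add: small_countable countable_finite)

lemma small_UN:
  assumes "universe TYPE('u)" and "small TYPE('u) I" and "\<And>i. i \<in> I \<Longrightarrow> small TYPE('u) (A i)"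
  shows "small TYPE('u) (\<Union>i\<in>I. A i)"
  using card_of_UNION_ordLess_infinite_Field_regularCard[of "|UNIV :: 'u set|" I A] assms
    universe_Cinfinite[OF assms(1)]
  by (auto simp: small_def universe_def)

lemma small_Un:
  assumes "universe TYPE('u)" and "small TYPE('u) A" and "small TYPE('u) B"
  shows "small TYPE('u) (A \<union> B)"
  using small_UN[OF assms(1), of "UNIV :: bool set" "\<lambda>b. if b then A else B"] assms
  by (auto simp: small_finite UNIV_bool Un_commute)

lemma small_Sigma:
  assumes "universe TYPE('u)" and "small TYPE('u) I" and "\<And>i. i \<in> I \<Longrightarrow> small TYPE('u) (A i)"
  shows "small TYPE('u) (Sigma I A)"
proof -
  have "Sigma I A = (\<Union>i\<in>I. Pair i ` A i)"
    by auto
  then show ?thesis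
    using assms by (simp add: small_UN small_image)
qed

lemma small_Pow:
  assumes "universe TYPE('u)" and "small TYPE('u) A"
  shows "small TYPE('u) (Pow A)"
proof -
  have "|A| \<le>o |UNIV :: 'u set|"
    using assms(2) ordLess_imp_ordLeq by (auto simp: small_def)
  then obtain f :: "_ \<Rightarrow> 'u" where f: "inj_on f A"
    by (metis card_of_ordLeq)
  have "small TYPE('u) (Pow (f ` A))"
    using assms small_image[OF assms(2)] by (auto simp: universe_def)
  moreover have "|Pow A| \<le>o |Pow (f ` A)|"
    using f by (intro card_of_ordLeqI[of "image f"]) (auto simp: inj_on_image_Pow)
  ultimately show ?thesis
    using small_ordLeq by blast
qed

lemma small_PiE:
  assumes "universe TYPE('u)" and "small TYPE('u) I" and "\<And>i. i \<in> I \<Longrightarrow> small TYPE('u) (A i)"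
  shows "small TYPE('u) (PiE I A)"
proof -
  let ?graph = "\<lambda>f. (\<lambda>i. (i, f i)) ` I"
  \<comment> \<open>A function is determined by its graph, so there are at most as many as subsets of the disjoint union.\<close>
  have "inj_on ?graph (PiE I A)"
  proof (rule inj_onI)
    fix f g assume fg: "f \<in> PiE I A" "g \<in> PiE I A" "?graph f = ?graph g"
    have "f i = g i" if "i \<in> I" for i
    proof -
      have "(i, f i) \<in> ?graph g"
        using fg(3) that by blast
      then show ?thesis by auto
    qed
    then show "f = g"
      using fg(1,2) by (auto intro: PiE_ext)
  qed
  moreover have "?graph ` PiE I A \<subseteq> Pow (Sigma I A)"
    by auto
  ultimately have "|PiE I A| \<le>o |Pow (Sigma I A)|"
    using card_of_ordLeq by blast
  then show ?thesis
    using assms small_ordLeq small_Pow small_Sigma by metis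
qed

text \<open>Small families of any type can therefore be reindexed by a subset of the universe.\<close>

lemma small_index:
  assumes "small TYPE('u) A"
  obtains J :: "'u set" and b where "bij_betw b J A" "small TYPE('u) J"
proof -
  have "|A| \<le>o |UNIV :: 'u set|"
    using assms ordLess_imp_ordLeq by (auto simp: small_def)
  then obtain f :: "_ \<Rightarrow> 'u" where f: "inj_on f A"
    by (metis card_of_ordLeq)
  then have "bij_betw (inv_into A f) (f ` A) A"
    by (simp add: bij_betw_inv_into inj_on_imp_bij_betw)
  then show ?thesis
    using that small_image[OF assms] by blast
qed

lemma small_choice:
  assumes "small U A" and "\<And>a. a \<in> A \<Longrightarrow> \<exists>b. b \<in> B \<and> R a b"
  shows "\<exists>B' \<subseteq> B. small U B' \<and> (\<forall>a\<in>A. \<exists>b\<in>B'. R a b)"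
proof -
  obtain f where f: "\<forall>a\<in>A. f a \<in> B \<and> R a (f a)"
    using assms(2) by metis
  then show ?thesis
    using small_image[OF assms(1), of f] by (intro exI[of _ "f ` A"]) auto
qed

locale regular =
  fixes \<alpha> :: "'u rel"
  assumes universe: "universe TYPE('u)"
    and regular: "regular_cardinal \<alpha>"
    and small_Field: "small TYPE('u) (Field \<alpha>)"
begin

lemma small_less:
  assumes "|A| <o \<alpha>" shows "small TYPE('u) A"
proof -
  have "\<alpha> =o |Field \<alpha>|"
    using regular by (meson card_of_Field_ordIso ordIso_symmetric regular_cardinal_def)
  then show ?thesis
    using assms small_Field small_ordLeq
    by (meson ordLess_imp_ordLeq ordLeq_ordIso_trans)
qed

lemma less_subset: "|B| <o \<alpha> \<Longrightarrow> A \<subseteq> B \<Longrightarrow> |A| <o \<alpha>"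
  by (meson card_of_mono1 ordLeq_ordLess_trans)

lemma less_image: "|A| <o \<alpha> \<Longrightarrow> |f ` A| <o \<alpha>"
  by (meson card_of_image ordLeq_ordLess_trans)

lemma less_finite: "finite A \<Longrightarrow> |A| <o \<alpha>"
  using regular by (auto simp: regular_cardinal_def cinfinite_def card_order_on_def
      intro!: finite_ordLess_infinite card_of_Well_order simp: Field_card_of)

lemma less_UN:
  assumes "|I| <o \<alpha>" and "\<And>i. i \<in> I \<Longrightarrow> |A i| <o \<alpha>"
  shows "|\<Union>i\<in>I. A i| <o \<alpha>"
  using card_of_UNION_ordLess_infinite_Field_regularCard[of \<alpha> I A] assms regular
  by (auto simp: regular_cardinal_def)

lemma less_Un: "|A| <o \<alpha> \<Longrightarrow> |B| <o \<alpha> \<Longrightarrow> |A \<union> B| <o \<alpha>"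
  using less_UN[of "UNIV :: bool set" "\<lambda>b. if b then A else B"]
  by (auto simp: less_finite UNIV_bool Un_commute)

end

section \<open>Categories\<close>

text \<open>
  Since the morphism sets are disjoint, a morphism determines its source and target. Stating
  typing conditions through these two functions lets the simplifier discharge them.
\<close>

context category
begin

definition in_hom :: "'m \<Rightarrow> 'o \<Rightarrow> 'o \<Rightarrow> bool"  (\<open>\<guillemotleft>_ : _ \<rightarrow> _\<guillemotright>\<close>) where
  "\<guillemotleft>f : X \<rightarrow> Y\<guillemotright> \<longleftrightarrow> X \<in> Ob C \<and> Y \<in> Ob C \<and> f \<in> Hom C X Y"

definition arr :: "'m \<Rightarrow> bool" where
  "arr f \<longleftrightarrow> (\<exists>X Y. \<guillemotleft>f : X \<rightarrow> Y\<guillemotright>)"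

definition dom :: "'m \<Rightarrow> 'o" where
  "dom f = (THE X. \<exists>Y. \<guillemotleft>f : X \<rightarrow> Y\<guillemotright>)"

definition cod :: "'m \<Rightarrow> 'o" where
  "cod f = (THE Y. \<exists>X. \<guillemotleft>f : X \<rightarrow> Y\<guillemotright>)"

lemma in_hom_iff: "\<guillemotleft>f : X \<rightarrow> Y\<guillemotright> \<longleftrightarrow> arr f \<and> dom f = X \<and> cod f = Y \<and> X \<in> Ob C \<and> Y \<in> Ob C"
proof -
  have 1: "dom f = X \<and> cod f = Y \<and> X \<in> Ob C \<and> Y \<in> Ob C" if "\<guillemotleft>f : X \<rightarrow> Y\<guillemotright>" for X Y
    using that Hom_disjoint unfolding dom_def cod_def in_hom_def
    by (auto intro!: the_equality)
  then show ?thesis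
    unfolding arr_def by metis
qed

lemma in_homD:
  assumes "\<guillemotleft>f : X \<rightarrow> Y\<guillemotright>"
  shows "arr f" "dom f = X" "cod f = Y" "X \<in> Ob C" "Y \<in> Ob C" "f \<in> Hom C X Y"
  using assms in_hom_iff in_hom_def by blast+

lemma in_homI: "X \<in> Ob C \<Longrightarrow> Y \<in> Ob C \<Longrightarrow> f \<in> Hom C X Y \<Longrightarrow> \<guillemotleft>f : X \<rightarrow> Y\<guillemotright>"
  by (simp add: in_hom_def)

lemma Hom_iff: "X \<in> Ob C \<Longrightarrow> Y \<in> Ob C \<Longrightarrow> f \<in> Hom C X Y \<longleftrightarrow> \<guillemotleft>f : X \<rightarrow> Y\<guillemotright>"
  by (simp add: in_hom_def)

lemma dom_Ob [simp]: "arr f \<Longrightarrow> dom f \<in> Ob C"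
  by (metis arr_def in_hom_iff)

lemma cod_Ob [simp]: "arr f \<Longrightarrow> cod f \<in> Ob C"
  by (metis arr_def in_hom_iff)

lemma arr_in_hom: "arr f \<Longrightarrow> \<guillemotleft>f : dom f \<rightarrow> cod f\<guillemotright>"
  by (simp add: in_hom_iff)

lemma comp_in_hom: "\<guillemotleft>g : Y \<rightarrow> Z\<guillemotright> \<Longrightarrow> \<guillemotleft>f : X \<rightarrow> Y\<guillemotright> \<Longrightarrow> \<guillemotleft>g \<cdot> f : X \<rightarrow> Z\<guillemotright>"
  by (auto simp: in_hom_def intro: Cmp_closed)

lemma arr_comp [simp]:
  assumes "arr f" "arr g" "dom g = cod f"
  shows "arr (g \<cdot> f)" "dom (g \<cdot> f) = dom f" "cod (g \<cdot> f) = cod g"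
  using comp_in_hom[of g "cod f" "cod g" f "dom f"] assms by (auto simp: in_hom_iff)

lemma arr_Idt [simp]:
  assumes "X \<in> Ob C"
  shows "arr (Idt C X)" "dom (Idt C X) = X" "cod (Idt C X) = X"
  using assms Idt_closed[OF assms] in_homI[of X X] by (auto simp: in_hom_iff)

lemma comp_assoc:
  assumes "arr f" "arr g" "arr h" "dom g = cod f" "dom h = cod g"
  shows "(h \<cdot> g) \<cdot> f = h \<cdot> (g \<cdot> f)"
  using Cmp_assoc[of "dom f" "cod f" "cod g" "cod h" f g h] assms
    arr_in_hom[of f] arr_in_hom[of g] arr_in_hom[of h]
  by (auto simp: in_hom_def)

lemma comp_Idt [simp]:
  assumes "arr f"
  shows "cod f = X \<Longrightarrow> Idt C X \<cdot> f = f" and "dom f = X \<Longrightarrow> f \<cdot> Idt C X = f"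
  using assms Cmp_Idt_left[of "dom f" "cod f" f] Cmp_Idt_right[of "dom f" "cod f" f] arr_in_hom[of f]
  by (auto simp: in_hom_def)

subsection \<open>Isomorphisms\<close>

lemma is_isoI:
  assumes "\<guillemotleft>f : X \<rightarrow> Y\<guillemotright>" "\<guillemotleft>g : Y \<rightarrow> X\<guillemotright>" "g \<cdot> f = Idt C X" "f \<cdot> g = Idt C Y"
  shows "is_iso C X Y f"
  using assms by (auto simp: is_iso_def in_hom_def)

lemma is_isoE:
  assumes "is_iso C X Y f" "X \<in> Ob C" "Y \<in> Ob C"
  obtains g where "\<guillemotleft>f : X \<rightarrow> Y\<guillemotright>" "\<guillemotleft>g : Y \<rightarrow> X\<guillemotright>" "g \<cdot> f = Idt C X" "f \<cdot> g = Idt C Y"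
  using assms by (auto simp: is_iso_def in_hom_def)

lemma is_iso_Idt: "X \<in> Ob C \<Longrightarrow> is_iso C X X (Idt C X)"
  by (rule is_isoI[of _ _ _ "Idt C X"]) (auto simp: in_hom_iff)

lemma left_right_inverse:
  assumes "\<guillemotleft>f : X \<rightarrow> Y\<guillemotright>" "\<guillemotleft>g : Y \<rightarrow> X\<guillemotright>" "\<guillemotleft>h : Y \<rightarrow> X\<guillemotright>" "g \<cdot> f = Idt C X" "f \<cdot> h = Idt C Y"
  shows "is_iso C X Y f"
proof -
  have "g = g \<cdot> (f \<cdot> h)"
    using assms by (auto simp: in_hom_iff)
  also have "\<dots> = h"
    using assms comp_assoc[of h f g] by (auto simp: in_hom_iff)
  finally show ?thesis
    using assms is_isoI by blast
qed

subsection \<open>Coproducts\<close>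

lemma is_coproductD:
  assumes "is_coproduct C I X Q \<iota>"
  shows "Q \<in> Ob C" and "\<And>i. i \<in> I \<Longrightarrow> \<guillemotleft>\<iota> i : X i \<rightarrow> Q\<guillemotright>" and "\<And>i. i \<in> I \<Longrightarrow> X i \<in> Ob C"
  using assms unfolding is_coproduct_def in_hom_def by (elim conjE; blast)+

lemma coproduct_ex1:
  assumes "is_coproduct C I X Q \<iota>" and "Z \<in> Ob C" and "\<And>i. i \<in> I \<Longrightarrow> t i \<in> Hom C (X i) Z"
  shows "\<exists>!h. h \<in> Hom C Q Z \<and> (\<forall>i\<in>I. h \<cdot> \<iota> i = t i)"
proof -
  have "\<forall>Z\<in>Ob C. \<forall>t. (\<forall>i\<in>I. t i \<in> Hom C (X i) Z) \<longrightarrow>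
      (\<exists>!h. h \<in> Hom C Q Z \<and> (\<forall>i\<in>I. h \<cdot> \<iota> i = t i))"
    using assms(1) unfolding is_coproduct_def by (elim conjE)
  from bspec[OF this assms(2)] show ?thesis
    using assms(3) by (elim allE[of _ t] impE) auto
qed

lemma copair_exists:
  assumes "is_coproduct C I X Q \<iota>" and "Z \<in> Ob C" and "\<And>i. i \<in> I \<Longrightarrow> \<guillemotleft>t i : X i \<rightarrow> Z\<guillemotright>"
  obtains h where "\<guillemotleft>h : Q \<rightarrow> Z\<guillemotright>" "\<And>i. i \<in> I \<Longrightarrow> h \<cdot> \<iota> i = t i"
proof -
  have "\<exists>!h. h \<in> Hom C Q Z \<and> (\<forall>i\<in>I. h \<cdot> \<iota> i = t i)"
    using in_homD(6)[OF assms(3)] by (intro coproduct_ex1[OF assms(1,2)])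
  then obtain h where "h \<in> Hom C Q Z" "\<forall>i\<in>I. h \<cdot> \<iota> i = t i"
    by (elim ex1E conjE)
  then show ?thesis
    using that[of h] in_homI[OF is_coproductD(1)[OF assms(1)] assms(2)] by blast
qed

lemma coproduct_ext:
  assumes "is_coproduct C I X Q \<iota>" and "\<guillemotleft>g : Q \<rightarrow> Z\<guillemotright>" and "\<guillemotleft>h : Q \<rightarrow> Z\<guillemotright>"
    and "\<And>i. i \<in> I \<Longrightarrow> g \<cdot> \<iota> i = h \<cdot> \<iota> i"
  shows "g = h"
proof -
  have "\<guillemotleft>g \<cdot> \<iota> i : X i \<rightarrow> Z\<guillemotright>" if "i \<in> I" for i
    using comp_in_hom[OF assms(2) is_coproductD(2)[OF assms(1) that]] .
  then have "\<exists>!k. k \<in> Hom C Q Z \<and> (\<forall>i\<in>I. k \<cdot> \<iota> i = g \<cdot> \<iota> i)"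
    using in_homD(5)[OF assms(2)] by (intro coproduct_ex1[OF assms(1)] in_homD(6))
  then show ?thesis
    by (rule ex1E) (metis assms(2-4) in_homD(6))
qed

lemma is_coproductI:
  assumes "Q \<in> Ob C" and "\<And>i. i \<in> I \<Longrightarrow> \<guillemotleft>\<iota> i : X i \<rightarrow> Q\<guillemotright>"
    and "\<And>Z t. Z \<in> Ob C \<Longrightarrow> (\<And>i. i \<in> I \<Longrightarrow> \<guillemotleft>t i : X i \<rightarrow> Z\<guillemotright>) \<Longrightarrow>
       \<exists>h. \<guillemotleft>h : Q \<rightarrow> Z\<guillemotright> \<and> (\<forall>i\<in>I. h \<cdot> \<iota> i = t i)"
    and "\<And>Z g h. \<guillemotleft>g : Q \<rightarrow> Z\<guillemotright> \<Longrightarrow> \<guillemotleft>h : Q \<rightarrow> Z\<guillemotright> \<Longrightarrow> (\<And>i. i \<in> I \<Longrightarrow> g \<cdot> \<iota> i = h \<cdot> \<iota> i) \<Longrightarrow> g = h"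
  shows "is_coproduct C I X Q \<iota>"
  unfolding is_coproduct_def
proof (intro conjI ballI allI impI)
  show "Q \<in> Ob C" by fact
  show "X i \<in> Ob C" "\<iota> i \<in> Hom C (X i) Q" if "i \<in> I" for i
    using assms(2)[OF that] by (auto simp: in_hom_def)
  fix Z t assume Z: "Z \<in> Ob C" and "\<forall>i\<in>I. t i \<in> Hom C (X i) Z"
  then have "\<And>i. i \<in> I \<Longrightarrow> \<guillemotleft>t i : X i \<rightarrow> Z\<guillemotright>"
    using assms(2) by (auto simp: in_hom_def)
  then obtain h where h: "\<guillemotleft>h : Q \<rightarrow> Z\<guillemotright>" "\<forall>i\<in>I. h \<cdot> \<iota> i = t i"
    using assms(3)[OF Z] by blast
  show "\<exists>!h. h \<in> Hom C Q Z \<and> (\<forall>i\<in>I. h \<cdot> \<iota> i = t i)"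
  proof (rule ex1I[of _ h])
    show "h \<in> Hom C Q Z \<and> (\<forall>i\<in>I. h \<cdot> \<iota> i = t i)"
      using h by (simp add: in_hom_def)
    show "g = h" if "g \<in> Hom C Q Z \<and> (\<forall>i\<in>I. g \<cdot> \<iota> i = t i)" for g
      using that h assms(1) Z by (intro assms(4)[of g Z h]) (auto simp: in_hom_def)
  qed
qed

lemma coproduct_reindex:
  assumes "is_coproduct C I X Q \<iota>" and "bij_betw b J I"
  shows "is_coproduct C J (\<lambda>j. X (b j)) Q (\<lambda>j. \<iota> (b j))"
proof (rule is_coproductI)
  have b: "b j \<in> I" if "j \<in> J" for j
    using that assms(2) bij_betwE by blast
  show "Q \<in> Ob C"
    using is_coproductD[OF assms(1)] by blast
  show "\<guillemotleft>\<iota> (b j) : X (b j) \<rightarrow> Q\<guillemotright>" if "j \<in> J" for j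
    using is_coproductD[OF assms(1)] b that by blast
  fix Z t assume Z: "Z \<in> Ob C" and t: "\<And>j. j \<in> J \<Longrightarrow> \<guillemotleft>t j : X (b j) \<rightarrow> Z\<guillemotright>"
  let ?t = "\<lambda>i. t (inv_into J b i)"
  have "\<guillemotleft>?t i : X i \<rightarrow> Z\<guillemotright>" if "i \<in> I" for i
    using t[of "inv_into J b i"] that assms(2)
    by (metis bij_betw_imp_surj_on bij_betw_inv_into_right inv_into_into)
  then obtain h where "\<guillemotleft>h : Q \<rightarrow> Z\<guillemotright>" "\<And>i. i \<in> I \<Longrightarrow> h \<cdot> \<iota> i = ?t i"
    using copair_exists[OF assms(1) Z, of ?t] by blast
  then show "\<exists>h. \<guillemotleft>h : Q \<rightarrow> Z\<guillemotright> \<and> (\<forall>j\<in>J. h \<cdot> \<iota> (b j) = t j)"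
    using b assms(2) by (metis bij_betw_inv_into_left)
next
  fix Z g h assume *: "\<guillemotleft>g : Q \<rightarrow> Z\<guillemotright>" "\<guillemotleft>h : Q \<rightarrow> Z\<guillemotright>" "\<And>j. j \<in> J \<Longrightarrow> g \<cdot> \<iota> (b j) = h \<cdot> \<iota> (b j)"
  have "g \<cdot> \<iota> i = h \<cdot> \<iota> i" if "i \<in> I" for i
    using *(3) that assms(2) by (metis bij_betw_imp_surj_on imageE)
  then show "g = h"
    using coproduct_ext[OF assms(1)] * by blast
qed

lemma coproduct_cong:
  assumes "\<And>i. i \<in> I \<Longrightarrow> X i = X' i" and "\<And>i. i \<in> I \<Longrightarrow> \<iota> i = \<iota>' i"
  shows "is_coproduct C I X Q \<iota> = is_coproduct C I X' Q \<iota>'"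
  using assms unfolding is_coproduct_def by (simp cong: ball_cong)

lemma coproduct_map_exists:
  assumes P: "is_coproduct C I X P \<iota>" and Q: "is_coproduct C I Y Q \<kappa>"
    and f: "\<And>i. i \<in> I \<Longrightarrow> \<guillemotleft>f i : X i \<rightarrow> Y i\<guillemotright>"
  obtains m where "\<guillemotleft>m : P \<rightarrow> Q\<guillemotright>" "\<And>i. i \<in> I \<Longrightarrow> m \<cdot> \<iota> i = \<kappa> i \<cdot> f i" "is_coproduct_map C I P \<iota> Q \<kappa> f m"
proof -
  have "\<And>i. i \<in> I \<Longrightarrow> \<guillemotleft>\<kappa> i \<cdot> f i : X i \<rightarrow> Q\<guillemotright>"
    using f is_coproductD(2)[OF Q] comp_in_hom by blast
  then obtain m where "\<guillemotleft>m : P \<rightarrow> Q\<guillemotright>" "\<And>i. i \<in> I \<Longrightarrow> m \<cdot> \<iota> i = \<kappa> i \<cdot> f i"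
    using copair_exists[OF P is_coproductD(1)[OF Q], of "\<lambda>i. \<kappa> i \<cdot> f i"] by blast
  then show ?thesis
    using that by (auto simp: is_coproduct_map_def in_hom_def)
qed

lemma coproduct_of_coproducts:
  assumes W: "\<And>i. i \<in> I \<Longrightarrow> is_coproduct C (K i) (X i) (W i) (\<iota> i)"
    and Q: "is_coproduct C (Sigma I K) (\<lambda>(i, k). X i k) Q \<kappa>"
    and l: "\<And>i. i \<in> I \<Longrightarrow> \<guillemotleft>l i : W i \<rightarrow> Q\<guillemotright>"
      "\<And>i k. i \<in> I \<Longrightarrow> k \<in> K i \<Longrightarrow> l i \<cdot> \<iota> i k = \<kappa> (i, k)"
  shows "is_coproduct C I W Q l"
proof (rule is_coproductI)
  show "Q \<in> Ob C"
    using is_coproductD[OF Q] by blast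
  show "\<guillemotleft>l i : W i \<rightarrow> Q\<guillemotright>" if "i \<in> I" for i
    using l that by blast
  have \<iota>: "\<guillemotleft>\<iota> i k : X i k \<rightarrow> W i\<guillemotright>" if "i \<in> I" "k \<in> K i" for i k
    using is_coproductD(2)[OF W[OF that(1)]] that by auto
  fix Z t assume Z: "Z \<in> Ob C" and t: "\<And>i. i \<in> I \<Longrightarrow> \<guillemotleft>t i : W i \<rightarrow> Z\<guillemotright>"
  obtain h where h: "\<guillemotleft>h : Q \<rightarrow> Z\<guillemotright>" "\<And>p. p \<in> Sigma I K \<Longrightarrow> h \<cdot> \<kappa> p = (case p of (i, k) \<Rightarrow> t i \<cdot> \<iota> i k)"
    by (rule copair_exists[OF Q Z, of "\<lambda>(i, k). t i \<cdot> \<iota> i k"]) (auto intro: comp_in_hom[OF t \<iota>])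
  have "h \<cdot> l i = t i" if i: "i \<in> I" for i
  proof (rule coproduct_ext[OF W[OF i] comp_in_hom[OF h(1) l(1)[OF i]] t[OF i]])
    show "(h \<cdot> l i) \<cdot> \<iota> i k = t i \<cdot> \<iota> i k" if "k \<in> K i" for k
      using h(1) h(2)[of "(i, k)"] l(1)[OF i] l(2)[OF i that] \<iota>[OF i that] i that
      by (auto simp: in_hom_iff comp_assoc)
  qed
  then show "\<exists>h. \<guillemotleft>h : Q \<rightarrow> Z\<guillemotright> \<and> (\<forall>i\<in>I. h \<cdot> l i = t i)"
    using h by blast
next
  fix Z g h assume *: "\<guillemotleft>g : Q \<rightarrow> Z\<guillemotright>" "\<guillemotleft>h : Q \<rightarrow> Z\<guillemotright>" "\<And>i. i \<in> I \<Longrightarrow> g \<cdot> l i = h \<cdot> l i"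
  show "g = h"
  proof (rule coproduct_ext[OF Q *(1,2)])
    fix p assume "p \<in> Sigma I K"
    then obtain i k where ik: "i \<in> I" "k \<in> K i" "p = (i, k)" by auto
    have "\<guillemotleft>\<iota> i k : X i k \<rightarrow> W i\<guillemotright>"
      using is_coproductD(2)[OF W[OF ik(1)]] ik by auto
    moreover have "g \<cdot> \<kappa> p = g \<cdot> (l i \<cdot> \<iota> i k)" "h \<cdot> \<kappa> p = h \<cdot> (l i \<cdot> \<iota> i k)"
      using l(2)[OF ik(1,2)] ik(3) by auto
    ultimately show "g \<cdot> \<kappa> p = h \<cdot> \<kappa> p"
      using *(1,2) *(3)[OF ik(1)] l(1)[OF ik(1)]
        comp_assoc[of "\<iota> i k" "l i" g] comp_assoc[of "\<iota> i k" "l i" h]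
      by (auto simp: in_hom_iff)
  qed
qed

lemma small_coproduct_exists:
  assumes "has_small_coproducts TYPE('u) C" and "small TYPE('u) I" and "\<And>i. i \<in> I \<Longrightarrow> X i \<in> Ob C"
  obtains Q \<iota> where "is_coproduct C I X Q \<iota>"
proof -
  obtain J :: "'u set" and b where b: "bij_betw b J I" and J: "small TYPE('u) J"
    using small_index[OF assms(2)] by blast
  have "\<forall>j\<in>J. X (b j) \<in> Ob C"
    using assms(3) b bij_betwE by blast
  then obtain Q \<iota> where Q: "is_coproduct C J (\<lambda>j. X (b j)) Q \<iota>"
    using assms(1) J unfolding has_small_coproducts_def by meson
  let ?b = "inv_into J b"
  have "is_coproduct C I (\<lambda>i. X (b (?b i))) Q (\<lambda>i. \<iota> (?b i))"
    using coproduct_reindex[OF Q bij_betw_inv_into[OF b]] .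
  also have "?this \<longleftrightarrow> is_coproduct C I X Q (\<lambda>i. \<iota> (?b i))"
    using b by (intro coproduct_cong) (auto simp: bij_betw_inv_into_right)
  finally show ?thesis
    using that by blast
qed

end

section \<open>Preadditive categories\<close>

context preadditive
begin

abbreviation plus  (infixl \<open>\<^bold>+\<close> 65) where
  "f \<^bold>+ g \<equiv> Add C f g"

definition mns  (\<open>\<^bold>- _\<close> [81] 80) where
  "\<^bold>- f = neg C (dom f) (cod f) f"

abbreviation diff  (infixl \<open>\<^bold>-\<close> 65) where
  "f \<^bold>- g \<equiv> f \<^bold>+ \<^bold>- g"

lemma in_hom_carrier:
  "X \<in> Ob C \<Longrightarrow> Y \<in> Ob C \<Longrightarrow> f \<in> carrier (hom_group C X Y) \<longleftrightarrow> \<guillemotleft>f : X \<rightarrow> Y\<guillemotright>"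
  by (simp add: hom_group_def in_hom_def)

lemma arr_carrier:
  assumes "arr f" shows "f \<in> carrier (hom_group C (dom f) (cod f))"
  using arr_in_hom[OF assms] by (simp add: in_hom_carrier assms)

lemma comm_group_arr:
  assumes "arr f" shows "comm_group (hom_group C (dom f) (cod f))"
  using assms by (simp add: hom_group)

lemma add_in_hom:
  assumes "\<guillemotleft>f : X \<rightarrow> Y\<guillemotright>" "\<guillemotleft>g : X \<rightarrow> Y\<guillemotright>" shows "\<guillemotleft>f \<^bold>+ g : X \<rightarrow> Y\<guillemotright>"
proof -
  have Ob: "X \<in> Ob C" "Y \<in> Ob C" using assms by (auto simp: in_hom_iff)
  interpret G: comm_group "hom_group C X Y" by (rule hom_group[OF Ob])
  show ?thesis
    using G.m_closed[of f g] assms by (simp add: in_hom_def hom_group_def)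
qed

lemma zero_in_hom:
  assumes "X \<in> Ob C" "Y \<in> Ob C" shows "\<guillemotleft>Zero C X Y : X \<rightarrow> Y\<guillemotright>"
proof -
  interpret G: comm_group "hom_group C X Y" by (rule hom_group[OF assms])
  show ?thesis
    using G.one_closed assms by (simp add: in_hom_def hom_group_def)
qed

lemma mns_in_hom:
  assumes "\<guillemotleft>f : X \<rightarrow> Y\<guillemotright>" shows "\<guillemotleft>\<^bold>- f : X \<rightarrow> Y\<guillemotright>"
proof -
  have f: "X \<in> Ob C" "Y \<in> Ob C" "dom f = X" "cod f = Y" using assms by (auto simp: in_hom_iff)
  interpret G: comm_group "hom_group C X Y" by (rule hom_group[OF f(1,2)])
  show ?thesis
    using G.inv_closed[of f] assms by (simp add: mns_def neg_def f(3,4) in_hom_carrier[OF f(1,2)])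
qed

lemma arr_add [simp]:
  assumes "arr f" "arr g" "dom g = dom f" "cod g = cod f"
  shows "arr (f \<^bold>+ g)" "dom (f \<^bold>+ g) = dom f" "cod (f \<^bold>+ g) = cod f"
  using add_in_hom[of f "dom f" "cod f" g] assms by (auto simp: in_hom_iff)

lemma arr_zero [simp]:
  assumes "X \<in> Ob C" "Y \<in> Ob C"
  shows "arr (Zero C X Y)" "dom (Zero C X Y) = X" "cod (Zero C X Y) = Y"
  using zero_in_hom[OF assms] by (auto simp: in_hom_iff)

lemma arr_mns [simp]:
  assumes "arr f"
  shows "arr (\<^bold>- f)" "dom (\<^bold>- f) = dom f" "cod (\<^bold>- f) = cod f"
  using mns_in_hom[OF arr_in_hom[OF assms]] by (auto simp: in_hom_iff)

lemma add_assoc: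
  assumes "arr f" "arr g" "arr h" "dom g = dom f" "cod g = cod f" "dom h = dom f" "cod h = cod f"
  shows "(f \<^bold>+ g) \<^bold>+ h = f \<^bold>+ (g \<^bold>+ h)"
proof -
  interpret G: comm_group "hom_group C (dom f) (cod f)" by (rule comm_group_arr[OF assms(1)])
  show ?thesis
    using G.m_assoc[of f g h] arr_carrier[OF assms(1)] arr_carrier[OF assms(2)] arr_carrier[OF assms(3)]
    by (simp add: assms hom_group_def)
qed

lemma add_commute:
  assumes "arr f" "arr g" "dom g = dom f" "cod g = cod f"
  shows "f \<^bold>+ g = g \<^bold>+ f"
proof -
  interpret G: comm_group "hom_group C (dom f) (cod f)" by (rule comm_group_arr[OF assms(1)])
  show ?thesis
    using G.m_comm[of f g] arr_carrier[OF assms(1)] arr_carrier[OF assms(2)]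
    by (simp add: assms hom_group_def)
qed

lemma add_zero [simp]:
  assumes "arr f" "dom f = X" "cod f = Y"
  shows "Zero C X Y \<^bold>+ f = f" "f \<^bold>+ Zero C X Y = f"
proof -
  interpret G: comm_group "hom_group C (dom f) (cod f)" by (rule comm_group_arr[OF assms(1)])
  show "Zero C X Y \<^bold>+ f = f" "f \<^bold>+ Zero C X Y = f"
    using G.l_one[of f] G.r_one[of f] arr_carrier[OF assms(1)] assms by (auto simp: hom_group_def)
qed

lemma add_mns [simp]:
  assumes "arr f"
  shows "f \<^bold>- f = Zero C (dom f) (cod f)" "\<^bold>- f \<^bold>+ f = Zero C (dom f) (cod f)"
proof -
  interpret G: comm_group "hom_group C (dom f) (cod f)" by (rule comm_group_arr[OF assms(1)])
  show "f \<^bold>- f = Zero C (dom f) (cod f)" "\<^bold>- f \<^bold>+ f = Zero C (dom f) (cod f)"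
    using G.r_inv[of f] G.l_inv[of f] arr_carrier[OF assms(1)]
    unfolding mns_def neg_def by (auto simp: hom_group_def)
qed

lemma mns_unique:
  assumes "arr f" "arr g" "dom g = dom f" "cod g = cod f" "f \<^bold>+ g = Zero C (dom f) (cod f)"
  shows "g = \<^bold>- f"
proof -
  have "g = \<^bold>- f \<^bold>+ (f \<^bold>+ g)"
    using assms(1-4) by (simp flip: add_assoc)
  then show ?thesis
    using assms by simp
qed

lemma mns_mns [simp]: "arr f \<Longrightarrow> \<^bold>- (\<^bold>- f) = f"
  using mns_unique[of "\<^bold>- f" f] by simp

lemma mns_zero [simp]: "X \<in> Ob C \<Longrightarrow> Y \<in> Ob C \<Longrightarrow> \<^bold>- Zero C X Y = Zero C X Y"
  using mns_unique[of "Zero C X Y" "Zero C X Y"] by simp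

lemma diff_eq_zero:
  assumes "arr f" "arr g" "dom g = dom f" "cod g = cod f" "f \<^bold>- g = Zero C (dom f) (cod f)"
  shows "f = g"
  using mns_unique[of f "\<^bold>- g"] assms mns_mns by (metis arr_mns)

lemma add_diff_cancel:
  assumes "arr f" "arr g" "dom g = dom f" "cod g = cod f"
  shows "g \<^bold>+ (f \<^bold>- g) = f" "(f \<^bold>- g) \<^bold>+ g = f"
proof -
  show "(f \<^bold>- g) \<^bold>+ g = f"
    using assms by (simp add: add_assoc)
  then show "g \<^bold>+ (f \<^bold>- g) = f"
    using assms by (metis add_commute arr_add arr_mns)
qed

lemma comp_add_left:
  assumes "arr f" "arr g" "arr g'" "dom g = cod f" "dom g' = cod f" "cod g' = cod g"
  shows "(g \<^bold>+ g') \<cdot> f = g \<cdot> f \<^bold>+ g' \<cdot> f"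
  using Cmp_Add_left[of "dom f" "cod f" "cod g" f g g'] assms
    arr_in_hom[of f] arr_in_hom[of g] arr_in_hom[of g']
  by (auto simp: in_hom_def)

lemma comp_add_right:
  assumes "arr f" "arr f'" "arr g" "dom g = cod f" "cod f' = cod f" "dom f' = dom f"
  shows "g \<cdot> (f \<^bold>+ f') = g \<cdot> f \<^bold>+ g \<cdot> f'"
  using Cmp_Add_right[of "dom f" "cod f" "cod g" f f' g] assms
    arr_in_hom[of f] arr_in_hom[of g] arr_in_hom[of f']
  by (auto simp: in_hom_def)

lemma idem_zero:
  assumes "arr f" "f \<^bold>+ f = f" shows "f = Zero C (dom f) (cod f)"
proof -
  have "f = (f \<^bold>+ f) \<^bold>- f"
    using assms(1) by (simp add: add_assoc)
  then show ?thesis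
    using assms by simp
qed

lemma comp_zero [simp]:
  assumes "arr f" "X \<in> Ob C"
  shows "cod f = Y \<Longrightarrow> Zero C Y X \<cdot> f = Zero C (dom f) X"
    and "dom f = Y \<Longrightarrow> f \<cdot> Zero C X Y = Zero C X (cod f)"
proof -
  have "Zero C (cod f) X \<cdot> f = Zero C (dom f) X"
    using idem_zero[of "Zero C (cod f) X \<cdot> f"] comp_add_left[of f "Zero C (cod f) X" "Zero C (cod f) X"] assms
    by simp
  then show "cod f = Y \<Longrightarrow> Zero C Y X \<cdot> f = Zero C (dom f) X" by simp
  have "f \<cdot> Zero C X (dom f) = Zero C X (cod f)"
    using idem_zero[of "f \<cdot> Zero C X (dom f)"] comp_add_right[of "Zero C X (dom f)" "Zero C X (dom f)" f] assms
    by simp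
  then show "dom f = Y \<Longrightarrow> f \<cdot> Zero C X Y = Zero C X (cod f)" by simp
qed

lemma comp_mns [simp]:
  assumes "arr f" "arr g" "dom g = cod f"
  shows "(\<^bold>- g) \<cdot> f = \<^bold>- (g \<cdot> f)" "g \<cdot> (\<^bold>- f) = \<^bold>- (g \<cdot> f)"
proof -
  show "(\<^bold>- g) \<cdot> f = \<^bold>- (g \<cdot> f)"
    using assms comp_add_left[of f g "\<^bold>- g"] by (intro mns_unique) auto
  show "g \<cdot> (\<^bold>- f) = \<^bold>- (g \<cdot> f)"
    using assms comp_add_right[of f "\<^bold>- f" g] by (intro mns_unique) auto
qed

lemma mns_add:
  assumes "arr f" "arr g" "dom g = dom f" "cod g = cod f"
  shows "\<^bold>- (f \<^bold>+ g) = \<^bold>- f \<^bold>- g"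
proof (rule mns_unique[symmetric])
  have "(f \<^bold>+ g) \<^bold>+ (\<^bold>- f \<^bold>- g) = f \<^bold>+ (g \<^bold>+ (\<^bold>- g \<^bold>- f))"
    using assms add_commute[of "\<^bold>- f" "\<^bold>- g"] by (simp add: add_assoc)
  also have "\<dots> = f \<^bold>+ ((g \<^bold>- g) \<^bold>- f)"
    using assms add_assoc[of g "\<^bold>- g" "\<^bold>- f"] by simp
  also have "\<dots> = Zero C (dom f) (cod f)"
    using assms by simp
  finally show "(f \<^bold>+ g) \<^bold>+ (\<^bold>- f \<^bold>- g) = Zero C (dom (f \<^bold>+ g)) (cod (f \<^bold>+ g))"
    using assms by simp
qed (use assms in auto)

lemmas comp_distrib = comp_add_left comp_add_right mns_add

lemma is_zero_object_iff: "is_zero_object C Z \<longleftrightarrow> Z \<in> Ob C \<and> Idt C Z = Zero C Z Z"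
proof
  assume Z: "is_zero_object C Z"
  then have "Z \<in> Ob C" "\<exists>!f. f \<in> Hom C Z Z"
    by (auto simp: is_zero_object_def)
  then show "Z \<in> Ob C \<and> Idt C Z = Zero C Z Z"
    using Idt_closed[of Z] in_homD(6)[OF zero_in_hom] by blast
next
  assume Z: "Z \<in> Ob C \<and> Idt C Z = Zero C Z Z"
  have "f = Zero C X Z" if "\<guillemotleft>f : X \<rightarrow> Z\<guillemotright>" for X f
  proof -
    have "f = Zero C Z Z \<cdot> f"
      using comp_Idt(1)[of f Z] Z that by (simp add: in_hom_iff)
    then show ?thesis
      using Z that by (simp add: in_hom_iff)
  qed
  moreover have "f = Zero C Z X" if "\<guillemotleft>f : Z \<rightarrow> X\<guillemotright>" for X f
  proof -
    have "f = f \<cdot> Zero C Z Z"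
      using comp_Idt(2)[of f Z] Z that by (simp add: in_hom_iff)
    then show ?thesis
      using Z that by (simp add: in_hom_iff)
  qed
  ultimately show "is_zero_object C Z"
    using Z zero_in_hom unfolding is_zero_object_def in_hom_def by (metis (no_types, lifting))
qed

lemma zero_objectD:
  assumes "is_zero_object C Z"
  shows "Z \<in> Ob C" and "\<guillemotleft>f : X \<rightarrow> Z\<guillemotright> \<Longrightarrow> f = Zero C X Z" and "\<guillemotleft>g : Z \<rightarrow> X\<guillemotright> \<Longrightarrow> g = Zero C Z X"
proof -
  show Z: "Z \<in> Ob C" using assms by (simp add: is_zero_object_def)
  show "f = Zero C X Z" if "\<guillemotleft>f : X \<rightarrow> Z\<guillemotright>"
    using assms that zero_in_hom[of X Z] unfolding is_zero_object_def in_hom_def by blast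
  show "g = Zero C Z X" if "\<guillemotleft>g : Z \<rightarrow> X\<guillemotright>"
    using assms that zero_in_hom[of Z X] unfolding is_zero_object_def in_hom_def by blast
qed

end

section \<open>Triangulated categories\<close>

context triangulated
begin

notation in_hom  (\<open>\<guillemotleft>_ : _ \<rightarrow> _\<guillemotright>\<close>)
notation plus  (infixl \<open>\<^bold>+\<close> 65)
notation mns  (\<open>\<^bold>- _\<close> [81] 80)
notation diff  (infixl \<open>\<^bold>-\<close> 65)

lemma ShA_in_hom:
  assumes "\<guillemotleft>f : X \<rightarrow> Y\<guillemotright>" shows "\<guillemotleft>ShA T f : ShO T X \<rightarrow> ShO T Y\<guillemotright>"
  using assms ShA_fully_faithful[of X Y] ShO_closed by (auto simp: in_hom_def bij_betw_def)

lemma ShO_Ob [simp]: "X \<in> Ob T \<Longrightarrow> ShO T X \<in> Ob T"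
  by (rule ShO_closed)

lemma arr_ShA [simp]:
  assumes "arr f"
  shows "arr (ShA T f)" "dom (ShA T f) = ShO T (dom f)" "cod (ShA T f) = ShO T (cod f)"
  using ShA_in_hom[OF arr_in_hom[OF assms]] by (auto simp: in_hom_iff)

lemma ShA_eqD:
  assumes "ShA T f = ShA T g" "\<guillemotleft>f : X \<rightarrow> Y\<guillemotright>" "\<guillemotleft>g : X \<rightarrow> Y\<guillemotright>"
  shows "f = g"
  using assms ShA_fully_faithful[of X Y] by (auto simp: in_hom_def bij_betw_def dest: inj_onD)

lemma ShA_full:
  assumes "\<guillemotleft>g : ShO T X \<rightarrow> ShO T Y\<guillemotright>" "X \<in> Ob T" "Y \<in> Ob T"
  obtains f where "\<guillemotleft>f : X \<rightarrow> Y\<guillemotright>" "ShA T f = g"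
proof -
  have "g \<in> ShA T ` Hom T X Y"
    using assms ShA_fully_faithful[of X Y] by (auto simp: in_hom_def bij_betw_def)
  then show ?thesis
    using that assms by (auto simp: in_hom_def)
qed

lemma ShA_comp [simp]: "arr f \<Longrightarrow> arr g \<Longrightarrow> dom g = cod f \<Longrightarrow> ShA T (g \<cdot> f) = ShA T g \<cdot> ShA T f"
  using ShA_Cmp[of "dom f" "cod f" "cod g" f g] arr_in_hom[of f] arr_in_hom[of g]
  by (simp add: in_hom_def)

lemma ShA_add [simp]:
  "arr f \<Longrightarrow> arr g \<Longrightarrow> dom g = dom f \<Longrightarrow> cod g = cod f \<Longrightarrow> ShA T (f \<^bold>+ g) = ShA T f \<^bold>+ ShA T g"
  using ShA_Add[of "dom f" "cod f" f g] arr_in_hom[of f] arr_in_hom[of g]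
  by (simp add: in_hom_def)

lemma ShA_zero [simp]:
  assumes "X \<in> Ob T" "Y \<in> Ob T" shows "ShA T (Zero T X Y) = Zero T (ShO T X) (ShO T Y)"
  using idem_zero[of "ShA T (Zero T X Y)"] ShA_add[of "Zero T X Y" "Zero T X Y"] assms by simp

lemma ShA_mns [simp]: "arr f \<Longrightarrow> ShA T (\<^bold>- f) = \<^bold>- ShA T f"
  using ShA_add[of f "\<^bold>- f"] by (intro mns_unique) (auto simp del: ShA_add)

lemma ShO_zero_object: "is_zero_object T Z \<Longrightarrow> is_zero_object T (ShO T Z)"
  unfolding is_zero_object_iff using ShA_Idt[of Z] ShA_zero[of Z Z] by auto

lemma desuspension:
  assumes "Y \<in> Ob T"
  obtains X f g where "X \<in> Ob T" "\<guillemotleft>f : ShO T X \<rightarrow> Y\<guillemotright>" "\<guillemotleft>g : Y \<rightarrow> ShO T X\<guillemotright>"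
    "f \<cdot> g = Idt T Y" "g \<cdot> f = Idt T (ShO T X)"
proof -
  obtain X f where "X \<in> Ob T" "is_iso T (ShO T X) Y f"
    using ShO_essentially_surjective[OF assms] by blast
  then show ?thesis
    using that assms ShO_closed by (elim is_isoE) auto
qed

lemma triD:
  assumes "exact_triangle T X Y Z f g h"
  shows "\<guillemotleft>f : X \<rightarrow> Y\<guillemotright>" "\<guillemotleft>g : Y \<rightarrow> Z\<guillemotright>" "\<guillemotleft>h : Z \<rightarrow> ShO T X\<guillemotright>"
  using assms by (auto simp: exact_triangle_def candidate_triangle_def in_hom_def)

lemma candidateI:
  assumes "\<guillemotleft>f : X \<rightarrow> Y\<guillemotright>" "\<guillemotleft>g : Y \<rightarrow> Z\<guillemotright>" "\<guillemotleft>h : Z \<rightarrow> ShO T X\<guillemotright>"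
  shows "candidate_triangle T X Y Z f g h"
  using assms by (auto simp: candidate_triangle_def in_hom_def)

lemma rotate_iff:
  assumes "\<guillemotleft>f : X \<rightarrow> Y\<guillemotright>" "\<guillemotleft>g : Y \<rightarrow> Z\<guillemotright>" "\<guillemotleft>h : Z \<rightarrow> ShO T X\<guillemotright>"
  shows "exact_triangle T X Y Z f g h \<longleftrightarrow> exact_triangle T Y Z (ShO T X) g h (\<^bold>- ShA T f)"
  using triangle_rotate[OF candidateI[OF assms]] assms by (simp add: mns_def in_hom_iff)

lemma rotate:
  "exact_triangle T X Y Z f g h \<Longrightarrow> exact_triangle T Y Z (ShO T X) g h (\<^bold>- ShA T f)"
  by (metis rotate_iff triD)

lemma fill:
  assumes "exact_triangle T X Y Z f g h" "exact_triangle T X' Y' Z' f' g' h'"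
    "\<guillemotleft>a : X \<rightarrow> X'\<guillemotright>" "\<guillemotleft>b : Y \<rightarrow> Y'\<guillemotright>" "b \<cdot> f = f' \<cdot> a"
  obtains c where "\<guillemotleft>c : Z \<rightarrow> Z'\<guillemotright>" "c \<cdot> g = g' \<cdot> b" "ShA T a \<cdot> h = h' \<cdot> c"
proof -
  have "a \<in> Hom T X X'" "b \<in> Hom T Y Y'" "Z \<in> Ob T" "Z' \<in> Ob T"
    using assms triD by (auto simp: in_hom_def)
  then show ?thesis
    using triangle_fill[OF assms(1,2)] assms(5) that by (metis in_homI)
qed

lemma cone_exists:
  assumes "\<guillemotleft>f : X \<rightarrow> Y\<guillemotright>"
  obtains Z g h where "exact_triangle T X Y Z f g h"
  using triangle_exists assms by (metis in_homD(4-6))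

subsection \<open>Long exact sequences\<close>

text \<open>
  Elementwise exactness of \<open>T(W,-)\<close> and \<open>T(-,W)\<close> on a triangle. All of it comes from filling in maps between
  the triangle and rotations of trivial triangles.
\<close>

lemma tri_comp_zero:
  assumes "exact_triangle T X Y Z f g h" shows "g \<cdot> f = Zero T X Z"
proof -
  obtain N where N: "is_zero_object T N"
    using zero_object by blast
  note [simp] = zero_objectD(1)[OF N] in_homD(1-5)[OF triD(1)[OF assms]] in_homD(1-5)[OF triD(2)[OF assms]]
  have "exact_triangle T X X N (Idt T X) (Zero T X N) (Zero T N (ShO T X))"
    using triangle_Idt N by simp
  then obtain c where c: "\<guillemotleft>c : N \<rightarrow> Z\<guillemotright>" "c \<cdot> Zero T X N = g \<cdot> f"
    by (rule fill[OF _ assms, of _ _ _ _ _ _ "Idt T X" f]) (auto simp: in_hom_iff)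
  then show ?thesis
    by (simp add: in_hom_iff flip: c(2))
qed

lemma tri_comp_zero3:
  assumes "exact_triangle T X Y Z f g h" shows "h \<cdot> g = Zero T Y (ShO T X)"
  using tri_comp_zero[OF rotate[OF assms]] .

lemma tri_comp_zeroS:
  assumes "exact_triangle T X Y Z f g h" shows "ShA T f \<cdot> h = Zero T Z (ShO T Y)"
proof -
  note [simp] = in_homD(1-5)[OF triD(1)[OF assms]] in_homD(1-5)[OF triD(2)[OF assms]]
    in_homD(1-5)[OF triD(3)[OF assms]]
  have "\<^bold>- (ShA T f \<cdot> h) = Zero T Z (ShO T Y)"
    using tri_comp_zero3[OF rotate[OF assms]] by simp
  then have "\<^bold>- (\<^bold>- (ShA T f \<cdot> h)) = \<^bold>- Zero T Z (ShO T Y)"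
    by simp
  then show ?thesis
    by (simp del: comp_mns)
qed

lemma tri_lift:
  assumes tri: "exact_triangle T X Y Z f g h" and t: "\<guillemotleft>t : W \<rightarrow> Y\<guillemotright>" and gt: "g \<cdot> t = Zero T W Z"
  obtains s where "\<guillemotleft>s : W \<rightarrow> X\<guillemotright>" "t = f \<cdot> s"
proof -
  obtain N where N: "is_zero_object T N"
    using zero_object by blast
  note [simp] = zero_objectD(1)[OF N] in_homD(1-5)[OF triD(1)[OF tri]] in_homD(1-5)[OF triD(2)[OF tri]]
    in_homD(1-5)[OF t]
  have "exact_triangle T W W N (Idt T W) (Zero T W N) (Zero T N (ShO T W))"
    using triangle_Idt N by simp
  note W = rotate[OF this]
  obtain c where c: "\<guillemotleft>c : ShO T W \<rightarrow> ShO T X\<guillemotright>"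
      "ShA T t \<cdot> \<^bold>- ShA T (Idt T W) = \<^bold>- ShA T f \<cdot> c"
    by (rule fill[OF W rotate[OF tri] t zero_in_hom]) (auto simp: gt)
  obtain s where s: "\<guillemotleft>s : W \<rightarrow> X\<guillemotright>" "ShA T s = c"
    using ShA_full[OF c(1)] by auto
  note [simp] = in_homD(1-5)[OF s(1)]
  have "\<^bold>- ShA T t = \<^bold>- ShA T (f \<cdot> s)"
    using c(2) by (simp add: ShA_Idt flip: s(2))
  then have "\<^bold>- (\<^bold>- ShA T t) = \<^bold>- (\<^bold>- ShA T (f \<cdot> s))"
    by (rule arg_cong)
  then have "ShA T t = ShA T (f \<cdot> s)"
    by (simp del: ShA_comp)
  then have "t = f \<cdot> s"
    by (rule ShA_eqD[of _ _ W Y]) (auto simp: in_hom_iff)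
  then show ?thesis
    using that s by blast
qed

lemma tri_lift3:
  assumes tri: "exact_triangle T X Y Z f g h" and t: "\<guillemotleft>t : W \<rightarrow> Z\<guillemotright>" and "h \<cdot> t = Zero T W (ShO T X)"
  obtains s where "\<guillemotleft>s : W \<rightarrow> Y\<guillemotright>" "t = g \<cdot> s"
  using tri_lift[OF rotate[OF tri] t assms(3)] .

lemma tri_liftS:
  assumes tri: "exact_triangle T X Y Z f g h" and t: "\<guillemotleft>t : W \<rightarrow> ShO T X\<guillemotright>"
    and "ShA T f \<cdot> t = Zero T W (ShO T Y)"
  obtains s where "\<guillemotleft>s : W \<rightarrow> Z\<guillemotright>" "t = h \<cdot> s"
proof -
  have "(\<^bold>- ShA T f) \<cdot> t = Zero T W (ShO T Y)"
    using assms(3) t triD(1)[OF tri] by (simp add: in_hom_iff)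
  then show ?thesis
    using tri_lift3[OF rotate[OF tri] t] that by blast
qed

lemma tri_ext:
  assumes tri: "exact_triangle T X Y Z f g h" and t: "\<guillemotleft>t : Y \<rightarrow> W\<guillemotright>" and tf: "t \<cdot> f = Zero T X W"
  obtains s where "\<guillemotleft>s : Z \<rightarrow> W\<guillemotright>" "t = s \<cdot> g"
proof -
  obtain N where N: "is_zero_object T N"
    using zero_object by blast
  note [simp] = zero_objectD(1)[OF N] in_homD(1-5)[OF triD(1)[OF tri]] in_homD(1-5)[OF triD(2)[OF tri]]
    in_homD(1-5)[OF t]
  have "exact_triangle T W W (ShO T N) (Idt T W) (Zero T W (ShO T N)) (Zero T (ShO T N) (ShO T W))"
    using triangle_Idt ShO_zero_object N by simp
  then have "exact_triangle T N W W (Zero T N W) (Idt T W) (Zero T W (ShO T N))"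
    by (subst rotate_iff) (auto simp: in_hom_iff)
  then obtain c where c: "\<guillemotleft>c : Z \<rightarrow> W\<guillemotright>" "c \<cdot> g = Idt T W \<cdot> t"
    by (rule fill[OF tri _ zero_in_hom t]) (auto simp: tf)
  then show ?thesis
    using that by simp
qed

lemma tri_ext3:
  assumes tri: "exact_triangle T X Y Z f g h" and t: "\<guillemotleft>t : Z \<rightarrow> W\<guillemotright>" and "t \<cdot> g = Zero T Y W"
  obtains s where "\<guillemotleft>s : ShO T X \<rightarrow> W\<guillemotright>" "t = s \<cdot> h"
  using tri_ext[OF rotate[OF tri] t assms(3)] .

lemma tri_extS:
  assumes tri: "exact_triangle T X Y Z f g h" and t: "\<guillemotleft>t : ShO T X \<rightarrow> W\<guillemotright>" and "t \<cdot> h = Zero T Z W"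
  obtains s where "\<guillemotleft>s : ShO T Y \<rightarrow> W\<guillemotright>" "t = s \<cdot> ShA T f"
proof -
  obtain s where s: "\<guillemotleft>s : ShO T Y \<rightarrow> W\<guillemotright>" "t = s \<cdot> \<^bold>- ShA T f"
    using tri_ext3[OF rotate[OF tri] t assms(3)] .
  note [simp] = in_homD(1-5)[OF s(1)] in_homD(1-5)[OF triD(1)[OF tri]]
  show ?thesis
    by (rule that[of "\<^bold>- s"]) (use s in \<open>auto simp: in_hom_iff\<close>)
qed

text \<open>
  The object of a cone of \<open>f\<close> is isomorphic to a suspension \<open>\<Sigma>W\<close>, and the triangle with \<open>\<Sigma>W\<close> in third place
  rotates back.
\<close>

lemma fibre_exists:
  assumes f: "\<guillemotleft>f : X \<rightarrow> Y\<guillemotright>"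
  obtains W w v where "exact_triangle T W X Y w f v"
proof -
  obtain Z g h where tri: "exact_triangle T X Y Z f g h"
    using cone_exists[OF f] .
  note g = triD(2)[OF tri] and h = triD(3)[OF tri]
  have Z: "Z \<in> Ob T" using g by (simp add: in_hom_iff)
  obtain W c d where W: "W \<in> Ob T" and d: "\<guillemotleft>d : ShO T W \<rightarrow> Z\<guillemotright>" and c: "\<guillemotleft>c : Z \<rightarrow> ShO T W\<guillemotright>"
    and dc: "d \<cdot> c = Idt T Z" and cd: "c \<cdot> d = Idt T (ShO T W)"
    using desuspension[OF Z] .
  note [simp] = in_homD(1-5)[OF f] in_homD(1-5)[OF g] in_homD(1-5)[OF h] in_homD(1-5)[OF c] in_homD(1-5)[OF d] W
  have "\<guillemotleft>\<^bold>- (h \<cdot> d) : ShO T W \<rightarrow> ShO T X\<guillemotright>"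
    by (simp add: in_hom_iff)
  then obtain w where w: "\<guillemotleft>w : W \<rightarrow> X\<guillemotright>" "ShA T w = \<^bold>- (h \<cdot> d)"
    using ShA_full by force
  have "exact_triangle T X Y (ShO T W) f (c \<cdot> g) (h \<cdot> d)"
  proof (rule triangle_iso[OF tri, where a = "Idt T X" and b = "Idt T Y" and c = c])
    show "candidate_triangle T X Y (ShO T W) f (c \<cdot> g) (h \<cdot> d)"
      by (rule candidateI) (auto simp: in_hom_iff)
    show "is_iso T Z (ShO T W) c"
      using is_isoI[OF c d dc cd] .
    have "(h \<cdot> d) \<cdot> c = h"
      by (simp add: comp_assoc dc)
    then show "ShA T (Idt T X) \<cdot> h = (h \<cdot> d) \<cdot> c"
      by (simp add: ShA_Idt)
  qed (auto simp: is_iso_Idt)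
  then have "exact_triangle T W X Y w f (c \<cdot> g)"
    using w by (subst rotate_iff) (auto simp: in_hom_iff)
  then show ?thesis
    using that by blast
qed

lemma cone_zero_iso:
  assumes tri: "exact_triangle T X Y Z f g h" and Z: "is_zero_object T Z"
  shows "is_iso T X Y f"
proof -
  note f = triD(1)[OF tri] and g = triD(2)[OF tri] and h = triD(3)[OF tri]
  note [simp] = in_homD(1-5)[OF f] in_homD(1-5)[OF g] in_homD(1-5)[OF h]
  have 1: "\<guillemotleft>Idt T Y : Y \<rightarrow> Y\<guillemotright>" "\<guillemotleft>Idt T (ShO T X) : ShO T X \<rightarrow> ShO T X\<guillemotright>"
    by (auto simp: in_hom_iff)
  have "g \<cdot> Idt T Y = Zero T Y Z" "Idt T (ShO T X) \<cdot> h = Zero T Z (ShO T X)"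
    using zero_objectD(2,3)[OF Z] g h by auto
  then obtain s t where s: "\<guillemotleft>s : Y \<rightarrow> X\<guillemotright>" "Idt T Y = f \<cdot> s"
      and t: "\<guillemotleft>t : ShO T Y \<rightarrow> ShO T X\<guillemotright>" "Idt T (ShO T X) = t \<cdot> ShA T f"
    by (metis tri_lift[OF tri 1(1)] tri_extS[OF tri 1(2)])
  obtain t' where t': "\<guillemotleft>t' : Y \<rightarrow> X\<guillemotright>" "ShA T t' = t"
    using ShA_full[OF t(1)] by auto
  note [simp] = in_homD(1-5)[OF t'(1)]
  have "ShA T (t' \<cdot> f) = ShA T (Idt T X)"
    using t(2) t'(2) by (simp add: ShA_Idt)
  then have "t' \<cdot> f = Idt T X"
    by (rule ShA_eqD[of _ _ X X]) (auto simp: in_hom_iff)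
  then show ?thesis
    using left_right_inverse[OF f t'(1) s(1)] s(2) by simp
qed

subsection \<open>Coproducts, suspension and triangles\<close>

text \<open>
  The suspension is an equivalence, so that every object of \<open>T\<close> is a test object \<open>\<Sigma>Z\<close> up to isomorphism.
\<close>

lemma coproduct_ShA:
  assumes Q: "is_coproduct T I X Q \<iota>"
  shows "is_coproduct T I (\<lambda>i. ShO T (X i)) (ShO T Q) (\<lambda>i. ShA T (\<iota> i))"
proof (rule is_coproductI)
  note [simp] = is_coproductD(1)[OF Q]
  note [simp] = in_homD(1-4)[OF is_coproductD(2)[OF Q]]
  show "ShO T Q \<in> Ob T" by simp
  show "\<guillemotleft>ShA T (\<iota> i) : ShO T (X i) \<rightarrow> ShO T Q\<guillemotright>" if "i \<in> I" for i
    using that by (simp add: in_hom_iff)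
  show "\<exists>h. \<guillemotleft>h : ShO T Q \<rightarrow> Z\<guillemotright> \<and> (\<forall>i\<in>I. h \<cdot> ShA T (\<iota> i) = t i)"
    if Z: "Z \<in> Ob T" and t: "\<And>i. i \<in> I \<Longrightarrow> \<guillemotleft>t i : ShO T (X i) \<rightarrow> Z\<guillemotright>" for Z t
  proof -
    obtain Z' d c where Z': "Z' \<in> Ob T" and d: "\<guillemotleft>d : ShO T Z' \<rightarrow> Z\<guillemotright>" and c: "\<guillemotleft>c : Z \<rightarrow> ShO T Z'\<guillemotright>"
      and dc: "d \<cdot> c = Idt T Z" and "c \<cdot> d = Idt T (ShO T Z')"
      using desuspension[OF Z] .
    note [simp] = in_homD(1-5)[OF c] in_homD(1-5)[OF d] Z'
    have dc': "d \<cdot> (c \<cdot> f) = f" if "\<guillemotleft>f : W \<rightarrow> Z\<guillemotright>" for f W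
      using that by (simp add: in_hom_iff dc flip: comp_assoc)
    have "\<exists>s. \<guillemotleft>s : X i \<rightarrow> Z'\<guillemotright> \<and> ShA T s = c \<cdot> t i" if "i \<in> I" for i
      by (rule ShA_full[OF comp_in_hom[OF c t[OF that]]]) (use that in auto)
    then obtain s where s: "\<And>i. i \<in> I \<Longrightarrow> \<guillemotleft>s i : X i \<rightarrow> Z'\<guillemotright>" "\<And>i. i \<in> I \<Longrightarrow> ShA T (s i) = c \<cdot> t i"
      by metis
    then obtain h where h: "\<guillemotleft>h : Q \<rightarrow> Z'\<guillemotright>" "\<And>i. i \<in> I \<Longrightarrow> h \<cdot> \<iota> i = s i"
      using copair_exists[OF Q Z' s(1)] by blast
    note [simp] = in_homD(1-5)[OF h(1)]
    have "(d \<cdot> ShA T h) \<cdot> ShA T (\<iota> i) = t i" if i: "i \<in> I" for i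
    proof -
      have "(d \<cdot> ShA T h) \<cdot> ShA T (\<iota> i) = d \<cdot> ShA T (h \<cdot> \<iota> i)"
        using i by (simp add: comp_assoc)
      also have "\<dots> = t i"
        using dc'[OF t[OF i]] i by (simp only: h(2) s(2))
      finally show ?thesis .
    qed
    then show ?thesis
      by (intro exI[of _ "d \<cdot> ShA T h"]) (auto simp: in_hom_iff)
  qed
  show "g = h"
    if gh: "\<guillemotleft>g : ShO T Q \<rightarrow> Z\<guillemotright>" "\<guillemotleft>h : ShO T Q \<rightarrow> Z\<guillemotright>"
      "\<And>i. i \<in> I \<Longrightarrow> g \<cdot> ShA T (\<iota> i) = h \<cdot> ShA T (\<iota> i)" for Z g h
  proof -
    have Z: "Z \<in> Ob T"
      using gh(1) by (simp add: in_hom_iff)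
    obtain Z' d c where Z': "Z' \<in> Ob T" and d: "\<guillemotleft>d : ShO T Z' \<rightarrow> Z\<guillemotright>" and c: "\<guillemotleft>c : Z \<rightarrow> ShO T Z'\<guillemotright>"
      and dc: "d \<cdot> c = Idt T Z" and "c \<cdot> d = Idt T (ShO T Z')"
      using desuspension[OF Z] .
    note [simp] = in_homD(1-5)[OF c] in_homD(1-5)[OF d] Z'
    have dc': "d \<cdot> (c \<cdot> f) = f" if "\<guillemotleft>f : W \<rightarrow> Z\<guillemotright>" for f W
      using that by (simp add: in_hom_iff dc flip: comp_assoc)
    obtain g' where g': "\<guillemotleft>g' : Q \<rightarrow> Z'\<guillemotright>" "ShA T g' = c \<cdot> g"
      using ShA_full[OF comp_in_hom[OF c gh(1)]] by auto
    obtain h' where h': "\<guillemotleft>h' : Q \<rightarrow> Z'\<guillemotright>" "ShA T h' = c \<cdot> h"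
      using ShA_full[OF comp_in_hom[OF c gh(2)]] by auto
    note [simp] = in_homD(1-5)[OF g'(1)] in_homD(1-5)[OF h'(1)] in_homD(1-5)[OF gh(1)] in_homD(1-5)[OF gh(2)]
    have "g' = h'"
    proof (rule coproduct_ext[OF Q g'(1) h'(1)])
      fix i assume i: "i \<in> I"
      have "ShA T (g' \<cdot> \<iota> i) = ShA T (h' \<cdot> \<iota> i)"
        using i gh(3)[OF i] by (simp add: g'(2) h'(2) comp_assoc)
      then show "g' \<cdot> \<iota> i = h' \<cdot> \<iota> i"
        by (rule ShA_eqD[of _ _ "X i" Z']) (use i in \<open>auto simp: in_hom_iff\<close>)
    qed
    then have "c \<cdot> g = c \<cdot> h"
      by (simp flip: g'(2) h'(2))
    then have "d \<cdot> (c \<cdot> g) = d \<cdot> (c \<cdot> h)"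
      by (rule arg_cong)
    then show ?thesis
      by (simp only: dc'[OF gh(1)] dc'[OF gh(2)])
  qed
qed

text \<open>
  The third map is recovered by comparison with a cone \<open>K\<close> of \<open>F\<close>: there is a map \<open>\<Coprod> Z\<^sub>i \<rightarrow> K\<close> by the
  filling axiom for each \<open>i\<close>, and it is an isomorphism.
\<close>

lemma coproduct_triangle:
  assumes P: "is_coproduct T I X P \<iota>" and Q: "is_coproduct T I Y Q \<kappa>" and R: "is_coproduct T I Z R \<mu>"
    and tri: "\<And>i. i \<in> I \<Longrightarrow> exact_triangle T (X i) (Y i) (Z i) (f i) (g i) (h i)"
    and F: "\<guillemotleft>F : P \<rightarrow> Q\<guillemotright>" "\<And>i. i \<in> I \<Longrightarrow> F \<cdot> \<iota> i = \<kappa> i \<cdot> f i"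
    and G: "\<guillemotleft>G : Q \<rightarrow> R\<guillemotright>" "\<And>i. i \<in> I \<Longrightarrow> G \<cdot> \<kappa> i = \<mu> i \<cdot> g i"
  obtains H where "exact_triangle T P Q R F G H"
proof -
  obtain K u v where K: "exact_triangle T P Q K F u v"
    using cone_exists[OF F(1)] .
  note u = triD(2)[OF K] and v = triD(3)[OF K]
  note [simp] = in_homD(1-5)[OF F(1)] in_homD(1-5)[OF G(1)] in_homD(1-5)[OF u] in_homD(1-5)[OF v]
  note [simp] = in_homD(1-4)[OF is_coproductD(2)[OF P]] in_homD(1-4)[OF is_coproductD(2)[OF Q]]
    in_homD(1-4)[OF is_coproductD(2)[OF R]] in_homD(1-3)[OF triD(1)[OF tri]]
    in_homD(1-3)[OF triD(2)[OF tri]] in_homD(1-3)[OF triD(3)[OF tri]]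
  have "\<exists>c. \<guillemotleft>c : Z i \<rightarrow> K\<guillemotright> \<and> c \<cdot> g i = u \<cdot> \<kappa> i \<and> ShA T (\<iota> i) \<cdot> h i = v \<cdot> c" if i: "i \<in> I" for i
    by (rule fill[OF tri[OF i] K is_coproductD(2)[OF P i] is_coproductD(2)[OF Q i]])
      (use F(2)[OF i] in auto)
  then obtain c where c: "\<And>i. i \<in> I \<Longrightarrow> \<guillemotleft>c i : Z i \<rightarrow> K\<guillemotright>"
      "\<And>i. i \<in> I \<Longrightarrow> c i \<cdot> g i = u \<cdot> \<kappa> i" "\<And>i. i \<in> I \<Longrightarrow> ShA T (\<iota> i) \<cdot> h i = v \<cdot> c i"
    by metis
  obtain C where C: "\<guillemotleft>C : R \<rightarrow> K\<guillemotright>" "\<And>i. i \<in> I \<Longrightarrow> C \<cdot> \<mu> i = c i"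
    using copair_exists[OF R _ c(1)] by auto
  note [simp] = in_homD(1-5)[OF C(1)]
  have CG: "C \<cdot> G = u"
  proof (rule coproduct_ext[OF Q comp_in_hom[OF C(1) G(1)] u])
    fix i assume i: "i \<in> I"
    have "(C \<cdot> G) \<cdot> \<kappa> i = (C \<cdot> \<mu> i) \<cdot> g i"
      using i by (simp add: comp_assoc G(2))
    then show "(C \<cdot> G) \<cdot> \<kappa> i = u \<cdot> \<kappa> i"
      using i by (simp add: C(2) c(2))
  qed
  have vC: "(v \<cdot> C) \<cdot> \<mu> i = ShA T (\<iota> i) \<cdot> h i" if "i \<in> I" for i
    using that by (simp add: comp_assoc C(2) c(3))
  \<comment> \<open>Composition with \<open>C\<close> is bijective on maps into every object \<open>W\<close>: this is the five lemma, as \<open>T(-, W)\<close>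
    takes coproducts to products and these preserve exactness.\<close>
  have inj: "t = Zero T K W" if t: "\<guillemotleft>t : K \<rightarrow> W\<guillemotright>" and tC: "t \<cdot> C = Zero T R W" for t W
  proof -
    note [simp] = in_homD(1-5)[OF t]
    have "t \<cdot> u = (t \<cdot> C) \<cdot> G"
      by (simp add: comp_assoc CG)
    then have "t \<cdot> u = Zero T Q W"
      by (simp add: tC)
    then obtain s where s: "\<guillemotleft>s : ShO T P \<rightarrow> W\<guillemotright>" "t = s \<cdot> v"
      using tri_ext3[OF K t] by blast
    note [simp] = in_homD(1-5)[OF s(1)]
    have "\<exists>r. \<guillemotleft>r : ShO T (Y i) \<rightarrow> W\<guillemotright> \<and> s \<cdot> ShA T (\<iota> i) = r \<cdot> ShA T (f i)" if i: "i \<in> I" for i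
    proof -
      have "(s \<cdot> ShA T (\<iota> i)) \<cdot> h i = (t \<cdot> C) \<cdot> \<mu> i"
        using i vC[OF i] by (simp add: s(2) comp_assoc)
      then have "(s \<cdot> ShA T (\<iota> i)) \<cdot> h i = Zero T (Z i) W"
        using i by (simp add: tC)
      then show ?thesis
        by (rule tri_extS[OF tri[OF i] comp_in_hom[OF s(1) ShA_in_hom[OF is_coproductD(2)[OF P i]]]]) blast
    qed
    then obtain r where r: "\<And>i. i \<in> I \<Longrightarrow> \<guillemotleft>r i : ShO T (Y i) \<rightarrow> W\<guillemotright>"
        "\<And>i. i \<in> I \<Longrightarrow> s \<cdot> ShA T (\<iota> i) = r i \<cdot> ShA T (f i)"
      by metis
    obtain r' where r': "\<guillemotleft>r' : ShO T Q \<rightarrow> W\<guillemotright>" "\<And>i. i \<in> I \<Longrightarrow> r' \<cdot> ShA T (\<kappa> i) = r i"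
      using copair_exists[OF coproduct_ShA[OF Q] _ r(1)] by auto
    note [simp] = in_homD(1-5)[OF r'(1)]
    have "s = r' \<cdot> ShA T F"
    proof (rule coproduct_ext[OF coproduct_ShA[OF P] s(1)])
      fix i assume i: "i \<in> I"
      have "(r' \<cdot> ShA T F) \<cdot> ShA T (\<iota> i) = r' \<cdot> ShA T (F \<cdot> \<iota> i)"
        using i by (simp add: comp_assoc)
      also have "\<dots> = (r' \<cdot> ShA T (\<kappa> i)) \<cdot> ShA T (f i)"
        using i by (simp add: F(2) comp_assoc)
      finally show "s \<cdot> ShA T (\<iota> i) = (r' \<cdot> ShA T F) \<cdot> ShA T (\<iota> i)"
        using i by (simp add: r(2) r'(2))
    qed (auto simp: in_hom_iff)
    then have "t = r' \<cdot> (ShA T F \<cdot> v)"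
      by (simp add: s(2) comp_assoc)
    then show ?thesis
      by (simp add: tri_comp_zeroS[OF K])
  qed
  have surj: "\<exists>s. \<guillemotleft>s : K \<rightarrow> W\<guillemotright> \<and> s \<cdot> C = t" if t: "\<guillemotleft>t : R \<rightarrow> W\<guillemotright>" for t W
  proof -
    note [simp] = in_homD(1-5)[OF t]
    have GF: "G \<cdot> F = Zero T P R"
    proof (rule coproduct_ext[OF P])
      fix i assume i: "i \<in> I"
      have "(G \<cdot> F) \<cdot> \<iota> i = (G \<cdot> \<kappa> i) \<cdot> f i"
        using i by (simp add: comp_assoc F(2))
      then have "(G \<cdot> F) \<cdot> \<iota> i = \<mu> i \<cdot> (g i \<cdot> f i)"
        using i by (simp add: comp_assoc G(2))
      then show "(G \<cdot> F) \<cdot> \<iota> i = Zero T P R \<cdot> \<iota> i"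
        using i by (simp add: tri_comp_zero[OF tri[OF i]])
    qed (auto simp: in_hom_iff)
    have "(t \<cdot> G) \<cdot> F = Zero T P W"
      by (simp add: comp_assoc GF)
    then obtain s where s: "\<guillemotleft>s : K \<rightarrow> W\<guillemotright>" "t \<cdot> G = s \<cdot> u"
      using tri_ext[OF K comp_in_hom[OF t G(1)]] by blast
    note [simp] = in_homD(1-5)[OF s(1)]
    let ?d = "t \<^bold>- s \<cdot> C"
    have d: "\<guillemotleft>?d : R \<rightarrow> W\<guillemotright>"
      by (auto simp: in_hom_iff)
    have dG: "?d \<cdot> G = Zero T Q W"
      using s(2) by (simp add: comp_distrib comp_assoc CG)
    have "\<exists>r. \<guillemotleft>r : ShO T (X i) \<rightarrow> W\<guillemotright> \<and> ?d \<cdot> \<mu> i = r \<cdot> h i" if i: "i \<in> I" for i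
    proof -
      have "(?d \<cdot> \<mu> i) \<cdot> g i = (?d \<cdot> G) \<cdot> \<kappa> i"
        using i comp_assoc[of "g i" "\<mu> i" ?d] comp_assoc[of "\<kappa> i" G ?d] by (simp add: G(2))
      then have "(?d \<cdot> \<mu> i) \<cdot> g i = Zero T (Y i) W"
        using i by (simp add: dG)
      then show ?thesis
        by (rule tri_ext3[OF tri[OF i] comp_in_hom[OF d is_coproductD(2)[OF R i]]]) blast
    qed
    then obtain r where r: "\<And>i. i \<in> I \<Longrightarrow> \<guillemotleft>r i : ShO T (X i) \<rightarrow> W\<guillemotright>" "\<And>i. i \<in> I \<Longrightarrow> ?d \<cdot> \<mu> i = r i \<cdot> h i"
      by metis
    obtain r' where r': "\<guillemotleft>r' : ShO T P \<rightarrow> W\<guillemotright>" "\<And>i. i \<in> I \<Longrightarrow> r' \<cdot> ShA T (\<iota> i) = r i"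
      using copair_exists[OF coproduct_ShA[OF P] _ r(1)] by auto
    note [simp] = in_homD(1-5)[OF r'(1)]
    have "?d = r' \<cdot> (v \<cdot> C)"
    proof (rule coproduct_ext[OF R])
      fix i assume i: "i \<in> I"
      have "(r' \<cdot> (v \<cdot> C)) \<cdot> \<mu> i = (r' \<cdot> ShA T (\<iota> i)) \<cdot> h i"
        using i comp_assoc[of "\<mu> i" "v \<cdot> C" r'] by (simp add: vC comp_assoc[of "h i"])
      then show "?d \<cdot> \<mu> i = (r' \<cdot> (v \<cdot> C)) \<cdot> \<mu> i"
        using i by (simp add: r(2) r'(2))
    qed (auto simp: in_hom_iff)
    then have "t = s \<cdot> C \<^bold>+ r' \<cdot> (v \<cdot> C)"
      using add_diff_cancel(1)[of t "s \<cdot> C"] by simp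
    also have "\<dots> = (s \<^bold>+ r' \<cdot> v) \<cdot> C"
      by (simp add: comp_distrib comp_assoc)
    finally show ?thesis
      by (intro exI[of _ "s \<^bold>+ r' \<cdot> v"]) (auto simp: in_hom_iff)
  qed
  obtain B where B: "\<guillemotleft>B : K \<rightarrow> R\<guillemotright>" "B \<cdot> C = Idt T R"
    using surj[of "Idt T R" R] by (auto simp: in_hom_iff)
  note [simp] = in_homD(1-5)[OF B(1)]
  have "C \<cdot> B \<^bold>- Idt T K = Zero T K K"
    by (rule inj) (auto simp: in_hom_iff comp_distrib comp_assoc B(2))
  then have CB: "C \<cdot> B = Idt T K"
    using diff_eq_zero[of "C \<cdot> B" "Idt T K"] by simp
  have "exact_triangle T P Q R F G (v \<cdot> C)"
  proof (rule triangle_iso[OF K, where a = "Idt T P" and b = "Idt T Q" and c = B])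
    show "candidate_triangle T P Q R F G (v \<cdot> C)"
      by (rule candidateI) (auto simp: in_hom_iff)
    show "is_iso T K R B"
      using is_isoI[OF B(1) C(1) CB B(2)] .
    have "B \<cdot> u = (B \<cdot> C) \<cdot> G"
      by (simp add: comp_assoc CG)
    then show "B \<cdot> u = G \<cdot> Idt T Q"
      by (simp add: B(2))
    show "ShA T (Idt T P) \<cdot> v = (v \<cdot> C) \<cdot> B"
      by (simp add: comp_assoc CB ShA_Idt)
  qed (auto simp: is_iso_Idt)
  then show ?thesis
    using that by blast
qed

subsection \<open>Idempotents split\<close>

text \<open>
  If \<open>P\<close> were \<open>A \<oplus> B\<close> with \<open>A\<close> the image of the idempotent \<open>e\<close>, then on the coproduct \<open>Q\<close> of countably many
  copies of \<open>P\<close> there would be the map \<open>\<psi>\<close> that fixes every \<open>B\<close> and shifts the copies of \<open>A\<close> by one. It can be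
  written in terms of \<open>e\<close> alone and is a split monomorphism. Its cone, which exists in any case, is
  the missing summand, the copy of \<open>A\<close> in degree zero.
\<close>

lemma idempotent_splits:
  assumes e: "\<guillemotleft>e : P \<rightarrow> P\<guillemotright>" and ee: "e \<cdot> e = e"
    and Q: "is_coproduct T (UNIV :: nat set) (\<lambda>_. P) Q \<iota>"
  obtains A p q where "\<guillemotleft>p : P \<rightarrow> A\<guillemotright>" "\<guillemotleft>q : A \<rightarrow> P\<guillemotright>" "p \<cdot> q = Idt T A" "q \<cdot> p = e"
proof -
  \<comment> \<open>the projection to \<open>B\<close>\<close>
  define e' where "e' = Idt T P \<^bold>- e"
  note [simp] = in_homD(1-5)[OF e] is_coproductD(1)[OF Q]
  have \<iota>[simp]: "arr (\<iota> n)" "dom (\<iota> n) = P" "cod (\<iota> n) = Q" for n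
    using is_coproductD(2)[OF Q, of n] by (auto simp: in_hom_iff)
  have e'[simp]: "arr e'" "dom e' = P" "cod e' = P"
    by (auto simp: e'_def)
  have ee': "e \<cdot> e' = Zero T P P" "e' \<cdot> e = Zero T P P"
    by (auto simp: e'_def comp_distrib ee)
  have e'e': "e' \<cdot> e' = e'"
    by (subst (1) e'_def) (simp add: comp_distrib ee')
  have sum: "f \<cdot> e' \<^bold>+ f \<cdot> e = f" if "\<guillemotleft>f : P \<rightarrow> W\<guillemotright>" for f W
  proof -
    have "f \<cdot> e' \<^bold>+ f \<cdot> e = f \<cdot> (e' \<^bold>+ e)"
      using that by (simp add: in_hom_iff comp_distrib)
    also have "e' \<^bold>+ e = Idt T P"
      by (simp add: e'_def add_assoc)
    finally show ?thesis
      using that by (simp add: in_hom_iff)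
  qed
  have sum_\<iota>: "\<iota> n \<cdot> e' \<^bold>+ \<iota> n \<cdot> e = \<iota> n" "\<iota> n \<cdot> e \<^bold>+ \<iota> n \<cdot> e' = \<iota> n" for n
  proof -
    show "\<iota> n \<cdot> e' \<^bold>+ \<iota> n \<cdot> e = \<iota> n"
      by (rule sum[of _ Q]) (simp add: in_hom_iff)
    then show "\<iota> n \<cdot> e \<^bold>+ \<iota> n \<cdot> e' = \<iota> n"
      by (subst add_commute) auto
  qed
  obtain \<psi> where \<psi>: "\<guillemotleft>\<psi> : Q \<rightarrow> Q\<guillemotright>" "\<And>n. \<psi> \<cdot> \<iota> n = \<iota> n \<cdot> e' \<^bold>+ \<iota> (Suc n) \<cdot> e"
    by (rule copair_exists[OF Q, of Q "\<lambda>n. \<iota> n \<cdot> e' \<^bold>+ \<iota> (Suc n) \<cdot> e"]) (auto simp: in_hom_iff)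
  \<comment> \<open>\<open>\<theta>\<close> shifts the copies of \<open>A\<close> back, and kills the first of them.\<close>
  obtain \<theta> where \<theta>: "\<guillemotleft>\<theta> : Q \<rightarrow> Q\<guillemotright>" "\<And>n. \<theta> \<cdot> \<iota> n = (case n of 0 \<Rightarrow> \<iota> 0 \<cdot> e' | Suc m \<Rightarrow> \<iota> n \<cdot> e' \<^bold>+ \<iota> m \<cdot> e)"
    by (rule copair_exists[OF Q, of Q "\<lambda>n. case n of 0 \<Rightarrow> \<iota> 0 \<cdot> e' | Suc m \<Rightarrow> \<iota> n \<cdot> e' \<^bold>+ \<iota> m \<cdot> e"])
      (auto simp: in_hom_iff split: nat.split)
  obtain \<pi> where \<pi>: "\<guillemotleft>\<pi> : Q \<rightarrow> P\<guillemotright>" "\<And>n. \<pi> \<cdot> \<iota> n = (case n of 0 \<Rightarrow> Idt T P | Suc m \<Rightarrow> Zero T P P)"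
    by (rule copair_exists[OF Q, of P "\<lambda>n. case n of 0 \<Rightarrow> Idt T P | Suc m \<Rightarrow> Zero T P P"])
      (auto simp: in_hom_iff split: nat.split)
  note [simp] = in_homD(1-5)[OF \<psi>(1)] in_homD(1-5)[OF \<theta>(1)] in_homD(1-5)[OF \<pi>(1)]
  have assoc: "f \<cdot> (\<iota> n \<cdot> g) = (f \<cdot> \<iota> n) \<cdot> g" if "\<guillemotleft>f : Q \<rightarrow> W\<guillemotright>" "\<guillemotleft>g : P \<rightarrow> P\<guillemotright>" for f g n W
    using that by (simp add: in_hom_iff comp_assoc)
  have assoc3: "(\<iota> n \<cdot> f) \<cdot> g = \<iota> n \<cdot> (f \<cdot> g)" if "\<guillemotleft>f : P \<rightarrow> P\<guillemotright>" "\<guillemotleft>g : P \<rightarrow> P\<guillemotright>" for f g n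
    using that by (simp add: in_hom_iff comp_assoc)
  have e'_in: "\<guillemotleft>e' : P \<rightarrow> P\<guillemotright>"
    by (simp add: in_hom_iff)
  note calc = comp_distrib assoc[OF _ e] assoc[OF _ e'_in] assoc3[OF e e] assoc3[OF e e'_in]
    assoc3[OF e'_in e] assoc3[OF e'_in e'_in] ee ee' e'e' sum_\<iota>
  have \<theta>\<psi>: "\<theta> \<cdot> \<psi> = Idt T Q"
  proof (rule coproduct_ext[OF Q comp_in_hom[OF \<theta>(1) \<psi>(1)]])
    fix n
    have "(\<theta> \<cdot> \<psi>) \<cdot> \<iota> n = (\<theta> \<cdot> \<iota> n) \<cdot> e' \<^bold>+ (\<theta> \<cdot> \<iota> (Suc n)) \<cdot> e"
      by (simp add: comp_assoc[of "\<iota> n" \<psi> \<theta>] \<psi>(2) comp_distrib assoc[OF \<theta>(1) e] assoc[OF \<theta>(1) e'_in])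
    also have "\<dots> = \<iota> n"
      by (cases n) (simp_all add: \<theta>(2) calc)
    finally show "(\<theta> \<cdot> \<psi>) \<cdot> \<iota> n = Idt T Q \<cdot> \<iota> n"
      by simp
  qed (simp add: in_hom_iff)
  \<comment> \<open>\<open>\<pi>\<close> is the projection to the copy in degree zero, so \<open>\<iota> 0 \<cdot> (e \<cdot> \<pi>)\<close> is the idempotent complementary to \<open>\<psi> \<cdot> \<theta>\<close>.\<close>
  have \<psi>\<theta>: "\<iota> 0 \<cdot> (e \<cdot> \<pi>) \<^bold>+ \<psi> \<cdot> \<theta> = Idt T Q"
  proof (rule coproduct_ext[OF Q])
    fix n
    have 1: "(\<iota> 0 \<cdot> (e \<cdot> \<pi>) \<^bold>+ \<psi> \<cdot> \<theta>) \<cdot> \<iota> n = \<iota> 0 \<cdot> (e \<cdot> (\<pi> \<cdot> \<iota> n)) \<^bold>+ \<psi> \<cdot> (\<theta> \<cdot> \<iota> n)"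
      by (simp add: comp_distrib comp_assoc)
    also have "\<dots> = \<iota> n"
    proof (cases n)
      case 0
      then show ?thesis
        by (simp add: \<pi>(2) \<theta>(2) assoc[OF \<psi>(1) e'_in] \<psi>(2) calc)
    next
      case (Suc m)
      have "\<psi> \<cdot> (\<iota> (Suc m) \<cdot> e' \<^bold>+ \<iota> m \<cdot> e) = \<iota> (Suc m)"
        by (simp add: comp_distrib assoc[OF \<psi>(1) e'_in] assoc[OF \<psi>(1) e] \<psi>(2) calc)
      then show ?thesis
        by (simp add: Suc \<pi>(2) \<theta>(2))
    qed
    finally show "(\<iota> 0 \<cdot> (e \<cdot> \<pi>) \<^bold>+ \<psi> \<cdot> \<theta>) \<cdot> \<iota> n = Idt T Q \<cdot> \<iota> n"
      by simp
  qed (auto simp: in_hom_iff)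
  let ?k = "\<iota> 0 \<cdot> (e \<cdot> \<pi>)"
  obtain A c b where A: "exact_triangle T Q Q A \<psi> c b"
    using cone_exists[OF \<psi>(1)] .
  note c = triD(2)[OF A] and b = triD(3)[OF A]
  note [simp] = in_homD(1-5)[OF c] in_homD(1-5)[OF b]
  have b0: "b = Zero T A (ShO T Q)"
  proof -
    have "b = ShA T (\<theta> \<cdot> \<psi>) \<cdot> b"
      by (simp add: \<theta>\<psi> ShA_Idt del: ShA_comp)
    also have "\<dots> = ShA T \<theta> \<cdot> (ShA T \<psi> \<cdot> b)"
      by (simp add: comp_assoc)
    finally show ?thesis
      by (simp add: tri_comp_zeroS[OF A])
  qed
  have "?k \<cdot> \<psi> = Zero T Q Q"
  proof (rule coproduct_ext[OF Q])
    fix n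
    have "(?k \<cdot> \<psi>) \<cdot> \<iota> n = \<iota> 0 \<cdot> (e \<cdot> (\<pi> \<cdot> (\<iota> n \<cdot> e') \<^bold>+ \<pi> \<cdot> (\<iota> (Suc n) \<cdot> e)))"
      by (simp add: comp_assoc \<psi>(2) comp_distrib)
    also have "\<dots> = \<iota> 0 \<cdot> (e \<cdot> ((\<pi> \<cdot> \<iota> n) \<cdot> e'))"
      by (simp add: assoc[OF \<pi>(1) e] assoc[OF \<pi>(1) e'_in] \<pi>(2) split: nat.split)
    also have "\<dots> = Zero T Q Q \<cdot> \<iota> n"
      by (cases n) (simp_all add: \<pi>(2) ee')
    finally show "(?k \<cdot> \<psi>) \<cdot> \<iota> n = Zero T Q Q \<cdot> \<iota> n" .
  qed (auto simp: in_hom_iff)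
  then obtain d where d: "\<guillemotleft>d : A \<rightarrow> Q\<guillemotright>" "?k = d \<cdot> c"
    using tri_ext[OF A, of ?k Q] by (auto simp: in_hom_iff)
  note [simp] = in_homD(1-5)[OF d(1)]
  have ck: "c \<cdot> ?k = c"
  proof -
    have "c \<cdot> (?k \<^bold>+ \<psi> \<cdot> \<theta>) = c \<cdot> ?k \<^bold>+ (c \<cdot> \<psi>) \<cdot> \<theta>"
      by (simp add: comp_distrib comp_assoc)
    then show ?thesis
      by (simp add: \<psi>\<theta> tri_comp_zero[OF A])
  qed
  have cd: "c \<cdot> d = Idt T A"
  proof -
    have "(c \<cdot> d \<^bold>- Idt T A) \<cdot> c = Zero T Q A"
      using ck by (simp add: comp_distrib comp_assoc flip: d(2))
    then obtain s where "\<guillemotleft>s : ShO T Q \<rightarrow> A\<guillemotright>" "c \<cdot> d \<^bold>- Idt T A = s \<cdot> b"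
      by (rule tri_ext3[OF A, rotated]) (auto simp: in_hom_iff)
    then have "c \<cdot> d \<^bold>- Idt T A = Zero T A A"
      by (simp add: b0 in_hom_iff)
    then show ?thesis
      using diff_eq_zero[of "c \<cdot> d" "Idt T A"] by simp
  qed
  have kd: "?k \<cdot> d = d"
    by (simp only: d(2)) (simp add: comp_assoc cd)
  have pi0: "\<pi> \<cdot> \<iota> 0 = Idt T P"
    by (simp add: \<pi>(2))
  show ?thesis
  proof (rule that[of "c \<cdot> \<iota> 0" A "e \<cdot> (\<pi> \<cdot> d)"])
    have "(c \<cdot> \<iota> 0) \<cdot> (e \<cdot> (\<pi> \<cdot> d)) = c \<cdot> (?k \<cdot> d)"
      by (simp add: comp_assoc)
    then show "(c \<cdot> \<iota> 0) \<cdot> (e \<cdot> (\<pi> \<cdot> d)) = Idt T A"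
      by (simp only: kd cd)
    have "(e \<cdot> (\<pi> \<cdot> d)) \<cdot> (c \<cdot> \<iota> 0) = e \<cdot> (\<pi> \<cdot> ((d \<cdot> c) \<cdot> \<iota> 0))"
      by (simp add: comp_assoc)
    also have "\<dots> = e \<cdot> ((\<pi> \<cdot> \<iota> 0) \<cdot> (e \<cdot> (\<pi> \<cdot> \<iota> 0)))"
      by (simp add: comp_assoc flip: d(2))
    also have "\<dots> = e"
      by (simp add: pi0 ee)
    finally show "(e \<cdot> (\<pi> \<cdot> d)) \<cdot> (c \<cdot> \<iota> 0) = e" .
  qed (auto simp: in_hom_iff)
qed

end

section \<open>The objects of \<open>T\<^sup>\<alpha>\<close>\<close>

locale well_generated = triangulated T + regular \<alpha>
  for T :: "('o, 'm, 'z) triangulated_scheme" (structure) and \<alpha> :: "'u rel" +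
  assumes locally_small: "locally_small TYPE('u) T"
    and small_coproducts: "has_small_coproducts TYPE('u) T"
    and generated: "alpha_compactly_generated \<alpha> T"
begin

abbreviation A :: "'o set" where "A \<equiv> alpha_objects \<alpha> T"

lemma coproduct_exists:
  assumes "small TYPE('u) I" and "\<And>i. i \<in> I \<Longrightarrow> X i \<in> Ob T"
  obtains Q \<iota> where "is_coproduct T I X Q \<iota>"
  by (rule small_coproduct_exists[OF small_coproducts assms(1), of X]) (use assms(2) that in blast)+

lemma coproduct_family_exists:
  assumes "\<And>i. i \<in> I \<Longrightarrow> small TYPE('u) (K i)" and "\<And>i k. i \<in> I \<Longrightarrow> k \<in> K i \<Longrightarrow> X i k \<in> Ob T"
  obtains W \<iota> where "\<And>i. i \<in> I \<Longrightarrow> is_coproduct T (K i) (X i) (W i) (\<iota> i)"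
proof -
  have "\<forall>i\<in>I. \<exists>W \<iota>. is_coproduct T (K i) (X i) W \<iota>"
    using coproduct_exists assms by metis
  then show ?thesis
    using that by metis
qed

lemma copair_family:
  assumes "\<And>i. i \<in> I \<Longrightarrow> is_coproduct T (K i) (X i) (W i) (\<iota> i)"
    and "\<And>i k. i \<in> I \<Longrightarrow> k \<in> K i \<Longrightarrow> \<guillemotleft>t i k : X i k \<rightarrow> Z i\<guillemotright>" and "\<And>i. i \<in> I \<Longrightarrow> Z i \<in> Ob T"
  obtains h where "\<And>i. i \<in> I \<Longrightarrow> \<guillemotleft>h i : W i \<rightarrow> Z i\<guillemotright>"
    "\<And>i k. i \<in> I \<Longrightarrow> k \<in> K i \<Longrightarrow> h i \<cdot> \<iota> i k = t i k"
proof -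
  have "\<exists>h. \<guillemotleft>h : W i \<rightarrow> Z i\<guillemotright> \<and> (\<forall>k\<in>K i. h \<cdot> \<iota> i k = t i k)" if "i \<in> I" for i
    by (rule copair_exists[OF assms(1)[OF that] assms(3)[OF that], of "t i"])
      (use assms(2) that in auto)
  then show ?thesis
    using that by metis
qed

lemma small_Hom: "X \<in> Ob T \<Longrightarrow> Y \<in> Ob T \<Longrightarrow> small TYPE('u) (Hom T X Y)"
  using locally_small by (simp add: locally_small_def)

lemma desuspensions:
  assumes "X ` I \<subseteq> Ob T"
  obtains X' d c where "\<And>i. i \<in> I \<Longrightarrow> X' i \<in> Ob T" "\<And>i. i \<in> I \<Longrightarrow> \<guillemotleft>d i : ShO T (X' i) \<rightarrow> X i\<guillemotright>"
    "\<And>i. i \<in> I \<Longrightarrow> \<guillemotleft>c i : X i \<rightarrow> ShO T (X' i)\<guillemotright>" "\<And>i. i \<in> I \<Longrightarrow> d i \<cdot> c i = Idt T (X i)"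
    "\<And>i. i \<in> I \<Longrightarrow> c i \<cdot> d i = Idt T (ShO T (X' i))"
proof -
  have X: "X i \<in> Ob T" if "i \<in> I" for i
    using assms that by blast
  have "\<forall>i\<in>I. \<exists>Y f g. Y \<in> Ob T \<and> \<guillemotleft>f : ShO T Y \<rightarrow> X i\<guillemotright> \<and> \<guillemotleft>g : X i \<rightarrow> ShO T Y\<guillemotright> \<and>
      f \<cdot> g = Idt T (X i) \<and> g \<cdot> f = Idt T (ShO T Y)"
    using desuspension X by metis
  then show ?thesis
    using that by metis
qed

subsection \<open>Small objects and supports\<close>

text \<open>
  A morphism into a coproduct factors through the coproduct of the summands in \<open>J\<close> if and only if
  it is fixed by the projection to these summands. In this form smallness is easy to transport.
\<close>

definition coproduct_projection where
  "coproduct_projection I X Q \<iota> J e \<longleftrightarrow> \<guillemotleft>e : Q \<rightarrow> Q\<guillemotright> \<and>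
     (\<forall>i\<in>I. e \<cdot> \<iota> i = (if i \<in> J then \<iota> i else Zero T (X i) Q))"

definition supported where
  "supported I X Q \<iota> J f \<longleftrightarrow> (\<exists>e. coproduct_projection I X Q \<iota> J e \<and> e \<cdot> f = f)"

lemma projection_exists:
  assumes "is_coproduct T I X Q \<iota>"
  obtains e where "coproduct_projection I X Q \<iota> J e"
  by (rule copair_exists[OF assms is_coproductD(1)[OF assms], of "\<lambda>i. if i \<in> J then \<iota> i else Zero T (X i) Q"])
    (use is_coproductD[OF assms] zero_in_hom in \<open>auto simp: coproduct_projection_def\<close>)

lemma projection_comp:
  assumes Q: "is_coproduct T I X Q \<iota>"
    and e: "coproduct_projection I X Q \<iota> J e" and e': "coproduct_projection I X Q \<iota> J' e'" and "J \<inter> I \<subseteq> J'"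
  shows "e' \<cdot> e = e"
proof (rule coproduct_ext[OF Q])
  note [simp] = in_homD(1-4)[OF is_coproductD(2)[OF Q]] is_coproductD(1)[OF Q]
  have e_in: "\<guillemotleft>e : Q \<rightarrow> Q\<guillemotright>" "\<guillemotleft>e' : Q \<rightarrow> Q\<guillemotright>"
    using e e' by (auto simp: coproduct_projection_def)
  note [simp] = in_homD(1-5)[OF e_in(1)] in_homD(1-5)[OF e_in(2)]
  show "(e' \<cdot> e) \<cdot> \<iota> i = e \<cdot> \<iota> i" if "i \<in> I" for i
    using that e e' assms(4) by (auto simp: comp_assoc coproduct_projection_def)
qed (use e e' in \<open>auto simp: coproduct_projection_def intro: comp_in_hom\<close>)

lemma supportedD:
  assumes Q: "is_coproduct T I X Q \<iota>" and e: "coproduct_projection I X Q \<iota> J' e"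
    and f: "\<guillemotleft>f : S \<rightarrow> Q\<guillemotright>" "supported I X Q \<iota> J f" and "J \<subseteq> J'"
  shows "e \<cdot> f = f"
proof -
  obtain d where d: "coproduct_projection I X Q \<iota> J d" "d \<cdot> f = f"
    using f(2) by (auto simp: supported_def)
  have in_hom: "\<guillemotleft>d : Q \<rightarrow> Q\<guillemotright>" "\<guillemotleft>e : Q \<rightarrow> Q\<guillemotright>"
    using d e by (auto simp: coproduct_projection_def)
  note [simp] = in_homD(1-5)[OF in_hom(1)] in_homD(1-5)[OF in_hom(2)] in_homD(1-5)[OF f(1)]
  have "e \<cdot> (d \<cdot> f) = (e \<cdot> d) \<cdot> f"
    by (simp add: comp_assoc)
  moreover have "e \<cdot> d = d"
    using projection_comp[OF Q d(1) e] assms(5) by blast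
  ultimately show ?thesis
    by (simp add: d(2))
qed

lemma projection_splits:
  assumes Q: "is_coproduct T I X Q \<iota>" and J: "J \<subseteq> I" and Q': "is_coproduct T J X Q' \<kappa>"
    and e: "coproduct_projection I X Q \<iota> J e"
  obtains m r where "\<guillemotleft>m : Q' \<rightarrow> Q\<guillemotright>" "\<And>i. i \<in> J \<Longrightarrow> m \<cdot> \<kappa> i = \<iota> i" "\<guillemotleft>r : Q \<rightarrow> Q'\<guillemotright>" "m \<cdot> r = e"
    "r \<cdot> m = Idt T Q'"
proof -
  note [simp] = is_coproductD(1)[OF Q] in_homD(1-4)[OF is_coproductD(2)[OF Q]]
    is_coproductD(1)[OF Q'] in_homD(1-4)[OF is_coproductD(2)[OF Q']]
  have e_in: "\<guillemotleft>e : Q \<rightarrow> Q\<guillemotright>" and e\<iota>: "\<And>i. i \<in> I \<Longrightarrow> e \<cdot> \<iota> i = (if i \<in> J then \<iota> i else Zero T (X i) Q)"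
    using e by (auto simp: coproduct_projection_def)
  obtain m where m: "\<guillemotleft>m : Q' \<rightarrow> Q\<guillemotright>" "\<And>i. i \<in> J \<Longrightarrow> m \<cdot> \<kappa> i = \<iota> i"
    by (rule copair_exists[OF Q' is_coproductD(1)[OF Q], of \<iota>]) (use J is_coproductD(2)[OF Q] in auto)
  obtain r where r: "\<guillemotleft>r : Q \<rightarrow> Q'\<guillemotright>"
      "\<And>i. i \<in> I \<Longrightarrow> r \<cdot> \<iota> i = (if i \<in> J then \<kappa> i else Zero T (X i) Q')"
    by (rule copair_exists[OF Q is_coproductD(1)[OF Q'], of "\<lambda>i. if i \<in> J then \<kappa> i else Zero T (X i) Q'"])
      (use is_coproductD(2)[OF Q'] zero_in_hom in auto)
  note [simp] = in_homD(1-5)[OF m(1)] in_homD(1-5)[OF r(1)]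
  have "m \<cdot> r = e"
    by (rule coproduct_ext[OF Q comp_in_hom[OF m(1) r(1)] e_in]) (auto simp: comp_assoc m(2) r(2) e\<iota>)
  moreover have "r \<cdot> m = Idt T Q'"
    by (rule coproduct_ext[OF Q' comp_in_hom[OF r(1) m(1)]]) (use J in \<open>auto simp: in_hom_iff comp_assoc m(2) r(2)\<close>)
  ultimately show ?thesis
    using that m r(1) by blast
qed

lemma alpha_small_iff:
  "alpha_small \<alpha> T S \<longleftrightarrow> S \<in> Ob T \<and>
     (\<forall>(I :: 'u set) X Q \<iota> f. small TYPE('u) I \<longrightarrow> is_coproduct T I X Q \<iota> \<longrightarrow> \<guillemotleft>f : S \<rightarrow> Q\<guillemotright> \<longrightarrow>
        (\<exists>J\<subseteq>I. |J| <o \<alpha> \<and> supported I X Q \<iota> J f))"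
proof -
  have main: "supported I X Q \<iota> J f \<longleftrightarrow> (\<exists>Q' \<kappa> m g. is_coproduct T J X Q' \<kappa> \<and>
           m \<in> Hom T Q' Q \<and> (\<forall>i\<in>J. m \<cdot> \<kappa> i = \<iota> i) \<and> g \<in> Hom T S Q' \<and> f = m \<cdot> g)" (is "_ \<longleftrightarrow> ?R")
    if Q: "is_coproduct T I X Q \<iota>" and I: "small TYPE('u) I" and J: "J \<subseteq> I" and f: "\<guillemotleft>f : S \<rightarrow> Q\<guillemotright>"
    for I :: "'u set" and X Q \<iota> f and J :: "'u set"
  proof -
    note [simp] = is_coproductD(1)[OF Q] in_homD(1-5)[OF f] in_homD(1-4)[OF is_coproductD(2)[OF Q]]
      is_coproductD(3)[OF Q]
    obtain e where e: "coproduct_projection I X Q \<iota> J e"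
      using projection_exists[OF Q] .
    then have e_in: "\<guillemotleft>e : Q \<rightarrow> Q\<guillemotright>" and e\<iota>: "\<And>i. i \<in> I \<Longrightarrow> e \<cdot> \<iota> i = (if i \<in> J then \<iota> i else Zero T (X i) Q)"
      by (auto simp: coproduct_projection_def)
    note [simp] = in_homD(1-5)[OF e_in]
    obtain Q' \<kappa> where Q': "is_coproduct T J X Q' \<kappa>"
      using coproduct_exists[of J X] small_subset[OF I J] J is_coproductD(3)[OF Q] by blast
    show ?thesis
    proof
      assume "supported I X Q \<iota> J f"
      then have ef: "e \<cdot> f = f"
        using supportedD[OF Q e f] by blast
      obtain m r where m: "\<guillemotleft>m : Q' \<rightarrow> Q\<guillemotright>" "\<And>i. i \<in> J \<Longrightarrow> m \<cdot> \<kappa> i = \<iota> i"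
          and r: "\<guillemotleft>r : Q \<rightarrow> Q'\<guillemotright>" and mr: "m \<cdot> r = e" and "r \<cdot> m = Idt T Q'"
        by (rule projection_splits[OF Q J Q' e]) (rule that)
      note [simp] = in_homD(1-5)[OF m(1)] in_homD(1-5)[OF r(1)]
      have "f = (m \<cdot> r) \<cdot> f"
        by (simp add: mr ef)
      then have "f = m \<cdot> (r \<cdot> f)"
        by (simp add: comp_assoc)
      then show ?R
        using Q' m in_homD(6)[OF comp_in_hom[OF r f]] in_homD(6)[OF m(1)] by blast
    next
      assume ?R
      then obtain Q' \<kappa> m g where Q': "is_coproduct T J X Q' \<kappa>" and "m \<in> Hom T Q' Q"
          and m\<kappa>: "\<And>i. i \<in> J \<Longrightarrow> m \<cdot> \<kappa> i = \<iota> i" and "g \<in> Hom T S Q'" and fmg: "f = m \<cdot> g"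
        by blast
      then have m: "\<guillemotleft>m : Q' \<rightarrow> Q\<guillemotright>" and g: "\<guillemotleft>g : S \<rightarrow> Q'\<guillemotright>"
        using is_coproductD(1)[OF Q'] by (auto simp: in_homI)
      note [simp] = in_homD(1-5)[OF m] in_homD(1-5)[OF g] in_homD(1-4)[OF is_coproductD(2)[OF Q']]
      have "e \<cdot> m = m"
        by (rule coproduct_ext[OF Q' comp_in_hom[OF e_in m] m]) (use J in \<open>auto simp: comp_assoc m\<kappa> e\<iota>\<close>)
      then have "e \<cdot> f = f"
        by (simp add: fmg flip: comp_assoc)
      then show "supported I X Q \<iota> J f"
        using e by (auto simp: supported_def)
    qed
  qed
  show ?thesis
    unfolding alpha_small_def
  proof (intro conj_cong iff_allI imp_cong refl)
    fix I :: "'u set" and X Q \<iota> f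
    assume "S \<in> Ob T" and I: "small TYPE('u) I" and Q: "is_coproduct T I X Q \<iota>"
    then show "f \<in> Hom T S Q \<longleftrightarrow> \<guillemotleft>f : S \<rightarrow> Q\<guillemotright>"
      by (simp add: Hom_iff is_coproductD(1))
    assume f: "\<guillemotleft>f : S \<rightarrow> Q\<guillemotright>"
    show "(\<exists>J Q' \<kappa> m g. J \<subseteq> I \<and> |J| <o \<alpha> \<and> is_coproduct T J X Q' \<kappa> \<and> m \<in> Hom T Q' Q \<and>
        (\<forall>i\<in>J. m \<cdot> \<kappa> i = \<iota> i) \<and> g \<in> Hom T S Q' \<and> f = m \<cdot> g) \<longleftrightarrow>
      (\<exists>J\<subseteq>I. |J| <o \<alpha> \<and> supported I X Q \<iota> J f)"
    proof (rule ex_cong1)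
      show "(\<exists>Q' \<kappa> m g. J \<subseteq> I \<and> |J| <o \<alpha> \<and> is_coproduct T J X Q' \<kappa> \<and> m \<in> Hom T Q' Q \<and>
          (\<forall>i\<in>J. m \<cdot> \<kappa> i = \<iota> i) \<and> g \<in> Hom T S Q' \<and> f = m \<cdot> g) \<longleftrightarrow>
        J \<subseteq> I \<and> |J| <o \<alpha> \<and> supported I X Q \<iota> J f" for J
        by (cases "J \<subseteq> I") (simp_all add: main[OF Q I _ f])
    qed
  qed
qed

lemma alpha_smallD:
  fixes I :: "'i set"
  assumes S: "alpha_small \<alpha> T S" and I: "small TYPE('u) I" and Q: "is_coproduct T I X Q \<iota>" and f: "\<guillemotleft>f : S \<rightarrow> Q\<guillemotright>"
  obtains J where "J \<subseteq> I" "|J| <o \<alpha>" "supported I X Q \<iota> J f"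
proof -
  obtain I' :: "'u set" and b where b: "bij_betw b I' I" "small TYPE('u) I'"
    using small_index[OF I] .
  have "\<forall>(I :: 'u set) X Q \<iota> f. small TYPE('u) I \<longrightarrow> is_coproduct T I X Q \<iota> \<longrightarrow> \<guillemotleft>f : S \<rightarrow> Q\<guillemotright> \<longrightarrow>
      (\<exists>J\<subseteq>I. |J| <o \<alpha> \<and> supported I X Q \<iota> J f)"
    using S alpha_small_iff by blast
  then obtain J where J: "J \<subseteq> I'" "|J| <o \<alpha>" "supported I' (\<lambda>i. X (b i)) Q (\<lambda>i. \<iota> (b i)) J f"
    using b(2) coproduct_reindex[OF Q b(1)] f by meson
  then obtain e where e: "coproduct_projection I' (\<lambda>i. X (b i)) Q (\<lambda>i. \<iota> (b i)) J e" "e \<cdot> f = f"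
    by (auto simp: supported_def)
  have "coproduct_projection I X Q \<iota> (b ` J) e"
    unfolding coproduct_projection_def
  proof (intro conjI ballI)
    show "\<guillemotleft>e : Q \<rightarrow> Q\<guillemotright>"
      using e(1) by (simp add: coproduct_projection_def)
    fix i assume "i \<in> I"
    then obtain i' where i': "i' \<in> I'" "i = b i'"
      using b(1) by (auto simp: bij_betw_def)
    then have "i' \<in> J \<longleftrightarrow> i \<in> b ` J"
      using J(1) b(1) by (auto simp: bij_betw_def inj_on_def)
    then show "e \<cdot> \<iota> i = (if i \<in> b ` J then \<iota> i else Zero T (X i) Q)"
      using e(1) i' by (simp add: coproduct_projection_def)
  qed
  then have "supported I X Q \<iota> (b ` J) f"
    using e(2) by (auto simp: supported_def)
  then show ?thesis
    using that[of "b ` J"] J less_image b(1) by (auto simp: bij_betw_def)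
qed

lemma alpha_smallI:
  assumes "S \<in> Ob T"
    and "\<And>(I :: 'u set) X Q \<iota> f. small TYPE('u) I \<Longrightarrow> is_coproduct T I X Q \<iota> \<Longrightarrow> \<guillemotleft>f : S \<rightarrow> Q\<guillemotright> \<Longrightarrow>
      \<exists>J\<subseteq>I. |J| <o \<alpha> \<and> supported I X Q \<iota> J f"
  shows "alpha_small \<alpha> T S"
  using assms alpha_small_iff by blast

lemma alpha_small_coproduct:
  assumes J: "|J| <o \<alpha>" and R: "is_coproduct T J S R \<sigma>" and S: "\<And>j. j \<in> J \<Longrightarrow> alpha_small \<alpha> T (S j)"
  shows "alpha_small \<alpha> T R"
proof (rule alpha_smallI)
  show "R \<in> Ob T" using is_coproductD(1)[OF R] .
  fix I :: "'u set" and X Q \<iota> f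
  assume I: "small TYPE('u) I" and Q: "is_coproduct T I X Q \<iota>" and f: "\<guillemotleft>f : R \<rightarrow> Q\<guillemotright>"
  have f\<sigma>: "\<guillemotleft>f \<cdot> \<sigma> j : S j \<rightarrow> Q\<guillemotright>" if "j \<in> J" for j
    using comp_in_hom[OF f is_coproductD(2)[OF R that]] .
  have "\<exists>K\<subseteq>I. |K| <o \<alpha> \<and> supported I X Q \<iota> K (f \<cdot> \<sigma> j)" if "j \<in> J" for j
    using alpha_smallD[OF S[OF that] I Q f\<sigma>[OF that]] by metis
  then obtain K where K: "\<And>j. j \<in> J \<Longrightarrow> K j \<subseteq> I" "\<And>j. j \<in> J \<Longrightarrow> |K j| <o \<alpha>"
      "\<And>j. j \<in> J \<Longrightarrow> supported I X Q \<iota> (K j) (f \<cdot> \<sigma> j)"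
    by metis
  obtain e where e: "coproduct_projection I X Q \<iota> (\<Union>j\<in>J. K j) e"
    using projection_exists[OF Q] .
  then have e_in: "\<guillemotleft>e : Q \<rightarrow> Q\<guillemotright>"
    by (simp add: coproduct_projection_def)
  note [simp] = in_homD(1-5)[OF e_in] in_homD(1-5)[OF f] in_homD(1-4)[OF is_coproductD(2)[OF R]]
  have "e \<cdot> f = f"
  proof (rule coproduct_ext[OF R comp_in_hom[OF e_in f] f])
    show "(e \<cdot> f) \<cdot> \<sigma> j = f \<cdot> \<sigma> j" if "j \<in> J" for j
      using supportedD[OF Q e f\<sigma>[OF that] K(3)[OF that]] that by (auto simp: comp_assoc)
  qed
  then have "supported I X Q \<iota> (\<Union>j\<in>J. K j) f"
    using e by (auto simp: supported_def)
  moreover have "(\<Union>j\<in>J. K j) \<subseteq> I" "|\<Union>j\<in>J. K j| <o \<alpha>"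
    using K(1) less_UN[of J K, OF J K(2)] by auto
  ultimately show "\<exists>J\<subseteq>I. |J| <o \<alpha> \<and> supported I X Q \<iota> J f"
    by blast
qed

subsection \<open>Factorisations of maps into coproducts\<close>

definition factorisation where
  "factorisation P I X Q \<iota> S g Y f R \<kappa> m h \<longleftrightarrow> (\<forall>i\<in>I. Y i \<in> P \<and> \<guillemotleft>f i : Y i \<rightarrow> X i\<guillemotright>) \<and>
     is_coproduct T I Y R \<kappa> \<and> \<guillemotleft>m : R \<rightarrow> Q\<guillemotright> \<and> (\<forall>i\<in>I. m \<cdot> \<kappa> i = \<iota> i \<cdot> f i) \<and>
     \<guillemotleft>h : S \<rightarrow> R\<guillemotright> \<and> g = m \<cdot> h"

definition covered where
  "covered P I X Q \<iota> S g \<longleftrightarrow> (\<exists>Y f R \<kappa> m h. factorisation P I X Q \<iota> S g Y f R \<kappa> m h)"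

lemma factorisationD:
  assumes "factorisation P I X Q \<iota> S g Y f R \<kappa> m h"
  shows "i \<in> I \<Longrightarrow> Y i \<in> P" "i \<in> I \<Longrightarrow> \<guillemotleft>f i : Y i \<rightarrow> X i\<guillemotright>" "is_coproduct T I Y R \<kappa>"
    "\<guillemotleft>m : R \<rightarrow> Q\<guillemotright>" "i \<in> I \<Longrightarrow> m \<cdot> \<kappa> i = \<iota> i \<cdot> f i" "\<guillemotleft>h : S \<rightarrow> R\<guillemotright>" "g = m \<cdot> h"
  using assms unfolding factorisation_def by blast+

lemma coveredI:
  assumes "\<And>i. i \<in> I \<Longrightarrow> Y i \<in> P" "\<And>i. i \<in> I \<Longrightarrow> \<guillemotleft>f i : Y i \<rightarrow> X i\<guillemotright>"
    "is_coproduct T I Y R \<kappa>" "\<guillemotleft>m : R \<rightarrow> Q\<guillemotright>" "\<And>i. i \<in> I \<Longrightarrow> m \<cdot> \<kappa> i = \<iota> i \<cdot> f i"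
    "\<guillemotleft>h : S \<rightarrow> R\<guillemotright>" "g = m \<cdot> h"
  shows "covered P I X Q \<iota> S g"
  unfolding covered_def factorisation_def using assms by blast

lemma covered_family:
  assumes "\<And>j. j \<in> J \<Longrightarrow> covered P I X Q \<iota> (S j) (g j)"
  obtains Y f R \<kappa> m h where
    "\<And>j. j \<in> J \<Longrightarrow> factorisation P I X Q \<iota> (S j) (g j) (Y j) (f j) (R j) (\<kappa> j) (m j) (h j)"
proof -
  have "\<forall>j\<in>J. covered P I X Q \<iota> (S j) (g j)"
    using assms by blast
  then have "\<exists>Y f R \<kappa> m h. \<forall>j\<in>J. factorisation P I X Q \<iota> (S j) (g j) (Y j) (f j) (R j) (\<kappa> j) (m j) (h j)"
    unfolding covered_def bchoice_iff .
  then show ?thesis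
    using that by (elim exE) blast
qed

lemma covered_mono: "covered P I X Q \<iota> S g \<Longrightarrow> P \<subseteq> P' \<Longrightarrow> covered P' I X Q \<iota> S g"
  unfolding covered_def factorisation_def by (elim ex_forward) auto

lemma perfect_iff:
  "alpha_perfect_class \<alpha> T P \<longleftrightarrow> (\<forall>S\<in>P. alpha_small \<alpha> T S) \<and>
     (\<forall>S\<in>P. \<forall>(I :: 'u set) X Q \<iota> g. small TYPE('u) I \<longrightarrow> is_coproduct T I X Q \<iota> \<longrightarrow> \<guillemotleft>g : S \<rightarrow> Q\<guillemotright> \<longrightarrow>
        covered P I X Q \<iota> S g)"
proof (cases "\<forall>S\<in>P. alpha_small \<alpha> T S")
  case True
  then have P: "P \<subseteq> Ob T"
    by (auto simp: alpha_small_def)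
  have "covered P I X Q \<iota> S g \<longleftrightarrow> (\<exists>Y f Q' \<kappa> m h. (\<forall>i\<in>I. Y i \<in> P \<and> f i \<in> Hom T (Y i) (X i)) \<and>
           is_coproduct T I Y Q' \<kappa> \<and> is_coproduct_map T I Q' \<kappa> Q \<iota> f m \<and>
           h \<in> Hom T S Q' \<and> g = m \<cdot> h)"
    if "is_coproduct T I X Q \<iota>" "S \<in> P" for I :: "'u set" and X Q \<iota> S g
  proof -
    have "is_coproduct T I Y R \<kappa> \<Longrightarrow> is_coproduct_map T I R \<kappa> Q \<iota> f m \<longleftrightarrow>
        \<guillemotleft>m : R \<rightarrow> Q\<guillemotright> \<and> (\<forall>i\<in>I. m \<cdot> \<kappa> i = \<iota> i \<cdot> f i)" for Y R \<kappa> f m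
      using is_coproductD(1)[OF that(1)] is_coproductD(1) by (auto simp: is_coproduct_map_def in_hom_def)
    moreover have "is_coproduct T I Y R \<kappa> \<Longrightarrow> h \<in> Hom T S R \<longleftrightarrow> \<guillemotleft>h : S \<rightarrow> R\<guillemotright>" for Y R \<kappa> h
      using P that(2) is_coproductD(1) by (auto simp: in_hom_def)
    moreover have "(\<forall>i\<in>I. Y i \<in> P \<and> f i \<in> Hom T (Y i) (X i)) \<longleftrightarrow> (\<forall>i\<in>I. Y i \<in> P \<and> \<guillemotleft>f i : Y i \<rightarrow> X i\<guillemotright>)" for Y f
      using P is_coproductD(3)[OF that(1)] by (auto simp: in_hom_def)
    ultimately show ?thesis
      unfolding covered_def factorisation_def by (intro iff_exI) blast
  qed
  moreover have "g \<in> Hom T S Q \<longleftrightarrow> \<guillemotleft>g : S \<rightarrow> Q\<guillemotright>" if "is_coproduct T I X Q \<iota>" "S \<in> P" for I :: "'u set" and X Q \<iota> S g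
    using P that is_coproductD(1) by (auto simp: in_hom_def)
  ultimately show ?thesis
    unfolding alpha_perfect_class_def by (simp cong: conj_cong imp_cong)
next
  case False
  then show ?thesis
    unfolding alpha_perfect_class_def by blast
qed

lemma A_alpha_small: "S \<in> A \<Longrightarrow> alpha_small \<alpha> T S"
  using alpha_objects_perfect[of \<alpha> T] perfect_iff by blast

lemma A_Ob: "S \<in> A \<Longrightarrow> S \<in> Ob T"
  by (drule A_alpha_small) (simp only: alpha_small_def)

lemma A_covered:
  fixes I :: "'u set"
  assumes "S \<in> A" "small TYPE('u) I" "is_coproduct T I X Q \<iota>" "\<guillemotleft>g : S \<rightarrow> Q\<guillemotright>"
  shows "covered A I X Q \<iota> S g"
  using alpha_objects_perfect[of \<alpha> T] assms unfolding perfect_iff by blast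

inductive_set coproduct_closure :: "'o set \<Rightarrow> 'o set" for P where
  base: "S \<in> P \<Longrightarrow> S \<in> coproduct_closure P"
| coproduct: "|J| <o \<alpha> \<Longrightarrow> (\<And>j. j \<in> J \<Longrightarrow> S j \<in> coproduct_closure P) \<Longrightarrow> is_coproduct T (J :: 'u set) S R \<sigma> \<Longrightarrow>
    R \<in> coproduct_closure P"

lemma closure_coproduct:
  fixes J :: "'j set"
  assumes J: "|J| <o \<alpha>" and S: "\<And>j. j \<in> J \<Longrightarrow> S j \<in> coproduct_closure P" and R: "is_coproduct T J S R \<sigma>"
  shows "R \<in> coproduct_closure P"
proof -
  obtain J' :: "'u set" and b where b: "bij_betw b J' J"
    using small_index[OF small_less[OF J]] .
  then have "|J'| =o |J|"
    using card_of_ordIso by blast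
  then have "|J'| <o \<alpha>"
    using J ordIso_ordLess_trans by blast
  then show ?thesis
    by (rule coproduct_closure.coproduct[OF _ _ coproduct_reindex[OF R b]])
      (use S bij_betwE[OF b] in blast)
qed

text \<open>
  The factorisations of the \<open>g \<cdot> \<sigma> j\<close> through \<open>\<Coprod>\<^sub>i Y\<^sub>j\<^sub>i\<close> are regrouped: \<open>\<Coprod>\<^sub>j \<Coprod>\<^sub>i Y\<^sub>j\<^sub>i\<close> is \<open>\<Coprod>\<^sub>i \<Coprod>\<^sub>j Y\<^sub>j\<^sub>i\<close>, and the
  coproduct over \<open>j\<close> has fewer than \<open>\<alpha>\<close> summands.
\<close>

lemma covered_coproduct:
  assumes I: "small TYPE('u) I" and Q: "is_coproduct T I X Q \<iota>" and R: "is_coproduct T J S R \<sigma>"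
    and J: "|J| <o \<alpha>" and g: "\<guillemotleft>g : R \<rightarrow> Q\<guillemotright>"
    and cov: "\<And>j. j \<in> J \<Longrightarrow> covered (coproduct_closure P) I X Q \<iota> (S j) (g \<cdot> \<sigma> j)"
  shows "covered (coproduct_closure P) I X Q \<iota> R g"
proof -
  obtain Y f R' \<kappa> m h where D: "\<And>j. j \<in> J \<Longrightarrow> factorisation (coproduct_closure P) I X Q \<iota> (S j) (g \<cdot> \<sigma> j)
      (Y j) (f j) (R' j) (\<kappa> j) (m j) (h j)"
    by (rule covered_family[OF cov]) (assumption, rule that)
  note Y = factorisationD(1)[OF D] and f = factorisationD(2)[OF D] and R' = factorisationD(3)[OF D]
    and m = factorisationD(4,5)[OF D] and h = factorisationD(6,7)[OF D]
  have Y_Ob: "Y j i \<in> Ob T" if "i \<in> I" "j \<in> J" for i j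
    using f[OF that(2,1)] by (simp add: in_hom_iff)
  obtain Z k where Z: "\<And>i. i \<in> I \<Longrightarrow> is_coproduct T J (\<lambda>j. Y j i) (Z i) (k i)"
    by (rule coproduct_family_exists[of I "\<lambda>_. J" "\<lambda>i j. Y j i"]) (use small_less[OF J] Y_Ob in auto)
  have Z_cl: "Z i \<in> coproduct_closure P" if "i \<in> I" for i
    using closure_coproduct[OF J _ Z[OF that]] Y that by blast
  obtain F where F: "\<And>i. i \<in> I \<Longrightarrow> \<guillemotleft>F i : Z i \<rightarrow> X i\<guillemotright>" "\<And>i j. i \<in> I \<Longrightarrow> j \<in> J \<Longrightarrow> F i \<cdot> k i j = f j i"
    by (rule copair_family[OF Z, where Z = X and t = "\<lambda>i j. f j i"]) (use f is_coproductD(3)[OF Q] in auto)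
  obtain N l where N: "is_coproduct T I Z N l"
    using coproduct_exists[OF I] is_coproductD(1)[OF Z] by metis
  obtain M where M: "\<guillemotleft>M : N \<rightarrow> Q\<guillemotright>" "\<And>i. i \<in> I \<Longrightarrow> M \<cdot> l i = \<iota> i \<cdot> F i"
    using coproduct_map_exists[OF N Q F(1)] by metis
  have k: "\<guillemotleft>k i j : Y j i \<rightarrow> Z i\<guillemotright>" if "i \<in> I" "j \<in> J" for i j
    using is_coproductD(2)[OF Z[OF that(1)] that(2)] .
  obtain n where n: "\<And>j. j \<in> J \<Longrightarrow> \<guillemotleft>n j : R' j \<rightarrow> N\<guillemotright>"
      "\<And>j i. j \<in> J \<Longrightarrow> i \<in> I \<Longrightarrow> n j \<cdot> \<kappa> j i = l i \<cdot> k i j"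
    by (rule copair_family[OF R', where Z = "\<lambda>_. N" and t = "\<lambda>j i. l i \<cdot> k i j"])
      (use comp_in_hom[OF is_coproductD(2)[OF N] k] is_coproductD(1)[OF N] in auto)
  obtain H where H: "\<guillemotleft>H : R \<rightarrow> N\<guillemotright>" "\<And>j. j \<in> J \<Longrightarrow> H \<cdot> \<sigma> j = n j \<cdot> h j"
    by (rule copair_exists[OF R is_coproductD(1)[OF N], of "\<lambda>j. n j \<cdot> h j"])
      (use comp_in_hom[OF n(1) h(1)] in auto)
  note [simp] = in_homD(1-5)[OF M(1)] in_homD(1-5)[OF H(1)] in_homD(1-5)[OF g]
    in_homD(1-4)[OF is_coproductD(2)[OF R]] in_homD(1-3)[OF n(1)] in_homD(1-3)[OF h(1)]
    in_homD(1-3)[OF F(1)] in_homD(1-3)[OF k] in_homD(1-4)[OF is_coproductD(2)[OF Q]]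
    in_homD(1-4)[OF is_coproductD(2)[OF N]]  in_homD(1-3)[OF is_coproductD(2)[OF R']]
  have Mn: "M \<cdot> n j = m j" if j: "j \<in> J" for j
  proof (rule coproduct_ext[OF R'[OF j] comp_in_hom[OF M(1) n(1)[OF j]] m(1)[OF j]])
    fix i assume i: "i \<in> I"
    have "(M \<cdot> n j) \<cdot> \<kappa> j i = (M \<cdot> l i) \<cdot> k i j"
      using i j by (simp add: comp_assoc n(2))
    also have "\<dots> = m j \<cdot> \<kappa> j i"
      using i j by (simp add: M(2) comp_assoc F(2) m(2))
    finally show "(M \<cdot> n j) \<cdot> \<kappa> j i = m j \<cdot> \<kappa> j i" .
  qed
  have "g = M \<cdot> H"
  proof (rule coproduct_ext[OF R g comp_in_hom[OF M(1) H(1)]])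
    show "g \<cdot> \<sigma> j = (M \<cdot> H) \<cdot> \<sigma> j" if "j \<in> J" for j
      using that comp_assoc[of "h j" "n j" M] by (simp add: comp_assoc[of "\<sigma> j"] H(2) h(2) Mn)
  qed
  then show ?thesis
    using Z_cl F(1) N M H(1) by (intro coveredI[of I Z _ F X N l M Q \<iota> H]) auto
qed

text \<open>
  Perfection of the closure of \<open>P\<close> under coproducts of fewer than \<open>\<alpha>\<close> objects need only be tested on maps
  out of objects of \<open>P\<close>, with the larger class allowed for the factorisations.
\<close>

lemma closure_perfect:
  assumes small: "\<And>S. S \<in> P \<Longrightarrow> alpha_small \<alpha> T S"
    and cov: "\<And>S (I :: 'u set) X Q \<iota> g. S \<in> P \<Longrightarrow> small TYPE('u) I \<Longrightarrow> is_coproduct T I X Q \<iota> \<Longrightarrow>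
      \<guillemotleft>g : S \<rightarrow> Q\<guillemotright> \<Longrightarrow> covered (coproduct_closure P) I X Q \<iota> S g"
  shows "coproduct_closure P \<subseteq> A"
proof (rule alpha_objects_greatest, unfold perfect_iff, intro conjI ballI allI impI)
  show "alpha_small \<alpha> T S" if "S \<in> coproduct_closure P" for S
    using that by induction (auto intro: small alpha_small_coproduct)
  show "covered (coproduct_closure P) I X Q \<iota> S g"
    if "S \<in> coproduct_closure P" "small TYPE('u) I" "is_coproduct T I X Q \<iota>" "\<guillemotleft>g : S \<rightarrow> Q\<guillemotright>"
    for S and I :: "'u set" and X Q \<iota> g
    using that(1,4)
  proof (induction arbitrary: g)
    case (base S)
    then show ?case
      using cov that(2,3) by blast
  next
    case (coproduct J S R \<sigma>)
    show ?case
      using coproduct.IH comp_in_hom[OF coproduct.prems is_coproductD(2)[OF coproduct.hyps(3)]]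
      by (intro covered_coproduct[OF that(2,3) coproduct.hyps(3,1) coproduct.prems]) blast
  qed
qed

text \<open>
  The criterion by which all closure properties of \<open>T\<^sup>\<alpha>\<close> are proved: \<open>T\<^sup>\<alpha>\<close> is the largest
  perfect class.
\<close>

lemma A_criterion:
  assumes "\<And>S. S \<in> P \<Longrightarrow> alpha_small \<alpha> T S"
    and "\<And>S (I :: 'u set) X Q \<iota> g. S \<in> P \<Longrightarrow> small TYPE('u) I \<Longrightarrow> is_coproduct T I X Q \<iota> \<Longrightarrow>
      \<guillemotleft>g : S \<rightarrow> Q\<guillemotright> \<Longrightarrow> covered (coproduct_closure (P \<union> A)) I X Q \<iota> S g"
  shows "P \<subseteq> A"
proof -
  have A: "A \<subseteq> coproduct_closure (P \<union> A)"
    by (auto intro: coproduct_closure.base)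
  have "coproduct_closure (P \<union> A) \<subseteq> A"
  proof (rule closure_perfect)
    show "alpha_small \<alpha> T S" if "S \<in> P \<union> A" for S
      using that assms(1) A_alpha_small by blast
    show "covered (coproduct_closure (P \<union> A)) I X Q \<iota> S g"
      if "S \<in> P \<union> A" "small TYPE('u) I" "is_coproduct T I X Q \<iota>" "\<guillemotleft>g : S \<rightarrow> Q\<guillemotright>"
      for S and I :: "'u set" and X Q \<iota> g
      using that(1) assms(2)[OF _ that(2-4)] covered_mono[OF A_covered[OF _ that(2-4)] A] by blast
  qed
  then show ?thesis
    by (auto intro: coproduct_closure.base)
qed

lemma A_coproduct:
  fixes J :: "'j set"
  assumes "|J| <o \<alpha>" "\<And>j. j \<in> J \<Longrightarrow> S j \<in> A" "is_coproduct T J S R \<sigma>"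
  shows "R \<in> A"
proof -
  have "A \<subseteq> coproduct_closure A"
    by (auto intro: coproduct_closure.base)
  then have "coproduct_closure A \<subseteq> A"
    using A_alpha_small covered_mono[OF A_covered] by (intro closure_perfect)
  moreover have "R \<in> coproduct_closure A"
    using assms by (intro closure_coproduct[OF assms(1) _ assms(3)]) (auto intro: coproduct_closure.base)
  ultimately show ?thesis
    by blast
qed

text \<open>
  A coproduct is determined up to isomorphism only, so an isomorphic object is a coproduct with one summand.
\<close>

lemma A_iso:
  assumes "S \<in> A" "\<guillemotleft>u : S \<rightarrow> S'\<guillemotright>" "\<guillemotleft>v : S' \<rightarrow> S\<guillemotright>" "u \<cdot> v = Idt T S'" "v \<cdot> u = Idt T S"
  shows "S' \<in> A"
proof (rule A_coproduct)
  note [simp] = in_homD(1-5)[OF assms(2)] in_homD(1-5)[OF assms(3)]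
  show "|{()}| <o \<alpha>" by (simp add: less_finite)
  show "S \<in> A" by fact
  show "is_coproduct T {()} (\<lambda>_. S) S' (\<lambda>_. u)"
  proof (rule is_coproductI)
    show "\<exists>h. \<guillemotleft>h : S' \<rightarrow> Z\<guillemotright> \<and> (\<forall>i\<in>{()}. h \<cdot> u = t i)"
      if "\<And>i. i \<in> {()} \<Longrightarrow> \<guillemotleft>t i : S \<rightarrow> Z\<guillemotright>" for Z t
    proof -
      have t: "\<guillemotleft>t () : S \<rightarrow> Z\<guillemotright>" using that by simp
      note [simp] = in_homD(1-5)[OF t]
      show ?thesis
        by (rule exI[of _ "t () \<cdot> v"]) (auto simp: in_hom_iff comp_assoc assms(5))
    qed
    show "g = h" if "\<guillemotleft>g : S' \<rightarrow> Z\<guillemotright>" "\<guillemotleft>h : S' \<rightarrow> Z\<guillemotright>" and gh: "\<And>i. i \<in> {()} \<Longrightarrow> g \<cdot> u = h \<cdot> u" for Z g h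
    proof -
      note [simp] = in_homD(1-5)[OF that(1)] in_homD(1-5)[OF that(2)]
      have "(g \<cdot> u) \<cdot> v = (h \<cdot> u) \<cdot> v"
        using gh by simp
      then show ?thesis
        by (simp add: comp_assoc assms(4))
    qed
  qed (use assms in auto)
qed

lemma sum_exists:
  assumes "X \<in> Ob T" "Y \<in> Ob T"
  obtains Z k where "is_coproduct T (UNIV :: bool set) (\<lambda>b. if b then X else Y) Z k"
  using binary_coproduct[OF assms] by metis

text \<open>
  The two factorisations combine to one through \<open>\<Coprod>\<^sub>i (Y\<^sub>i \<oplus> Y'\<^sub>i)\<close>.
\<close>

lemma covered_add:
  assumes I: "small TYPE('u) I" and Q: "is_coproduct T I X Q \<iota>"
    and cov: "covered (coproduct_closure P) I X Q \<iota> S g" "covered (coproduct_closure P) I X Q \<iota> S g'"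
  shows "covered (coproduct_closure P) I X Q \<iota> S (g \<^bold>+ g')"
proof -
  obtain Y f R \<kappa> m h where D: "\<And>b. b \<in> UNIV \<Longrightarrow>
      factorisation (coproduct_closure P) I X Q \<iota> S (if b then g else g') (Y b) (f b) (R b) (\<kappa> b) (m b) (h b)"
  proof (rule covered_family[where J = UNIV and g = "\<lambda>b. if b then g else g'" and S = "\<lambda>_. S"])
    show "covered (coproduct_closure P) I X Q \<iota> S (if b then g else g')" for b
      using cov by simp
  qed (rule that)
  note D = D[OF UNIV_I]
  note Y = factorisationD(1)[OF D] and f = factorisationD(2)[OF D] and R = factorisationD(3)[OF D]
    and m = factorisationD(4,5)[OF D] and h = factorisationD(6,7)[OF D]
  have Y_Ob: "Y b i \<in> Ob T" if "i \<in> I" for i b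
    using f[OF that] by (simp add: in_hom_iff)
  obtain Z k where Z: "\<And>i. i \<in> I \<Longrightarrow> is_coproduct T (UNIV :: bool set) (\<lambda>b. Y b i) (Z i) (k i)"
    by (rule coproduct_family_exists[of I "\<lambda>_. UNIV :: bool set" "\<lambda>i b. Y b i"])
      (use Y_Ob in \<open>auto intro!: small_finite[OF universe]\<close>)
  have Z_cl: "Z i \<in> coproduct_closure P" if "i \<in> I" for i
    using closure_coproduct[OF less_finite _ Z[OF that]] Y that by simp
  obtain F where F: "\<And>i. i \<in> I \<Longrightarrow> \<guillemotleft>F i : Z i \<rightarrow> X i\<guillemotright>" "\<And>i b. i \<in> I \<Longrightarrow> b \<in> UNIV \<Longrightarrow> F i \<cdot> k i b = f b i"
    by (rule copair_family[OF Z, where Z = X and t = "\<lambda>i b. f b i"]) (use f is_coproductD(3)[OF Q] in auto)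
  obtain N l where N: "is_coproduct T I Z N l"
    using coproduct_exists[OF I] is_coproductD(1)[OF Z] by metis
  obtain M where M: "\<guillemotleft>M : N \<rightarrow> Q\<guillemotright>" "\<And>i. i \<in> I \<Longrightarrow> M \<cdot> l i = \<iota> i \<cdot> F i"
    using coproduct_map_exists[OF N Q F(1)] by metis
  have k: "\<guillemotleft>k i b : Y b i \<rightarrow> Z i\<guillemotright>" if "i \<in> I" for i b
    using is_coproductD(2)[OF Z[OF that]] by auto
  obtain n where n: "\<And>b. b \<in> UNIV \<Longrightarrow> \<guillemotleft>n b : R b \<rightarrow> N\<guillemotright>"
      "\<And>b i. b \<in> UNIV \<Longrightarrow> i \<in> I \<Longrightarrow> n b \<cdot> \<kappa> b i = l i \<cdot> k i b"
    by (rule copair_family[of UNIV "\<lambda>_. I" Y R \<kappa> "\<lambda>b i. l i \<cdot> k i b" "\<lambda>_. N"])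
      (use R comp_in_hom[OF is_coproductD(2)[OF N] k] is_coproductD(1)[OF N] in auto)
  note [simp] = in_homD(1-5)[OF M(1)] in_homD(1-3)[OF n(1)[OF UNIV_I]] in_homD(1-5)[OF h(1)]
    in_homD(1-3)[OF F(1)] in_homD(1-3)[OF k] in_homD(1-4)[OF is_coproductD(2)[OF Q]]
    in_homD(1-4)[OF is_coproductD(2)[OF N]]  in_homD(1-3)[OF is_coproductD(2)[OF R]]
  have Mn: "M \<cdot> n b = m b" for b
  proof (rule coproduct_ext[OF R comp_in_hom[OF M(1) n(1)] m(1)])
    fix i assume i: "i \<in> I"
    have "(M \<cdot> n b) \<cdot> \<kappa> b i = (M \<cdot> l i) \<cdot> k i b"
      using i by (simp add: comp_assoc n(2))
    also have "\<dots> = m b \<cdot> \<kappa> b i"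
      using i by (simp add: M(2) comp_assoc F(2) m(2))
    finally show "(M \<cdot> n b) \<cdot> \<kappa> b i = m b \<cdot> \<kappa> b i" .
  qed simp
  have "g = m True \<cdot> h True" "g' = m False \<cdot> h False"
    using h(2)[of True] h(2)[of False] by auto
  then have "g \<^bold>+ g' = M \<cdot> (n True \<cdot> h True \<^bold>+ n False \<cdot> h False)"
    by (simp add: comp_distrib Mn flip: comp_assoc)
  then show ?thesis
    using Z_cl F(1) N M by (intro coveredI[of I Z _ F X N l M Q \<iota> "n True \<cdot> h True \<^bold>+ n False \<cdot> h False"])
      (auto simp: in_hom_iff)
qed

subsection \<open>Closure under suspension\<close>

text \<open>
  Every family is a family of suspensions up to isomorphism, and so is its coproduct. Maps \<open>\<Sigma>S \<rightarrow> \<Coprod>\<^sub>i X\<^sub>i\<close>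
  thereby correspond to maps \<open>S \<rightarrow> \<Coprod>\<^sub>i X'\<^sub>i\<close>, which is how the properties of \<open>S\<close> pass to \<open>\<Sigma>S\<close>.
\<close>

lemma coproduct_desuspend:
  assumes I: "small TYPE('u) I" and Q: "is_coproduct T I X Q \<iota>"
  obtains X' d c Q' \<iota>' D C where
    "\<And>i. i \<in> I \<Longrightarrow> \<guillemotleft>d i : ShO T (X' i) \<rightarrow> X i\<guillemotright>" "\<And>i. i \<in> I \<Longrightarrow> \<guillemotleft>c i : X i \<rightarrow> ShO T (X' i)\<guillemotright>"
    "\<And>i. i \<in> I \<Longrightarrow> d i \<cdot> c i = Idt T (X i)" "is_coproduct T I X' Q' \<iota>'"
    "\<guillemotleft>D : ShO T Q' \<rightarrow> Q\<guillemotright>" "\<guillemotleft>C : Q \<rightarrow> ShO T Q'\<guillemotright>" "D \<cdot> C = Idt T Q"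
    "\<And>i. i \<in> I \<Longrightarrow> D \<cdot> ShA T (\<iota>' i) = \<iota> i \<cdot> d i" "\<And>i. i \<in> I \<Longrightarrow> C \<cdot> \<iota> i = ShA T (\<iota>' i) \<cdot> c i"
proof -
  have "X ` I \<subseteq> Ob T"
    using is_coproductD(3)[OF Q] by blast
  then obtain X' d c where X': "\<And>i. i \<in> I \<Longrightarrow> X' i \<in> Ob T"
    and d: "\<And>i. i \<in> I \<Longrightarrow> \<guillemotleft>d i : ShO T (X' i) \<rightarrow> X i\<guillemotright>" and c: "\<And>i. i \<in> I \<Longrightarrow> \<guillemotleft>c i : X i \<rightarrow> ShO T (X' i)\<guillemotright>"
    and dc: "\<And>i. i \<in> I \<Longrightarrow> d i \<cdot> c i = Idt T (X i)" and "\<And>i. i \<in> I \<Longrightarrow> c i \<cdot> d i = Idt T (ShO T (X' i))"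
    by (rule desuspensions) (rule that)
  obtain Q' \<iota>' where Q': "is_coproduct T I X' Q' \<iota>'"
    by (rule coproduct_exists[OF I X']) (assumption, rule that)
  note SQ' = coproduct_ShA[OF Q']
  obtain D where D: "\<guillemotleft>D : ShO T Q' \<rightarrow> Q\<guillemotright>" "\<And>i. i \<in> I \<Longrightarrow> D \<cdot> ShA T (\<iota>' i) = \<iota> i \<cdot> d i"
    using coproduct_map_exists[OF SQ' Q, of d] d by blast
  obtain C where C: "\<guillemotleft>C : Q \<rightarrow> ShO T Q'\<guillemotright>" "\<And>i. i \<in> I \<Longrightarrow> C \<cdot> \<iota> i = ShA T (\<iota>' i) \<cdot> c i"
    using coproduct_map_exists[OF Q SQ', of c] c by blast
  note [simp] = in_homD(1-5)[OF D(1)] in_homD(1-5)[OF C(1)] in_homD(1-3)[OF d] in_homD(1-3)[OF c]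
    in_homD(1-4)[OF is_coproductD(2)[OF Q]] in_homD(1-4)[OF is_coproductD(2)[OF Q']]
  have "D \<cdot> C = Idt T Q"
  proof (rule coproduct_ext[OF Q comp_in_hom[OF D(1) C(1)]])
    fix i assume i: "i \<in> I"
    have "(D \<cdot> C) \<cdot> \<iota> i = (D \<cdot> ShA T (\<iota>' i)) \<cdot> c i"
      using i by (simp add: comp_assoc C(2))
    then show "(D \<cdot> C) \<cdot> \<iota> i = Idt T Q \<cdot> \<iota> i"
      using i by (simp add: D(2) comp_assoc dc)
  qed (simp add: in_hom_iff)
  then show ?thesis
    using that[OF d c dc Q' D(1) C(1) _ D(2) C(2)] by blast
qed

lemma projection_ShA:
  assumes Q: "is_coproduct T I X Q \<iota>" and e: "coproduct_projection I X Q \<iota> J e"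
  shows "coproduct_projection I (\<lambda>i. ShO T (X i)) (ShO T Q) (\<lambda>i. ShA T (\<iota> i)) J (ShA T e)"
proof -
  have e_in: "\<guillemotleft>e : Q \<rightarrow> Q\<guillemotright>"
    using e by (simp add: coproduct_projection_def)
  note [simp] = in_homD(1-5)[OF e_in] in_homD(1-4)[OF is_coproductD(2)[OF Q]]
  have "ShA T e \<cdot> ShA T (\<iota> i) = ShA T (e \<cdot> \<iota> i)" if "i \<in> I" for i
    using that by simp
  then show ?thesis
    using e ShA_in_hom[OF e_in] by (auto simp: coproduct_projection_def simp del: ShA_comp)
qed

lemma alpha_small_ShO:
  assumes S: "alpha_small \<alpha> T S"
  shows "alpha_small \<alpha> T (ShO T S)"
proof (rule alpha_smallI)
  have S_Ob: "S \<in> Ob T"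
    using S unfolding alpha_small_iff by blast
  then show "ShO T S \<in> Ob T" by simp
  fix I :: "'u set" and X Q \<iota> f
  assume I: "small TYPE('u) I" and Q: "is_coproduct T I X Q \<iota>" and f: "\<guillemotleft>f : ShO T S \<rightarrow> Q\<guillemotright>"
  obtain X' d c Q' \<iota>' D C where d: "\<And>i. i \<in> I \<Longrightarrow> \<guillemotleft>d i : ShO T (X' i) \<rightarrow> X i\<guillemotright>"
    and c: "\<And>i. i \<in> I \<Longrightarrow> \<guillemotleft>c i : X i \<rightarrow> ShO T (X' i)\<guillemotright>" and dc: "\<And>i. i \<in> I \<Longrightarrow> d i \<cdot> c i = Idt T (X i)"
    and Q': "is_coproduct T I X' Q' \<iota>'"
    and D: "\<guillemotleft>D : ShO T Q' \<rightarrow> Q\<guillemotright>" and C: "\<guillemotleft>C : Q \<rightarrow> ShO T Q'\<guillemotright>" and DC: "D \<cdot> C = Idt T Q"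
    and D\<iota>: "\<And>i. i \<in> I \<Longrightarrow> D \<cdot> ShA T (\<iota>' i) = \<iota> i \<cdot> d i" and C\<iota>: "\<And>i. i \<in> I \<Longrightarrow> C \<cdot> \<iota> i = ShA T (\<iota>' i) \<cdot> c i"
    by (rule coproduct_desuspend[OF I Q]) (rule that)
  obtain g where g: "\<guillemotleft>g : S \<rightarrow> Q'\<guillemotright>" "ShA T g = C \<cdot> f"
    using ShA_full[OF comp_in_hom[OF C f] S_Ob is_coproductD(1)[OF Q']] .
  obtain J where J: "J \<subseteq> I" "|J| <o \<alpha>" "supported I X' Q' \<iota>' J g"
    using alpha_smallD[OF S I Q' g(1)] .
  then obtain e where e: "coproduct_projection I X' Q' \<iota>' J e" "e \<cdot> g = g"
    unfolding supported_def by blast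
  then have e_in: "\<guillemotleft>e : Q' \<rightarrow> Q'\<guillemotright>" and e\<iota>: "\<And>i. i \<in> I \<Longrightarrow> e \<cdot> \<iota>' i = (if i \<in> J then \<iota>' i else Zero T (X' i) Q')"
    by (auto simp: coproduct_projection_def)
  note [simp] = in_homD(1-5)[OF D(1)] in_homD(1-5)[OF C(1)] in_homD(1-5)[OF e_in] in_homD(1-3)[OF d] in_homD(1-3)[OF c]
    in_homD(1-4)[OF is_coproductD(2)[OF Q]] in_homD(1-4)[OF is_coproductD(2)[OF Q']] in_homD(1-5)[OF f]
    in_homD(1-5)[OF g(1)]
  have "coproduct_projection I X Q \<iota> J (D \<cdot> (ShA T e \<cdot> C))"
    unfolding coproduct_projection_def
  proof (intro conjI ballI)
    show "\<guillemotleft>D \<cdot> (ShA T e \<cdot> C) : Q \<rightarrow> Q\<guillemotright>"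
      by (simp add: in_hom_iff)
    fix i assume i: "i \<in> I"
    have "(D \<cdot> (ShA T e \<cdot> C)) \<cdot> \<iota> i = D \<cdot> (ShA T (e \<cdot> \<iota>' i) \<cdot> c i)"
      using i by (simp add: comp_assoc C\<iota>)
    also have "\<dots> = (if i \<in> J then (D \<cdot> ShA T (\<iota>' i)) \<cdot> c i else Zero T (X i) Q)"
      using i by (simp add: e\<iota> comp_assoc)
    also have "\<dots> = (if i \<in> J then \<iota> i else Zero T (X i) Q)"
      using i by (simp add: D\<iota> comp_assoc dc)
    finally show "(D \<cdot> (ShA T e \<cdot> C)) \<cdot> \<iota> i = (if i \<in> J then \<iota> i else Zero T (X i) Q)" .
  qed
  moreover have "(D \<cdot> (ShA T e \<cdot> C)) \<cdot> f = f"
  proof -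
    have "(D \<cdot> (ShA T e \<cdot> C)) \<cdot> f = D \<cdot> ShA T (e \<cdot> g)"
      by (simp add: comp_assoc g(2))
    also have "\<dots> = (D \<cdot> C) \<cdot> f"
      by (simp add: e(2) g(2) comp_assoc)
    finally show ?thesis
      by (simp add: DC)
  qed
  ultimately have "supported I X Q \<iota> J f"
    unfolding supported_def by blast
  then show "\<exists>J\<subseteq>I. |J| <o \<alpha> \<and> supported I X Q \<iota> J f"
    using J by blast
qed

lemma alpha_small_ShO_D:
  assumes S: "alpha_small \<alpha> T (ShO T S)" and S_Ob: "S \<in> Ob T"
  shows "alpha_small \<alpha> T S"
proof (rule alpha_smallI[OF S_Ob])
  fix I :: "'u set" and X Q \<iota> f
  assume I: "small TYPE('u) I" and Q: "is_coproduct T I X Q \<iota>" and f: "\<guillemotleft>f : S \<rightarrow> Q\<guillemotright>"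
  obtain J where J: "J \<subseteq> I" "|J| <o \<alpha>" "supported I (\<lambda>i. ShO T (X i)) (ShO T Q) (\<lambda>i. ShA T (\<iota> i)) J (ShA T f)"
    using alpha_smallD[OF S I coproduct_ShA[OF Q] ShA_in_hom[OF f]] .
  obtain e where e: "coproduct_projection I X Q \<iota> J e"
    using projection_exists[OF Q] .
  then have e_in: "\<guillemotleft>e : Q \<rightarrow> Q\<guillemotright>"
    by (simp add: coproduct_projection_def)
  have "ShA T e \<cdot> ShA T f = ShA T f"
    by (rule supportedD[OF coproduct_ShA[OF Q] projection_ShA[OF Q e] ShA_in_hom[OF f] J(3)]) simp
  then have "ShA T (e \<cdot> f) = ShA T f"
    using e_in f by (simp add: in_hom_iff)
  then have "e \<cdot> f = f"
    by (rule ShA_eqD[OF _ comp_in_hom[OF e_in f] f])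
  then show "\<exists>J\<subseteq>I. |J| <o \<alpha> \<and> supported I X Q \<iota> J f"
    using J e unfolding supported_def by blast
qed

lemma closure_base: "P \<subseteq> coproduct_closure (P \<union> A)"
  by (auto intro: coproduct_closure.base)

lemma A_ShO:
  assumes "S \<in> A" shows "ShO T S \<in> A"
proof -
  have "ShO T ` A \<subseteq> A"
  proof (rule A_criterion)
    show "alpha_small \<alpha> T S" if "S \<in> ShO T ` A" for S
      using that alpha_small_ShO A_alpha_small by blast
    fix R and I :: "'u set" and X Q \<iota> g
    assume R: "R \<in> ShO T ` A" and I: "small TYPE('u) I" and Q: "is_coproduct T I X Q \<iota>" and g: "\<guillemotleft>g : R \<rightarrow> Q\<guillemotright>"
    obtain S where S: "S \<in> A" and RS: "R = ShO T S"
      using R by blast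
    have S_Ob: "S \<in> Ob T"
      using A_Ob[OF S] .
    obtain X' d c Q' \<iota>' D C where d: "\<And>i. i \<in> I \<Longrightarrow> \<guillemotleft>d i : ShO T (X' i) \<rightarrow> X i\<guillemotright>"
      and "\<And>i. i \<in> I \<Longrightarrow> \<guillemotleft>c i : X i \<rightarrow> ShO T (X' i)\<guillemotright>" and "\<And>i. i \<in> I \<Longrightarrow> d i \<cdot> c i = Idt T (X i)"
      and Q': "is_coproduct T I X' Q' \<iota>'"
      and D: "\<guillemotleft>D : ShO T Q' \<rightarrow> Q\<guillemotright>" and C: "\<guillemotleft>C : Q \<rightarrow> ShO T Q'\<guillemotright>" and DC: "D \<cdot> C = Idt T Q"
      and D\<iota>: "\<And>i. i \<in> I \<Longrightarrow> D \<cdot> ShA T (\<iota>' i) = \<iota> i \<cdot> d i" and "\<And>i. i \<in> I \<Longrightarrow> C \<cdot> \<iota> i = ShA T (\<iota>' i) \<cdot> c i"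
      by (rule coproduct_desuspend[OF I Q]) (rule that)
    obtain g' where g': "\<guillemotleft>g' : S \<rightarrow> Q'\<guillemotright>" "ShA T g' = C \<cdot> g"
      using ShA_full[OF comp_in_hom[OF C g[unfolded RS]] S_Ob is_coproductD(1)[OF Q']] .
    obtain Y f N \<kappa> m h where F: "factorisation A I X' Q' \<iota>' S g' Y f N \<kappa> m h"
      using A_covered[OF S I Q' g'(1)] unfolding covered_def by blast
    note f = factorisationD(2)[OF F] and N = factorisationD(3)[OF F] and m = factorisationD(4)[OF F] and h = factorisationD(6)[OF F]
    note [simp] = in_homD(1-5)[OF D(1)] in_homD(1-5)[OF C(1)] in_homD(1-3)[OF d]
      in_homD(1-4)[OF is_coproductD(2)[OF Q]] in_homD(1-4)[OF is_coproductD(2)[OF Q']] in_homD(1-5)[OF g]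
      in_homD(1-5)[OF m] in_homD(1-5)[OF h] in_homD(1-3)[OF f] in_homD(1-4)[OF is_coproductD(2)[OF N]]
    have "covered (ShO T ` A) I X Q \<iota> R g"
    proof (rule coveredI[OF _ _ coproduct_ShA[OF N]])
      show "ShO T (Y i) \<in> ShO T ` A" if "i \<in> I" for i
        using factorisationD(1)[OF F that] by blast
      show "\<guillemotleft>d i \<cdot> ShA T (f i) : ShO T (Y i) \<rightarrow> X i\<guillemotright>" if "i \<in> I" for i
        using comp_in_hom[OF d ShA_in_hom[OF f]] that by blast
      show "\<guillemotleft>D \<cdot> ShA T m : ShO T N \<rightarrow> Q\<guillemotright>" "\<guillemotleft>ShA T h : R \<rightarrow> ShO T N\<guillemotright>"
        using comp_in_hom[OF D ShA_in_hom[OF m]] ShA_in_hom[OF h] RS by auto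
      fix i assume i: "i \<in> I"
      have "(D \<cdot> ShA T m) \<cdot> ShA T (\<kappa> i) = D \<cdot> ShA T (m \<cdot> \<kappa> i)"
        using i by (simp add: comp_assoc)
      also have "\<dots> = (D \<cdot> ShA T (\<iota>' i)) \<cdot> ShA T (f i)"
        using i by (simp add: factorisationD(5)[OF F] comp_assoc)
      also have "\<dots> = \<iota> i \<cdot> (d i \<cdot> ShA T (f i))"
        using i by (simp add: D\<iota> comp_assoc)
      finally show "(D \<cdot> ShA T m) \<cdot> ShA T (\<kappa> i) = \<iota> i \<cdot> (d i \<cdot> ShA T (f i))" .
    next
      have "(D \<cdot> ShA T m) \<cdot> ShA T h = D \<cdot> ShA T g'"
        by (simp add: comp_assoc factorisationD(7)[OF F])
      also have "\<dots> = (D \<cdot> C) \<cdot> g"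
        using RS by (simp add: g'(2) comp_assoc)
      finally show "g = (D \<cdot> ShA T m) \<cdot> ShA T h"
        by (simp add: DC)
    qed
    then show "covered (coproduct_closure (ShO T ` A \<union> A)) I X Q \<iota> R g"
      by (rule covered_mono[OF _ closure_base])
  qed
  then show ?thesis
    using assms by blast
qed

lemma A_ShO_D:
  assumes "S \<in> Ob T" "ShO T S \<in> A" shows "S \<in> A"
proof -
  let ?P = "{S \<in> Ob T. ShO T S \<in> A}"
  have "?P \<subseteq> A"
  proof (rule A_criterion)
    show "alpha_small \<alpha> T S" if "S \<in> ?P" for S
      using that alpha_small_ShO_D A_alpha_small by blast
    fix S and I :: "'u set" and X Q \<iota> g
    assume S: "S \<in> ?P" and I: "small TYPE('u) I" and Q: "is_coproduct T I X Q \<iota>" and g: "\<guillemotleft>g : S \<rightarrow> Q\<guillemotright>"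
    have SS: "ShO T S \<in> A" and S_Ob: "S \<in> Ob T"
      using S by auto
    obtain Y f N \<kappa> m h where F: "factorisation A I (\<lambda>i. ShO T (X i)) (ShO T Q) (\<lambda>i. ShA T (\<iota> i)) (ShO T S) (ShA T g) Y f N \<kappa> m h"
      using A_covered[OF SS I coproduct_ShA[OF Q] ShA_in_hom[OF g]] unfolding covered_def by blast
    note f = factorisationD(2)[OF F] and N = factorisationD(3)[OF F] and m = factorisationD(4)[OF F] and h = factorisationD(6)[OF F]
    have Y_Ob: "Y ` I \<subseteq> Ob T"
      using is_coproductD(3)[OF N] by blast
    obtain Y' d c where Y': "\<And>i. i \<in> I \<Longrightarrow> Y' i \<in> Ob T" and d: "\<And>i. i \<in> I \<Longrightarrow> \<guillemotleft>d i : ShO T (Y' i) \<rightarrow> Y i\<guillemotright>"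
      and c: "\<And>i. i \<in> I \<Longrightarrow> \<guillemotleft>c i : Y i \<rightarrow> ShO T (Y' i)\<guillemotright>" and dc: "\<And>i. i \<in> I \<Longrightarrow> d i \<cdot> c i = Idt T (Y i)"
      and cd: "\<And>i. i \<in> I \<Longrightarrow> c i \<cdot> d i = Idt T (ShO T (Y' i))"
      by (rule desuspensions[OF Y_Ob]) (rule that)
    obtain N' \<kappa>' where N': "is_coproduct T I Y' N' \<kappa>'"
      by (rule coproduct_exists[OF I Y']) (assumption, rule that)
    note [simp] = in_homD(1-3)[OF d] in_homD(1-3)[OF c] Y'
      in_homD(1-4)[OF is_coproductD(2)[OF Q]] in_homD(1-4)[OF is_coproductD(2)[OF N']] in_homD(1-5)[OF g]
      in_homD(1-5)[OF m] in_homD(1-5)[OF h] in_homD(1-3)[OF f] in_homD(1-4)[OF is_coproductD(2)[OF N]]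
    have "\<exists>f'. \<guillemotleft>f' : Y' i \<rightarrow> X i\<guillemotright> \<and> ShA T f' = f i \<cdot> d i" if i: "i \<in> I" for i
      using ShA_full[OF comp_in_hom[OF f[OF i] d[OF i]] Y'[OF i] is_coproductD(3)[OF Q i]] by blast
    then obtain f' where f': "\<And>i. i \<in> I \<Longrightarrow> \<guillemotleft>f' i : Y' i \<rightarrow> X i\<guillemotright>" "\<And>i. i \<in> I \<Longrightarrow> ShA T (f' i) = f i \<cdot> d i"
      by metis
    obtain m' where m': "\<guillemotleft>m' : N' \<rightarrow> Q\<guillemotright>" "\<And>i. i \<in> I \<Longrightarrow> m' \<cdot> \<kappa>' i = \<iota> i \<cdot> f' i"
      using coproduct_map_exists[OF N' Q f'(1)] by blast
    obtain n where n: "\<guillemotleft>n : N \<rightarrow> ShO T N'\<guillemotright>" "\<And>i. i \<in> I \<Longrightarrow> n \<cdot> \<kappa> i = ShA T (\<kappa>' i) \<cdot> c i"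
      using coproduct_map_exists[OF N coproduct_ShA[OF N'] c] by blast
    obtain h' where h': "\<guillemotleft>h' : S \<rightarrow> N'\<guillemotright>" "ShA T h' = n \<cdot> h"
      using ShA_full[OF comp_in_hom[OF n(1) h] S_Ob is_coproductD(1)[OF N']] .
    note [simp] = in_homD(1-5)[OF m'(1)] in_homD(1-5)[OF n(1)] in_homD(1-5)[OF h'(1)] in_homD(1-3)[OF f'(1)]
    have mn: "ShA T m' \<cdot> n = m"
    proof (rule coproduct_ext[OF N comp_in_hom[OF ShA_in_hom[OF m'(1)] n(1)] m])
      fix i assume i: "i \<in> I"
      have "(ShA T m' \<cdot> n) \<cdot> \<kappa> i = ShA T (m' \<cdot> \<kappa>' i) \<cdot> c i"
        using i by (simp add: comp_assoc n(2))
      also have "\<dots> = ShA T (\<iota> i) \<cdot> (f i \<cdot> (d i \<cdot> c i))"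
        using i by (simp add: m'(2) f'(2) comp_assoc)
      finally show "(ShA T m' \<cdot> n) \<cdot> \<kappa> i = m \<cdot> \<kappa> i"
        using i by (simp add: dc factorisationD(5)[OF F])
    qed
    have "ShA T g = ShA T (m' \<cdot> h')"
      by (simp add: h'(2) factorisationD(7)[OF F] mn flip: comp_assoc)
    then have "g = m' \<cdot> h'"
      by (rule ShA_eqD[OF _ g comp_in_hom[OF m'(1) h'(1)]])
    moreover have "Y' i \<in> ?P" if "i \<in> I" for i
      using A_iso[OF factorisationD(1)[OF F that] c[OF that] d[OF that] cd[OF that] dc[OF that]] Y'[OF that] by simp
    ultimately have "covered ?P I X Q \<iota> S g"
      using N' f'(1) m' h'(1) by (intro coveredI[of I Y' ?P f' X N' \<kappa>' m' Q \<iota> h'])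
    then show "covered (coproduct_closure (?P \<union> A)) I X Q \<iota> S g"
      by (rule covered_mono[OF _ closure_base])
  qed
  then show ?thesis
    using assms by blast
qed

lemma A_desuspension:
  assumes "S \<in> A"
  obtains S' d c where "S' \<in> A" "\<guillemotleft>d : ShO T S' \<rightarrow> S\<guillemotright>" "\<guillemotleft>c : S \<rightarrow> ShO T S'\<guillemotright>"
    "d \<cdot> c = Idt T S" "c \<cdot> d = Idt T (ShO T S')"
proof -
  obtain S' d c where S': "S' \<in> Ob T" "\<guillemotleft>d : ShO T S' \<rightarrow> S\<guillemotright>" "\<guillemotleft>c : S \<rightarrow> ShO T S'\<guillemotright>"
    "d \<cdot> c = Idt T S" "c \<cdot> d = Idt T (ShO T S')"
    using desuspension[OF A_Ob[OF assms]] .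
  then have "S' \<in> A"
    using A_ShO_D A_iso[OF assms S'(3,2,5,4)] by blast
  then show ?thesis
    using that S' by blast
qed

subsection \<open>Closure under cones\<close>

lemma diff_left_cancel:
  assumes "arr f" "arr g" "arr h" "dom g = dom f" "cod g = cod f" "dom h = dom f" "cod h = cod f"
    and "f \<^bold>- g = f \<^bold>- h"
  shows "g = h"
proof -
  have "f \<^bold>- (f \<^bold>- g) = f \<^bold>- (f \<^bold>- h)"
    using assms(8) by simp
  then show ?thesis
    using assms(1-7) by (simp add: mns_add flip: add_assoc)
qed

text \<open>
  Let \<open>e\<close> be the projection to a set of summands that supports \<open>f \<cdot> b\<close>. Then \<open>e \<cdot> f - f\<close> vanishes on \<open>y\<close>, hence
  comes from \<open>\<Sigma>x\<close>, and is supported by fewer than \<open>\<alpha>\<close> summands, too.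
\<close>

lemma alpha_small_cone:
  assumes tri: "exact_triangle T x y c a b d" and x: "alpha_small \<alpha> T x" and y: "alpha_small \<alpha> T y"
  shows "alpha_small \<alpha> T c"
proof (rule alpha_smallI)
  note ab = triD[OF tri]
  show "c \<in> Ob T" using ab(2) by (simp add: in_hom_iff)
  fix I :: "'u set" and X Q \<iota> f
  assume I: "small TYPE('u) I" and Q: "is_coproduct T I X Q \<iota>" and f: "\<guillemotleft>f : c \<rightarrow> Q\<guillemotright>"
  obtain J where J: "J \<subseteq> I" "|J| <o \<alpha>" "supported I X Q \<iota> J (f \<cdot> b)"
    using alpha_smallD[OF y I Q comp_in_hom[OF f ab(2)]] .
  obtain e where e: "coproduct_projection I X Q \<iota> J e" "e \<cdot> (f \<cdot> b) = f \<cdot> b"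
    using J(3) unfolding supported_def by blast
  then have e_in: "\<guillemotleft>e : Q \<rightarrow> Q\<guillemotright>"
    by (simp add: coproduct_projection_def)
  note [simp] = in_homD(1-5)[OF ab(1)] in_homD(1-5)[OF ab(2)] in_homD(1-5)[OF ab(3)] in_homD(1-5)[OF f]
    in_homD(1-5)[OF e_in]
  have diff: "\<guillemotleft>e \<cdot> f \<^bold>- f : c \<rightarrow> Q\<guillemotright>" "(e \<cdot> f \<^bold>- f) \<cdot> b = Zero T y Q"
    by (auto simp: in_hom_iff comp_distrib comp_assoc e(2))
  obtain r where r: "\<guillemotleft>r : ShO T x \<rightarrow> Q\<guillemotright>" "e \<cdot> f \<^bold>- f = r \<cdot> d"
    using tri_ext3[OF tri diff] .
  obtain J' where J': "J' \<subseteq> I" "|J'| <o \<alpha>" "supported I X Q \<iota> J' r"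
    using alpha_smallD[OF alpha_small_ShO[OF x] I Q r(1)] .
  obtain k where k: "coproduct_projection I X Q \<iota> (J \<union> J') k"
    using projection_exists[OF Q] .
  then have k_in: "\<guillemotleft>k : Q \<rightarrow> Q\<guillemotright>"
    by (simp add: coproduct_projection_def)
  note [simp] = in_homD(1-5)[OF k_in] in_homD(1-5)[OF r(1)]
  have ke: "k \<cdot> e = e"
    using projection_comp[OF Q e(1) k] by blast
  have kr: "k \<cdot> r = r"
    using supportedD[OF Q k r(1) J'(3)] by blast
  have "e \<cdot> f \<^bold>- k \<cdot> f = k \<cdot> (e \<cdot> f \<^bold>- f)"
    by (simp add: comp_distrib ke flip: comp_assoc)
  also have "\<dots> = e \<cdot> f \<^bold>- f"
    by (simp add: r(2) kr flip: comp_assoc)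
  finally have "k \<cdot> f = f"
    by (rule diff_left_cancel[rotated 7]) auto
  then have "supported I X Q \<iota> (J \<union> J') f"
    using k unfolding supported_def by blast
  then show "\<exists>J\<subseteq>I. |J| <o \<alpha> \<and> supported I X Q \<iota> J f"
    using J J' less_Un by blast
qed

lemma covered_comp:
  assumes "covered P I X Q \<iota> S g" and "\<guillemotleft>t : S' \<rightarrow> S\<guillemotright>"
  shows "covered P I X Q \<iota> S' (g \<cdot> t)"
proof -
  obtain Y f N \<kappa> m h where F: "factorisation P I X Q \<iota> S g Y f N \<kappa> m h"
    using assms(1) unfolding covered_def by blast
  note m = factorisationD(4)[OF F] and h = factorisationD(6)[OF F]
  have "g \<cdot> t = m \<cdot> (h \<cdot> t)"
    using m h assms(2) factorisationD(7)[OF F] by (simp add: in_hom_iff comp_assoc)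
  then have "factorisation P I X Q \<iota> S' (g \<cdot> t) Y f N \<kappa> m (h \<cdot> t)"
    using F comp_in_hom[OF h assms(2)] unfolding factorisation_def by blast
  then show ?thesis
    unfolding covered_def by blast
qed

text \<open>
  Let \<open>g : c \<rightarrow> \<Coprod>\<^sub>i X\<^sub>i\<close> start in a cone of \<open>a : x \<rightarrow> y\<close>. The composite \<open>y \<rightarrow> c \<rightarrow> \<Coprod>\<^sub>i X\<^sub>i\<close> factors through a
  coproduct of maps \<open>y\<^sub>i \<rightarrow> X\<^sub>i\<close>. As it vanishes on \<open>x\<close>, the map \<open>x \<rightarrow> \<Coprod>\<^sub>i y\<^sub>i\<close> lifts to the coproduct of the
  fibres of these maps, hence factors through some \<open>\<Coprod>\<^sub>i x\<^sub>i\<close> lying over the fibres. The cones \<open>c\<^sub>i\<close> of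
  \<open>x\<^sub>i \<rightarrow> y\<^sub>i\<close> map to \<open>X\<^sub>i\<close>, and \<open>g\<close> factors through \<open>\<Coprod>\<^sub>i c\<^sub>i\<close> up to a map that vanishes on \<open>y\<close> and thus
  comes from \<open>\<Sigma>x\<close>.
\<close>

lemma covered_cone:
  fixes I :: "'u set"
  assumes tri: "exact_triangle T x y c a b d" and x: "x \<in> A" and y: "y \<in> A"
    and I: "small TYPE('u) I" and Q: "is_coproduct T I X Q \<iota>" and g: "\<guillemotleft>g : c \<rightarrow> Q\<guillemotright>"
    and P: "P = {c. \<exists>x\<in>A. \<exists>y\<in>A. \<exists>a b d. exact_triangle T x y c a b d}"
  shows "covered (coproduct_closure (P \<union> A)) I X Q \<iota> c g"
proof -
  note abd = triD[OF tri]
  note [simp] = in_homD(1-5)[OF abd(1)] in_homD(1-5)[OF abd(2)] in_homD(1-5)[OF abd(3)] in_homD(1-5)[OF g]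
    in_homD(1-4)[OF is_coproductD(2)[OF Q]] is_coproductD(1)[OF Q] is_coproductD(3)[OF Q]
  \<comment> \<open>\<open>m : N \<rightarrow> Q\<close> is the coproduct of the maps \<open>f i : Y i \<rightarrow> X i\<close>.\<close>
  obtain Y f N \<kappa> m z where F: "factorisation A I X Q \<iota> y (g \<cdot> b) Y f N \<kappa> m z"
    using A_covered[OF y I Q comp_in_hom[OF g abd(2)]] unfolding covered_def by blast
  note Y = factorisationD(1)[OF F] and f = factorisationD(2)[OF F] and N = factorisationD(3)[OF F]
    and m = factorisationD(4,5)[OF F] and z = factorisationD(6)[OF F] and gb = factorisationD(7)[OF F]
  have "\<exists>W k v. exact_triangle T W (Y i) (X i) k (f i) v" if "i \<in> I" for i
    by (rule fibre_exists[OF f[OF that]]) blast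
  then obtain W k v where W: "\<And>i. i \<in> I \<Longrightarrow> exact_triangle T (W i) (Y i) (X i) (k i) (f i) (v i)"
    by metis
  note k = triD(1)[OF W]
  have W_Ob: "W i \<in> Ob T" if "i \<in> I" for i
    using in_homD(4)[OF k[OF that]] .
  obtain L l where L: "is_coproduct T I W L l"
    by (rule coproduct_exists[OF I W_Ob]) (assumption, rule that)
  obtain K where K: "\<guillemotleft>K : L \<rightarrow> N\<guillemotright>" "\<And>i. i \<in> I \<Longrightarrow> K \<cdot> l i = \<kappa> i \<cdot> k i"
    using coproduct_map_exists[OF L N k] by blast
  \<comment> \<open>The coproduct of the fibres is a fibre of \<open>m\<close>.\<close>
  obtain H where LNQ: "exact_triangle T L N Q K m H"
    using coproduct_triangle[OF L N Q W K m(1) m(2)] by blast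
  note [simp] = in_homD(1-3)[OF f] in_homD(1-5)[OF m(1)] in_homD(1-5)[OF z] in_homD(1-4)[OF is_coproductD(2)[OF N]]
    in_homD(1-4)[OF is_coproductD(2)[OF L]] in_homD(1-3)[OF k] in_homD(1-5)[OF K(1)]
  have "m \<cdot> (z \<cdot> a) = (g \<cdot> b) \<cdot> a"
    by (simp add: gb flip: comp_assoc)
  also have "\<dots> = g \<cdot> (b \<cdot> a)"
    by (simp add: comp_assoc)
  finally have "m \<cdot> (z \<cdot> a) = Zero T x Q"
    by (simp add: tri_comp_zero[OF tri])
  \<comment> \<open>As \<open>z \<cdot> a\<close> lifts to the fibre \<open>L\<close>, it factors through a coproduct of objects of \<open>T\<^sup>\<alpha>\<close> over the \<open>W i\<close>.\<close>
  then obtain t where t: "\<guillemotleft>t : x \<rightarrow> L\<guillemotright>" "z \<cdot> a = K \<cdot> t"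
    by (rule tri_lift[OF LNQ comp_in_hom[OF z abd(1)]]) (rule that)
  obtain Y' f' N' \<kappa>' m' h' where F': "factorisation A I W L l x t Y' f' N' \<kappa>' m' h'"
    using A_covered[OF x I L t(1)] unfolding covered_def by blast
  note Y' = factorisationD(1)[OF F'] and f' = factorisationD(2)[OF F'] and N' = factorisationD(3)[OF F']
    and m' = factorisationD(4,5)[OF F'] and h' = factorisationD(6)[OF F'] and t' = factorisationD(7)[OF F']
  note kf' = comp_in_hom[OF k f']
  have "\<exists>c p q. exact_triangle T (Y' i) (Y i) c (k i \<cdot> f' i) p q" if "i \<in> I" for i
    by (rule cone_exists[OF kf'[OF that that]]) blast
  then obtain c' p q where c': "\<And>i. i \<in> I \<Longrightarrow> exact_triangle T (Y' i) (Y i) (c' i) (k i \<cdot> f' i) (p i) (q i)"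
    by metis
  note p = triD(2)[OF c']
  note [simp] = in_homD(1-5)[OF t(1)] in_homD(1-3)[OF f'] in_homD(1-5)[OF m'(1)] in_homD(1-5)[OF h']
    in_homD(1-4)[OF is_coproductD(2)[OF N']] in_homD(1-3)[OF p] in_homD(5)[OF p]
  have "\<exists>s. \<guillemotleft>s : c' i \<rightarrow> X i\<guillemotright> \<and> f i = s \<cdot> p i" if i: "i \<in> I" for i
  proof -
    have "f i \<cdot> (k i \<cdot> f' i) = (f i \<cdot> k i) \<cdot> f' i"
      using i by (simp add: comp_assoc)
    also have "\<dots> = Zero T (Y' i) (X i)"
      using i by (simp add: tri_comp_zero[OF W])
    finally show ?thesis
      by (rule tri_ext[OF c'[OF i] f[OF i]]) blast
  qed
  then obtain s where s: "\<And>i. i \<in> I \<Longrightarrow> \<guillemotleft>s i : c' i \<rightarrow> X i\<guillemotright>" "\<And>i. i \<in> I \<Longrightarrow> f i = s i \<cdot> p i"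
    by metis
  have c'_Ob: "c' i \<in> Ob T" if "i \<in> I" for i
    using in_homD(4)[OF s(1)[OF that]] .
  obtain M \<mu> where M: "is_coproduct T I c' M \<mu>"
    by (rule coproduct_exists[OF I c'_Ob]) (assumption, rule that)
  obtain G where G: "\<guillemotleft>G : N \<rightarrow> M\<guillemotright>" "\<And>i. i \<in> I \<Longrightarrow> G \<cdot> \<kappa> i = \<mu> i \<cdot> p i"
    using coproduct_map_exists[OF N M p] by blast
  obtain S where S: "\<guillemotleft>S : M \<rightarrow> Q\<guillemotright>" "\<And>i. i \<in> I \<Longrightarrow> S \<cdot> \<mu> i = \<iota> i \<cdot> s i"
    using coproduct_map_exists[OF M Q s(1)] by blast
  note [simp] = in_homD(1-5)[OF G(1)] in_homD(1-5)[OF S(1)] in_homD(1-4)[OF is_coproductD(2)[OF M]] in_homD(1-3)[OF s(1)]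
  have SG: "S \<cdot> G = m"
  proof (rule coproduct_ext[OF N comp_in_hom[OF S(1) G(1)] m(1)])
    fix i assume i: "i \<in> I"
    have "(S \<cdot> G) \<cdot> \<kappa> i = (S \<cdot> \<mu> i) \<cdot> p i"
      using i by (simp add: comp_assoc G(2))
    then show "(S \<cdot> G) \<cdot> \<kappa> i = m \<cdot> \<kappa> i"
      using i by (simp add: S(2) m(2) comp_assoc flip: s(2))
  qed
  have "G \<cdot> (K \<cdot> m') = Zero T N' M"
  proof (rule coproduct_ext[OF N'])
    fix i assume i: "i \<in> I"
    have "(G \<cdot> (K \<cdot> m')) \<cdot> \<kappa>' i = G \<cdot> ((K \<cdot> l i) \<cdot> f' i)"
      using i by (simp add: comp_assoc m'(2))
    also have "\<dots> = (G \<cdot> \<kappa> i) \<cdot> (k i \<cdot> f' i)"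
      using i by (simp add: K(2) comp_assoc)
    also have "\<dots> = \<mu> i \<cdot> (p i \<cdot> (k i \<cdot> f' i))"
      using i by (simp add: G(2) comp_assoc)
    also have "\<dots> = Zero T N' M \<cdot> \<kappa>' i"
      using i by (simp add: tri_comp_zero[OF c'])
    finally show "(G \<cdot> (K \<cdot> m')) \<cdot> \<kappa>' i = Zero T N' M \<cdot> \<kappa>' i" .
  qed (auto simp: in_hom_iff)
  then have "(G \<cdot> (K \<cdot> m')) \<cdot> h' = Zero T x M"
    by simp
  then have "(G \<cdot> z) \<cdot> a = Zero T x M"
    by (simp add: comp_assoc t(2) t')
  then obtain u where u: "\<guillemotleft>u : c \<rightarrow> M\<guillemotright>" "G \<cdot> z = u \<cdot> b"
    by (rule tri_ext[OF tri comp_in_hom[OF G(1) z]]) (rule that)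
  note [simp] = in_homD(1-5)[OF u(1)]
  have "c' i \<in> coproduct_closure (P \<union> A)" if "i \<in> I" for i
    using c'[OF that] Y'[OF that] Y[OF that] unfolding P by (intro coproduct_closure.base) blast
  then have cov1: "covered (coproduct_closure (P \<union> A)) I X Q \<iota> c (S \<cdot> u)"
    by (intro coveredI[OF _ s(1) M S u(1)]) auto
  have "(S \<cdot> u) \<cdot> b = g \<cdot> b"
    by (simp add: comp_assoc gb flip: u(2)) (simp add: SG flip: comp_assoc)
  then have "(g \<^bold>- S \<cdot> u) \<cdot> b = Zero T y Q"
    by (simp add: comp_distrib)
  then obtain r where r: "\<guillemotleft>r : ShO T x \<rightarrow> Q\<guillemotright>" "g \<^bold>- S \<cdot> u = r \<cdot> d"
    by (rule tri_ext3[OF tri, rotated]) (auto simp: in_hom_iff intro: that)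
  have "A \<subseteq> coproduct_closure (P \<union> A)"
    by (auto intro: coproduct_closure.base)
  \<comment> \<open>\<open>\<Sigma>x\<close> lies in \<open>T\<^sup>\<alpha>\<close>, so the correction term has a factorisation as well.\<close>
  then have cov2: "covered (coproduct_closure (P \<union> A)) I X Q \<iota> c (r \<cdot> d)"
    by (rule covered_mono[OF covered_comp[OF A_covered[OF A_ShO[OF x] I Q r(1)] abd(3)]])
  have "S \<cdot> u \<^bold>+ r \<cdot> d = g"
    using add_diff_cancel(1)[of g "S \<cdot> u"] by (simp add: r(2))
  then show ?thesis
    using covered_add[OF I Q cov1 cov2] by simp
qed

lemma A_cone:
  assumes tri: "exact_triangle T x y c a b d" and x: "x \<in> A" and y: "y \<in> A"
  shows "c \<in> A"
proof -
  define P where "P = {c. \<exists>x\<in>A. \<exists>y\<in>A. \<exists>a b d. exact_triangle T x y c a b d}"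
  have "P \<subseteq> A"
  proof (rule A_criterion)
    fix c assume "c \<in> P"
    then obtain x y a b d where *: "x \<in> A" "y \<in> A" "exact_triangle T x y c a b d"
      unfolding P_def by blast
    show "alpha_small \<alpha> T c"
      using alpha_small_cone[OF *(3)] *(1,2) A_alpha_small by blast
    show "covered (coproduct_closure (P \<union> A)) I X Q \<iota> c g"
      if "small TYPE('u) I" "is_coproduct T I X Q \<iota>" "\<guillemotleft>g : c \<rightarrow> Q\<guillemotright>" for I :: "'u set" and X Q \<iota> g
      using covered_cone[OF *(3,1,2) that P_def] .
  qed
  then show ?thesis
    using assms unfolding P_def by blast
qed

lemma A_fibre:
  assumes tri: "exact_triangle T w x y a b d" and x: "x \<in> A" and y: "y \<in> A"
  shows "w \<in> A"
  using A_ShO_D[OF _ A_cone[OF rotate[OF tri] x y]] triD(1)[OF tri] by (simp add: in_hom_iff)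

subsection \<open>The generators lie in \<open>T\<^sup>\<alpha>\<close>\<close>

text \<open>
  Take one copy of \<open>S\<close> for each map \<open>h : S \<rightarrow> X\<close>.
\<close>

lemma precover:
  assumes "small TYPE('u) \<S>" and "\<S> \<subseteq> Ob T" and X: "X \<in> Ob T"
  obtains W \<kappa> w where "is_coproduct T (Sigma \<S> (\<lambda>S. Hom T S X)) fst W \<kappa>" "\<guillemotleft>w : W \<rightarrow> X\<guillemotright>"
    "\<And>S h. S \<in> \<S> \<Longrightarrow> \<guillemotleft>h : S \<rightarrow> X\<guillemotright> \<Longrightarrow> w \<cdot> \<kappa> (S, h) = h"
    "\<And>S h. S \<in> \<S> \<Longrightarrow> \<guillemotleft>h : S \<rightarrow> X\<guillemotright> \<Longrightarrow> \<exists>k. \<guillemotleft>k : S \<rightarrow> W\<guillemotright> \<and> w \<cdot> k = h"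
proof -
  let ?H = "Sigma \<S> (\<lambda>S. Hom T S X)"
  have small: "small TYPE('u) ?H"
    using assms by (intro small_Sigma[OF universe]) (auto intro: small_Hom)
  have H: "fst p \<in> Ob T" "\<guillemotleft>snd p : fst p \<rightarrow> X\<guillemotright>" if "p \<in> ?H" for p
    using that assms by (auto simp: in_hom_def)
  obtain W \<kappa> where W: "is_coproduct T ?H fst W \<kappa>"
    by (rule coproduct_exists[OF small H(1)]) (assumption, rule that)
  obtain w where w: "\<guillemotleft>w : W \<rightarrow> X\<guillemotright>" "\<And>p. p \<in> ?H \<Longrightarrow> w \<cdot> \<kappa> p = snd p"
    by (rule copair_exists[OF W X H(2)]) (assumption, rule that)
  have 1: "w \<cdot> \<kappa> (S, h) = h" "\<guillemotleft>\<kappa> (S, h) : S \<rightarrow> W\<guillemotright>" if "S \<in> \<S>" "\<guillemotleft>h : S \<rightarrow> X\<guillemotright>" for S h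
    using w(2)[of "(S, h)"] is_coproductD(2)[OF W, of "(S, h)"] that by (auto dest: in_homD(6))
  then show ?thesis
    using that[OF W w(1)] by blast
qed

definition surjective_on where
  "surjective_on \<S> f \<longleftrightarrow> (\<forall>S\<in>\<S>. \<forall>h. \<guillemotleft>h : S \<rightarrow> cod f\<guillemotright> \<longrightarrow> (\<exists>k. \<guillemotleft>k : S \<rightarrow> dom f\<guillemotright> \<and> f \<cdot> k = h))"

definition generating where
  "generating \<S> \<longleftrightarrow> (\<forall>X\<in>Ob T. (\<forall>S\<in>\<S>. \<forall>h. \<guillemotleft>h : S \<rightarrow> X\<guillemotright> \<longrightarrow> h = Zero T S X) \<longrightarrow> is_zero_object T X)"

definition perfect where
  "perfect \<S> \<longleftrightarrow> (\<forall>(I :: 'u set) X Y f P \<iota> Q \<kappa> m. small TYPE('u) I \<longrightarrow>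
     (\<forall>i\<in>I. \<guillemotleft>f i : X i \<rightarrow> Y i\<guillemotright> \<and> surjective_on \<S> (f i)) \<longrightarrow> is_coproduct T I X P \<iota> \<longrightarrow> is_coproduct T I Y Q \<kappa> \<longrightarrow>
     \<guillemotleft>m : P \<rightarrow> Q\<guillemotright> \<longrightarrow> (\<forall>i\<in>I. m \<cdot> \<iota> i = \<kappa> i \<cdot> f i) \<longrightarrow> surjective_on \<S> m)"

lemma surjective_onD:
  assumes "surjective_on \<S> p" "\<guillemotleft>p : P \<rightarrow> X\<guillemotright>" "x \<in> \<S>" "\<guillemotleft>h : x \<rightarrow> X\<guillemotright>"
  obtains k where "\<guillemotleft>k : x \<rightarrow> P\<guillemotright>" "p \<cdot> k = h"
  using assms in_homD(2,3)[OF assms(2)] unfolding surjective_on_def by metis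

lemma surjective_onI:
  assumes "\<guillemotleft>p : P \<rightarrow> X\<guillemotright>" "\<And>x h. x \<in> \<S> \<Longrightarrow> \<guillemotleft>h : x \<rightarrow> X\<guillemotright> \<Longrightarrow> \<exists>k. \<guillemotleft>k : x \<rightarrow> P\<guillemotright> \<and> p \<cdot> k = h"
  shows "surjective_on \<S> p"
  using assms(2) in_homD(2,3)[OF assms(1)] unfolding surjective_on_def by metis

lemma perfectD:
  assumes "perfect \<S>" and "small TYPE('u) (I :: 'u set)" and "\<And>i. i \<in> I \<Longrightarrow> \<guillemotleft>f i : X i \<rightarrow> Y i\<guillemotright>"
    and "is_coproduct T I X P \<iota>" and "is_coproduct T I Y Q \<kappa>" and "\<guillemotleft>m : P \<rightarrow> Q\<guillemotright>"
    and "\<And>i. i \<in> I \<Longrightarrow> m \<cdot> \<iota> i = \<kappa> i \<cdot> f i" and "\<And>i. i \<in> I \<Longrightarrow> surjective_on \<S> (f i)"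
  shows "surjective_on \<S> m"
  using assms(1)[unfolded perfect_def, rule_format, OF assms(2) _ assms(4-6)] assms(3,7,8) by blast

text \<open>
  That the generators lie in \<open>T\<^sup>\<alpha>\<close> is where their perfection and the definition of \<open>T\<^sup>\<alpha>\<close> meet.
  Given \<open>g : S \<rightarrow> \<Coprod>\<^sub>i X\<^sub>i\<close>, cover every \<open>X\<^sub>i\<close> by a coproduct \<open>W\<^sub>i\<close> of generators. By perfection \<open>g\<close> lifts to
  \<open>\<Coprod>\<^sub>i W\<^sub>i\<close>, which is a coproduct of generators, and smallness of \<open>S\<close> leaves fewer than \<open>\<alpha>\<close> of them. Grouped by
  \<open>i\<close>, these form coproducts \<open>Z\<^sub>i\<close> of fewer than \<open>\<alpha>\<close> generators through which \<open>g\<close> factors.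
\<close>

lemma generators:
  obtains \<S> where "small TYPE('u) \<S>" "\<S> \<subseteq> A" "generating \<S>" "perfect \<S>"
proof -
  obtain \<S> where \<S>: "small TYPE('u) \<S>" "\<And>S. S \<in> \<S> \<Longrightarrow> alpha_small \<alpha> T S"
    and zero: "\<And>X. X \<in> Ob T \<Longrightarrow> is_zero_object T X \<longleftrightarrow> (\<forall>S\<in>\<S>. Hom T S X = {Zero T S X})"
    and perf: "\<forall>(I :: 'u set) X Y f P \<iota> Q \<kappa> m.
           small TYPE('u) I \<longrightarrow> (\<forall>i\<in>I. f i \<in> Hom T (X i) (Y i)) \<longrightarrow>
           is_coproduct T I X P \<iota> \<longrightarrow> is_coproduct T I Y Q \<kappa> \<longrightarrow>
           is_coproduct_map T I P \<iota> Q \<kappa> f m \<longrightarrow>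
           (\<forall>S\<in>\<S>. \<forall>i\<in>I. hom_surjective T S (X i) (Y i) (f i)) \<longrightarrow>
           (\<forall>S\<in>\<S>. hom_surjective T S P Q m)"
    using generated unfolding alpha_compactly_generated_def by (elim exE conjE) (rule that, blast+)
  have \<S>_Ob: "S \<in> Ob T" if "S \<in> \<S>" for S
    using \<S>(2)[OF that] unfolding alpha_small_iff by blast
  have surj_iff: "hom_surjective T S X Y f \<longleftrightarrow> (\<forall>h. \<guillemotleft>h : S \<rightarrow> Y\<guillemotright> \<longrightarrow> (\<exists>k. \<guillemotleft>k : S \<rightarrow> X\<guillemotright> \<and> f \<cdot> k = h))"
    if "S \<in> \<S>" "\<guillemotleft>f : X \<rightarrow> Y\<guillemotright>" for S X Y f
  proof -
    have Hom: "h \<in> Hom T S X \<longleftrightarrow> \<guillemotleft>h : S \<rightarrow> X\<guillemotright>" "h \<in> Hom T S Y \<longleftrightarrow> \<guillemotleft>h : S \<rightarrow> Y\<guillemotright>" for h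
      using \<S>_Ob[OF that(1)] in_homD(4,5)[OF that(2)] by (auto simp: Hom_iff)
    have "(\<lambda>h. f \<cdot> h) ` Hom T S X \<subseteq> Hom T S Y"
      using comp_in_hom[OF that(2)] by (auto simp: Hom)
    then show ?thesis
      unfolding hom_surjective_def using Hom by (auto simp: set_eq_iff image_iff) metis+
  qed
  have surj: "\<exists>k. \<guillemotleft>k : S \<rightarrow> P\<guillemotright> \<and> m \<cdot> k = h"
    if I: "small TYPE('u) I" and f: "\<And>i. i \<in> I \<Longrightarrow> \<guillemotleft>f i : X i \<rightarrow> Y i\<guillemotright>"
      and P: "is_coproduct T I X P \<iota>" and Q: "is_coproduct T I Y Q \<kappa>" and m: "\<guillemotleft>m : P \<rightarrow> Q\<guillemotright>"
       "\<And>i. i \<in> I \<Longrightarrow> m \<cdot> \<iota> i = \<kappa> i \<cdot> f i"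
      and lift: "\<And>S i h. S \<in> \<S> \<Longrightarrow> i \<in> I \<Longrightarrow> \<guillemotleft>h : S \<rightarrow> Y i\<guillemotright> \<Longrightarrow> \<exists>k. \<guillemotleft>k : S \<rightarrow> X i\<guillemotright> \<and> f i \<cdot> k = h"
      and h: "S \<in> \<S>" "\<guillemotleft>h : S \<rightarrow> Q\<guillemotright>"
    for I :: "'u set" and X Y f P \<iota> Q \<kappa> m S h
  proof -
    have "is_coproduct_map T I P \<iota> Q \<kappa> f m"
      using m in_homD(6)[OF m(1)] by (auto simp: is_coproduct_map_def)
    moreover have "\<forall>i\<in>I. f i \<in> Hom T (X i) (Y i)"
      using in_homD(6)[OF f] by blast
    moreover have "\<forall>S\<in>\<S>. \<forall>i\<in>I. hom_surjective T S (X i) (Y i) (f i)"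
      using surj_iff f lift by blast
    ultimately have "hom_surjective T S P Q m"
      using perf[rule_format, OF I _ P Q] h(1) by blast
    then show ?thesis
      using surj_iff[OF h(1) m(1)] h(2) by blast
  qed
  have "\<S> \<subseteq> A"
  proof (rule A_criterion)
    show "alpha_small \<alpha> T S" if "S \<in> \<S>" for S
      using \<S>(2)[OF that] .
    fix S and I :: "'u set" and X Q \<iota> g
    assume S: "S \<in> \<S>" and I: "small TYPE('u) I" and Q: "is_coproduct T I X Q \<iota>" and g: "\<guillemotleft>g : S \<rightarrow> Q\<guillemotright>"
    let ?K = "\<lambda>i. Sigma \<S> (\<lambda>S. Hom T S (X i))"
    have "\<exists>W \<kappa> w. is_coproduct T (?K i) fst W \<kappa> \<and> \<guillemotleft>w : W \<rightarrow> X i\<guillemotright> \<and> (\<forall>p\<in>?K i. w \<cdot> \<kappa> p = snd p) \<and>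
        (\<forall>S h. S \<in> \<S> \<longrightarrow> \<guillemotleft>h : S \<rightarrow> X i\<guillemotright> \<longrightarrow> (\<exists>k. \<guillemotleft>k : S \<rightarrow> W\<guillemotright> \<and> w \<cdot> k = h))" if i: "i \<in> I" for i
    proof -
      have Xi: "X i \<in> Ob T"
        using is_coproductD(3)[OF Q i] .
      have "\<S> \<subseteq> Ob T" using \<S>_Ob by blast
      then obtain W \<kappa> w where W: "is_coproduct T (?K i) fst W \<kappa>" "\<guillemotleft>w : W \<rightarrow> X i\<guillemotright>"
          "\<And>S h. S \<in> \<S> \<Longrightarrow> \<guillemotleft>h : S \<rightarrow> X i\<guillemotright> \<Longrightarrow> w \<cdot> \<kappa> (S, h) = h"
          "\<And>S h. S \<in> \<S> \<Longrightarrow> \<guillemotleft>h : S \<rightarrow> X i\<guillemotright> \<Longrightarrow> \<exists>k. \<guillemotleft>k : S \<rightarrow> W\<guillemotright> \<and> w \<cdot> k = h"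
        by (rule precover[OF \<S>(1) _ Xi]) (rule that)
      moreover have "w \<cdot> \<kappa> p = snd p" if "p \<in> ?K i" for p
        using that W(3)[of "fst p" "snd p"] \<S>_Ob Xi by (auto simp: Hom_iff)
      ultimately show ?thesis
        by blast
    qed
    then have "\<forall>i\<in>I. \<exists>W \<kappa> w. is_coproduct T (?K i) fst W \<kappa> \<and> \<guillemotleft>w : W \<rightarrow> X i\<guillemotright> \<and> (\<forall>p\<in>?K i. w \<cdot> \<kappa> p = snd p) \<and>
        (\<forall>S h. S \<in> \<S> \<longrightarrow> \<guillemotleft>h : S \<rightarrow> X i\<guillemotright> \<longrightarrow> (\<exists>k. \<guillemotleft>k : S \<rightarrow> W\<guillemotright> \<and> w \<cdot> k = h))" ..
    then have "\<exists>W \<kappa> w. \<forall>i\<in>I. is_coproduct T (?K i) fst (W i) (\<kappa> i) \<and> \<guillemotleft>w i : W i \<rightarrow> X i\<guillemotright> \<and>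
        (\<forall>p\<in>?K i. w i \<cdot> \<kappa> i p = snd p) \<and>
        (\<forall>S h. S \<in> \<S> \<longrightarrow> \<guillemotleft>h : S \<rightarrow> X i\<guillemotright> \<longrightarrow> (\<exists>k. \<guillemotleft>k : S \<rightarrow> W i\<guillemotright> \<and> w i \<cdot> k = h))"
      unfolding bchoice_iff .
    then obtain W \<kappa> w where W: "\<And>i. i \<in> I \<Longrightarrow> is_coproduct T (?K i) fst (W i) (\<kappa> i)"
      and w: "\<And>i. i \<in> I \<Longrightarrow> \<guillemotleft>w i : W i \<rightarrow> X i\<guillemotright>" "\<And>i p. i \<in> I \<Longrightarrow> p \<in> ?K i \<Longrightarrow> w i \<cdot> \<kappa> i p = snd p"
        "\<And>i S h. i \<in> I \<Longrightarrow> S \<in> \<S> \<Longrightarrow> \<guillemotleft>h : S \<rightarrow> X i\<guillemotright> \<Longrightarrow> \<exists>k. \<guillemotleft>k : S \<rightarrow> W i\<guillemotright> \<and> w i \<cdot> k = h"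
      by (elim exE) (rule that, blast+)
    have IK: "small TYPE('u) (Sigma I ?K)"
      using \<S>(1) \<S>_Ob is_coproductD(3)[OF Q]
      by (intro small_Sigma[OF universe] I) (auto intro: small_Hom)
    have K: "fst p \<in> Ob T" "\<guillemotleft>snd p : fst p \<rightarrow> X i\<guillemotright>" if "i \<in> I" "p \<in> ?K i" for i p
      using that \<S>_Ob is_coproductD(3)[OF Q] by (auto simp: in_hom_def)
    obtain R \<rho> where R: "is_coproduct T (Sigma I ?K) (\<lambda>(i, p). fst p) R \<rho>"
      by (rule coproduct_exists[OF IK, of "\<lambda>(i, p). fst p"]) (use K in auto)
    have \<rho>: "\<guillemotleft>\<rho> (i, p) : fst p \<rightarrow> R\<guillemotright>" if "i \<in> I" "p \<in> ?K i" for i p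
      using is_coproductD(2)[OF R, of "(i, p)"] that by auto
    obtain l where l: "\<And>i. i \<in> I \<Longrightarrow> \<guillemotleft>l i : W i \<rightarrow> R\<guillemotright>" "\<And>i p. i \<in> I \<Longrightarrow> p \<in> ?K i \<Longrightarrow> l i \<cdot> \<kappa> i p = \<rho> (i, p)"
      by (rule copair_family[OF W, where Z = "\<lambda>_. R" and t = "\<lambda>i p. \<rho> (i, p)"])
        (assumption, rule \<rho>, assumption, assumption, rule is_coproductD(1)[OF R], rule that)
    have RW: "is_coproduct T I W R l"
      by (rule coproduct_of_coproducts[where \<kappa> = \<rho> and \<iota> = \<kappa> and K = ?K and X = "\<lambda>_. fst"])
        (use W R l in auto)
    obtain m where m: "\<guillemotleft>m : R \<rightarrow> Q\<guillemotright>" "\<And>i. i \<in> I \<Longrightarrow> m \<cdot> l i = \<iota> i \<cdot> w i"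
      using coproduct_map_exists[OF RW Q w(1)] by blast
    have "\<exists>t. \<guillemotleft>t : S \<rightarrow> R\<guillemotright> \<and> m \<cdot> t = g"
      using surj[OF I w(1) RW Q m(1) m(2) _ S g] w(3) by blast
    then obtain t where t: "\<guillemotleft>t : S \<rightarrow> R\<guillemotright>" "m \<cdot> t = g"
      by blast
    obtain J where J: "J \<subseteq> Sigma I ?K" "|J| <o \<alpha>" "supported (Sigma I ?K) (\<lambda>(i, p). fst p) R \<rho> J t"
      using alpha_smallD[OF \<S>(2)[OF S] IK R t(1)] .
    then obtain e where e: "coproduct_projection (Sigma I ?K) (\<lambda>(i, p). fst p) R \<rho> J e" "e \<cdot> t = t"
      unfolding supported_def by blast
    then have e_in: "\<guillemotleft>e : R \<rightarrow> R\<guillemotright>" and e\<rho>: "\<And>i p. i \<in> I \<Longrightarrow> p \<in> ?K i \<Longrightarrow>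
        e \<cdot> \<rho> (i, p) = (if (i, p) \<in> J then \<rho> (i, p) else Zero T (fst p) R)"
      by (auto simp: coproduct_projection_def)
    \<comment> \<open>The set \<open>J\<close> of remaining generators, grouped by \<open>i\<close>.\<close>
    define J' where "J' i = {p. (i, p) \<in> J}" for i
    have J'K: "J' i \<subseteq> ?K i" for i
      using J(1) unfolding J'_def by blast
    have J'_less: "|J' i| <o \<alpha>" for i
    proof -
      have "J' i \<subseteq> snd ` J"
        unfolding J'_def by force
      then show ?thesis
        using less_subset[OF less_image[OF J(2)]] by blast
    qed
    obtain Z k where Z: "\<And>i. i \<in> I \<Longrightarrow> is_coproduct T (J' i) fst (Z i) (k i)"
      by (rule coproduct_family_exists[of I J' "\<lambda>_. fst"])
        (assumption | rule that small_less[OF J'_less] K(1) subsetD[OF J'K])+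
    have "fst p \<in> coproduct_closure (\<S> \<union> A)" if "p \<in> J' i" for i p
      using subsetD[OF J'K that] by (auto intro: coproduct_closure.base)
    then have Z_cl: "Z i \<in> coproduct_closure (\<S> \<union> A)" if "i \<in> I" for i
      by (rule closure_coproduct[OF J'_less _ Z[OF that]])
    have k: "\<guillemotleft>k i p : fst p \<rightarrow> Z i\<guillemotright>" if "i \<in> I" "p \<in> J' i" for i p
      using is_coproductD(2)[OF Z[OF that(1)] that(2)] .
    obtain F where F: "\<And>i. i \<in> I \<Longrightarrow> \<guillemotleft>F i : Z i \<rightarrow> X i\<guillemotright>" "\<And>i p. i \<in> I \<Longrightarrow> p \<in> J' i \<Longrightarrow> F i \<cdot> k i p = snd p"
      by (rule copair_family[OF Z, where Z = X and t = "\<lambda>_. snd"])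
        (assumption | rule that K(2) subsetD[OF J'K] is_coproductD(3)[OF Q])+
    obtain N \<nu> where N: "is_coproduct T I Z N \<nu>"
      by (rule coproduct_exists[OF I, of Z]) (use is_coproductD(1)[OF Z] in auto)
    obtain M where M: "\<guillemotleft>M : N \<rightarrow> Q\<guillemotright>" "\<And>i. i \<in> I \<Longrightarrow> M \<cdot> \<nu> i = \<iota> i \<cdot> F i"
      using coproduct_map_exists[OF N Q F(1)] by blast
    have *: "\<guillemotleft>if p \<in> J' i then \<nu> i \<cdot> k i p else Zero T (fst p) N : fst p \<rightarrow> N\<guillemotright>" if "i \<in> I" "p \<in> ?K i" for i p
      using comp_in_hom[OF is_coproductD(2)[OF N that(1)] k[OF that(1)]] zero_in_hom[OF K(1)[OF that] is_coproductD(1)[OF N]]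
      by auto
    have "\<guillemotleft>case q of (i, p) \<Rightarrow> if p \<in> J' i then \<nu> i \<cdot> k i p else Zero T (fst p) N : case q of (i, p) \<Rightarrow> fst p \<rightarrow> N\<guillemotright>"
      if q: "q \<in> Sigma I ?K" for q
    proof -
      obtain i p where "q = (i, p)" "i \<in> I" "p \<in> ?K i"
        using q by blast
      then show ?thesis
        using *[of i p] by (simp only: prod.case)
    qed
    then obtain n where n: "\<guillemotleft>n : R \<rightarrow> N\<guillemotright>" "\<And>q. q \<in> Sigma I ?K \<Longrightarrow>
        n \<cdot> \<rho> q = (case q of (i, p) \<Rightarrow> if p \<in> J' i then \<nu> i \<cdot> k i p else Zero T (fst p) N)"
      by (rule copair_exists[OF R is_coproductD(1)[OF N]]) (assumption, rule that)
    have n: "\<guillemotleft>n : R \<rightarrow> N\<guillemotright>" "\<And>i p. i \<in> I \<Longrightarrow> p \<in> ?K i \<Longrightarrow>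
        n \<cdot> \<rho> (i, p) = (if p \<in> J' i then \<nu> i \<cdot> k i p else Zero T (fst p) N)"
      using n(1) n(2)[of "(_, _)"] by auto
    note [simp] = in_homD(1-5)[OF M(1)] in_homD(1-5)[OF n(1)] in_homD(1-5)[OF m(1)] in_homD(1-5)[OF e_in]
      in_homD(1-5)[OF t(1)] in_homD(1-3)[OF F(1)] in_homD(1-3)[OF k] in_homD(1-3)[OF l(1)]  in_homD(1-3)[OF w(1)]
      in_homD(1-4)[OF is_coproductD(2)[OF N]] in_homD(1-4)[OF is_coproductD(2)[OF Q]]
      in_homD(1-3)[OF is_coproductD(2)[OF W]] in_homD(1-3)[OF \<rho>]
    \<comment> \<open>\<open>n\<close> projects \<open>R\<close> to the summands in \<open>J\<close>, which \<open>e\<close> does as an endomorphism of \<open>R\<close>.\<close>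
    have "M \<cdot> n = m \<cdot> e"
    proof (rule coproduct_ext[OF R])
      fix q assume "q \<in> Sigma I ?K"
      then obtain i p where ip: "i \<in> I" "p \<in> ?K i" and q: "q = (i, p)"
        by blast
      note [simp] = in_homD(1-5)[OF \<rho>[OF ip]]
      show "(M \<cdot> n) \<cdot> \<rho> q = (m \<cdot> e) \<cdot> \<rho> q"
      proof (cases "p \<in> J' i")
        case True
        have "(M \<cdot> n) \<cdot> \<rho> q = (M \<cdot> \<nu> i) \<cdot> k i p"
          using True ip(1) n(2)[OF ip] by (simp add: q comp_assoc del: ip)
        also have "\<dots> = \<iota> i \<cdot> snd p"
          using True ip(1) by (simp add: M(2) F(2) comp_assoc)
        also have "\<dots> = (m \<cdot> l i) \<cdot> \<kappa> i p"
          using ip(1) w(2)[OF ip] in_homD(1-3)[OF is_coproductD(2)[OF W[OF ip(1)] ip(2)]] by (simp add: m(2) comp_assoc)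
        also have "\<dots> = m \<cdot> \<rho> q"
          using ip(1) l(2)[OF ip] in_homD(1-3)[OF is_coproductD(2)[OF W[OF ip(1)] ip(2)]] by (simp add: q comp_assoc)
        also have "\<dots> = (m \<cdot> e) \<cdot> \<rho> q"
          using True e\<rho>[OF ip] by (simp add: q J'_def comp_assoc)
        finally show ?thesis .
      next
        case False
        then show ?thesis
          using n(2)[OF ip] e\<rho>[OF ip] by (simp add: q J'_def comp_assoc)
      qed
    qed (auto simp: in_hom_iff)
    then have "g = M \<cdot> (n \<cdot> t)"
      by (simp add: comp_assoc e(2) t(2) flip: comp_assoc[of t n M])
    then show "covered (coproduct_closure (\<S> \<union> A)) I X Q \<iota> S g"
      using Z_cl M(2) comp_in_hom[OF n(1) t(1)] by (intro coveredI[OF _ F(1) N M(1)]) auto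
  qed
  moreover have "generating \<S>"
    unfolding generating_def
  proof (intro ballI impI)
    fix X assume X: "X \<in> Ob T" and h: "\<forall>S\<in>\<S>. \<forall>h. \<guillemotleft>h : S \<rightarrow> X\<guillemotright> \<longrightarrow> h = Zero T S X"
    have "Hom T S X = {Zero T S X}" if S: "S \<in> \<S>" for S
    proof -
      have "f = Zero T S X" if "f \<in> Hom T S X" for f
        using h S in_homI[OF \<S>_Ob[OF S] X that] by blast
      then show ?thesis
        using in_homD(6)[OF zero_in_hom[OF \<S>_Ob[OF S] X]] by blast
    qed
    then show "is_zero_object T X"
      using zero[OF X] by blast
  qed
  moreover have "perfect \<S>"
    unfolding perfect_def
  proof (intro allI impI)
    fix I :: "'u set" and X Y f P \<iota> Q \<kappa> m
    assume I: "small TYPE('u) I" and f: "\<forall>i\<in>I. \<guillemotleft>f i : X i \<rightarrow> Y i\<guillemotright> \<and> surjective_on \<S> (f i)"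
      and P: "is_coproduct T I X P \<iota>" and Q: "is_coproduct T I Y Q \<kappa>" and m: "\<guillemotleft>m : P \<rightarrow> Q\<guillemotright>"
       "\<forall>i\<in>I. m \<cdot> \<iota> i = \<kappa> i \<cdot> f i"
    show "surjective_on \<S> m"
    proof (rule surjective_onI[OF m(1)])
      show "\<exists>k. \<guillemotleft>k : S \<rightarrow> P\<guillemotright> \<and> m \<cdot> k = h" if S: "S \<in> \<S>" "\<guillemotleft>h : S \<rightarrow> Q\<guillemotright>" for S h
      proof (rule surj[OF I _ P Q m(1) _ _ S])
        show "\<exists>k. \<guillemotleft>k : S \<rightarrow> X i\<guillemotright> \<and> f i \<cdot> k = h" if "S \<in> \<S>" "i \<in> I" "\<guillemotleft>h : S \<rightarrow> Y i\<guillemotright>" for S i h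
          by (rule surjective_onD[of \<S> "f i" "X i" "Y i" S h]) (use f that in blast)+
      qed (use f m(2) in auto)
    qed
  qed
  ultimately show ?thesis
    using that \<S>(1) by blast
qed

section \<open>Solution sets for maps out of \<open>T\<^sup>\<alpha>\<close>\<close>

text \<open>
  The maps from \<open>T\<^sup>\<alpha>\<close> to \<open>X\<close> may start at a proper class of objects. The set \<open>\<G>\<close> makes them accessible to
  small coproducts: a coproduct of members of \<open>\<G>\<close> covers \<open>X\<close> as well as one over all of \<open>T\<^sup>\<alpha>\<close> would.
\<close>

definition approximable where
  "approximable X \<longleftrightarrow> X \<in> Ob T \<and> (\<exists>\<G>. small TYPE('u) \<G> \<and> \<G> \<subseteq> A \<and>
     (\<forall>x\<in>A. \<forall>f. \<guillemotleft>f : x \<rightarrow> X\<guillemotright> \<longrightarrow> (\<exists>G\<in>\<G>. \<exists>u v. \<guillemotleft>u : x \<rightarrow> G\<guillemotright> \<and> \<guillemotleft>v : G \<rightarrow> X\<guillemotright> \<and> f = v \<cdot> u)))"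

lemma approximableI:
  assumes "X \<in> Ob T" "small TYPE('u) \<G>" "\<G> \<subseteq> A"
    and "\<And>x f. x \<in> A \<Longrightarrow> \<guillemotleft>f : x \<rightarrow> X\<guillemotright> \<Longrightarrow> \<exists>G\<in>\<G>. \<exists>u v. \<guillemotleft>u : x \<rightarrow> G\<guillemotright> \<and> \<guillemotleft>v : G \<rightarrow> X\<guillemotright> \<and> f = v \<cdot> u"
  shows "approximable X"
  unfolding approximable_def using assms by blast

lemma approximableE:
  assumes "approximable X"
  obtains \<G> where "X \<in> Ob T" "small TYPE('u) \<G>" "\<G> \<subseteq> A"
    "\<And>x f. x \<in> A \<Longrightarrow> \<guillemotleft>f : x \<rightarrow> X\<guillemotright> \<Longrightarrow> \<exists>G\<in>\<G>. \<exists>u v. \<guillemotleft>u : x \<rightarrow> G\<guillemotright> \<and> \<guillemotleft>v : G \<rightarrow> X\<guillemotright> \<and> f = v \<cdot> u"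
  using assms unfolding approximable_def by blast

lemma approximable_A:
  assumes "S \<in> A" shows "approximable S"
proof (rule approximableI[of _ "{S}"])
  show "S \<in> Ob T" using A_Ob[OF assms] .
  show "small TYPE('u) {S}" "{S} \<subseteq> A"
    using assms by (simp_all add: small_finite[OF universe])
  fix x f assume "\<guillemotleft>f : x \<rightarrow> S\<guillemotright>"
  then show "\<exists>G\<in>{S}. \<exists>u v. \<guillemotleft>u : x \<rightarrow> G\<guillemotright> \<and> \<guillemotleft>v : G \<rightarrow> S\<guillemotright> \<and> f = v \<cdot> u"
    by (intro bexI[of _ S] exI[of _ f] exI[of _ "Idt T S"]) (auto simp: in_hom_iff)
qed

lemma approximable_retract:
  assumes Y: "approximable Y" and s: "\<guillemotleft>s : X \<rightarrow> Y\<guillemotright>" and r: "\<guillemotleft>r : Y \<rightarrow> X\<guillemotright>" and rs: "r \<cdot> s = Idt T X"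
  shows "approximable X"
proof -
  obtain \<G> where G: "small TYPE('u) \<G>" "\<G> \<subseteq> A"
    "\<And>x f. x \<in> A \<Longrightarrow> \<guillemotleft>f : x \<rightarrow> Y\<guillemotright> \<Longrightarrow> \<exists>G\<in>\<G>. \<exists>u v. \<guillemotleft>u : x \<rightarrow> G\<guillemotright> \<and> \<guillemotleft>v : G \<rightarrow> Y\<guillemotright> \<and> f = v \<cdot> u"
    by (rule approximableE[OF Y]) (rule that)
  show ?thesis
  proof (rule approximableI[OF _ G(1,2)])
    show "X \<in> Ob T" using in_homD(4)[OF s] .
    fix x f assume x: "x \<in> A" and f: "\<guillemotleft>f : x \<rightarrow> X\<guillemotright>"
    obtain G u v where uv: "G \<in> \<G>" "\<guillemotleft>u : x \<rightarrow> G\<guillemotright>" "\<guillemotleft>v : G \<rightarrow> Y\<guillemotright>" "s \<cdot> f = v \<cdot> u"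
      using G(3)[OF x comp_in_hom[OF s f]] by blast
    note [simp] = in_homD(1-5)[OF s] in_homD(1-5)[OF r] in_homD(1-5)[OF f] in_homD(1-5)[OF uv(2)] in_homD(1-5)[OF uv(3)]
    have "f = (r \<cdot> s) \<cdot> f"
      by (simp add: rs)
    then have "f = (r \<cdot> v) \<cdot> u"
      by (simp add: comp_assoc uv(4))
    then show "\<exists>G\<in>\<G>. \<exists>u v. \<guillemotleft>u : x \<rightarrow> G\<guillemotright> \<and> \<guillemotleft>v : G \<rightarrow> X\<guillemotright> \<and> f = v \<cdot> u"
      using uv comp_in_hom[OF r uv(3)] by blast
  qed
qed

lemma approximable_ShO:
  assumes X: "approximable X" shows "approximable (ShO T X)"
proof -
  obtain \<G> where X: "X \<in> Ob T" and G: "small TYPE('u) \<G>" "\<G> \<subseteq> A"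
    "\<And>x f. x \<in> A \<Longrightarrow> \<guillemotleft>f : x \<rightarrow> X\<guillemotright> \<Longrightarrow> \<exists>G\<in>\<G>. \<exists>u v. \<guillemotleft>u : x \<rightarrow> G\<guillemotright> \<and> \<guillemotleft>v : G \<rightarrow> X\<guillemotright> \<and> f = v \<cdot> u"
    by (rule approximableE[OF X]) (rule that)
  show ?thesis
  proof (rule approximableI[of _ "ShO T ` \<G>"])
    show "ShO T X \<in> Ob T" "small TYPE('u) (ShO T ` \<G>)" "ShO T ` \<G> \<subseteq> A"
      using X G A_ShO by (auto simp: small_image)
    fix x f assume x: "x \<in> A" and f: "\<guillemotleft>f : x \<rightarrow> ShO T X\<guillemotright>"
    obtain x' d c where x': "x' \<in> A" "\<guillemotleft>d : ShO T x' \<rightarrow> x\<guillemotright>" "\<guillemotleft>c : x \<rightarrow> ShO T x'\<guillemotright>" "d \<cdot> c = Idt T x"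
      using A_desuspension[OF x] by blast
    obtain f' where f': "\<guillemotleft>f' : x' \<rightarrow> X\<guillemotright>" "ShA T f' = f \<cdot> d"
      using ShA_full[OF comp_in_hom[OF f x'(2)] A_Ob[OF x'(1)] X] .
    obtain G u v where uv: "G \<in> \<G>" "\<guillemotleft>u : x' \<rightarrow> G\<guillemotright>" "\<guillemotleft>v : G \<rightarrow> X\<guillemotright>" "f' = v \<cdot> u"
      using G(3)[OF x'(1) f'(1)] by blast
    note [simp] = in_homD(1-5)[OF x'(2)] in_homD(1-5)[OF x'(3)] in_homD(1-5)[OF f]
      in_homD(1-5)[OF uv(2)] in_homD(1-5)[OF uv(3)]
    have "f = (f \<cdot> d) \<cdot> c"
      by (simp add: comp_assoc x'(4))
    also have "\<dots> = ShA T v \<cdot> (ShA T u \<cdot> c)"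
      by (simp add: comp_assoc uv(4) flip: f'(2))
    finally show "\<exists>G\<in>ShO T ` \<G>. \<exists>u v. \<guillemotleft>u : x \<rightarrow> G\<guillemotright> \<and> \<guillemotleft>v : G \<rightarrow> ShO T X\<guillemotright> \<and> f = v \<cdot> u"
      using uv(1) comp_in_hom[OF ShA_in_hom[OF uv(2)] x'(3)] ShA_in_hom[OF uv(3)] by blast
  qed
qed

lemma approximable_ShO_D:
  assumes SX: "approximable (ShO T X)" and X: "X \<in> Ob T" shows "approximable X"
proof -
  obtain \<G> where G: "small TYPE('u) \<G>" "\<G> \<subseteq> A"
    "\<And>x f. x \<in> A \<Longrightarrow> \<guillemotleft>f : x \<rightarrow> ShO T X\<guillemotright> \<Longrightarrow> \<exists>G\<in>\<G>. \<exists>u v. \<guillemotleft>u : x \<rightarrow> G\<guillemotright> \<and> \<guillemotleft>v : G \<rightarrow> ShO T X\<guillemotright> \<and> f = v \<cdot> u"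
    by (rule approximableE[OF SX]) (rule that)
  have "\<exists>\<G>'\<subseteq>A. small TYPE('u) \<G>' \<and> (\<forall>G\<in>\<G>. \<exists>G'\<in>\<G>'. \<exists>d c. \<guillemotleft>d : ShO T G' \<rightarrow> G\<guillemotright> \<and> \<guillemotleft>c : G \<rightarrow> ShO T G'\<guillemotright> \<and> d \<cdot> c = Idt T G)"
  proof (rule small_choice[OF G(1)])
    fix G assume "G \<in> \<G>"
    then have "G \<in> A"
      using G(2) by blast
    then show "\<exists>G'. G' \<in> A \<and> (\<exists>d c. \<guillemotleft>d : ShO T G' \<rightarrow> G\<guillemotright> \<and> \<guillemotleft>c : G \<rightarrow> ShO T G'\<guillemotright> \<and> d \<cdot> c = Idt T G)"
      by (rule A_desuspension) blast
  qed
  then obtain \<G>' where G': "\<G>' \<subseteq> A" "small TYPE('u) \<G>'"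
    "\<And>G. G \<in> \<G> \<Longrightarrow> \<exists>G'\<in>\<G>'. \<exists>d c. \<guillemotleft>d : ShO T G' \<rightarrow> G\<guillemotright> \<and> \<guillemotleft>c : G \<rightarrow> ShO T G'\<guillemotright> \<and> d \<cdot> c = Idt T G"
    by blast
  show ?thesis
  proof (rule approximableI[OF X G'(2,1)])
    fix x f assume x: "x \<in> A" and f: "\<guillemotleft>f : x \<rightarrow> X\<guillemotright>"
    obtain G u v where uv: "G \<in> \<G>" "\<guillemotleft>u : ShO T x \<rightarrow> G\<guillemotright>" "\<guillemotleft>v : G \<rightarrow> ShO T X\<guillemotright>" "ShA T f = v \<cdot> u"
      using G(3)[OF A_ShO[OF x] ShA_in_hom[OF f]] by blast
    obtain G' d c where dc: "G' \<in> \<G>'" "\<guillemotleft>d : ShO T G' \<rightarrow> G\<guillemotright>" "\<guillemotleft>c : G \<rightarrow> ShO T G'\<guillemotright>" "d \<cdot> c = Idt T G"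
      using G'(3)[OF uv(1)] by blast
    have G'_Ob: "G' \<in> Ob T"
      using dc(1) G'(1) A_Ob by blast
    obtain u' where u': "\<guillemotleft>u' : x \<rightarrow> G'\<guillemotright>" "ShA T u' = c \<cdot> u"
      using ShA_full[OF comp_in_hom[OF dc(3) uv(2)] A_Ob[OF x] G'_Ob] .
    obtain v' where v': "\<guillemotleft>v' : G' \<rightarrow> X\<guillemotright>" "ShA T v' = v \<cdot> d"
      using ShA_full[OF comp_in_hom[OF uv(3) dc(2)] G'_Ob X] .
    note [simp] = in_homD(1-5)[OF dc(2)] in_homD(1-5)[OF dc(3)] in_homD(1-5)[OF u'(1)] in_homD(1-5)[OF v'(1)]
      in_homD(1-5)[OF uv(2)] in_homD(1-5)[OF uv(3)]
    have "v \<cdot> u = v \<cdot> ((d \<cdot> c) \<cdot> u)"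
      by (simp add: dc(4))
    then have "ShA T f = ShA T (v' \<cdot> u')"
      by (simp add: uv(4) u'(2) v'(2) comp_assoc)
    then have "f = v' \<cdot> u'"
      by (rule ShA_eqD[OF _ f comp_in_hom[OF v'(1) u'(1)]])
    then show "\<exists>G\<in>\<G>'. \<exists>u v. \<guillemotleft>u : x \<rightarrow> G\<guillemotright> \<and> \<guillemotleft>v : G \<rightarrow> X\<guillemotright> \<and> f = v \<cdot> u"
      using dc(1) u'(1) v'(1) by blast
  qed
qed

text \<open>
  A map from \<open>T\<^sup>\<alpha>\<close> to \<open>\<Coprod>\<^sub>i X\<^sub>i\<close> factors through some \<open>\<Coprod>\<^sub>i Y\<^sub>i\<close> with \<open>Y\<^sub>i\<close> in \<open>T\<^sup>\<alpha>\<close>, hence through a coproduct of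
  members \<open>G\<^sub>i\<close> of the solution sets, of which fewer than \<open>\<alpha>\<close> matter. The ways to choose them form a small set.
\<close>

lemma approximable_coproduct:
  fixes I :: "'u set"
  assumes I: "small TYPE('u) I" and Q: "is_coproduct T I X Q \<iota>" and X: "\<And>i. i \<in> I \<Longrightarrow> approximable (X i)"
  shows "approximable Q"
proof -
  have "\<forall>i\<in>I. \<exists>\<G>. small TYPE('u) \<G> \<and> \<G> \<subseteq> A \<and>
     (\<forall>x\<in>A. \<forall>f. \<guillemotleft>f : x \<rightarrow> X i\<guillemotright> \<longrightarrow> (\<exists>G\<in>\<G>. \<exists>u v. \<guillemotleft>u : x \<rightarrow> G\<guillemotright> \<and> \<guillemotleft>v : G \<rightarrow> X i\<guillemotright> \<and> f = v \<cdot> u))"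
    using X unfolding approximable_def by blast
  then obtain \<G> where \<G>: "\<forall>i\<in>I. small TYPE('u) (\<G> i) \<and> \<G> i \<subseteq> A \<and>
     (\<forall>x\<in>A. \<forall>f. \<guillemotleft>f : x \<rightarrow> X i\<guillemotright> \<longrightarrow> (\<exists>G\<in>\<G> i. \<exists>u v. \<guillemotleft>u : x \<rightarrow> G\<guillemotright> \<and> \<guillemotleft>v : G \<rightarrow> X i\<guillemotright> \<and> f = v \<cdot> u))"
    unfolding bchoice_iff by (elim exE)
  define \<Omega> where "\<Omega> = {p \<in> Sigma (Pow I) (\<lambda>J. PiE J \<G>). |fst p| <o \<alpha>}"
  have small: "small TYPE('u) \<Omega>"
  proof (rule small_subset)
    show "small TYPE('u) (Sigma (Pow I) (\<lambda>J. PiE J \<G>))"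
    proof (intro small_Sigma[OF universe] small_PiE[OF universe] small_Pow[OF universe] I)
      show "small TYPE('u) J" if "J \<in> Pow I" for J
        using small_subset[OF I] that by blast
      show "small TYPE('u) (\<G> i)" if "J \<in> Pow I" "i \<in> J" for J i
        using \<G> that by blast
    qed
  qed (auto simp: \<Omega>_def)
  have "\<exists>\<B>\<subseteq>A. small TYPE('u) \<B> \<and> (\<forall>p\<in>\<Omega>. \<exists>R\<in>\<B>. \<exists>\<sigma>. is_coproduct T (fst p) (snd p) R \<sigma>)"
  proof (rule small_choice[OF small])
    fix p assume "p \<in> \<Omega>"
    then have p: "fst p \<subseteq> I" "|fst p| <o \<alpha>" "snd p \<in> PiE (fst p) \<G>"
      by (auto simp: \<Omega>_def)
    have GA: "snd p i \<in> A" if "i \<in> fst p" for i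
      using p \<G> that PiE_mem[OF p(3) that] by blast
    obtain R \<sigma> where R: "is_coproduct T (fst p) (snd p) R \<sigma>"
      by (rule coproduct_exists[OF small_less[OF p(2)] A_Ob[OF GA]]) (assumption, rule that)
    then show "\<exists>R. R \<in> A \<and> (\<exists>\<sigma>. is_coproduct T (fst p) (snd p) R \<sigma>)"
      using A_coproduct[OF p(2) GA R] by blast
  qed
  then obtain \<B> where \<B>: "\<B> \<subseteq> A" "small TYPE('u) \<B>" "\<And>p. p \<in> \<Omega> \<Longrightarrow> \<exists>R\<in>\<B>. \<exists>\<sigma>. is_coproduct T (fst p) (snd p) R \<sigma>"
    by blast
  show ?thesis
  proof (rule approximableI[OF is_coproductD(1)[OF Q] \<B>(2,1)])
    fix x g assume x: "x \<in> A" and g: "\<guillemotleft>g : x \<rightarrow> Q\<guillemotright>"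
    obtain Y f N \<kappa> m h where F: "factorisation A I X Q \<iota> x g Y f N \<kappa> m h"
      using A_covered[OF x I Q g] unfolding covered_def by blast
    note Y = factorisationD(1)[OF F] and f = factorisationD(2)[OF F] and N = factorisationD(3)[OF F]
      and m = factorisationD(4,5)[OF F] and h = factorisationD(6)[OF F] and gmh = factorisationD(7)[OF F]
    have "\<forall>i\<in>I. \<exists>G u v. G \<in> \<G> i \<and> \<guillemotleft>u : Y i \<rightarrow> G\<guillemotright> \<and> \<guillemotleft>v : G \<rightarrow> X i\<guillemotright> \<and> f i = v \<cdot> u"
      using \<G> Y f by blast
    then obtain G u v where Guv: "\<forall>i\<in>I. G i \<in> \<G> i \<and> \<guillemotleft>u i : Y i \<rightarrow> G i\<guillemotright> \<and> \<guillemotleft>v i : G i \<rightarrow> X i\<guillemotright> \<and> f i = v i \<cdot> u i"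
      unfolding bchoice_iff by (elim exE)
    then have u: "\<And>i. i \<in> I \<Longrightarrow> \<guillemotleft>u i : Y i \<rightarrow> G i\<guillemotright>" and v: "\<And>i. i \<in> I \<Longrightarrow> \<guillemotleft>v i : G i \<rightarrow> X i\<guillemotright>"
      and fvu: "\<And>i. i \<in> I \<Longrightarrow> f i = v i \<cdot> u i"
      by auto
    have G_Ob: "G i \<in> Ob T" if "i \<in> I" for i
      using in_homD(5)[OF u[OF that]] .
    obtain N' \<kappa>' where N': "is_coproduct T I G N' \<kappa>'"
      by (rule coproduct_exists[OF I G_Ob]) (assumption, rule that)
    obtain U where U: "\<guillemotleft>U : N \<rightarrow> N'\<guillemotright>" "\<And>i. i \<in> I \<Longrightarrow> U \<cdot> \<kappa> i = \<kappa>' i \<cdot> u i"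
      using coproduct_map_exists[OF N N' u] by blast
    obtain V where V: "\<guillemotleft>V : N' \<rightarrow> Q\<guillemotright>" "\<And>i. i \<in> I \<Longrightarrow> V \<cdot> \<kappa>' i = \<iota> i \<cdot> v i"
      using coproduct_map_exists[OF N' Q v] by blast
    note [simp] = in_homD(1-5)[OF U(1)] in_homD(1-5)[OF V(1)] in_homD(1-5)[OF m(1)] in_homD(1-5)[OF h]
      in_homD(1-3)[OF u] in_homD(1-3)[OF v] in_homD(1-4)[OF is_coproductD(2)[OF N]]
      in_homD(1-4)[OF is_coproductD(2)[OF N']] in_homD(1-4)[OF is_coproductD(2)[OF Q]]
    have VU: "V \<cdot> U = m"
    proof (rule coproduct_ext[OF N comp_in_hom[OF V(1) U(1)] m(1)])
      fix i assume i: "i \<in> I"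
      have "(V \<cdot> U) \<cdot> \<kappa> i = (V \<cdot> \<kappa>' i) \<cdot> u i"
        using i by (simp add: comp_assoc U(2))
      then show "(V \<cdot> U) \<cdot> \<kappa> i = m \<cdot> \<kappa> i"
        using i by (simp add: V(2) m(2) comp_assoc fvu)
    qed
    obtain J where J: "J \<subseteq> I" "|J| <o \<alpha>" "supported I G N' \<kappa>' J (U \<cdot> h)"
      using alpha_smallD[OF A_alpha_small[OF x] I N' comp_in_hom[OF U(1) h]] .
    then obtain e where e: "coproduct_projection I G N' \<kappa>' J e" "e \<cdot> (U \<cdot> h) = U \<cdot> h"
      unfolding supported_def by blast
    have "(J, restrict G J) \<in> \<Omega>"
      using J Guv by (auto simp: \<Omega>_def)
    then obtain R \<sigma> where R: "R \<in> \<B>" "is_coproduct T J (restrict G J) R \<sigma>"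
      using \<B>(3) by fastforce
    have R': "is_coproduct T J G R \<sigma>"
      using R(2) coproduct_cong[of J "restrict G J" G \<sigma> \<sigma> R] by simp
    obtain c r where c: "\<guillemotleft>c : R \<rightarrow> N'\<guillemotright>" and "\<And>i. i \<in> J \<Longrightarrow> c \<cdot> \<sigma> i = \<kappa>' i"
      and r: "\<guillemotleft>r : N' \<rightarrow> R\<guillemotright>" and cr: "c \<cdot> r = e" and "r \<cdot> c = Idt T R"
      by (rule projection_splits[OF N' J(1) R' e(1)]) (rule that)
    note [simp] = in_homD(1-5)[OF c] in_homD(1-5)[OF r]
    have "g = V \<cdot> (U \<cdot> h)"
      by (simp add: gmh flip: VU comp_assoc)
    also have "\<dots> = V \<cdot> ((c \<cdot> r) \<cdot> (U \<cdot> h))"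
      by (simp add: cr e(2))
    also have "\<dots> = (V \<cdot> c) \<cdot> (r \<cdot> (U \<cdot> h))"
      by (simp add: comp_assoc)
    finally show "\<exists>G\<in>\<B>. \<exists>u v. \<guillemotleft>u : x \<rightarrow> G\<guillemotright> \<and> \<guillemotleft>v : G \<rightarrow> Q\<guillemotright> \<and> g = v \<cdot> u"
      using R(1) comp_in_hom[OF V(1) c] comp_in_hom[OF r comp_in_hom[OF U(1) h]] by blast
  qed
qed

text \<open>
  A map \<open>f : x \<rightarrow> z''\<close> gives \<open>x \<rightarrow> \<Sigma>z\<close>, which factors through a member \<open>y\<close> of the solution set of \<open>\<Sigma>z\<close>.
  The composite \<open>y \<rightarrow> \<Sigma>z \<rightarrow> \<Sigma>z'\<close> need not vanish, but it vanishes on \<open>x\<close>, so it factors through the cone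
  of \<open>x \<rightarrow> y\<close>, hence through a member \<open>y'\<close> of the solution set of \<open>\<Sigma>z'\<close>. Replacing \<open>y\<close> by the fibre \<open>w\<close>
  of \<open>y \<rightarrow> y'\<close> makes the composite vanish, and \<open>f\<close> factors through \<open>w\<close> up to a map that comes from \<open>z'\<close>.
\<close>

lemma approximable_cone:
  assumes tri: "exact_triangle T z z' z'' a b d" and z: "approximable z" and z': "approximable z'"
  shows "approximable z''"
proof -
  note abd = triD[OF tri]
  obtain \<G>1 where G1: "small TYPE('u) \<G>1" "\<G>1 \<subseteq> A"
    "\<And>x f. x \<in> A \<Longrightarrow> \<guillemotleft>f : x \<rightarrow> ShO T z\<guillemotright> \<Longrightarrow> \<exists>G\<in>\<G>1. \<exists>u v. \<guillemotleft>u : x \<rightarrow> G\<guillemotright> \<and> \<guillemotleft>v : G \<rightarrow> ShO T z\<guillemotright> \<and> f = v \<cdot> u"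
    by (rule approximableE[OF approximable_ShO[OF z]]) (rule that)
  obtain \<G>2 where G2: "small TYPE('u) \<G>2" "\<G>2 \<subseteq> A"
    "\<And>x f. x \<in> A \<Longrightarrow> \<guillemotleft>f : x \<rightarrow> ShO T z'\<guillemotright> \<Longrightarrow> \<exists>G\<in>\<G>2. \<exists>u v. \<guillemotleft>u : x \<rightarrow> G\<guillemotright> \<and> \<guillemotleft>v : G \<rightarrow> ShO T z'\<guillemotright> \<and> f = v \<cdot> u"
    by (rule approximableE[OF approximable_ShO[OF z']]) (rule that)
  obtain \<G>3 where G3: "small TYPE('u) \<G>3" "\<G>3 \<subseteq> A"
    "\<And>x f. x \<in> A \<Longrightarrow> \<guillemotleft>f : x \<rightarrow> z'\<guillemotright> \<Longrightarrow> \<exists>G\<in>\<G>3. \<exists>u v. \<guillemotleft>u : x \<rightarrow> G\<guillemotright> \<and> \<guillemotleft>v : G \<rightarrow> z'\<guillemotright> \<and> f = v \<cdot> u"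
    by (rule approximableE[OF z']) (rule that)
  have "\<forall>h. \<exists>w k v. arr h \<longrightarrow> exact_triangle T w (dom h) (cod h) k h v"
    using fibre_exists[OF arr_in_hom] by metis
  then obtain w k v where "\<forall>h. arr h \<longrightarrow> exact_triangle T (w h) (dom h) (cod h) (k h) h (v h)"
    unfolding choice_iff by (elim exE)
  then have w: "exact_triangle T (w h) y y' (k h) h (v h)" if "\<guillemotleft>h : y \<rightarrow> y'\<guillemotright>" for h y y'
    using in_homD(1-3)[OF that] by auto
  \<comment> \<open>The data of the construction: \<open>y\<close>, \<open>y'\<close>, a map \<open>y \<rightarrow> y'\<close>, and a member for the correction term from \<open>z'\<close>.\<close>
  define \<Omega> where "\<Omega> = Sigma \<G>1 (\<lambda>y. Sigma \<G>2 (\<lambda>y'. Hom T y y' \<times> \<G>3))"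
  have small: "small TYPE('u) \<Omega>"
    unfolding \<Omega>_def using G1 G2 G3 A_Ob
    by (intro small_Sigma[OF universe] small_Hom) auto
  let ?R = "\<lambda>p R. case p of (y, y', h, y'') \<Rightarrow> \<exists>q.
      is_coproduct T (UNIV :: bool set) (\<lambda>b. if b then w h else y'') R q"
  have "\<exists>\<B>\<subseteq>A. small TYPE('u) \<B> \<and> (\<forall>p\<in>\<Omega>. \<exists>R\<in>\<B>. ?R p R)"
  proof (rule small_choice[OF small])
    fix p assume "p \<in> \<Omega>"
    then obtain y y' h y'' where p: "p = (y, y', h, y'')" and y: "y \<in> A" "y' \<in> A" "y'' \<in> A" and "h \<in> Hom T y y'"
      using G1(2) G2(2) G3(2) unfolding \<Omega>_def by blast
    then have h: "\<guillemotleft>h : y \<rightarrow> y'\<guillemotright>"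
      using A_Ob by (simp add: in_hom_def)
    have wA: "w h \<in> A"
      using A_fibre[OF w[OF h] y(1,2)] .
    obtain R q where R: "is_coproduct T (UNIV :: bool set) (\<lambda>b. if b then w h else y'') R q"
      using sum_exists[OF A_Ob[OF wA] A_Ob[OF y(3)]] .
    have "R \<in> A"
      by (rule A_coproduct[OF _ _ R]) (use wA y(3) in \<open>auto simp: less_finite\<close>)
    then show "\<exists>R. R \<in> A \<and> ?R p R"
      using R p by auto
  qed
  then obtain \<B> where \<B>: "\<B> \<subseteq> A" "small TYPE('u) \<B>" "\<And>p. p \<in> \<Omega> \<Longrightarrow> \<exists>R\<in>\<B>. ?R p R"
    by blast
  show ?thesis
  proof (rule approximableI[OF in_homD(5)[OF abd(2)] \<B>(2,1)])
    fix x f assume x: "x \<in> A" and f: "\<guillemotleft>f : x \<rightarrow> z''\<guillemotright>"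
    obtain y u1 v1 where y: "y \<in> \<G>1" and u1: "\<guillemotleft>u1 : x \<rightarrow> y\<guillemotright>" and v1: "\<guillemotleft>v1 : y \<rightarrow> ShO T z\<guillemotright>"
      and df: "d \<cdot> f = v1 \<cdot> u1"
      using G1(3)[OF x comp_in_hom[OF abd(3) f]] by blast
    note [simp] = in_homD(1-5)[OF abd(1)] in_homD(1-5)[OF abd(2)] in_homD(1-5)[OF abd(3)]
      in_homD(1-5)[OF f] in_homD(1-5)[OF u1] in_homD(1-5)[OF v1]
    obtain c j l where c: "exact_triangle T x y c u1 j l"
      using cone_exists[OF u1] .
    have cA: "c \<in> A"
      using A_cone[OF c x] y G1(2) by blast
    note j = triD(2)[OF c]
    have "(ShA T a \<cdot> v1) \<cdot> u1 = (ShA T a \<cdot> d) \<cdot> f"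
      by (simp add: comp_assoc df)
    then have "(ShA T a \<cdot> v1) \<cdot> u1 = Zero T x (ShO T z')"
      by (simp add: tri_comp_zeroS[OF tri])
    then obtain t where t: "\<guillemotleft>t : c \<rightarrow> ShO T z'\<guillemotright>" "ShA T a \<cdot> v1 = t \<cdot> j"
      by (rule tri_ext[OF c comp_in_hom[OF ShA_in_hom[OF abd(1)] v1]]) (rule that)
    obtain y' u2 v2 where y': "y' \<in> \<G>2" and u2: "\<guillemotleft>u2 : c \<rightarrow> y'\<guillemotright>" and v2: "\<guillemotleft>v2 : y' \<rightarrow> ShO T z'\<guillemotright>"
      and tvu: "t = v2 \<cdot> u2"
      using G2(3)[OF cA t(1)] by blast
    note [simp] = in_homD(1-5)[OF j] in_homD(1-5)[OF u2] in_homD(1-5)[OF v2]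
    have hu: "(u2 \<cdot> j) \<cdot> u1 = Zero T x y'"
      by (simp add: comp_assoc tri_comp_zero[OF c])
    define h where "h = u2 \<cdot> j"
    have h: "\<guillemotleft>h : y \<rightarrow> y'\<guillemotright>"
      unfolding h_def by (rule comp_in_hom[OF u2 j])
    note W = w[OF h] and k = triD(1)[OF w[OF h]]
    note [simp] = in_homD(1-5)[OF k] in_homD(1-5)[OF h]
    obtain s where s: "\<guillemotleft>s : x \<rightarrow> w h\<guillemotright>" "u1 = k h \<cdot> s"
      using tri_lift[OF W u1 hu[folded h_def]] .
    note [simp] = in_homD(1-5)[OF s(1)]
    have "ShA T a \<cdot> v1 = v2 \<cdot> h"
      by (simp add: t(2) tvu h_def comp_assoc)
    moreover have "ShA T a \<cdot> (v1 \<cdot> k h) = (ShA T a \<cdot> v1) \<cdot> k h"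
      by (simp add: comp_assoc)
    ultimately have "ShA T a \<cdot> (v1 \<cdot> k h) = v2 \<cdot> (h \<cdot> k h)"
      by (simp add: comp_assoc)
    also have "\<dots> = Zero T (w h) (ShO T z')"
      by (simp add: tri_comp_zero[OF W])
    finally have "ShA T a \<cdot> (v1 \<cdot> k h) = Zero T (w h) (ShO T z')" .
    then obtain g' where g': "\<guillemotleft>g' : w h \<rightarrow> z''\<guillemotright>" "v1 \<cdot> k h = d \<cdot> g'"
      by (rule tri_liftS[OF tri comp_in_hom[OF v1 k]]) (rule that)
    note [simp] = in_homD(1-5)[OF g'(1)]
    have "d \<cdot> (g' \<cdot> s) = (v1 \<cdot> k h) \<cdot> s"
      by (simp add: g'(2) comp_assoc)
    also have "\<dots> = v1 \<cdot> u1"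
      by (simp add: comp_assoc s(2))
    finally have "d \<cdot> (f \<^bold>- g' \<cdot> s) = Zero T x (ShO T z)"
      by (simp add: comp_distrib df)
    moreover have "\<guillemotleft>f \<^bold>- g' \<cdot> s : x \<rightarrow> z''\<guillemotright>"
      by (simp add: in_hom_iff)
    ultimately obtain g where g: "\<guillemotleft>g : x \<rightarrow> z'\<guillemotright>" "f \<^bold>- g' \<cdot> s = b \<cdot> g"
      using tri_lift3[OF tri] by blast
    obtain y'' u3 v3 where y'': "y'' \<in> \<G>3" and u3: "\<guillemotleft>u3 : x \<rightarrow> y''\<guillemotright>" and v3: "\<guillemotleft>v3 : y'' \<rightarrow> z'\<guillemotright>" and gvu: "g = v3 \<cdot> u3"
      using G3(3)[OF x g(1)] by blast
    note [simp] = in_homD(1-5)[OF u3] in_homD(1-5)[OF v3]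
    have "(y, y', h, y'') \<in> \<Omega>"
      unfolding \<Omega>_def using y y' y'' in_homD(6)[OF h] by blast
    then obtain R q where R: "R \<in> \<B>" and q: "is_coproduct T (UNIV :: bool set) (\<lambda>b. if b then w h else y'') R q"
      using \<B>(3) by fastforce
    have qT: "\<guillemotleft>q True : w h \<rightarrow> R\<guillemotright>" and qF: "\<guillemotleft>q False : y'' \<rightarrow> R\<guillemotright>"
      using is_coproductD(2)[OF q, of True] is_coproductD(2)[OF q, of False] by auto
    obtain V where V: "\<guillemotleft>V : R \<rightarrow> z''\<guillemotright>" "\<And>\<beta>. \<beta> \<in> UNIV \<Longrightarrow> V \<cdot> q \<beta> = (if \<beta> then g' else b \<cdot> v3)"
      by (rule copair_exists[OF q in_homD(5)[OF abd(2)], of "\<lambda>\<beta>. if \<beta> then g' else b \<cdot> v3"])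
        (use g'(1) comp_in_hom[OF abd(2) v3] in auto)
    note [simp] = in_homD(1-5)[OF qT] in_homD(1-5)[OF qF] in_homD(1-5)[OF V(1)]
    have "V \<cdot> (q True \<cdot> s \<^bold>+ q False \<cdot> u3) = (V \<cdot> q True) \<cdot> s \<^bold>+ (V \<cdot> q False) \<cdot> u3"
      by (simp add: comp_distrib comp_assoc)
    also have "\<dots> = g' \<cdot> s \<^bold>+ (f \<^bold>- g' \<cdot> s)"
      by (simp add: V(2) g(2) gvu comp_assoc)
    finally have "f = V \<cdot> (q True \<cdot> s \<^bold>+ q False \<cdot> u3)"
      using add_diff_cancel(1)[of f "g' \<cdot> s"] by simp
    moreover have "\<guillemotleft>q True \<cdot> s \<^bold>+ q False \<cdot> u3 : x \<rightarrow> R\<guillemotright>"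
      by (simp add: in_hom_iff)
    ultimately show "\<exists>G\<in>\<B>. \<exists>u v. \<guillemotleft>u : x \<rightarrow> G\<guillemotright> \<and> \<guillemotleft>v : G \<rightarrow> z''\<guillemotright> \<and> f = v \<cdot> u"
      using R V(1) by blast
  qed
qed

subsection \<open>Every object has a solution set\<close>

lemma approximable_small_coproduct:
  fixes I :: "'i set"
  assumes I: "small TYPE('u) I" and Q: "is_coproduct T I X Q \<iota>" and X: "\<And>i. i \<in> I \<Longrightarrow> approximable (X i)"
  shows "approximable Q"
proof -
  obtain J :: "'u set" and \<beta> where \<beta>: "bij_betw \<beta> J I" "small TYPE('u) J"
    using small_index[OF I] .
  show ?thesis
    by (rule approximable_coproduct[OF \<beta>(2) coproduct_reindex[OF Q \<beta>(1)]])
      (use X bij_betwE[OF \<beta>(1)] in blast)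
qed

lemma zero_object_A:
  assumes "is_zero_object T Z" shows "Z \<in> A"
proof (rule A_coproduct[where J = "{} :: unit set" and S = undefined and \<sigma> = undefined])
  show "is_coproduct T {} undefined Z undefined"
  proof (rule is_coproductI)
    show "Z \<in> Ob T" using zero_objectD(1)[OF assms] .
    show "\<exists>h. \<guillemotleft>h : Z \<rightarrow> W\<guillemotright> \<and> (\<forall>i\<in>{}. h \<cdot> undefined i = t i)" if "W \<in> Ob T" for W t
      using zero_in_hom[OF zero_objectD(1)[OF assms] that] by blast
    show "g = h" if "\<guillemotleft>g : Z \<rightarrow> W\<guillemotright>" "\<guillemotleft>h : Z \<rightarrow> W\<guillemotright>" for W g h
      using zero_objectD(3)[OF assms] that by metis
  qed auto
qed (auto simp: less_finite)

definition approximable_map where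
  "approximable_map f \<longleftrightarrow> (\<exists>Z g h. exact_triangle T (dom f) (cod f) Z f g h \<and> approximable Z)"

lemma approximable_mapI:
  assumes "exact_triangle T X Y Z f g h" "approximable Z" shows "approximable_map f"
  using assms triD(1)[OF assms(1)] unfolding approximable_map_def by (auto simp: in_hom_iff)

lemma approximable_mapE:
  assumes "approximable_map f" "\<guillemotleft>f : X \<rightarrow> Y\<guillemotright>"
  obtains Z g h where "exact_triangle T X Y Z f g h" "approximable Z"
  using assms unfolding approximable_map_def by (auto simp: in_hom_iff)

text \<open>The octahedral axiom gives two cases of the rule that two of three maps determine the third.\<close>

lemma approximable_map_comp:
  assumes f: "\<guillemotleft>f : X \<rightarrow> Y\<guillemotright>" "approximable_map f" and g: "\<guillemotleft>g : Y \<rightarrow> Z\<guillemotright>" "approximable_map g"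
  shows "approximable_map (g \<cdot> f)"
proof -
  obtain F u v where F: "exact_triangle T X Y F f u v" "approximable F"
    using approximable_mapE[OF f(2,1)] .
  obtain G u' v' where G: "exact_triangle T Y Z G g u' v'" "approximable G"
    using approximable_mapE[OF g(2,1)] .
  obtain H u'' v'' where H: "exact_triangle T X Z H (g \<cdot> f) u'' v''"
    using cone_exists[OF comp_in_hom[OF g(1) f(1)]] .
  obtain a b where tri: "exact_triangle T F H G a b (ShA T u \<cdot> v')"
    using octahedral[OF F(1) G(1) H] by blast
  have "approximable (ShO T H)"
    by (rule approximable_cone[OF rotate[OF rotate[OF tri]] G(2) approximable_ShO[OF F(2)]])
  then have "approximable H"
    by (rule approximable_ShO_D) (use in_homD(5)[OF triD(2)[OF H]] in simp)
  then show ?thesis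
    using approximable_mapI[OF H] by blast
qed

lemma approximable_map_cancel:
  assumes f: "\<guillemotleft>f : X \<rightarrow> Y\<guillemotright>" and gf: "approximable_map (g \<cdot> f)" and g: "\<guillemotleft>g : Y \<rightarrow> Z\<guillemotright>" "approximable_map g"
  shows "approximable_map f"
proof -
  obtain F u v where F: "exact_triangle T X Y F f u v"
    using cone_exists[OF f] .
  obtain G u' v' where G: "exact_triangle T Y Z G g u' v'" "approximable G"
    using approximable_mapE[OF g(2,1)] .
  obtain H u'' v'' where H: "exact_triangle T X Z H (g \<cdot> f) u'' v''" "approximable H"
    using approximable_mapE[OF gf comp_in_hom[OF g(1) f]] .
  obtain a b where tri: "exact_triangle T F H G a b (ShA T u \<cdot> v')"
    using octahedral[OF F(1) G(1) H(1)] by blast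
  have "approximable (ShO T F)"
    by (rule approximable_cone[OF rotate[OF tri] H(2) G(2)])
  then have "approximable F"
    by (rule approximable_ShO_D) (use in_homD(5)[OF triD(2)[OF F]] in simp)
  then show ?thesis
    using approximable_mapI[OF F] by blast
qed

text \<open>
  Every object \<open>X\<close> is the start of a tower \<open>X = U\<^sub>0 \<rightarrow> U\<^sub>1 \<rightarrow> \<dots>\<close> whose maps vanish on the generators and on
  their desuspensions, and have cones built from objects of \<open>T\<^sup>\<alpha>\<close>. By perfection the shift map of
  \<open>D = \<Coprod> U\<^sub>n\<close> vanishes on the generators, and so does its suspension, whence \<open>1 - shift\<close> has cone zero. The map
  to \<open>D\<close> from \<open>B = \<Coprod> X\<close>, the coproduct of the constant tower, commutes with \<open>1 - shift\<close>. Its cone has a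
  solution set since the cones of \<open>X \<rightarrow> U\<^sub>n\<close> have one, and hence so does the cone of \<open>1 - shift\<close> on \<open>B\<close>. But \<open>X\<close> is a
  retract of this last cone.
\<close>

lemma approximable_all:
  assumes X: "X \<in> Ob T" shows "approximable X"
proof -
  obtain \<S> where \<S>: "small TYPE('u) \<S>" "\<S> \<subseteq> A"
    and zero: "generating \<S>" and perf: "perfect \<S>"
    by (rule generators) (rule that)
  have "\<exists>\<S>'\<subseteq>A. small TYPE('u) \<S>' \<and> (\<forall>S\<in>\<S>. \<exists>S'\<in>\<S>'. \<exists>d c. \<guillemotleft>d : ShO T S' \<rightarrow> S\<guillemotright> \<and> \<guillemotleft>c : S \<rightarrow> ShO T S'\<guillemotright> \<and> d \<cdot> c = Idt T S)"
  proof (rule small_choice[OF \<S>(1)])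
    fix S assume "S \<in> \<S>"
    then have "S \<in> A"
      using \<S>(2) by blast
    then show "\<exists>S'. S' \<in> A \<and> (\<exists>d c. \<guillemotleft>d : ShO T S' \<rightarrow> S\<guillemotright> \<and> \<guillemotleft>c : S \<rightarrow> ShO T S'\<guillemotright> \<and> d \<cdot> c = Idt T S)"
      by (rule A_desuspension) blast
  qed
  then obtain \<S>' where \<S>': "\<S>' \<subseteq> A" "small TYPE('u) \<S>'" "\<And>S. S \<in> \<S> \<Longrightarrow>
      \<exists>S'\<in>\<S>'. \<exists>d c. \<guillemotleft>d : ShO T S' \<rightarrow> S\<guillemotright> \<and> \<guillemotleft>c : S \<rightarrow> ShO T S'\<guillemotright> \<and> d \<cdot> c = Idt T S"
    by blast
  have "\<exists>W w V u q. approximable W \<and> exact_triangle T W U V w u q \<and>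
      surjective_on \<S> w \<and> surjective_on \<S> (ShA T w)"
    if U: "U \<in> Ob T" for U
  proof -
    let ?\<G> = "\<S> \<union> \<S>'"
    have G: "small TYPE('u) ?\<G>" "?\<G> \<subseteq> Ob T"
      using small_Un[OF universe \<S>(1) \<S>'(2)] \<S>(2) \<S>'(1) A_Ob by auto
    obtain W \<kappa> w where W: "is_coproduct T (Sigma ?\<G> (\<lambda>S. Hom T S U)) fst W \<kappa>" and w: "\<guillemotleft>w : W \<rightarrow> U\<guillemotright>"
      and "\<And>S h. S \<in> ?\<G> \<Longrightarrow> \<guillemotleft>h : S \<rightarrow> U\<guillemotright> \<Longrightarrow> w \<cdot> \<kappa> (S, h) = h"
      and lift: "\<And>S h. S \<in> ?\<G> \<Longrightarrow> \<guillemotleft>h : S \<rightarrow> U\<guillemotright> \<Longrightarrow> \<exists>k. \<guillemotleft>k : S \<rightarrow> W\<guillemotright> \<and> w \<cdot> k = h"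
      by (rule precover[OF G U]) (rule that)
    obtain V u q where V: "exact_triangle T W U V w u q"
      using cone_exists[OF w] .
    have "approximable W"
    proof (rule approximable_small_coproduct[OF _ W])
      show "small TYPE('u) (Sigma ?\<G> (\<lambda>S. Hom T S U))"
        using G U by (intro small_Sigma[OF universe]) (auto intro: small_Hom)
      show "approximable (fst p)" if "p \<in> Sigma ?\<G> (\<lambda>S. Hom T S U)" for p
        using that \<S>(2) \<S>'(1) by (intro approximable_A) auto
    qed
    moreover have "\<exists>k. \<guillemotleft>k : S \<rightarrow> ShO T W\<guillemotright> \<and> ShA T w \<cdot> k = h" if S: "S \<in> \<S>" and h: "\<guillemotleft>h : S \<rightarrow> ShO T U\<guillemotright>" for S h
    proof -
      obtain S' d c where S': "S' \<in> \<S>'" and d: "\<guillemotleft>d : ShO T S' \<rightarrow> S\<guillemotright>" and c: "\<guillemotleft>c : S \<rightarrow> ShO T S'\<guillemotright>" and dc: "d \<cdot> c = Idt T S"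
        using \<S>'(3)[OF S] by blast
      have S'_Ob: "S' \<in> Ob T"
        using S' G(2) by blast
      obtain h' where h': "\<guillemotleft>h' : S' \<rightarrow> U\<guillemotright>" "ShA T h' = h \<cdot> d"
        using ShA_full[OF comp_in_hom[OF h d] S'_Ob U] .
      obtain k where k: "\<guillemotleft>k : S' \<rightarrow> W\<guillemotright>" "w \<cdot> k = h'"
        using lift[OF _ h'(1)] S' by blast
      note [simp] = in_homD(1-5)[OF h] in_homD(1-5)[OF d] in_homD(1-5)[OF c] in_homD(1-5)[OF w] in_homD(1-5)[OF k(1)]
      have "ShA T w \<cdot> (ShA T k \<cdot> c) = ShA T (w \<cdot> k) \<cdot> c"
        by (simp add: comp_assoc)
      also have "\<dots> = h"
        by (simp only: k(2) h'(2)) (simp add: comp_assoc dc)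
      finally show ?thesis
        using comp_in_hom[OF ShA_in_hom[OF k(1)] c] by blast
    qed
    then have "surjective_on \<S> (ShA T w)"
      by (rule surjective_onI[OF ShA_in_hom[OF w]])
    moreover have "surjective_on \<S> w"
      using lift by (intro surjective_onI[OF w]) blast
    ultimately show ?thesis
      using V by blast
  qed
  then have "\<forall>U\<in>Ob T. \<exists>W w V u q. approximable W \<and> exact_triangle T W U V w u q \<and>
      surjective_on \<S> w \<and> surjective_on \<S> (ShA T w)" ..
  then obtain W w V u q where step: "\<forall>U\<in>Ob T. approximable (W U) \<and> exact_triangle T (W U) U (V U) (w U) (u U) (q U) \<and>
      surjective_on \<S> (w U) \<and> surjective_on \<S> (ShA T (w U))"
    unfolding bchoice_iff by (elim exE)
  define U where "U = rec_nat X (\<lambda>_. V)"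
  define b where "b = rec_nat (Idt T X) (\<lambda>n b. u (U n) \<cdot> b)"
  have U_simps: "U 0 = X" "U (Suc n) = V (U n)" for n
    by (auto simp: U_def)
  have b_simps: "b 0 = Idt T X" "b (Suc n) = u (U n) \<cdot> b n" for n
    by (auto simp: b_def)
  have tri: "U n \<in> Ob T" for n
  proof (induction n)
    case (Suc n)
    then have "exact_triangle T (W (U n)) (U n) (V (U n)) (w (U n)) (u (U n)) (q (U n))"
      using step by blast
    then show ?case
      using triD(2) unfolding U_simps by (blast dest: in_homD(5))
  qed (simp add: U_simps X)
  then have tri: "exact_triangle T (W (U n)) (U n) (U (Suc n)) (w (U n)) (u (U n)) (q (U n))"
    and W: "approximable (W (U n))" for n
    using step unfolding U_simps by blast+
  have surj: "surjective_on \<S> (w (U n))" "surjective_on \<S> (ShA T (w (U n)))" for n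
    using step in_homD(5)[OF triD(1)[OF tri[of n]]] by auto
  note w = triD(1)[OF tri] and u = triD(2)[OF tri]
  have b: "\<guillemotleft>b n : X \<rightarrow> U n\<guillemotright> \<and> approximable_map (b n)" for n
  proof (induction n)
    case 0
    obtain N where N: "is_zero_object T N"
      using zero_object by blast
    show ?case
      unfolding U_simps b_simps
      using approximable_mapI[OF triangle_Idt[OF X N] approximable_A[OF zero_object_A[OF N]]] X
      by (simp add: in_hom_iff)
  next
    case (Suc n)
    have "approximable_map (u (U n))"
      by (rule approximable_mapI[OF rotate[OF tri] approximable_ShO[OF W]])
    then show ?case
      using approximable_map_comp[OF _ _ u[of n]] comp_in_hom[OF u] Suc unfolding b_simps by blast
  qed
  have N: "small TYPE('u) (UNIV :: nat set)"
    by (simp add: small_countable[OF universe])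
  then obtain J :: "'u set" and \<beta> where \<beta>: "bij_betw \<beta> J (UNIV :: nat set)" "small TYPE('u) J"
    using small_index by blast
  obtain D \<iota> where D: "is_coproduct T (UNIV :: nat set) U D \<iota>"
    by (rule coproduct_exists[OF N, of U]) (rule in_homD(5)[OF w], rule that)
  obtain P \<kappa> where P: "is_coproduct T (UNIV :: nat set) (\<lambda>n. W (U n)) P \<kappa>"
    by (rule coproduct_exists[OF N, of "\<lambda>n. W (U n)"]) (rule in_homD(4)[OF w], rule that)
  obtain B \<epsilon> where B: "is_coproduct T (UNIV :: nat set) (\<lambda>_. X) B \<epsilon>"
    by (rule coproduct_exists[OF N, of "\<lambda>_. X"]) (rule X, rule that)
  have \<iota>: "\<guillemotleft>\<iota> n : U n \<rightarrow> D\<guillemotright>" and \<epsilon>: "\<guillemotleft>\<epsilon> n : X \<rightarrow> B\<guillemotright>" and \<kappa>: "\<guillemotleft>\<kappa> n : W (U n) \<rightarrow> P\<guillemotright>" for n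
    using is_coproductD(2)[OF D] is_coproductD(2)[OF B] is_coproductD(2)[OF P] by auto
  note b_in = b[THEN conjunct1]
  obtain m where m: "\<guillemotleft>m : P \<rightarrow> D\<guillemotright>" "\<And>n. n \<in> UNIV \<Longrightarrow> m \<cdot> \<kappa> n = \<iota> n \<cdot> w (U n)"
    using coproduct_map_exists[OF P D w] by blast
  obtain s where s: "\<guillemotleft>s : D \<rightarrow> D\<guillemotright>" "\<And>n. n \<in> UNIV \<Longrightarrow> s \<cdot> \<iota> n = \<iota> (Suc n) \<cdot> u (U n)"
    by (rule copair_exists[OF D is_coproductD(1)[OF D] comp_in_hom[OF \<iota> u]]) (rule that)
  obtain s' where s': "\<guillemotleft>s' : B \<rightarrow> B\<guillemotright>" "\<And>n. n \<in> UNIV \<Longrightarrow> s' \<cdot> \<epsilon> n = \<epsilon> (Suc n)"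
    by (rule copair_exists[OF B is_coproductD(1)[OF B], of "\<lambda>n. \<epsilon> (Suc n)"]) (rule \<epsilon>, rule that)
  obtain \<beta>' where \<beta>': "\<guillemotleft>\<beta>' : B \<rightarrow> D\<guillemotright>" "\<And>n. n \<in> UNIV \<Longrightarrow> \<beta>' \<cdot> \<epsilon> n = \<iota> n \<cdot> b n"
    by (rule copair_exists[OF B is_coproductD(1)[OF D] comp_in_hom[OF \<iota> b_in]]) (rule that)
  obtain f where f: "\<guillemotleft>f : B \<rightarrow> X\<guillemotright>" "\<And>n. n \<in> UNIV \<Longrightarrow> f \<cdot> \<epsilon> n = Idt T X"
    by (rule copair_exists[OF B X, of "\<lambda>_. Idt T X"]) (simp add: in_hom_iff X, rule that)
  note [simp] = in_homD(1-5)[OF w] in_homD(1-5)[OF u] in_homD(1-5)[OF b_in] in_homD(1-5)[OF \<iota>]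
    in_homD(1-5)[OF \<epsilon>] in_homD(1-5)[OF \<kappa>] in_homD(1-5)[OF m(1)] in_homD(1-5)[OF s(1)]
    in_homD(1-5)[OF s'(1)] in_homD(1-5)[OF \<beta>'(1)] in_homD(1-5)[OF f(1)]
  have sm: "s \<cdot> m = Zero T P D"
  proof (rule coproduct_ext[OF P comp_in_hom[OF s(1) m(1)]])
    fix n
    have "(s \<cdot> m) \<cdot> \<kappa> n = (s \<cdot> \<iota> n) \<cdot> w (U n)"
      by (simp add: comp_assoc m(2))
    also have "\<dots> = \<iota> (Suc n) \<cdot> (u (U n) \<cdot> w (U n))"
      by (simp add: s(2) comp_assoc)
    finally show "(s \<cdot> m) \<cdot> \<kappa> n = Zero T P D \<cdot> \<kappa> n"
      by (simp add: tri_comp_zero[OF tri])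
  qed (simp add: in_hom_iff)
  \<comment> \<open>The shift map \<open>s\<close> kills \<open>m\<close>, and \<open>m\<close> is surjective on maps from the generators.\<close>
  have ghost: "s \<cdot> h = Zero T S D" if S: "S \<in> \<S>" and h: "\<guillemotleft>h : S \<rightarrow> D\<guillemotright>" for S h
  proof -
    have "surjective_on \<S> m"
      by (rule perfectD[OF perf \<beta>(2) w coproduct_reindex[OF P \<beta>(1)] coproduct_reindex[OF D \<beta>(1)] m(1) _ surj(1)])
        (simp add: m(2))
    then obtain k where k: "\<guillemotleft>k : S \<rightarrow> P\<guillemotright>" "m \<cdot> k = h"
      using surjective_onD[OF _ m(1) S h] by blast
    note [simp] = in_homD(1-5)[OF k(1)]
    have "s \<cdot> h = (s \<cdot> m) \<cdot> k"
      by (simp add: comp_assoc k(2))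
    then show ?thesis
      by (simp add: sm)
  qed
  have ghostS: "ShA T s \<cdot> h = Zero T S (ShO T D)" if S: "S \<in> \<S>" and h: "\<guillemotleft>h : S \<rightarrow> ShO T D\<guillemotright>" for S h
  proof -
    have "ShA T m \<cdot> ShA T (\<kappa> n) = ShA T (\<iota> n) \<cdot> ShA T (w (U n))" for n
      using arg_cong[OF m(2)[of n], of "ShA T"] by simp
    then have "surjective_on \<S> (ShA T m)"
      by (intro perfectD[OF perf \<beta>(2) ShA_in_hom[OF w] coproduct_reindex[OF coproduct_ShA[OF P] \<beta>(1)]
            coproduct_reindex[OF coproduct_ShA[OF D] \<beta>(1)] ShA_in_hom[OF m(1)] _ surj(2)])
    then obtain k where k: "\<guillemotleft>k : S \<rightarrow> ShO T P\<guillemotright>" "ShA T m \<cdot> k = h"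
      using surjective_onD[OF _ ShA_in_hom[OF m(1)] S h] by blast
    note [simp] = in_homD(1-5)[OF k(1)]
    have "ShA T s \<cdot> h = (ShA T s \<cdot> ShA T m) \<cdot> k"
      by (simp add: comp_assoc k(2))
    also have "ShA T s \<cdot> ShA T m = ShA T (s \<cdot> m)"
      by simp
    finally show ?thesis
      by (simp add: sm del: ShA_comp)
  qed
  let ?c = "Idt T D \<^bold>- s" and ?c' = "Idt T B \<^bold>- s'"
  have c: "\<guillemotleft>?c : D \<rightarrow> D\<guillemotright>" and c': "\<guillemotleft>?c' : B \<rightarrow> B\<guillemotright>"
    by (auto simp: in_hom_iff)
  obtain Z p r where Z: "exact_triangle T D D Z ?c p r"
    using cone_exists[OF c] .
  note [simp] = in_homD(1-5)[OF triD(2)[OF Z]] in_homD(1-5)[OF triD(3)[OF Z]]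
  have "is_zero_object T Z"
  proof (rule zero[unfolded generating_def, rule_format])
    fix S h assume S: "S \<in> \<S>" and h: "\<guillemotleft>h : S \<rightarrow> Z\<guillemotright>"
    note [simp] = in_homD(1-5)[OF h]
    have rh: "\<guillemotleft>r \<cdot> h : S \<rightarrow> ShO T D\<guillemotright>"
      by (simp add: in_hom_iff)
    have "ShA T ?c \<cdot> (r \<cdot> h) = r \<cdot> h"
      using ghostS[OF S rh] by (simp add: comp_distrib ShA_Idt)
    moreover have "ShA T ?c \<cdot> (r \<cdot> h) = (ShA T ?c \<cdot> r) \<cdot> h"
      by (simp add: comp_assoc)
    ultimately have "r \<cdot> h = Zero T S (ShO T D)"
      using tri_comp_zeroS[OF Z] by simp
    then obtain k where k: "\<guillemotleft>k : S \<rightarrow> D\<guillemotright>" "h = p \<cdot> k"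
      using tri_lift3[OF Z h] by blast
    note [simp] = in_homD(1-5)[OF k(1)]
    have "h = p \<cdot> (?c \<cdot> k)"
      using ghost[OF S k(1)] k(2) by (simp add: comp_distrib)
    also have "\<dots> = (p \<cdot> ?c) \<cdot> k"
      by (simp add: comp_assoc)
    finally show "h = Zero T S Z"
      using tri_comp_zero[OF Z] by simp
  qed simp
  then have am_c: "approximable_map ?c"
    using approximable_mapI[OF Z] approximable_A zero_object_A by blast
  have am_\<beta>': "approximable_map \<beta>'"
  proof -
    have "\<forall>n. \<exists>Z g h. exact_triangle T X (U n) Z (b n) g h \<and> approximable Z"
      using b approximable_mapE by metis
    then obtain C g h where C: "\<forall>n. exact_triangle T X (U n) (C n) (b n) (g n) (h n) \<and> approximable (C n)"
      unfolding choice_iff by (elim exE)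
    then have tri_C: "exact_triangle T X (U n) (C n) (b n) (g n) (h n)" for n
      by blast
    obtain R \<rho> where R: "is_coproduct T (UNIV :: nat set) C R \<rho>"
      by (rule coproduct_exists[OF N, of C]) (rule in_homD(5)[OF triD(2)[OF tri_C]], rule that)
    obtain G where G: "\<guillemotleft>G : D \<rightarrow> R\<guillemotright>" "\<And>n. n \<in> UNIV \<Longrightarrow> G \<cdot> \<iota> n = \<rho> n \<cdot> g n"
      using coproduct_map_exists[OF D R triD(2)[OF tri_C]] by blast
    obtain H where "exact_triangle T B D R \<beta>' G H"
      using coproduct_triangle[OF B D R tri_C \<beta>' G] by blast
    moreover have "approximable R"
      using C by (intro approximable_small_coproduct[OF N R]) blast
    ultimately show ?thesis
      by (rule approximable_mapI)
  qed
  have "\<beta>' \<cdot> ?c' = ?c \<cdot> \<beta>'"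
  proof (rule coproduct_ext[OF B comp_in_hom[OF \<beta>'(1) c'] comp_in_hom[OF c \<beta>'(1)]])
    fix n
    have "(\<beta>' \<cdot> ?c') \<cdot> \<epsilon> n = \<iota> n \<cdot> b n \<^bold>- \<iota> (Suc n) \<cdot> b (Suc n)"
      by (simp add: comp_distrib comp_assoc s'(2) \<beta>'(2))
    moreover have "s \<cdot> (\<iota> n \<cdot> b n) = (s \<cdot> \<iota> n) \<cdot> b n"
      by (simp add: comp_assoc)
    ultimately show "(\<beta>' \<cdot> ?c') \<cdot> \<epsilon> n = (?c \<cdot> \<beta>') \<cdot> \<epsilon> n"
      by (simp add: comp_distrib comp_assoc \<beta>'(2) s(2) b_simps)
  qed
  then have "approximable_map ?c'"
    using approximable_map_cancel[OF c' _ \<beta>'(1) am_\<beta>'] approximable_map_comp[OF \<beta>'(1) am_\<beta>' c am_c] by simp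
  then obtain C g h where C: "exact_triangle T B B C ?c' g h" "approximable C"
    using approximable_mapE[OF _ c'] by blast
  \<comment> \<open>The codiagonal \<open>f : B \<rightarrow> X\<close> is invariant under the shift, so it factors through the cone of \<open>1 - shift\<close>.\<close>
  have "f \<cdot> ?c' = Zero T B X"
  proof (rule coproduct_ext[OF B])
    show "(f \<cdot> ?c') \<cdot> \<epsilon> n = Zero T B X \<cdot> \<epsilon> n" for n
      by (simp add: comp_distrib comp_assoc s'(2) f(2))
  qed (auto simp: in_hom_iff X)
  then obtain t where t: "\<guillemotleft>t : C \<rightarrow> X\<guillemotright>" "f = t \<cdot> g"
    using tri_ext[OF C(1) f(1)] by blast
  note [simp] = in_homD(1-5)[OF t(1)] in_homD(1-5)[OF triD(2)[OF C(1)]]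
  have "t \<cdot> (g \<cdot> \<epsilon> 0) = f \<cdot> \<epsilon> 0"
    by (simp add: t(2) comp_assoc)
  then show ?thesis
    using approximable_retract[OF C(2) comp_in_hom[OF triD(2)[OF C(1)] \<epsilon>] t(1)] f(2) by simp
qed

section \<open>Phantom maps\<close>

text \<open>The projective objects of interest are the values of \<open>S\<^sub>\<alpha>\<close> at the following coproducts.\<close>

definition cellular where
  "cellular P I Y \<iota> \<longleftrightarrow> small TYPE('u) (I :: 'u set) \<and> is_coproduct T I Y P \<iota> \<and> Y ` I \<subseteq> A"

definition phantom where
  "phantom f \<longleftrightarrow> (\<forall>x\<in>A. \<forall>h. \<guillemotleft>h : x \<rightarrow> dom f\<guillemotright> \<longrightarrow> f \<cdot> h = Zero T x (cod f))"

lemma phantomD: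
  assumes "phantom f" "\<guillemotleft>f : X \<rightarrow> Y\<guillemotright>" "x \<in> A" "\<guillemotleft>h : x \<rightarrow> X\<guillemotright>"
  shows "f \<cdot> h = Zero T x Y"
  using assms in_homD(2,3)[OF assms(2)] unfolding phantom_def by metis

text \<open>
  A solution set of \<open>X\<close> suffices to form a coproduct that covers \<open>X\<close> with respect to all of \<open>T\<^sup>\<alpha>\<close>.
\<close>

lemma cellular_cover:
  assumes X: "X \<in> Ob T"
  obtains P I Y \<iota> p where "cellular P I Y \<iota>" "\<guillemotleft>p : P \<rightarrow> X\<guillemotright>" "surjective_on A p"
proof -
  obtain \<G> where \<G>: "small TYPE('u) \<G>" "\<G> \<subseteq> A"
    "\<And>x f. x \<in> A \<Longrightarrow> \<guillemotleft>f : x \<rightarrow> X\<guillemotright> \<Longrightarrow> \<exists>G\<in>\<G>. \<exists>u v. \<guillemotleft>u : x \<rightarrow> G\<guillemotright> \<and> \<guillemotleft>v : G \<rightarrow> X\<guillemotright> \<and> f = v \<cdot> u"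
    by (rule approximableE[OF approximable_all[OF X]]) (rule that)
  have Ob: "\<G> \<subseteq> Ob T"
    using \<G>(2) A_Ob by blast
  obtain P \<kappa> p where P: "is_coproduct T (Sigma \<G> (\<lambda>S. Hom T S X)) fst P \<kappa>" and p: "\<guillemotleft>p : P \<rightarrow> X\<guillemotright>"
    and "\<And>S h. S \<in> \<G> \<Longrightarrow> \<guillemotleft>h : S \<rightarrow> X\<guillemotright> \<Longrightarrow> p \<cdot> \<kappa> (S, h) = h"
    and lift: "\<And>S h. S \<in> \<G> \<Longrightarrow> \<guillemotleft>h : S \<rightarrow> X\<guillemotright> \<Longrightarrow> \<exists>k. \<guillemotleft>k : S \<rightarrow> P\<guillemotright> \<and> p \<cdot> k = h"
    by (rule precover[OF \<G>(1) Ob X]) (rule that)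
  have "small TYPE('u) (Sigma \<G> (\<lambda>S. Hom T S X))"
    using \<G>(1) Ob X by (intro small_Sigma[OF universe]) (auto intro: small_Hom)
  then obtain J :: "'u set" and \<beta> where \<beta>: "bij_betw \<beta> J (Sigma \<G> (\<lambda>S. Hom T S X))" "small TYPE('u) J"
    by (rule small_index) (rule that)
  have "fst (\<beta> j) \<in> A" if "j \<in> J" for j
    using bij_betwE[OF \<beta>(1)] that \<G>(2) by force
  then have "cellular P J (\<lambda>j. fst (\<beta> j)) (\<lambda>j. \<kappa> (\<beta> j))"
    using coproduct_reindex[OF P \<beta>(1)] \<beta>(2) unfolding cellular_def by blast
  moreover have "surjective_on A p"
    unfolding surjective_on_def
  proof (intro ballI allI impI)
    fix x h assume x: "x \<in> A" and "\<guillemotleft>h : x \<rightarrow> cod p\<guillemotright>"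
    then have h: "\<guillemotleft>h : x \<rightarrow> X\<guillemotright>"
      using in_homD(3)[OF p] by simp
    obtain G u v where G: "G \<in> \<G>" and u: "\<guillemotleft>u : x \<rightarrow> G\<guillemotright>" and v: "\<guillemotleft>v : G \<rightarrow> X\<guillemotright>" and hvu: "h = v \<cdot> u"
      using \<G>(3)[OF x h] by blast
    obtain k where k: "\<guillemotleft>k : G \<rightarrow> P\<guillemotright>" "p \<cdot> k = v"
      using lift[OF G v] by blast
    note [simp] = in_homD(1-5)[OF u] in_homD(1-5)[OF k(1)] in_homD(1-5)[OF p]
    have "p \<cdot> (k \<cdot> u) = (p \<cdot> k) \<cdot> u"
      by (simp add: comp_assoc)
    then show "\<exists>k. \<guillemotleft>k : x \<rightarrow> dom p\<guillemotright> \<and> p \<cdot> k = h"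
      using comp_in_hom[OF k(1) u] k(2) hvu by auto
  qed
  ultimately show ?thesis
    using that p by blast
qed

lemma phantom_cellular:
  assumes P: "cellular P I Y \<iota>" and f: "\<guillemotleft>f : P \<rightarrow> Z\<guillemotright>" "phantom f"
  shows "f = Zero T P Z"
proof -
  have Q: "is_coproduct T I Y P \<iota>" and Y: "\<And>i. i \<in> I \<Longrightarrow> Y i \<in> A"
    using P by (auto simp: cellular_def)
  show ?thesis
  proof (rule coproduct_ext[OF Q f(1)])
    show "\<guillemotleft>Zero T P Z : P \<rightarrow> Z\<guillemotright>"
      using f(1) by (auto simp: in_hom_iff)
    show "f \<cdot> \<iota> i = Zero T P Z \<cdot> \<iota> i" if i: "i \<in> I" for i
      using phantomD[OF f(2,1) Y[OF i] is_coproductD(2)[OF Q i]] is_coproductD(2)[OF Q i] f(1)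
      by (auto simp: in_hom_iff)
  qed
qed

text \<open>
  A map that is surjective on \<open>T\<^sup>\<alpha>\<close> has a phantom cone map and its fibre is injective on \<open>T\<^sup>\<alpha>\<close>, because
  \<open>T\<^sup>\<alpha>\<close> is closed under suspension.
\<close>

lemma A_surjective_phantom:
  assumes tri: "exact_triangle T K P X k p v" and p: "surjective_on A p"
  shows "phantom v"
    and "x \<in> A \<Longrightarrow> \<guillemotleft>t : x \<rightarrow> K\<guillemotright> \<Longrightarrow> k \<cdot> t = Zero T x P \<Longrightarrow> t = Zero T x K"
proof -
  note [simp] = in_homD(1-5)[OF triD(1)[OF tri]] in_homD(1-5)[OF triD(2)[OF tri]] in_homD(1-5)[OF triD(3)[OF tri]]
  show ph: "phantom v"
    unfolding phantom_def
  proof (intro ballI allI impI)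
    fix x h assume x: "x \<in> A" and "\<guillemotleft>h : x \<rightarrow> dom v\<guillemotright>"
    then have h: "\<guillemotleft>h : x \<rightarrow> X\<guillemotright>" by simp
    obtain k' where k': "\<guillemotleft>k' : x \<rightarrow> P\<guillemotright>" "p \<cdot> k' = h"
      using surjective_onD[OF p triD(2)[OF tri] x h] .
    note [simp] = in_homD(1-5)[OF k'(1)]
    have "v \<cdot> h = (v \<cdot> p) \<cdot> k'"
      by (simp add: comp_assoc k'(2))
    then show "v \<cdot> h = Zero T x (cod v)"
      by (simp add: tri_comp_zero3[OF tri])
  qed
  assume x: "x \<in> A" and t: "\<guillemotleft>t : x \<rightarrow> K\<guillemotright>" and kt: "k \<cdot> t = Zero T x P"
  note [simp] = in_homD(1-5)[OF t]
  have "ShA T k \<cdot> ShA T t = ShA T (k \<cdot> t)"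
    by simp
  then have "ShA T k \<cdot> ShA T t = Zero T (ShO T x) (ShO T P)"
    by (simp add: kt del: ShA_comp)
  then obtain s where s: "\<guillemotleft>s : ShO T x \<rightarrow> X\<guillemotright>" "ShA T t = v \<cdot> s"
    using tri_liftS[OF tri ShA_in_hom[OF t]] by blast
  then have "ShA T t = ShA T (Zero T x K)"
    using phantomD[OF ph triD(3)[OF tri] A_ShO[OF x] s(1)] by simp
  then show "t = Zero T x K"
    by (rule ShA_eqD[OF _ t]) (simp add: in_hom_iff)
qed

text \<open>The functor \<open>S\<^sub>\<alpha>\<close> reflects isomorphisms, since \<open>T\<^sup>\<alpha>\<close> contains the generators.\<close>

lemma A_bijective_iso:
  assumes f: "\<guillemotleft>f : X \<rightarrow> Y\<guillemotright>" and surj: "surjective_on A f"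
    and inj: "\<And>x t. x \<in> A \<Longrightarrow> \<guillemotleft>t : x \<rightarrow> X\<guillemotright> \<Longrightarrow> f \<cdot> t = Zero T x Y \<Longrightarrow> t = Zero T x X"
  shows "is_iso T X Y f"
proof -
  obtain Z g h where tri: "exact_triangle T X Y Z f g h"
    using cone_exists[OF f] .
  obtain \<S> where \<S>: "\<S> \<subseteq> A" and zero: "generating \<S>"
    by (rule generators) (rule that)
  note [simp] = in_homD(1-5)[OF triD(1)[OF tri]] in_homD(1-5)[OF triD(2)[OF tri]] in_homD(1-5)[OF triD(3)[OF tri]]
  have "is_zero_object T Z"
  proof (rule zero[unfolded generating_def, rule_format])
    fix S t assume "S \<in> \<S>" and t: "\<guillemotleft>t : S \<rightarrow> Z\<guillemotright>"
    then have S: "S \<in> A" using \<S> by blast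
    obtain x d c where x: "x \<in> A" and d: "\<guillemotleft>d : ShO T x \<rightarrow> S\<guillemotright>" and c: "\<guillemotleft>c : S \<rightarrow> ShO T x\<guillemotright>"
      and dc: "d \<cdot> c = Idt T S"
      by (rule A_desuspension[OF S]) (rule that)
    note [simp] = in_homD(1-5)[OF t] in_homD(1-5)[OF d] in_homD(1-5)[OF c]
    have htd: "\<guillemotleft>h \<cdot> (t \<cdot> d) : ShO T x \<rightarrow> ShO T X\<guillemotright>"
      by (simp add: in_hom_iff)
    have X_Ob: "X \<in> Ob T" by simp
    obtain s where s: "\<guillemotleft>s : x \<rightarrow> X\<guillemotright>" "ShA T s = h \<cdot> (t \<cdot> d)"
      using ShA_full[OF htd A_Ob[OF x] X_Ob] .
    note [simp] = in_homD(1-5)[OF s(1)]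
    have "ShA T (f \<cdot> s) = (ShA T f \<cdot> h) \<cdot> (t \<cdot> d)"
      by (simp add: s(2) comp_assoc)
    also have "\<dots> = ShA T (Zero T x Y)"
      by (simp add: tri_comp_zeroS[OF tri])
    finally have "f \<cdot> s = Zero T x Y"
      by (rule ShA_eqD[of _ _ x Y]) (auto simp: in_hom_iff)
    then have "s = Zero T x X"
      by (rule inj[OF x s(1)])
    then have "h \<cdot> (t \<cdot> d) = Zero T (ShO T x) (ShO T X)"
      using s(2) A_Ob[OF x] by simp
    then have "(h \<cdot> (t \<cdot> d)) \<cdot> c = Zero T S (ShO T X)"
      by simp
    then have "h \<cdot> t = Zero T S (ShO T X)"
      by (simp add: comp_assoc dc)
    then obtain y where y: "\<guillemotleft>y : S \<rightarrow> Y\<guillemotright>" "t = g \<cdot> y"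
      using tri_lift3[OF tri t] by blast
    obtain z where z: "\<guillemotleft>z : S \<rightarrow> X\<guillemotright>" "f \<cdot> z = y"
      using surjective_onD[OF surj f S y(1)] .
    note [simp] = in_homD(1-5)[OF z(1)]
    have "t = (g \<cdot> f) \<cdot> z"
      by (simp add: y(2) z(2) comp_assoc)
    then show "t = Zero T S Z"
      by (simp add: tri_comp_zero[OF tri])
  qed simp
  then show ?thesis
    by (rule cone_zero_iso[OF tri])
qed

end

section \<open>The category of modules\<close>

context category
begin

subsection \<open>Presheaves and their morphisms\<close>

lemma ab_presheafD:
  assumes "ab_presheaf U C F"
  shows "X \<in> Ob C \<Longrightarrow> comm_group (PO F X)" and "X \<in> Ob C \<Longrightarrow> small U (carrier (PO F X))"
    and "\<guillemotleft>f : X \<rightarrow> Y\<guillemotright> \<Longrightarrow> PA F f \<in> hom (PO F Y) (PO F X)"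
    and "X \<in> Ob C \<Longrightarrow> x \<in> carrier (PO F X) \<Longrightarrow> PA F (Idt C X) x = x"
    and "\<guillemotleft>f : X \<rightarrow> Y\<guillemotright> \<Longrightarrow> \<guillemotleft>g : Y \<rightarrow> Z\<guillemotright> \<Longrightarrow> z \<in> carrier (PO F Z) \<Longrightarrow> PA F (g \<cdot> f) z = PA F f (PA F g z)"
  using assms unfolding ab_presheaf_def in_hom_def by blast+

lemma ab_presheafI:
  assumes "\<And>X. X \<in> Ob C \<Longrightarrow> comm_group (PO F X)" and "\<And>X. X \<in> Ob C \<Longrightarrow> small U (carrier (PO F X))"
    and "\<And>f X Y. \<guillemotleft>f : X \<rightarrow> Y\<guillemotright> \<Longrightarrow> PA F f \<in> hom (PO F Y) (PO F X)"
    and "\<And>X x. X \<in> Ob C \<Longrightarrow> x \<in> carrier (PO F X) \<Longrightarrow> PA F (Idt C X) x = x"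
    and "\<And>f g X Y Z z. \<guillemotleft>f : X \<rightarrow> Y\<guillemotright> \<Longrightarrow> \<guillemotleft>g : Y \<rightarrow> Z\<guillemotright> \<Longrightarrow> z \<in> carrier (PO F Z) \<Longrightarrow>
      PA F (g \<cdot> f) z = PA F f (PA F g z)"
  shows "ab_presheaf U C F"
  using assms unfolding ab_presheaf_def in_hom_def by simp

lemma PA_closed:
  assumes "ab_presheaf U C F" "\<guillemotleft>f : X \<rightarrow> Y\<guillemotright>" "y \<in> carrier (PO F Y)"
  shows "PA F f y \<in> carrier (PO F X)"
  using ab_presheafD(3)[OF assms(1,2)] assms(3) by (auto simp: hom_def)

lemma PA_mult:
  assumes "ab_presheaf U C F" "\<guillemotleft>f : X \<rightarrow> Y\<guillemotright>" "y \<in> carrier (PO F Y)" "z \<in> carrier (PO F Y)"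
  shows "PA F f (y \<otimes>\<^bsub>PO F Y\<^esub> z) = PA F f y \<otimes>\<^bsub>PO F X\<^esub> PA F f z"
  using ab_presheafD(3)[OF assms(1,2)] assms(3,4) by (auto simp: hom_def)

lemma comm_group_hom_one:
  assumes "comm_group G" "comm_group H" "h \<in> hom G H" shows "h \<one>\<^bsub>G\<^esub> = \<one>\<^bsub>H\<^esub>"
  using hom_one[OF assms(3)] assms(1,2) by (simp add: comm_group_def)

lemma PA_one:
  assumes "ab_presheaf U C F" "\<guillemotleft>f : X \<rightarrow> Y\<guillemotright>"
  shows "PA F f \<one>\<^bsub>PO F Y\<^esub> = \<one>\<^bsub>PO F X\<^esub>"
  using comm_group_hom_one[OF ab_presheafD(1)[OF assms(1)] ab_presheafD(1)[OF assms(1)] ab_presheafD(3)[OF assms]]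
    in_homD(4,5)[OF assms(2)] by blast

definition component :: "('o, 'm) presheaf_map \<Rightarrow> 'o \<Rightarrow> 'm \<Rightarrow> 'm" where
  "component f = fst (snd f)"

definition presheaf_map :: "('o, 'm) presheaf \<Rightarrow> ('o \<Rightarrow> 'm \<Rightarrow> 'm) \<Rightarrow> ('o, 'm) presheaf \<Rightarrow> ('o, 'm) presheaf_map" where
  "presheaf_map F \<tau> G = (F, \<lambda>X\<in>Ob C. \<lambda>x\<in>carrier (PO F X). \<tau> X x, G)"

lemma component_presheaf_map [simp]:
  "X \<in> Ob C \<Longrightarrow> x \<in> carrier (PO F X) \<Longrightarrow> component (presheaf_map F \<tau> G) X x = \<tau> X x"
  by (simp add: component_def presheaf_map_def)

lemma presheaf_HomD:
  assumes "f \<in> presheaf_Hom C F G"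
  shows "X \<in> Ob C \<Longrightarrow> component f X \<in> hom (PO F X) (PO G X)"
    and "X \<in> Ob C \<Longrightarrow> x \<in> carrier (PO F X) \<Longrightarrow> component f X x \<in> carrier (PO G X)"
    and "X \<in> Ob C \<Longrightarrow> x \<in> carrier (PO F X) \<Longrightarrow> y \<in> carrier (PO F X) \<Longrightarrow>
      component f X (x \<otimes>\<^bsub>PO F X\<^esub> y) = component f X x \<otimes>\<^bsub>PO G X\<^esub> component f X y"
    and "\<guillemotleft>h : X \<rightarrow> Y\<guillemotright> \<Longrightarrow> y \<in> carrier (PO F Y) \<Longrightarrow> component f X (PA F h y) = PA G h (component f Y y)"
    and "f = presheaf_map F (component f) G"
proof -
  obtain \<tau> where f: "f = (F, \<tau>, G)" and \<tau>: "\<tau> \<in> (\<Pi>\<^sub>E X\<in>Ob C. hom (PO F X) (PO G X) \<inter> extensional (carrier (PO F X)))"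
    and nat: "\<forall>X\<in>Ob C. \<forall>Y\<in>Ob C. \<forall>h\<in>Hom C X Y. \<forall>x\<in>carrier (PO F Y). \<tau> X (PA F h x) = PA G h (\<tau> Y x)"
    using assms unfolding presheaf_Hom_def by blast
  have hom: "\<tau> X \<in> hom (PO F X) (PO G X)" "\<tau> X \<in> extensional (carrier (PO F X))" if "X \<in> Ob C" for X
    using \<tau> that by (auto dest: PiE_mem)
  show "X \<in> Ob C \<Longrightarrow> component f X \<in> hom (PO F X) (PO G X)"
    using hom by (simp add: f component_def)
  show "X \<in> Ob C \<Longrightarrow> x \<in> carrier (PO F X) \<Longrightarrow> component f X x \<in> carrier (PO G X)"
    "X \<in> Ob C \<Longrightarrow> x \<in> carrier (PO F X) \<Longrightarrow> y \<in> carrier (PO F X) \<Longrightarrow>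
      component f X (x \<otimes>\<^bsub>PO F X\<^esub> y) = component f X x \<otimes>\<^bsub>PO G X\<^esub> component f X y"
    using hom(1)[of X] by (auto simp: f component_def hom_def)
  show "\<guillemotleft>h : X \<rightarrow> Y\<guillemotright> \<Longrightarrow> y \<in> carrier (PO F Y) \<Longrightarrow> component f X (PA F h y) = PA G h (component f Y y)"
    using nat by (simp add: f component_def in_hom_def)
  have "\<tau> = (\<lambda>X\<in>Ob C. \<lambda>x\<in>carrier (PO F X). \<tau> X x)"
  proof (rule ext)
    show "\<tau> X = (\<lambda>X\<in>Ob C. \<lambda>x\<in>carrier (PO F X). \<tau> X x) X" for X
    proof (cases "X \<in> Ob C")
      case True
      then show ?thesis
        using extensional_restrict[OF hom(2)] by simp
    next
      case False
      then show ?thesis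
        using PiE_arb[OF \<tau> False] by simp
    qed
  qed
  then show "f = presheaf_map F (component f) G"
    by (simp add: f component_def presheaf_map_def)
qed

lemma presheaf_HomI:
  assumes F: "ab_presheaf U C F" and hom: "\<And>X. X \<in> Ob C \<Longrightarrow> \<tau> X \<in> hom (PO F X) (PO G X)"
    and nat: "\<And>h X Y y. \<guillemotleft>h : X \<rightarrow> Y\<guillemotright> \<Longrightarrow> y \<in> carrier (PO F Y) \<Longrightarrow> \<tau> X (PA F h y) = PA G h (\<tau> Y y)"
  shows "presheaf_map F \<tau> G \<in> presheaf_Hom C F G"
proof -
  have "restrict (\<tau> X) (carrier (PO F X)) \<in> hom (PO F X) (PO G X)" if X: "X \<in> Ob C" for X
  proof -
    interpret comm_group "PO F X" using ab_presheafD(1)[OF F X] .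
    show ?thesis
      using hom[OF X] by (auto simp: hom_def)
  qed
  then have "(\<lambda>X\<in>Ob C. \<lambda>x\<in>carrier (PO F X). \<tau> X x) \<in>
      (\<Pi>\<^sub>E X\<in>Ob C. hom (PO F X) (PO G X) \<inter> extensional (carrier (PO F X)))"
    by simp
  moreover have "\<forall>X\<in>Ob C. \<forall>Y\<in>Ob C. \<forall>f\<in>Hom C X Y. \<forall>x\<in>carrier (PO F Y).
      (\<lambda>X\<in>Ob C. \<lambda>x\<in>carrier (PO F X). \<tau> X x) X (PA F f x) =
      PA G f ((\<lambda>X\<in>Ob C. \<lambda>x\<in>carrier (PO F X). \<tau> X x) Y x)"
  proof (intro ballI)
    fix X Y f x assume XY: "X \<in> Ob C" "Y \<in> Ob C" and "f \<in> Hom C X Y" and x: "x \<in> carrier (PO F Y)"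
    then have f: "\<guillemotleft>f : X \<rightarrow> Y\<guillemotright>"
      by (simp add: in_hom_def)
    show "(\<lambda>X\<in>Ob C. \<lambda>x\<in>carrier (PO F X). \<tau> X x) X (PA F f x) =
        PA G f ((\<lambda>X\<in>Ob C. \<lambda>x\<in>carrier (PO F X). \<tau> X x) Y x)"
      using nat[OF f x] PA_closed[OF F f x] XY x by simp
  qed
  ultimately show ?thesis
    unfolding presheaf_Hom_def presheaf_map_def by blast
qed

lemma presheaf_Hom_ext:
  assumes f: "f \<in> presheaf_Hom C F G" and g: "g \<in> presheaf_Hom C F G"
    and eq: "\<And>X x. X \<in> Ob C \<Longrightarrow> x \<in> carrier (PO F X) \<Longrightarrow> component f X x = component g X x"
  shows "f = g"
proof -
  have "presheaf_map F (component f) G = presheaf_map F (component g) G"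
    unfolding presheaf_map_def using eq by (simp cong: restrict_cong)
  then show ?thesis
    using presheaf_HomD(5)[OF f] presheaf_HomD(5)[OF g] by simp
qed

lemma Mod_simps [simp]:
  "Ob (Mod_alpha \<alpha> C) = {F. ab_presheaf TYPE('u) C F \<and> preserves_alpha_products (\<alpha> :: 'u rel) C F}"
  "Hom (Mod_alpha \<alpha> C) = presheaf_Hom C"
  by (simp_all add: Mod_alpha_def)

lemma Mod_Idt: "Idt (Mod_alpha \<alpha> C) F = presheaf_map F (\<lambda>_ x. x) F"
  by (simp add: Mod_alpha_def presheaf_map_def)

lemma Mod_Cmp:
  assumes "f \<in> presheaf_Hom C F G" "g \<in> presheaf_Hom C G H"
  shows "g \<cdot>\<^bsub>Mod_alpha \<alpha> C\<^esub> f = presheaf_map F (\<lambda>X x. component g X (component f X x)) H"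
  using assms unfolding presheaf_Hom_def by (auto simp: Mod_alpha_def presheaf_map_def component_def)

lemma Mod_Add:
  assumes "f \<in> presheaf_Hom C F G" "g \<in> presheaf_Hom C F G"
  shows "Add (Mod_alpha \<alpha> C) f g = presheaf_map F (\<lambda>X x. component f X x \<otimes>\<^bsub>PO G X\<^esub> component g X x) G"
  using assms unfolding presheaf_Hom_def by (auto simp: Mod_alpha_def presheaf_map_def component_def)

lemma component_Add:
  assumes "f \<in> presheaf_Hom C F G" "g \<in> presheaf_Hom C F G" "X \<in> Ob C" "x \<in> carrier (PO F X)"
  shows "component (Add (Mod_alpha \<alpha> C) f g) X x = component f X x \<otimes>\<^bsub>PO G X\<^esub> component g X x"
  using assms(3,4) by (simp add: Mod_Add[OF assms(1,2)])

lemma Mod_Zero: "Zero (Mod_alpha \<alpha> C) F G = presheaf_map F (\<lambda>X x. \<one>\<^bsub>PO G X\<^esub>) G"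
  by (simp add: Mod_alpha_def presheaf_map_def)

lemma Mod_Idt_in: "ab_presheaf U C F \<Longrightarrow> presheaf_map F (\<lambda>_ x. x) F \<in> presheaf_Hom C F F"
  by (rule presheaf_HomI) (auto simp: hom_def)

lemma Mod_Cmp_in:
  assumes "ab_presheaf U C F" "f \<in> presheaf_Hom C F G" "g \<in> presheaf_Hom C G H"
  shows "g \<cdot>\<^bsub>Mod_alpha \<alpha> C\<^esub> f \<in> presheaf_Hom C F H"
  unfolding Mod_Cmp[OF assms(2,3)]
proof (rule presheaf_HomI[OF assms(1)])
  show "(\<lambda>x. component g X (component f X x)) \<in> hom (PO F X) (PO H X)" if X: "X \<in> Ob C" for X
    using presheaf_HomD(2,3)[OF assms(2) X] presheaf_HomD(2,3)[OF assms(3) X] by (auto simp: hom_def)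
  show "component g X (component f X (PA F h y)) = PA H h (component g Y (component f Y y))"
    if "\<guillemotleft>h : X \<rightarrow> Y\<guillemotright>" "y \<in> carrier (PO F Y)" for h X Y y
    using presheaf_HomD(4)[OF assms(2) that]
      presheaf_HomD(4)[OF assms(3) that(1) presheaf_HomD(2)[OF assms(2) in_homD(5)[OF that(1)] that(2)]] by simp
qed

lemma component_Cmp:
  assumes "f \<in> presheaf_Hom C F G" "g \<in> presheaf_Hom C G H" "X \<in> Ob C" "x \<in> carrier (PO F X)"
  shows "component (g \<cdot>\<^bsub>Mod_alpha \<alpha> C\<^esub> f) X x = component g X (component f X x)"
  using assms(3,4) by (simp add: Mod_Cmp[OF assms(1,2)])

lemma Mod_Zero_in:
  assumes "ab_presheaf U C F" "ab_presheaf U C G"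
  shows "presheaf_map F (\<lambda>X x. \<one>\<^bsub>PO G X\<^esub>) G \<in> presheaf_Hom C F G"
proof (rule presheaf_HomI[OF assms(1)])
  show "(\<lambda>x. \<one>\<^bsub>PO G X\<^esub>) \<in> hom (PO F X) (PO G X)" if "X \<in> Ob C" for X
  proof -
    interpret comm_group "PO G X" using ab_presheafD(1)[OF assms(2) that] .
    show ?thesis by (auto simp: hom_def)
  qed
qed (simp add: PA_one[OF assms(2)])

lemma Mod_Add_in:
  assumes "ab_presheaf U C F" "ab_presheaf U C G" "f \<in> presheaf_Hom C F G" "g \<in> presheaf_Hom C F G"
  shows "Add (Mod_alpha \<alpha> C) f g \<in> presheaf_Hom C F G"
  unfolding Mod_Add[OF assms(3,4)]
proof (rule presheaf_HomI[OF assms(1)])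
  show "(\<lambda>x. component f X x \<otimes>\<^bsub>PO G X\<^esub> component g X x) \<in> hom (PO F X) (PO G X)" if "X \<in> Ob C" for X
  proof -
    interpret comm_group "PO G X" using ab_presheafD(1)[OF assms(2) that] .
    show ?thesis
      using hom_group_mult presheaf_HomD(1)[OF assms(3) that] presheaf_HomD(1)[OF assms(4) that] by blast
  qed
  show "component f X (PA F h y) \<otimes>\<^bsub>PO G X\<^esub> component g X (PA F h y) =
      PA G h (component f Y y \<otimes>\<^bsub>PO G Y\<^esub> component g Y y)"
    if "\<guillemotleft>h : X \<rightarrow> Y\<guillemotright>" "y \<in> carrier (PO F Y)" for h X Y y
    using presheaf_HomD(4)[OF assms(3) that] presheaf_HomD(4)[OF assms(4) that]
      PA_mult[OF assms(2) that(1) presheaf_HomD(2)[OF assms(3) in_homD(5)[OF that(1)] that(2)]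
        presheaf_HomD(2)[OF assms(4) in_homD(5)[OF that(1)] that(2)]] by simp
qed

lemma Mod_hom_group:
  assumes F: "ab_presheaf U C F" and G: "ab_presheaf U C G"
  shows "comm_group (hom_group (Mod_alpha \<alpha> C) F G)"
proof (rule comm_groupI)
  let ?H = "hom_group (Mod_alpha \<alpha> C) F G"
  have [simp]: "carrier ?H = presheaf_Hom C F G" "x \<otimes>\<^bsub>?H\<^esub> y = Add (Mod_alpha \<alpha> C) x y"
    "\<one>\<^bsub>?H\<^esub> = presheaf_map F (\<lambda>X x. \<one>\<^bsub>PO G X\<^esub>) G" for x y
    by (simp_all add: hom_group_def Mod_Zero)
  have one: "presheaf_map F (\<lambda>X x. \<one>\<^bsub>PO G X\<^esub>) G \<in> presheaf_Hom C F G"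
    by (rule Mod_Zero_in[OF F G])
  note ext = presheaf_Hom_ext[where F = F and G = G]
  note cl = Mod_Add_in[OF F G] and add = component_Add[where F = F and G = G]
  show "x \<otimes>\<^bsub>?H\<^esub> y \<in> carrier ?H" if "x \<in> carrier ?H" "y \<in> carrier ?H" for x y
    using that Mod_Add_in[OF F G] by simp
  show "\<one>\<^bsub>?H\<^esub> \<in> carrier ?H"
    using one by simp
  show "x \<otimes>\<^bsub>?H\<^esub> y \<otimes>\<^bsub>?H\<^esub> z = x \<otimes>\<^bsub>?H\<^esub> (y \<otimes>\<^bsub>?H\<^esub> z)"
    if "x \<in> carrier ?H" "y \<in> carrier ?H" "z \<in> carrier ?H" for x y z
    using that by (auto intro!: ext simp: add cl presheaf_HomD(2) comm_groupE(3)[OF ab_presheafD(1)[OF G]])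
  show "x \<otimes>\<^bsub>?H\<^esub> y = y \<otimes>\<^bsub>?H\<^esub> x" if "x \<in> carrier ?H" "y \<in> carrier ?H" for x y
    using that by (auto intro!: ext simp: add cl presheaf_HomD(2) comm_groupE(4)[OF ab_presheafD(1)[OF G]])
  show "\<one>\<^bsub>?H\<^esub> \<otimes>\<^bsub>?H\<^esub> x = x" if "x \<in> carrier ?H" for x
    using that by (auto intro!: ext simp: add cl one presheaf_HomD(2) comm_groupE(5)[OF ab_presheafD(1)[OF G]])
  show "\<exists>y\<in>carrier ?H. y \<otimes>\<^bsub>?H\<^esub> x = \<one>\<^bsub>?H\<^esub>" if "x \<in> carrier ?H" for x
  proof -
    have x: "x \<in> presheaf_Hom C F G" using that by simp
    let ?y = "presheaf_map F (\<lambda>X a. inv\<^bsub>PO G X\<^esub> component x X a) G"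
    have y: "?y \<in> presheaf_Hom C F G"
    proof (rule presheaf_HomI[OF F])
      fix X assume X: "X \<in> Ob C"
      interpret comm_group "PO G X" using ab_presheafD(1)[OF G X] .
      show "(\<lambda>a. inv\<^bsub>PO G X\<^esub> component x X a) \<in> hom (PO F X) (PO G X)"
        using presheaf_HomD(2,3)[OF x X] by (auto simp: hom_def inv_mult)
    next
      fix h X Y a assume h: "\<guillemotleft>h : X \<rightarrow> Y\<guillemotright>" and a: "a \<in> carrier (PO F Y)"
      have XY: "X \<in> Ob C" "Y \<in> Ob C" using h by (auto simp: in_hom_iff)
      interpret GX: comm_group "PO G X" using ab_presheafD(1)[OF G XY(1)] .
      interpret GY: comm_group "PO G Y" using ab_presheafD(1)[OF G XY(2)] .
      interpret group_hom "PO G Y" "PO G X" "PA G h"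
        using ab_presheafD(3)[OF G h] by unfold_locales
      show "inv\<^bsub>PO G X\<^esub> component x X (PA F h a) = PA G h (inv\<^bsub>PO G Y\<^esub> component x Y a)"
        using presheaf_HomD(2)[OF x XY(2) a] presheaf_HomD(4)[OF x h a] by simp
    qed
    have inv: "inv\<^bsub>PO G X\<^esub> z \<otimes>\<^bsub>PO G X\<^esub> z = \<one>\<^bsub>PO G X\<^esub>" if "X \<in> Ob C" "z \<in> carrier (PO G X)" for X z
      using ab_presheafD(1)[OF G that(1)] that(2) by (simp add: comm_group_def group.l_inv)
    have "Add (Mod_alpha \<alpha> C) ?y x = presheaf_map F (\<lambda>X x. \<one>\<^bsub>PO G X\<^esub>) G"
      using x y by (auto intro!: ext simp: add cl one presheaf_HomD(2) inv)
    then show ?thesis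
      using y by auto
  qed
qed

lemma Mod_preadditive: "preadditive (Mod_alpha (\<alpha> :: 'u rel) C)"
proof -
  let ?M = "Mod_alpha \<alpha> C"
  note ext = presheaf_Hom_ext
  show ?thesis
  proof (intro preadditive.intro category.intro preadditive_axioms.intro)
    show "X = X' \<and> Y = Y'" if "f \<in> Hom ?M X Y" "f \<in> Hom ?M X' Y'" for f X Y X' Y'
      using that by (auto simp: presheaf_Hom_def)
    show "Idt ?M X \<in> Hom ?M X X" if "X \<in> Ob ?M" for X
      using that by (auto simp: Mod_Idt Mod_Idt_in)
    show "g \<cdot>\<^bsub>?M\<^esub> f \<in> Hom ?M X Z" if "X \<in> Ob ?M" "f \<in> Hom ?M X Y" "g \<in> Hom ?M Y Z" for X Y Z f g
      using that by (auto intro: Mod_Cmp_in)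
    show "(h \<cdot>\<^bsub>?M\<^esub> g) \<cdot>\<^bsub>?M\<^esub> f = h \<cdot>\<^bsub>?M\<^esub> (g \<cdot>\<^bsub>?M\<^esub> f)"
      if "W \<in> Ob ?M" "X \<in> Ob ?M" "f \<in> Hom ?M W X" "g \<in> Hom ?M X Y" "h \<in> Hom ?M Y Z" for W X Y Z f g h
    proof -
      have fgh: "f \<in> presheaf_Hom C W X" "g \<in> presheaf_Hom C X Y" "h \<in> presheaf_Hom C Y Z"
          "ab_presheaf TYPE('u) C W" "ab_presheaf TYPE('u) C X"
        using that by auto
      note gf = Mod_Cmp_in[OF fgh(4,1,2), where \<alpha> = \<alpha>] and hg = Mod_Cmp_in[OF fgh(5,2,3), where \<alpha> = \<alpha>]
      show ?thesis
      proof (rule ext[OF Mod_Cmp_in[OF fgh(4,1) hg] Mod_Cmp_in[OF fgh(4) gf fgh(3)]])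
        fix V v assume v: "V \<in> Ob C" "v \<in> carrier (PO W V)"
        show "component ((h \<cdot>\<^bsub>?M\<^esub> g) \<cdot>\<^bsub>?M\<^esub> f) V v = component (h \<cdot>\<^bsub>?M\<^esub> (g \<cdot>\<^bsub>?M\<^esub> f)) V v"
          using v presheaf_HomD(2)[OF fgh(1) v]
          by (simp add: component_Cmp[OF fgh(1) hg] component_Cmp[OF gf fgh(3)] component_Cmp[OF fgh(1,2)]
              component_Cmp[OF fgh(2,3)])
      qed
    qed
    show "Idt ?M Y \<cdot>\<^bsub>?M\<^esub> f = f" if "X \<in> Ob ?M" "Y \<in> Ob ?M" "f \<in> Hom ?M X Y" for X Y f
    proof -
      have f: "f \<in> presheaf_Hom C X Y" "ab_presheaf TYPE('u) C X" "ab_presheaf TYPE('u) C Y"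
        using that by auto
      note Id = Mod_Idt_in[OF f(3)]
      show ?thesis
        unfolding Mod_Idt
        by (rule ext[OF Mod_Cmp_in[OF f(2,1) Id] f(1)])
          (simp add: component_Cmp[OF f(1) Id] presheaf_HomD(2)[OF f(1)])
    qed
    show "f \<cdot>\<^bsub>?M\<^esub> Idt ?M X = f" if "X \<in> Ob ?M" "Y \<in> Ob ?M" "f \<in> Hom ?M X Y" for X Y f
    proof -
      have f: "f \<in> presheaf_Hom C X Y" "ab_presheaf TYPE('u) C X"
        using that by auto
      note Id = Mod_Idt_in[OF f(2)]
      show ?thesis
        unfolding Mod_Idt
        by (rule ext[OF Mod_Cmp_in[OF f(2) Id f(1)] f(1)]) (simp add: component_Cmp[OF Id f(1)])
    qed
    show "comm_group (hom_group ?M X Y)" if "X \<in> Ob ?M" "Y \<in> Ob ?M" for X Y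
      using that by (auto intro: Mod_hom_group)
    show "Add ?M g g' \<cdot>\<^bsub>?M\<^esub> f = Add ?M (g \<cdot>\<^bsub>?M\<^esub> f) (g' \<cdot>\<^bsub>?M\<^esub> f)"
      if "X \<in> Ob ?M" "Y \<in> Ob ?M" "Z \<in> Ob ?M" "f \<in> Hom ?M X Y" "g \<in> Hom ?M Y Z" "g' \<in> Hom ?M Y Z" for X Y Z f g g'
    proof -
      have f: "f \<in> presheaf_Hom C X Y" "g \<in> presheaf_Hom C Y Z" "g' \<in> presheaf_Hom C Y Z"
          "ab_presheaf TYPE('u) C X" "ab_presheaf TYPE('u) C Y" "ab_presheaf TYPE('u) C Z"
        using that by auto
      note g = Mod_Add_in[OF f(5,6,2,3), where \<alpha> = \<alpha>]
      note c = Mod_Cmp_in[OF f(4,1,2), where \<alpha> = \<alpha>] Mod_Cmp_in[OF f(4,1,3), where \<alpha> = \<alpha>]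
      show ?thesis
        by (rule ext[OF Mod_Cmp_in[OF f(4,1) g] Mod_Add_in[OF f(4,6) c]])
          (simp add: component_Cmp[OF f(1) g] component_Add[OF f(2,3)] component_Add[OF c] component_Cmp[OF f(1,2)]
            component_Cmp[OF f(1,3)] presheaf_HomD(2)[OF f(1)])
    qed
    show "g \<cdot>\<^bsub>?M\<^esub> Add ?M f f' = Add ?M (g \<cdot>\<^bsub>?M\<^esub> f) (g \<cdot>\<^bsub>?M\<^esub> f')"
      if "X \<in> Ob ?M" "Y \<in> Ob ?M" "Z \<in> Ob ?M" "f \<in> Hom ?M X Y" "f' \<in> Hom ?M X Y" "g \<in> Hom ?M Y Z" for X Y Z f f' g
    proof -
      have f: "f \<in> presheaf_Hom C X Y" "f' \<in> presheaf_Hom C X Y" "g \<in> presheaf_Hom C Y Z"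
          "ab_presheaf TYPE('u) C X" "ab_presheaf TYPE('u) C Y" "ab_presheaf TYPE('u) C Z"
        using that by auto
      note a = Mod_Add_in[OF f(4,5,1,2), where \<alpha> = \<alpha>]
      note c = Mod_Cmp_in[OF f(4,1,3), where \<alpha> = \<alpha>] Mod_Cmp_in[OF f(4,2,3), where \<alpha> = \<alpha>]
      show ?thesis
        by (rule ext[OF Mod_Cmp_in[OF f(4) a f(3)] Mod_Add_in[OF f(4,6) c]])
          (simp add: component_Cmp[OF a f(3)] component_Add[OF f(1,2)] component_Add[OF c] component_Cmp[OF f(1,3)]
            component_Cmp[OF f(2,3)] presheaf_HomD(2)[OF f(1)] presheaf_HomD(2)[OF f(2)] presheaf_HomD(3)[OF f(3)])
    qed
  qed
qed

subsection \<open>Products\<close>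

lemma preserves_iff:
  assumes F: "ab_presheaf TYPE('u) C F"
  shows "preserves_alpha_products (\<alpha> :: 'u rel) C F \<longleftrightarrow>
    (\<forall>(I :: 'u set) X P \<iota>. |I| <o \<alpha> \<longrightarrow> is_coproduct C I X P \<iota> \<longrightarrow>
      (\<forall>x\<in>carrier (PO F P). \<forall>y\<in>carrier (PO F P). (\<forall>i\<in>I. PA F (\<iota> i) x = PA F (\<iota> i) y) \<longrightarrow> x = y) \<and>
      (\<forall>t. (\<forall>i\<in>I. t i \<in> carrier (PO F (X i))) \<longrightarrow> (\<exists>x\<in>carrier (PO F P). \<forall>i\<in>I. PA F (\<iota> i) x = t i)))"
proof -
  have "(\<lambda>x. \<lambda>i\<in>I. PA F (\<iota> i) x) \<in> iso (PO F P) (product_group I (\<lambda>i. PO F (X i))) \<longleftrightarrow>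
      (\<forall>x\<in>carrier (PO F P). \<forall>y\<in>carrier (PO F P). (\<forall>i\<in>I. PA F (\<iota> i) x = PA F (\<iota> i) y) \<longrightarrow> x = y) \<and>
      (\<forall>t. (\<forall>i\<in>I. t i \<in> carrier (PO F (X i))) \<longrightarrow> (\<exists>x\<in>carrier (PO F P). \<forall>i\<in>I. PA F (\<iota> i) x = t i))"
      (is "?\<phi> \<in> _ \<longleftrightarrow> ?inj \<and> ?surj")
    if P: "is_coproduct C I X P \<iota>" for I :: "'u set" and X P \<iota>
  proof -
    note \<iota> = is_coproductD(2)[OF P]
    have hom: "?\<phi> \<in> hom (PO F P) (product_group I (\<lambda>i. PO F (X i)))"
      using PA_closed[OF F \<iota>] PA_mult[OF F \<iota>] by (auto simp: hom_def intro!: restrict_ext)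
    have "inj_on ?\<phi> (carrier (PO F P)) \<longleftrightarrow> ?inj"
      by (simp add: inj_on_def restrict_def fun_eq_iff) blast
    moreover have "?\<phi> ` carrier (PO F P) = (\<Pi>\<^sub>E i\<in>I. carrier (PO F (X i))) \<longleftrightarrow> ?surj"
    proof
      assume surj: "?\<phi> ` carrier (PO F P) = (\<Pi>\<^sub>E i\<in>I. carrier (PO F (X i)))"
      show ?surj
      proof (intro allI impI)
        fix t assume "\<forall>i\<in>I. t i \<in> carrier (PO F (X i))"
        then have "restrict t I \<in> ?\<phi> ` carrier (PO F P)"
          unfolding surj by auto
        then obtain x where x: "x \<in> carrier (PO F P)" "restrict t I = ?\<phi> x"
          by blast
        have "PA F (\<iota> i) x = t i" if "i \<in> I" for i
          using fun_cong[OF x(2), of i] that by simp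
        then show "\<exists>x\<in>carrier (PO F P). \<forall>i\<in>I. PA F (\<iota> i) x = t i"
          using x(1) by blast
      qed
    next
      assume surj: ?surj
      show "?\<phi> ` carrier (PO F P) = (\<Pi>\<^sub>E i\<in>I. carrier (PO F (X i)))"
      proof
        show "?\<phi> ` carrier (PO F P) \<subseteq> (\<Pi>\<^sub>E i\<in>I. carrier (PO F (X i)))"
          using hom by (auto simp: hom_def)
        show "(\<Pi>\<^sub>E i\<in>I. carrier (PO F (X i))) \<subseteq> ?\<phi> ` carrier (PO F P)"
        proof
          fix t assume t: "t \<in> (\<Pi>\<^sub>E i\<in>I. carrier (PO F (X i)))"
          have "\<forall>i\<in>I. t i \<in> carrier (PO F (X i))"
            using PiE_mem[OF t] by blast
          from surj[rule_format, OF this[rule_format]]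
          obtain x where x: "x \<in> carrier (PO F P)" "\<forall>i\<in>I. PA F (\<iota> i) x = t i"
            by blast
          have "?\<phi> x = t"
          proof (rule ext)
            show "?\<phi> x i = t i" for i
              using x(2) PiE_arb[OF t, of i] by (cases "i \<in> I") auto
          qed
          then show "t \<in> ?\<phi> ` carrier (PO F P)"
            using x(1) by blast
        qed
      qed
    qed
    ultimately show ?thesis
      using hom by (simp add: iso_def bij_betw_def)
  qed
  then show ?thesis
    unfolding preserves_alpha_products_def by simp
qed

lemma product_ext:
  assumes F: "ab_presheaf TYPE('u) C F" "preserves_alpha_products (\<alpha> :: 'u rel) C F"
    and I: "|I :: 'u set| <o \<alpha>" and P: "is_coproduct C I X P \<iota>"
    and x: "x \<in> carrier (PO F P)" and y: "y \<in> carrier (PO F P)" and eq: "\<And>i. i \<in> I \<Longrightarrow> PA F (\<iota> i) x = PA F (\<iota> i) y"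
  shows "x = y"
  using F(2)[unfolded preserves_iff[OF F(1)], rule_format, OF I P, THEN conjunct1, rule_format, OF x y] eq by blast

lemma product_exists:
  assumes F: "ab_presheaf TYPE('u) C F" "preserves_alpha_products (\<alpha> :: 'u rel) C F"
    and I: "|I :: 'u set| <o \<alpha>" and P: "is_coproduct C I X P \<iota>" and t: "\<And>i. i \<in> I \<Longrightarrow> t i \<in> carrier (PO F (X i))"
  obtains x where "x \<in> carrier (PO F P)" "\<And>i. i \<in> I \<Longrightarrow> PA F (\<iota> i) x = t i"
  using F(2)[unfolded preserves_iff[OF F(1)], rule_format, OF I P, THEN conjunct2, rule_format, of t] t that by blast

subsection \<open>Epimorphisms are surjective\<close>

text \<open>
  The cokernel of a morphism of modules is computed objectwise, because products of abelian groups
  are exact. A cokernel of an epimorphism vanishes. The elements of the quotient groups are chosen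
  as representatives of cosets, so that they have the required type.
\<close>

lemma epi_surjective:
  assumes e: "is_epi (Mod_alpha (\<alpha> :: 'u rel) C) F G e"
    and FG: "F \<in> Ob (Mod_alpha \<alpha> C)" "G \<in> Ob (Mod_alpha \<alpha> C)" and Y: "Y \<in> Ob C" and y: "y \<in> carrier (PO G Y)"
  shows "\<exists>x\<in>carrier (PO F Y). component e Y x = y"
proof -
  have F: "ab_presheaf TYPE('u) C F" "preserves_alpha_products \<alpha> C F"
    and G: "ab_presheaf TYPE('u) C G" "preserves_alpha_products \<alpha> C G"
    using FG by auto
  have e_in: "e \<in> presheaf_Hom C F G"
    using e by (simp add: is_epi_def)
  define H where "H X = component e X ` carrier (PO F X)" for X
  have H_sub: "subgroup (H X) (PO G X)" if "X \<in> Ob C" for X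
    using ab_presheafD(1)[OF F(1) that] ab_presheafD(1)[OF G(1) that] presheaf_HomD(1)[OF e_in that]
    unfolding H_def by (intro group_hom.img_is_subgroup)
      (simp add: comm_group_def group_hom_def group_hom_axioms_def)
  \<comment> \<open>The quotient of \<open>G\<close> by the image of \<open>e\<close>, with a chosen representative \<open>r X x\<close> for each coset.\<close>
  define r where "r X x = (SOME y. y \<in> x <#\<^bsub>PO G X\<^esub> H X)" for X x
  have r_coset: "r X x \<in> x <#\<^bsub>PO G X\<^esub> H X" if "X \<in> Ob C" "x \<in> carrier (PO G X)" for X x
  proof -
    interpret comm_group "PO G X" using ab_presheafD(1)[OF G(1) that(1)] .
    have "x \<in> x <#\<^bsub>PO G X\<^esub> H X"
      using subgroup.one_closed[OF H_sub[OF that(1)]] that(2) by (force simp: l_coset_def)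
    then show ?thesis
      unfolding r_def by (rule someI)
  qed
  have r_mult: "r X x = r X (x \<otimes>\<^bsub>PO G X\<^esub> h)" if X: "X \<in> Ob C" and x: "x \<in> carrier (PO G X)" and h: "h \<in> H X" for X x h
  proof -
    interpret comm_group "PO G X" using ab_presheafD(1)[OF G(1) X] .
    have "x \<otimes>\<^bsub>PO G X\<^esub> h \<in> x <#\<^bsub>PO G X\<^esub> H X"
      using h by (auto simp: l_coset_def)
    then have "x <#\<^bsub>PO G X\<^esub> H X = (x \<otimes>\<^bsub>PO G X\<^esub> h) <#\<^bsub>PO G X\<^esub> H X"
      using l_repr_independence[OF _ x H_sub[OF X]] by blast
    then show ?thesis
      by (simp add: r_def)
  qed
  have r_ex: "\<exists>h\<in>H X. r X x = x \<otimes>\<^bsub>PO G X\<^esub> h" if "X \<in> Ob C" "x \<in> carrier (PO G X)" for X x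
    using r_coset[OF that] by (auto simp: l_coset_def)
  have H_car: "h \<in> carrier (PO G X)" if "X \<in> Ob C" "h \<in> H X" for X h
    using subgroup.mem_carrier[OF H_sub] that by blast
  have r_closed: "r X x \<in> carrier (PO G X)" if X: "X \<in> Ob C" "x \<in> carrier (PO G X)" for X x
    using r_ex[OF X] H_car[OF X(1)] X comm_groupE(1)[OF ab_presheafD(1)[OF G(1) X(1)]] by fastforce
  have r_r: "r X (r X x \<otimes>\<^bsub>PO G X\<^esub> r X y) = r X (x \<otimes>\<^bsub>PO G X\<^esub> y)"
    if X: "X \<in> Ob C" and x: "x \<in> carrier (PO G X)" and y: "y \<in> carrier (PO G X)" for X x y
  proof -
    interpret comm_group "PO G X" using ab_presheafD(1)[OF G(1) X] .
    obtain h k where hk: "h \<in> H X" "k \<in> H X" "r X x = x \<otimes>\<^bsub>PO G X\<^esub> h" "r X y = y \<otimes>\<^bsub>PO G X\<^esub> k"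
      using r_ex[OF X x] r_ex[OF X y] by blast
    have car: "h \<in> carrier (PO G X)" "k \<in> carrier (PO G X)"
      using hk H_car[OF X] by auto
    have "r X x \<otimes>\<^bsub>PO G X\<^esub> r X y = (x \<otimes>\<^bsub>PO G X\<^esub> y) \<otimes>\<^bsub>PO G X\<^esub> (h \<otimes>\<^bsub>PO G X\<^esub> k)"
      using hk(3,4) x y car by (simp add: m_ac)
    then show ?thesis
      using r_mult[OF X _ subgroup.m_closed[OF H_sub[OF X] hk(1,2)], of "x \<otimes>\<^bsub>PO G X\<^esub> y"] x y by simp
  qed
  have PA_H: "PA G f h \<in> H X" if f: "\<guillemotleft>f : X \<rightarrow> Y\<guillemotright>" and h: "h \<in> H Y" for f X Y h
  proof -
    obtain x where x: "x \<in> carrier (PO F Y)" "h = component e Y x"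
      using h unfolding H_def by blast
    then show ?thesis
      using presheaf_HomD(4)[OF e_in f x(1)] PA_closed[OF F(1) f x(1)] unfolding H_def by force
  qed
  have r_PA: "r X (PA G f (r Y y)) = r X (PA G f y)" if f: "\<guillemotleft>f : X \<rightarrow> Y\<guillemotright>" and y: "y \<in> carrier (PO G Y)" for f X Y y
  proof -
    have XY: "X \<in> Ob C" "Y \<in> Ob C" using f by (auto simp: in_hom_iff)
    obtain h where h: "h \<in> H Y" "r Y y = y \<otimes>\<^bsub>PO G Y\<^esub> h"
      using r_ex[OF XY(2) y] by blast
    have "PA G f (r Y y) = PA G f y \<otimes>\<^bsub>PO G X\<^esub> PA G f h"
      using PA_mult[OF G(1) f y H_car[OF XY(2) h(1)]] h(2) by simp
    then show ?thesis
      using r_mult[OF XY(1) PA_closed[OF G(1) f y] PA_H[OF f h(1)]] by simp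
  qed
  have r_eqD: "\<exists>h\<in>H X. x = y \<otimes>\<^bsub>PO G X\<^esub> h" if X: "X \<in> Ob C" and x: "x \<in> carrier (PO G X)" and y: "y \<in> carrier (PO G X)"
      and eq: "r X x = r X y" for X x y
  proof -
    interpret comm_group "PO G X" using ab_presheafD(1)[OF G(1) X] .
    obtain h k where hk: "h \<in> H X" "k \<in> H X" "r X x = x \<otimes>\<^bsub>PO G X\<^esub> h" "r X y = y \<otimes>\<^bsub>PO G X\<^esub> k"
      using r_ex[OF X x] r_ex[OF X y] by blast
    have car: "h \<in> carrier (PO G X)" "k \<in> carrier (PO G X)"
      using hk H_car[OF X] by auto
    have "x = (x \<otimes>\<^bsub>PO G X\<^esub> h) \<otimes>\<^bsub>PO G X\<^esub> inv\<^bsub>PO G X\<^esub> h"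
      using x car by (simp add: m_assoc)
    also have "\<dots> = y \<otimes>\<^bsub>PO G X\<^esub> (k \<otimes>\<^bsub>PO G X\<^esub> inv\<^bsub>PO G X\<^esub> h)"
      using eq hk(3,4) y car by (simp add: m_assoc)
    finally show ?thesis
      using subgroup.m_closed[OF H_sub[OF X] hk(2) subgroup.m_inv_closed[OF H_sub[OF X] hk(1)]] by blast
  qed
  define Q where "Q = \<lparr>PO = \<lambda>X. \<lparr>carrier = r X ` carrier (PO G X),
      monoid.mult = \<lambda>a b. r X (a \<otimes>\<^bsub>PO G X\<^esub> b), one = r X \<one>\<^bsub>PO G X\<^esub>\<rparr>, PA = \<lambda>f a. r (dom f) (PA G f a)\<rparr>"
  have Q_simps: "carrier (PO Q X) = r X ` carrier (PO G X)" "a \<otimes>\<^bsub>PO Q X\<^esub> b = r X (a \<otimes>\<^bsub>PO G X\<^esub> b)"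
      "\<one>\<^bsub>PO Q X\<^esub> = r X \<one>\<^bsub>PO G X\<^esub>" "PA Q f a = r (dom f) (PA G f a)" for X a b f
    by (simp_all add: Q_def)
  have r_hom: "r X \<in> hom (PO G X) (PO Q X)" if "X \<in> Ob C" for X
    using r_r[OF that] by (auto simp: hom_def Q_simps)
  have Q: "ab_presheaf TYPE('u) C Q"
  proof (rule ab_presheafI)
    fix X assume X: "X \<in> Ob C"
    interpret comm_group "PO G X" using ab_presheafD(1)[OF G(1) X] .
    show "comm_group (PO Q X)"
      using hom_imp_img_comm_group[OF r_hom[OF X]] by (simp add: Q_def)
    show "small TYPE('u) (carrier (PO Q X))"
      using small_image[OF ab_presheafD(2)[OF G(1) X]] by (simp add: Q_simps)
    show "PA Q (Idt C X) a = a" if a: "a \<in> carrier (PO Q X)" for a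
    proof -
      obtain x where x: "x \<in> carrier (PO G X)" "a = r X x"
        using a by (auto simp: Q_simps)
      then show ?thesis
        using X r_PA[of "Idt C X" X X x] ab_presheafD(4)[OF G(1) X]
        by (simp add: Q_simps in_hom_iff)
    qed
  next
    fix f X Y assume f: "\<guillemotleft>f : X \<rightarrow> Y\<guillemotright>"
    have XY: "X \<in> Ob C" "Y \<in> Ob C" and [simp]: "dom f = X" using f by (auto simp: in_hom_iff)
    show "PA Q f \<in> hom (PO Q Y) (PO Q X)"
      unfolding hom_def
    proof (intro CollectI conjI ballI funcsetI)
      fix a assume "a \<in> carrier (PO Q Y)"
      then obtain x where x: "x \<in> carrier (PO G Y)" "a = r Y x"
        by (auto simp: Q_simps)
      show "PA Q f a \<in> carrier (PO Q X)"
        using PA_closed[OF G(1) f r_closed[OF XY(2) x(1)]] by (auto simp: Q_simps x(2))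
      fix b assume "b \<in> carrier (PO Q Y)"
      then obtain y where y: "y \<in> carrier (PO G Y)" "b = r Y y"
        by (auto simp: Q_simps)
      have xy: "x \<otimes>\<^bsub>PO G Y\<^esub> y \<in> carrier (PO G Y)"
        using comm_groupE(1)[OF ab_presheafD(1)[OF G(1) XY(2)]] x y by blast
      have "PA Q f (a \<otimes>\<^bsub>PO Q Y\<^esub> b) = r X (PA G f x \<otimes>\<^bsub>PO G X\<^esub> PA G f y)"
        using r_r[OF XY(2) x(1) y(1)] r_PA[OF f xy] PA_mult[OF G(1) f x(1) y(1)] by (simp add: Q_simps x(2) y(2))
      also have "\<dots> = PA Q f a \<otimes>\<^bsub>PO Q X\<^esub> PA Q f b"
        using r_r[OF XY(1) PA_closed[OF G(1) f x(1)] PA_closed[OF G(1) f y(1)]] r_PA[OF f x(1)] r_PA[OF f y(1)]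
        by (simp add: Q_simps x(2) y(2))
      finally show "PA Q f (a \<otimes>\<^bsub>PO Q Y\<^esub> b) = PA Q f a \<otimes>\<^bsub>PO Q X\<^esub> PA Q f b" .
    qed
  next
    fix f g X Y Z a assume f: "\<guillemotleft>f : X \<rightarrow> Y\<guillemotright>" and g: "\<guillemotleft>g : Y \<rightarrow> Z\<guillemotright>" and "a \<in> carrier (PO Q Z)"
    then obtain z where z: "z \<in> carrier (PO G Z)" "a = r Z z"
      by (auto simp: Q_simps)
    have gf: "\<guillemotleft>g \<cdot> f : X \<rightarrow> Z\<guillemotright>" and [simp]: "dom f = X" "dom g = Y" "dom (g \<cdot> f) = X"
      using comp_in_hom[OF g f] f g by (auto simp: in_hom_iff)
    have "PA Q (g \<cdot> f) a = r X (PA G f (PA G g z))"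
      using r_PA[OF gf z(1)] ab_presheafD(5)[OF G(1) f g z(1)] by (simp add: Q_simps z(2))
    moreover have "PA Q f (PA Q g a) = r X (PA G f (PA G g z))"
      using r_PA[OF g z(1)] r_PA[OF f PA_closed[OF G(1) g z(1)]] by (simp add: Q_simps z(2))
    ultimately show "PA Q (g \<cdot> f) a = PA Q f (PA Q g a)"
      by simp
  qed
  \<comment> \<open>If the components of two elements differ by elements of the image of \<open>e\<close>, preimages of these differences in
    \<open>F\<close> are the components of one element.\<close>
  have "preserves_alpha_products \<alpha> C Q"
    unfolding preserves_iff[OF Q]
  proof (intro allI impI conjI ballI)
    fix I :: "'u set" and X P \<iota>
    assume I: "|I| <o \<alpha>" and P: "is_coproduct C I X P \<iota>"
    note \<iota> = is_coproductD(2)[OF P] and P_Ob = is_coproductD(1)[OF P] and X_Ob = is_coproductD(3)[OF P]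
    have PA_Q: "PA Q (\<iota> i) (r P x) = r (X i) (PA G (\<iota> i) x)" if "i \<in> I" "x \<in> carrier (PO G P)" for i x
      using r_PA[OF \<iota>[OF that(1)] that(2)] in_homD(2)[OF \<iota>[OF that(1)]] by (simp add: Q_simps)
    {
      fix a b assume ab: "a \<in> carrier (PO Q P)" "b \<in> carrier (PO Q P)" "\<forall>i\<in>I. PA Q (\<iota> i) a = PA Q (\<iota> i) b"
      then obtain x y where x: "x \<in> carrier (PO G P)" "a = r P x" and y: "y \<in> carrier (PO G P)" "b = r P y"
        by (auto simp: Q_simps)
      have "\<exists>m\<in>carrier (PO F (X i)). PA G (\<iota> i) x = PA G (\<iota> i) y \<otimes>\<^bsub>PO G (X i)\<^esub> component e (X i) m" if i: "i \<in> I" for i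
        using r_eqD[OF X_Ob[OF i] PA_closed[OF G(1) \<iota>[OF i] x(1)] PA_closed[OF G(1) \<iota>[OF i] y(1)]]
          ab(3) i PA_Q[OF i x(1)] PA_Q[OF i y(1)] x(2) y(2) unfolding H_def by auto
      then obtain m where m: "\<And>i. i \<in> I \<Longrightarrow> m i \<in> carrier (PO F (X i))"
          "\<And>i. i \<in> I \<Longrightarrow> PA G (\<iota> i) x = PA G (\<iota> i) y \<otimes>\<^bsub>PO G (X i)\<^esub> component e (X i) (m i)"
        by metis
      obtain n where n: "n \<in> carrier (PO F P)" "\<And>i. i \<in> I \<Longrightarrow> PA F (\<iota> i) n = m i"
        using product_exists[OF F I P m(1)] by blast
      have en: "component e P n \<in> carrier (PO G P)"
        using presheaf_HomD(2)[OF e_in P_Ob n(1)] .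
      have "x = y \<otimes>\<^bsub>PO G P\<^esub> component e P n"
      proof (rule product_ext[OF G I P x(1)])
        show "y \<otimes>\<^bsub>PO G P\<^esub> component e P n \<in> carrier (PO G P)"
          using comm_groupE(1)[OF ab_presheafD(1)[OF G(1) P_Ob] y(1) en] .
        show "PA G (\<iota> i) x = PA G (\<iota> i) (y \<otimes>\<^bsub>PO G P\<^esub> component e P n)" if i: "i \<in> I" for i
          using m(2)[OF i] PA_mult[OF G(1) \<iota>[OF i] y(1) en] presheaf_HomD(4)[OF e_in \<iota>[OF i] n(1)] n(2)[OF i] by simp
      qed
      then show "a = b"
        using r_mult[OF P_Ob y(1), of "component e P n"] n(1) x(2) y(2) unfolding H_def by simp
    }
    fix t assume "\<forall>i\<in>I. t i \<in> carrier (PO Q (X i))"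
    then have "\<forall>i\<in>I. \<exists>s. s \<in> carrier (PO G (X i)) \<and> t i = r (X i) s"
      by (auto simp: Q_simps)
    then obtain s where s: "\<And>i. i \<in> I \<Longrightarrow> s i \<in> carrier (PO G (X i))" "\<And>i. i \<in> I \<Longrightarrow> t i = r (X i) (s i)"
      by metis
    obtain x where x: "x \<in> carrier (PO G P)" "\<And>i. i \<in> I \<Longrightarrow> PA G (\<iota> i) x = s i"
      using product_exists[OF G I P s(1)] by blast
    then show "\<exists>x\<in>carrier (PO Q P). \<forall>i\<in>I. PA Q (\<iota> i) x = t i"
      using PA_Q s(2) by (intro bexI[of _ "r P x"]) (auto simp: Q_simps)
  qed
  then have Q_Ob: "Q \<in> Ob (Mod_alpha \<alpha> C)"
    using Q by simp
  have \<pi>: "presheaf_map G r Q \<in> presheaf_Hom C G Q"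
    by (rule presheaf_HomI[OF G(1) r_hom]) (simp_all add: Q_simps r_PA in_hom_iff)
  have z: "presheaf_map G (\<lambda>X x. \<one>\<^bsub>PO Q X\<^esub>) Q \<in> presheaf_Hom C G Q"
    by (rule Mod_Zero_in[OF G(1) Q])
  have "presheaf_map G r Q \<cdot>\<^bsub>Mod_alpha \<alpha> C\<^esub> e = presheaf_map G (\<lambda>X x. \<one>\<^bsub>PO Q X\<^esub>) Q \<cdot>\<^bsub>Mod_alpha \<alpha> C\<^esub> e"
  proof (rule presheaf_Hom_ext[OF Mod_Cmp_in[OF F(1) e_in \<pi>] Mod_Cmp_in[OF F(1) e_in z]])
    fix X x assume X: "X \<in> Ob C" "x \<in> carrier (PO F X)"
    interpret comm_group "PO G X" using ab_presheafD(1)[OF G(1) X(1)] .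
    have ex: "component e X x \<in> H X" "component e X x \<in> carrier (PO G X)"
      using X(2) presheaf_HomD(2)[OF e_in X] unfolding H_def by auto
    have "r X (component e X x) = r X \<one>\<^bsub>PO G X\<^esub>"
      using r_mult[OF X(1) one_closed ex(1)] ex(2) by simp
    then show "component (presheaf_map G r Q \<cdot>\<^bsub>Mod_alpha \<alpha> C\<^esub> e) X x =
        component (presheaf_map G (\<lambda>X x. \<one>\<^bsub>PO Q X\<^esub>) Q \<cdot>\<^bsub>Mod_alpha \<alpha> C\<^esub> e) X x"
      using X ex(2) unfolding component_Cmp[OF e_in \<pi> X] component_Cmp[OF e_in z X] by (simp add: Q_simps)
  qed
  then have eq: "presheaf_map G r Q = presheaf_map G (\<lambda>X x. \<one>\<^bsub>PO Q X\<^esub>) Q"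
    using e \<pi> z Q_Ob unfolding is_epi_def by (metis Mod_simps(2))
  interpret comm_group "PO G Y" using ab_presheafD(1)[OF G(1) Y] .
  have "r Y y = r Y \<one>\<^bsub>PO G Y\<^esub>"
    using arg_cong[OF eq, of "\<lambda>f. component f Y y"] Y y by (simp add: Q_simps)
  then obtain h where "h \<in> H Y" "y = \<one>\<^bsub>PO G Y\<^esub> \<otimes>\<^bsub>PO G Y\<^esub> h"
    using r_eqD[OF Y y one_closed] by blast
  then show ?thesis
    using H_car[OF Y] unfolding H_def by auto
qed

end

section \<open>Projective resolutions of length one\<close>

context category
begin

lemma projective_retract:
  assumes P: "projective C P" and s: "\<guillemotleft>s : X \<rightarrow> P\<guillemotright>" and r: "\<guillemotleft>r : P \<rightarrow> X\<guillemotright>" and rs: "r \<cdot> s = Idt C X"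
  shows "projective C X"
  unfolding projective_def
proof (intro conjI ballI allI impI)
  show "X \<in> Ob C" using in_homD(4)[OF s] .
  fix M N e f assume MN: "M \<in> Ob C" "N \<in> Ob C" and e: "is_epi C M N e" and "f \<in> Hom C X N"
  then have f: "\<guillemotleft>f : X \<rightarrow> N\<guillemotright>" and e_in: "\<guillemotleft>e : M \<rightarrow> N\<guillemotright>"
    using in_homD(4)[OF s] by (auto simp: in_hom_def is_epi_def)
  obtain g where "g \<in> Hom C P M" and eg: "e \<cdot> g = f \<cdot> r"
    using P MN e in_homD(6)[OF comp_in_hom[OF f r]] unfolding projective_def by blast
  then have g: "\<guillemotleft>g : P \<rightarrow> M\<guillemotright>"
    using in_homD(4)[OF r] MN by (simp add: in_hom_def)
  note [simp] = in_homD(1-5)[OF s] in_homD(1-5)[OF r] in_homD(1-5)[OF f] in_homD(1-5)[OF g] in_homD(1-5)[OF e_in]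
  have "e \<cdot> (g \<cdot> s) = (e \<cdot> g) \<cdot> s"
    by (simp add: comp_assoc)
  then have "e \<cdot> (g \<cdot> s) = f"
    by (simp add: eg comp_assoc rs)
  then show "\<exists>g\<in>Hom C X M. e \<cdot> g = f"
    using in_homD(6)[OF comp_in_hom[OF g s]] by blast
qed

lemma projectiveD:
  assumes "projective C P" "is_epi C M N e" "\<guillemotleft>e : M \<rightarrow> N\<guillemotright>" "\<guillemotleft>f : P \<rightarrow> N\<guillemotright>"
  obtains g where "\<guillemotleft>g : P \<rightarrow> M\<guillemotright>" "e \<cdot> g = f"
  using assms unfolding projective_def in_hom_def by blast

end

context preadditive
begin

lemma is_kernelD:
  assumes "is_kernel C K k X f Y" "X \<in> Ob C" "Y \<in> Ob C"
  shows "\<guillemotleft>k : K \<rightarrow> X\<guillemotright>" "\<guillemotleft>f : X \<rightarrow> Y\<guillemotright>" "f \<cdot> k = Zero C K Y"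
    and "\<guillemotleft>g : W \<rightarrow> X\<guillemotright> \<Longrightarrow> f \<cdot> g = Zero C W Y \<Longrightarrow> \<exists>!h. \<guillemotleft>h : W \<rightarrow> K\<guillemotright> \<and> k \<cdot> h = g"
  using assms unfolding is_kernel_def in_hom_def by simp_all

lemma kernel_lift:
  assumes "is_kernel C K k X f Y" "X \<in> Ob C" "Y \<in> Ob C" "\<guillemotleft>g : W \<rightarrow> X\<guillemotright>" "f \<cdot> g = Zero C W Y"
  obtains h where "\<guillemotleft>h : W \<rightarrow> K\<guillemotright>" "k \<cdot> h = g"
  using is_kernelD(4)[OF assms] by blast

lemma kernel_mono:
  assumes K: "is_kernel C K k X f Y" "X \<in> Ob C" "Y \<in> Ob C" and g: "\<guillemotleft>g : W \<rightarrow> K\<guillemotright>" and h: "\<guillemotleft>h : W \<rightarrow> K\<guillemotright>"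
    and eq: "k \<cdot> g = k \<cdot> h"
  shows "g = h"
proof -
  note k = is_kernelD[OF K]
  note [simp] = in_homD(1-5)[OF k(1)] in_homD(1-5)[OF k(2)] in_homD(1-5)[OF g]
  have "f \<cdot> (k \<cdot> g) = (f \<cdot> k) \<cdot> g"
    by (simp add: comp_assoc)
  then have "f \<cdot> (k \<cdot> g) = Zero C W Y"
    by (simp add: k(3))
  then show ?thesis
    using k(4)[OF comp_in_hom[OF k(1) g]] g h eq by metis
qed

lemma cokernel_epi:
  assumes "is_cokernel C X f Y q Q" "X \<in> Ob C" "Y \<in> Ob C"
  shows "is_epi C Y Q q"
  unfolding is_epi_def
proof (intro conjI ballI impI)
  have Q: "Q \<in> Ob C" "f \<in> Hom C X Y" "q \<in> Hom C Y Q" "q \<cdot> f = Zero C X Q"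
    and univ: "\<And>W g. W \<in> Ob C \<Longrightarrow> g \<in> Hom C Y W \<Longrightarrow> g \<cdot> f = Zero C X W \<Longrightarrow> \<exists>!h. h \<in> Hom C Q W \<and> h \<cdot> q = g"
    using assms(1) unfolding is_cokernel_def by blast+
  show "q \<in> Hom C Y Q" by fact
  fix Z g h assume Z: "Z \<in> Ob C" and g: "g \<in> Hom C Q Z" and h: "h \<in> Hom C Q Z" and eq: "g \<cdot> q = h \<cdot> q"
  have in_hom: "\<guillemotleft>f : X \<rightarrow> Y\<guillemotright>" "\<guillemotleft>q : Y \<rightarrow> Q\<guillemotright>" "\<guillemotleft>g : Q \<rightarrow> Z\<guillemotright>"
    using Q Z g assms by (auto simp: in_hom_def)
  note [simp] = in_homD(1-5)[OF in_hom(1)] in_homD(1-5)[OF in_hom(2)] in_homD(1-5)[OF in_hom(3)]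
  have "(g \<cdot> q) \<cdot> f = Zero C X Z"
    by (simp add: comp_assoc Q(4))
  then show "g = h"
    using univ[OF Z in_homD(6)[OF comp_in_hom[OF in_hom(3,2)]]] g h eq by metis
qed

text \<open>
  Schanuel's lemma: if \<open>M\<close> has a projective resolution of length one, then the kernel \<open>K\<^sub>1\<close> of any other
  map from a projective object onto \<open>M\<close> is a retract of a sum of projectives. The identity of \<open>K\<^sub>1\<close> is
  therefore a sum of maps through projectives, and lifts along epimorphisms onto \<open>K\<^sub>1\<close>.
\<close>

lemma schanuel_section:
  assumes K: "short_exact C K i P p M" "projective C P" "projective C K"
    and K\<^sub>1: "short_exact C K\<^sub>1 k P\<^sub>1 q M" "projective C P\<^sub>1"
    and \<pi>: "is_epi C P\<^sub>2 K\<^sub>1 \<pi>" "P\<^sub>2 \<in> Ob C"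
  obtains \<sigma> where "\<guillemotleft>\<sigma> : K\<^sub>1 \<rightarrow> P\<^sub>2\<guillemotright>" "\<pi> \<cdot> \<sigma> = Idt C K\<^sub>1"
proof -
  have Ob: "K \<in> Ob C" "P \<in> Ob C" "M \<in> Ob C" "K\<^sub>1 \<in> Ob C" "P\<^sub>1 \<in> Ob C"
    using assms by (auto simp: projective_def short_exact_def is_kernel_def is_cokernel_def)
  have ker: "is_kernel C K i P p M" and ker\<^sub>1: "is_kernel C K\<^sub>1 k P\<^sub>1 q M"
    and epi: "is_epi C P M p" and epi\<^sub>1: "is_epi C P\<^sub>1 M q"
    using K(1) K\<^sub>1(1) cokernel_epi Ob by (auto simp: short_exact_def)
  note i = is_kernelD(1)[OF ker Ob(2,3)] and p = is_kernelD(2)[OF ker Ob(2,3)]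
  note k = is_kernelD(1)[OF ker\<^sub>1 Ob(5,3)] and q = is_kernelD(2)[OF ker\<^sub>1 Ob(5,3)]
  have \<pi>_in: "\<guillemotleft>\<pi> : P\<^sub>2 \<rightarrow> K\<^sub>1\<guillemotright>"
    using \<pi> Ob by (simp add: is_epi_def in_hom_def)
  obtain l where l: "\<guillemotleft>l : P \<rightarrow> P\<^sub>1\<guillemotright>" "q \<cdot> l = p"
    using projectiveD[OF K(2) epi\<^sub>1 q p] .
  obtain m where m: "\<guillemotleft>m : P\<^sub>1 \<rightarrow> P\<guillemotright>" "p \<cdot> m = q"
    using projectiveD[OF K\<^sub>1(2) epi p q] .
  note [simp] = in_homD(1-5)[OF i] in_homD(1-5)[OF p] in_homD(1-5)[OF k] in_homD(1-5)[OF q] in_homD(1-5)[OF \<pi>_in]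
    in_homD(1-5)[OF l(1)] in_homD(1-5)[OF m(1)] \<pi>(2)
  have "q \<cdot> (l \<cdot> m) = (q \<cdot> l) \<cdot> m"
    by (simp add: comp_assoc)
  then have qlm: "q \<cdot> (l \<cdot> m) = q"
    by (simp add: l(2) m(2))
  \<comment> \<open>\<open>1 - l \<cdot> m\<close> and \<open>m \<cdot> k\<close> give maps \<open>P\<^sub>1 \<rightarrow> K\<^sub>1\<close> and \<open>K\<^sub>1 \<rightarrow> K\<close>.\<close>
  obtain n where n: "\<guillemotleft>n : P\<^sub>1 \<rightarrow> K\<^sub>1\<guillemotright>" "k \<cdot> n = Idt C P\<^sub>1 \<^bold>- l \<cdot> m"
    by (rule kernel_lift[OF ker\<^sub>1 Ob(5,3), of "Idt C P\<^sub>1 \<^bold>- l \<cdot> m"]) (auto simp: in_hom_iff comp_distrib qlm)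
  have "p \<cdot> (m \<cdot> k) = (p \<cdot> m) \<cdot> k"
    by (simp add: comp_assoc)
  then have "p \<cdot> (m \<cdot> k) = Zero C K\<^sub>1 M"
    by (simp add: m(2) is_kernelD(3)[OF ker\<^sub>1 Ob(5,3)])
  then obtain r where r: "\<guillemotleft>r : K\<^sub>1 \<rightarrow> K\<guillemotright>" "i \<cdot> r = m \<cdot> k"
    by (rule kernel_lift[OF ker Ob(2,3) comp_in_hom[OF m(1) k]]) (rule that)
  have "q \<cdot> (l \<cdot> i) = (q \<cdot> l) \<cdot> i"
    by (simp add: comp_assoc)
  then have "q \<cdot> (l \<cdot> i) = Zero C K M"
    by (simp add: l(2) is_kernelD(3)[OF ker Ob(2,3)])
  then obtain h where h: "\<guillemotleft>h : K \<rightarrow> K\<^sub>1\<guillemotright>" "k \<cdot> h = l \<cdot> i"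
    by (rule kernel_lift[OF ker\<^sub>1 Ob(5,3) comp_in_hom[OF l(1) i]]) (rule that)
  note [simp] = in_homD(1-5)[OF n(1)] in_homD(1-5)[OF r(1)] in_homD(1-5)[OF h(1)]
  \<comment> \<open>The identity of \<open>K\<^sub>1\<close> is a sum of one map through \<open>P\<^sub>1\<close> and one through \<open>K\<close>.\<close>
  have Id: "n \<cdot> k \<^bold>+ h \<cdot> r = Idt C K\<^sub>1"
  proof (rule kernel_mono[OF ker\<^sub>1 Ob(5,3)])
    have "k \<cdot> (n \<cdot> k \<^bold>+ h \<cdot> r) = (k \<cdot> n) \<cdot> k \<^bold>+ (k \<cdot> h) \<cdot> r"
      by (simp add: comp_distrib comp_assoc)
    also have "\<dots> = (k \<^bold>- l \<cdot> (m \<cdot> k)) \<^bold>+ l \<cdot> (m \<cdot> k)"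
      by (simp add: n(2) h(2) comp_distrib comp_assoc r(2))
    also have "\<dots> = k"
      by (rule add_diff_cancel(2)) auto
    finally show "k \<cdot> (n \<cdot> k \<^bold>+ h \<cdot> r) = k \<cdot> Idt C K\<^sub>1"
      by simp
  qed (auto simp: in_hom_iff)
  obtain n' where n': "\<guillemotleft>n' : P\<^sub>1 \<rightarrow> P\<^sub>2\<guillemotright>" "\<pi> \<cdot> n' = n"
    using projectiveD[OF K\<^sub>1(2) \<pi>(1) \<pi>_in n(1)] .
  obtain h' where h': "\<guillemotleft>h' : K \<rightarrow> P\<^sub>2\<guillemotright>" "\<pi> \<cdot> h' = h"
    using projectiveD[OF K(3) \<pi>(1) \<pi>_in h(1)] .
  note [simp] = in_homD(1-5)[OF n'(1)] in_homD(1-5)[OF h'(1)]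
  have "\<pi> \<cdot> (n' \<cdot> k \<^bold>+ h' \<cdot> r) = (\<pi> \<cdot> n') \<cdot> k \<^bold>+ (\<pi> \<cdot> h') \<cdot> r"
    by (simp add: comp_distrib comp_assoc)
  then have "\<pi> \<cdot> (n' \<cdot> k \<^bold>+ h' \<cdot> r) = Idt C K\<^sub>1"
    by (simp add: n'(2) h'(2) Id)
  then show ?thesis
    by (intro that[of "n' \<cdot> k \<^bold>+ h' \<cdot> r"]) (auto simp: in_hom_iff)
qed

end

section \<open>The functor \<open>S\<^sub>\<alpha>\<close>\<close>

context well_generated
begin

abbreviation TA where "TA \<equiv> alpha_subcategory \<alpha> T"
abbreviation Modules where "Modules \<equiv> Mod_alpha \<alpha> TA"

lemma TA_simps [simp]: "Ob TA = A" "Hom TA = Hom T" "Idt TA = Idt T" "Cmp TA = Cmp T"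
  by (simp_all add: alpha_subcategory_def full_subcategory_def)

lemma TA_category: "category TA"
proof (rule category.intro, unfold TA_simps)
  show "X = X' \<and> Y = Y'" if "X \<in> A" "Y \<in> A" "X' \<in> A" "Y' \<in> A" "f \<in> Hom T X Y" "f \<in> Hom T X' Y'" for X Y X' Y' f
    using Hom_disjoint[OF that(1-4)[THEN A_Ob] that(5,6)] .
  show "Idt T X \<in> Hom T X X" if "X \<in> A" for X
    using Idt_closed[OF A_Ob[OF that]] .
  show "g \<cdot> f \<in> Hom T X Z" if "X \<in> A" "Y \<in> A" "Z \<in> A" "f \<in> Hom T X Y" "g \<in> Hom T Y Z" for X Y Z f g
    using Cmp_closed[OF that(1-3)[THEN A_Ob] that(4,5)] .
  show "(h \<cdot> g) \<cdot> f = h \<cdot> (g \<cdot> f)"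
    if "W \<in> A" "X \<in> A" "Y \<in> A" "Z \<in> A" "f \<in> Hom T W X" "g \<in> Hom T X Y" "h \<in> Hom T Y Z" for W X Y Z f g h
    using Cmp_assoc[OF that(1-4)[THEN A_Ob] that(5-7)] .
  show "Idt T Y \<cdot> f = f" "f \<cdot> Idt T X = f" if "X \<in> A" "Y \<in> A" "f \<in> Hom T X Y" for X Y f
    using Cmp_Idt_left[OF that(1,2)[THEN A_Ob] that(3)] Cmp_Idt_right[OF that(1,2)[THEN A_Ob] that(3)] by auto
qed

interpretation TA: category TA
  by (rule TA_category)

lemma TA_in_hom: "TA.in_hom f x y \<longleftrightarrow> x \<in> A \<and> y \<in> A \<and> in_hom f x y"
  using A_Ob by (auto simp: TA.in_hom_def in_hom_def)

lemma in_TA: "in_hom f x y \<Longrightarrow> x \<in> A \<Longrightarrow> y \<in> A \<Longrightarrow> TA.in_hom f x y"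
  by (simp add: TA_in_hom)

lemma TA_coproduct:
  assumes "is_coproduct T I X P \<iota>" "P \<in> A" "\<And>i. i \<in> I \<Longrightarrow> X i \<in> A"
  shows "is_coproduct TA I X P \<iota>"
  using assms A_Ob unfolding is_coproduct_def by simp

text \<open>
  The inclusion of \<open>T\<^sup>\<alpha>\<close> preserves coproducts of fewer than \<open>\<alpha>\<close> objects, because the coproduct in \<open>T\<close> lies
  in \<open>T\<^sup>\<alpha>\<close>.
\<close>

lemma TA_coproductD:
  assumes P: "is_coproduct TA I X P \<iota>" and I: "|I| <o \<alpha>"
  shows "is_coproduct T I X P \<iota>"
proof -
  have X: "X i \<in> A" if "i \<in> I" for i
    using TA.is_coproductD(3)[OF P that] by simp
  have PA: "P \<in> A"
    using TA.is_coproductD(1)[OF P] by simp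
  obtain Q \<kappa> where Q: "is_coproduct T I X Q \<kappa>"
    by (rule coproduct_exists[OF small_less[OF I] A_Ob[OF X]]) (assumption, rule that)
  have QA: "Q \<in> A"
    using A_coproduct[OF I X Q] .
  have \<iota>: "in_hom (\<iota> i) (X i) P" if "i \<in> I" for i
    using TA.is_coproductD(2)[OF P that] by (simp add: TA_in_hom)
  note \<kappa> = is_coproductD(2)[OF Q]
  obtain h where h: "in_hom h Q P" "\<And>i. i \<in> I \<Longrightarrow> h \<cdot> \<kappa> i = \<iota> i"
    by (rule copair_exists[OF Q A_Ob[OF PA] \<iota>]) (assumption, rule that)
  obtain k where "TA.in_hom k P Q" and k\<iota>: "\<And>i. i \<in> I \<Longrightarrow> k \<cdot>\<^bsub>TA\<^esub> \<iota> i = \<kappa> i"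
    by (rule TA.copair_exists[OF P, of Q \<kappa>]) (use QA X \<kappa> in \<open>auto intro: in_TA\<close>)
  then have k: "in_hom k P Q" "\<And>i. i \<in> I \<Longrightarrow> k \<cdot> \<iota> i = \<kappa> i"
    by (auto simp: TA_in_hom)
  note [simp] = in_homD(1-5)[OF h(1)] in_homD(1-5)[OF k(1)] in_homD(1-4)[OF \<iota>] in_homD(1-4)[OF \<kappa>]
  have hk: "h \<cdot> k = Idt T P"
  proof (rule TA.coproduct_ext[OF P])
    show "TA.in_hom (h \<cdot> k) P P" "TA.in_hom (Idt T P) P P"
      using PA comp_in_hom[OF h(1) k(1)] by (auto intro!: in_TA simp: in_hom_iff)
    show "(h \<cdot> k) \<cdot>\<^bsub>TA\<^esub> \<iota> i = Idt T P \<cdot>\<^bsub>TA\<^esub> \<iota> i" if "i \<in> I" for i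
      using that by (simp add: comp_assoc h(2) k(2))
  qed
  show ?thesis
  proof (rule is_coproductI)
    show "in_hom (\<iota> i) (X i) P" if "i \<in> I" for i
      using \<iota>[OF that] .
    show "P \<in> Ob T" by (simp add: A_Ob PA)
    fix Z t assume Z: "Z \<in> Ob T" and t: "\<And>i. i \<in> I \<Longrightarrow> in_hom (t i) (X i) Z"
    obtain s where s: "in_hom s Q Z" "\<And>i. i \<in> I \<Longrightarrow> s \<cdot> \<kappa> i = t i"
      by (rule copair_exists[OF Q Z t]) (assumption, rule that)
    have "(s \<cdot> k) \<cdot> \<iota> i = t i" if "i \<in> I" for i
      using that in_homD(1-5)[OF s(1)] by (simp add: comp_assoc k(2) s(2))
    then show "\<exists>h. in_hom h P Z \<and> (\<forall>i\<in>I. h \<cdot> \<iota> i = t i)"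
      using comp_in_hom[OF s(1) k(1)] by blast
  next
    fix Z f g assume f: "in_hom f P Z" and g: "in_hom g P Z" and eq: "\<And>i. i \<in> I \<Longrightarrow> f \<cdot> \<iota> i = g \<cdot> \<iota> i"
    note [simp] = in_homD(1-5)[OF f] in_homD(1-5)[OF g]
    have "f \<cdot> h = g \<cdot> h"
      by (rule coproduct_ext[OF Q comp_in_hom[OF f h(1)] comp_in_hom[OF g h(1)]])
        (simp add: comp_assoc h(2) eq)
    then have "(f \<cdot> h) \<cdot> k = (g \<cdot> h) \<cdot> k"
      by simp
    then show "f = g"
      by (simp add: comp_assoc hk)
  qed
qed

lemma S_simps [simp]:
  "carrier (PO (S_alpha T X) x) = Hom T x X" "a \<otimes>\<^bsub>PO (S_alpha T X) x\<^esub> b = a \<^bold>+ b"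
  "\<one>\<^bsub>PO (S_alpha T X) x\<^esub> = Zero T x X" "PA (S_alpha T X) f h = h \<cdot> f"
  by (simp_all add: S_alpha_def hom_group_def)

lemma S_carrier: "x \<in> A \<Longrightarrow> X \<in> Ob T \<Longrightarrow> h \<in> Hom T x X \<longleftrightarrow> in_hom h x X"
  by (simp add: Hom_iff A_Ob)

lemma S_presheaf:
  assumes X: "X \<in> Ob T" shows "ab_presheaf TYPE('u) TA (S_alpha T X)"
proof (rule TA.ab_presheafI)
  show "comm_group (PO (S_alpha T X) x)" if "x \<in> Ob TA" for x
    using that hom_group[OF A_Ob X] by (simp add: S_alpha_def)
  show "small TYPE('u) (carrier (PO (S_alpha T X) x))" if "x \<in> Ob TA" for x
    using that small_Hom[OF A_Ob X] by simp
  show "PA (S_alpha T X) f \<in> hom (PO (S_alpha T X) y) (PO (S_alpha T X) x)" if "TA.in_hom f x y" for f x y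
    using that X comp_in_hom by (auto simp: TA_in_hom S_carrier hom_def in_hom_iff comp_add_left)
  show "PA (S_alpha T X) (Idt TA x) h = h" if "x \<in> Ob TA" "h \<in> carrier (PO (S_alpha T X) x)" for x h
    using that X by (simp add: S_carrier in_hom_iff)
  show "PA (S_alpha T X) (g \<cdot>\<^bsub>TA\<^esub> f) h = PA (S_alpha T X) f (PA (S_alpha T X) g h)"
    if "TA.in_hom f x y" "TA.in_hom g y z" "h \<in> carrier (PO (S_alpha T X) z)" for f g x y z h
    using that X by (simp add: TA_in_hom S_carrier in_hom_iff comp_assoc)
qed

lemma S_Mod:
  assumes X: "X \<in> Ob T" shows "S_alpha T X \<in> Ob Modules"
proof -
  have "preserves_alpha_products \<alpha> TA (S_alpha T X)"
    unfolding TA.preserves_iff[OF S_presheaf[OF X]]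
  proof (intro allI impI conjI ballI)
    fix I :: "'u set" and Y P \<iota>
    assume I: "|I| <o \<alpha>" and "is_coproduct TA I Y P \<iota>"
    then have P: "is_coproduct T I Y P \<iota>" and PA: "P \<in> A" and Y: "\<And>i. i \<in> I \<Longrightarrow> Y i \<in> A"
      using TA_coproductD TA.is_coproductD by auto
    show "a = b" if "a \<in> carrier (PO (S_alpha T X) P)" "b \<in> carrier (PO (S_alpha T X) P)"
      "\<forall>i\<in>I. PA (S_alpha T X) (\<iota> i) a = PA (S_alpha T X) (\<iota> i) b" for a b
      using that X PA by (intro coproduct_ext[OF P, of a X b]) (auto simp: S_carrier)
    fix t assume "\<forall>i\<in>I. t i \<in> carrier (PO (S_alpha T X) (Y i))"
    then have "in_hom (t i) (Y i) X" if "i \<in> I" for i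
      using that X Y by (simp add: S_carrier)
    then obtain h where "in_hom h P X" "\<And>i. i \<in> I \<Longrightarrow> h \<cdot> \<iota> i = t i"
      by (rule copair_exists[OF P X]) (assumption, rule that)
    then show "\<exists>h\<in>carrier (PO (S_alpha T X) P). \<forall>i\<in>I. PA (S_alpha T X) (\<iota> i) h = t i"
      using X PA by (intro bexI[of _ h]) (simp_all add: S_carrier)
  qed
  then show ?thesis
    using S_presheaf[OF X] by simp
qed

abbreviation S_map where "S_map \<equiv> S_alpha_map \<alpha> T"

lemma S_map_in:
  assumes f: "in_hom f X Y" shows "S_map X Y f \<in> presheaf_Hom TA (S_alpha T X) (S_alpha T Y)"
proof -
  have "S_map X Y f = TA.presheaf_map (S_alpha T X) (\<lambda>_ h. f \<cdot> h) (S_alpha T Y)"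
    by (simp add: S_alpha_map_def TA.presheaf_map_def)
  also have "\<dots> \<in> presheaf_Hom TA (S_alpha T X) (S_alpha T Y)"
  proof (rule TA.presheaf_HomI[OF S_presheaf[OF in_homD(4)[OF f]]])
    note [simp] = in_homD(1-5)[OF f]
    show "(\<lambda>h. f \<cdot> h) \<in> hom (PO (S_alpha T X) x) (PO (S_alpha T Y) x)" if "x \<in> Ob TA" for x
      using that by (auto simp: hom_def S_carrier in_hom_iff comp_add_right)
    show "f \<cdot> PA (S_alpha T X) h k = PA (S_alpha T Y) h (f \<cdot> k)"
      if "TA.in_hom h x y" "k \<in> carrier (PO (S_alpha T X) y)" for h k x y
      using that by (auto simp: TA_in_hom S_carrier in_hom_iff comp_assoc)
  qed
  finally show ?thesis .
qed

lemma S_map_component: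
  assumes "x \<in> A" "in_hom h x X" shows "TA.component (S_map X Y f) x h = f \<cdot> h"
  using assms in_homD(6)[OF assms(2)] by (simp add: S_alpha_map_def TA.component_def)

lemma S_HomD:
  assumes \<tau>: "\<tau> \<in> presheaf_Hom TA (S_alpha T X) F" and X: "X \<in> Ob T" and x: "x \<in> A" and h: "in_hom h x X"
  shows "TA.component \<tau> x h \<in> carrier (PO F x)"
    and "in_hom k x X \<Longrightarrow> TA.component \<tau> x (h \<^bold>+ k) = TA.component \<tau> x h \<otimes>\<^bsub>PO F x\<^esub> TA.component \<tau> x k"
    and "y \<in> A \<Longrightarrow> in_hom f y x \<Longrightarrow> TA.component \<tau> y (h \<cdot> f) = PA F f (TA.component \<tau> x h)"
  using TA.presheaf_HomD(2)[OF \<tau>, of x h] TA.presheaf_HomD(3)[OF \<tau>, of x h k] TA.presheaf_HomD(4)[OF \<tau>, of f y x h]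
    x h X by (auto simp: S_carrier TA_in_hom)

lemma S_Hom_ext:
  assumes "\<sigma> \<in> presheaf_Hom TA (S_alpha T X) F" "\<tau> \<in> presheaf_Hom TA (S_alpha T X) F" "X \<in> Ob T"
    and "\<And>x h. x \<in> A \<Longrightarrow> in_hom h x X \<Longrightarrow> TA.component \<sigma> x h = TA.component \<tau> x h"
  shows "\<sigma> = \<tau>"
  by (rule TA.presheaf_Hom_ext[OF assms(1,2)]) (use assms(3,4) in \<open>simp add: S_carrier\<close>)

subsection \<open>Modules are additive functors\<close>

text \<open>
  Additivity follows from the preservation of finite products: on \<open>z \<oplus> z\<close> the codiagonal acts by
  \<open>y \<mapsto> (y, y)\<close>, which is the sum of the actions of the two projections.
\<close>

lemma PA_add:
  assumes F: "F \<in> Ob Modules" and x: "x \<in> A" and z: "z \<in> A" and f: "in_hom f x z" and g: "in_hom g x z"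
    and y: "y \<in> carrier (PO F z)"
  shows "PA F (f \<^bold>+ g) y = PA F f y \<otimes>\<^bsub>PO F x\<^esub> PA F g y"
proof -
  have F: "ab_presheaf TYPE('u) TA F" "preserves_alpha_products \<alpha> TA F"
    using F by auto
  obtain N where N: "is_zero_object T N"
    using zero_object by blast
  have NA: "N \<in> A"
    using zero_object_A[OF N] .
  have zero: "PA F (Zero T z' z) y = \<one>\<^bsub>PO F z'\<^esub>" if z': "z' \<in> A" for z'
  proof -
    note [simp] = zero_objectD(1)[OF N] A_Ob[OF z] A_Ob[OF z']
    have a: "TA.in_hom (Zero T z' N) z' N" "TA.in_hom (Zero T N z) N z"
      using z z' NA zero_in_hom by (auto intro: in_TA)
    have empty: "is_coproduct TA {} (\<lambda>_. N) N (\<lambda>_. Idt T N)"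
    proof (rule TA_coproduct[OF is_coproductI NA])
      show "h = k" if "in_hom h N Z" "in_hom k N Z" for h k Z
        using zero_objectD(3)[OF N] that by metis
      show "\<exists>h. in_hom h N Z \<and> (\<forall>i\<in>{}. h \<cdot> Idt T N = t i)" if "Z \<in> Ob T" for Z t
        using zero_in_hom[OF zero_objectD(1)[OF N] that] by blast
    qed auto
    have "PA F (Zero T N z) y = \<one>\<^bsub>PO F N\<^esub>"
      by (rule TA.product_ext[OF F _ empty])
        (use TA.PA_closed[OF F(1) a(2) y] comm_groupE(2)[OF TA.ab_presheafD(1)[OF F(1)]] NA less_finite in auto)
    moreover have "Zero T z' z = Zero T N z \<cdot>\<^bsub>TA\<^esub> Zero T z' N"
      by simp
    ultimately show ?thesis
      using TA.ab_presheafD(5)[OF F(1) a y] TA.PA_one[OF F(1) a(1)] by simp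
  qed
  obtain R q where R': "is_coproduct T (UNIV :: bool set) (\<lambda>b. if b then z else z) R q"
    using sum_exists[OF A_Ob[OF z] A_Ob[OF z]] .
  have RA: "R \<in> A"
    by (rule A_coproduct[OF _ _ R']) (simp_all add: z less_finite)
  obtain J :: "'u set" and \<beta> where \<beta>: "bij_betw \<beta> J (UNIV :: bool set)"
    by (rule small_index[OF small_finite[OF universe, of "UNIV :: bool set"]]) simp
  have J: "|J| <o \<alpha>"
    using bij_betw_finite[OF \<beta>] by (simp add: less_finite)
  have R: "is_coproduct TA J (\<lambda>_. z) R (\<lambda>j. q (\<beta> j))"
    using TA_coproduct[OF coproduct_reindex[OF R' \<beta>] RA] z by simp
  have q: "in_hom (q b) z R" for b
    using is_coproductD(2)[OF R', of b] by simp
  have ex: "\<exists>h. in_hom h R z \<and> (\<forall>b. h \<cdot> q b = t b)" if "\<And>b. in_hom (t b) z z" for t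
    by (rule copair_exists[OF R' A_Ob[OF z], of t]) (use that in auto)
  have z_Ob: "z \<in> Ob T"
    using A_Ob[OF z] .
  obtain d where d: "in_hom d R z" "\<And>b. d \<cdot> q b = Idt T z"
    using ex[of "\<lambda>_. Idt T z"] z_Ob by (auto simp: in_hom_iff)
  have "\<exists>p. in_hom p R z \<and> (\<forall>b. p \<cdot> q b = (if b = c then Idt T z else Zero T z z))" for c
    using ex[of "\<lambda>b. if b = c then Idt T z else Zero T z z"] z_Ob by (auto simp: in_hom_iff)
  then obtain p where p: "\<And>c. in_hom (p c) R z" "\<And>c b. p c \<cdot> q b = (if b = c then Idt T z else Zero T z z)"
    by metis
  note [simp] = in_homD(1-5)[OF q] in_homD(1-5)[OF d(1)] in_homD(1-5)[OF p(1)] in_homD(1-5)[OF f] in_homD(1-5)[OF g]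
  note TAin = in_TA[OF q z RA] in_TA[OF d(1) RA z] in_TA[OF p(1) RA z] in_TA[OF f x z] in_TA[OF g x z]
  interpret GR: comm_group "PO F R" using TA.ab_presheafD(1)[OF F(1)] RA by simp
  interpret Gz: comm_group "PO F z" using TA.ab_presheafD(1)[OF F(1)] z by simp
  have py: "PA F (p c) y \<in> carrier (PO F R)" and dy: "PA F d y \<in> carrier (PO F R)" for c
    using TA.PA_closed[OF F(1) TAin(3) y] TA.PA_closed[OF F(1) TAin(2) y] by auto
  have qp: "PA F (q b) (PA F (p c) y) = (if b = c then y else \<one>\<^bsub>PO F z\<^esub>)" for b c
  proof -
    have "PA F (q b) (PA F (p c) y) = PA F (p c \<cdot> q b) y"
      using TA.ab_presheafD(5)[OF F(1) TAin(1) TAin(3) y] by simp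
    then show ?thesis
      unfolding p(2) using TA.ab_presheafD(4)[OF F(1) _ y] z zero[OF z] by simp
  qed
  have sum: "PA F d y = PA F (p True) y \<otimes>\<^bsub>PO F R\<^esub> PA F (p False) y"
  proof (rule TA.product_ext[OF F J R dy])
    fix j assume "j \<in> J"
    have "PA F (q (\<beta> j)) (PA F d y) = y"
      using TA.ab_presheafD(5)[OF F(1) TAin(1,2) y] TA.ab_presheafD(4)[OF F(1) _ y] z d(2) by simp
    then show "PA F (q (\<beta> j)) (PA F d y) = PA F (q (\<beta> j)) (PA F (p True) y \<otimes>\<^bsub>PO F R\<^esub> PA F (p False) y)"
      using TA.PA_mult[OF F(1) TAin(1) py py] qp y by (cases "\<beta> j") auto
  qed (use py in auto)
  let ?h = "q True \<cdot> f \<^bold>+ q False \<cdot> g"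
  have h: "TA.in_hom ?h x R"
    using x RA by (intro in_TA) (auto simp: in_hom_iff)
  have id: "Idt T z \<cdot> f = f" "Idt T z \<cdot> g = g" "Zero T z z \<cdot> f = Zero T x z" "Zero T z z \<cdot> g = Zero T x z"
    using z_Ob by auto
  have "d \<cdot> ?h = f \<^bold>+ g" "p True \<cdot> ?h = f" "p False \<cdot> ?h = g"
    using d(2) p(2) z_Ob by (auto simp: comp_distrib simp flip: comp_assoc)
  then show ?thesis
    using TA.ab_presheafD(5)[OF F(1) h TAin(2) y] TA.ab_presheafD(5)[OF F(1) h TAin(3) y, of True]
      TA.ab_presheafD(5)[OF F(1) h TAin(3) y, of False] TA.PA_mult[OF F(1) h py py] sum by simp
qed

subsection \<open>Modules of the form \<open>S\<^sub>\<alpha>(\<Coprod> Y\<^sub>i)\<close>\<close>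

text \<open>
  Every map from \<open>T\<^sup>\<alpha>\<close> to a coproduct of objects of \<open>T\<^sup>\<alpha>\<close> lives on the coproduct of fewer than \<open>\<alpha>\<close>
  summands, which is again in \<open>T\<^sup>\<alpha>\<close>. The coproduct of the summands in \<open>J\<close> is called a stage.
\<close>

definition stage where
  "stage P I Y \<iota> J R \<kappa> c r \<longleftrightarrow> is_coproduct T J Y R \<kappa> \<and> R \<in> A \<and> in_hom c R P \<and> (\<forall>i\<in>J. c \<cdot> \<kappa> i = \<iota> i) \<and>
     in_hom r P R \<and> r \<cdot> c = Idt T R \<and> coproduct_projection I Y P \<iota> J (c \<cdot> r)"

lemma cellularD:
  assumes "cellular P I Y \<iota>"
  shows "small TYPE('u) I" "is_coproduct T I Y P \<iota>" "P \<in> Ob T" "i \<in> I \<Longrightarrow> Y i \<in> A" "i \<in> I \<Longrightarrow> in_hom (\<iota> i) (Y i) P"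
  using assms is_coproductD(1,2) unfolding cellular_def by auto

lemma stage_exists:
  assumes P: "cellular P I Y \<iota>" and J: "J \<subseteq> I" "|J| <o \<alpha>"
  shows "\<exists>R \<kappa> c r. stage P I Y \<iota> J R \<kappa> c r"
proof -
  note Q = cellularD(2)[OF P]
  have Y: "Y i \<in> A" if "i \<in> J" for i
    using cellularD(4)[OF P] J(1) that by blast
  obtain R \<kappa> where R: "is_coproduct T J Y R \<kappa>"
    by (rule coproduct_exists[OF small_less[OF J(2)] A_Ob[OF Y]]) (assumption, rule that)
  obtain e where e: "coproduct_projection I Y P \<iota> J e"
    using projection_exists[OF Q] .
  obtain c r where "in_hom c R P" "\<And>i. i \<in> J \<Longrightarrow> c \<cdot> \<kappa> i = \<iota> i" "in_hom r P R" "c \<cdot> r = e" "r \<cdot> c = Idt T R"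
    by (rule projection_splits[OF Q J(1) R e]) (rule that)
  then show ?thesis
    using R e A_coproduct[OF J(2) Y R] unfolding stage_def by blast
qed

lemma stageD:
  assumes "stage P I Y \<iota> J R \<kappa> c r"
  shows "is_coproduct T J Y R \<kappa>" "R \<in> A" "in_hom c R P" "i \<in> J \<Longrightarrow> c \<cdot> \<kappa> i = \<iota> i" "in_hom r P R" "r \<cdot> c = Idt T R"
    "coproduct_projection I Y P \<iota> J (c \<cdot> r)" "i \<in> J \<Longrightarrow> in_hom (\<kappa> i) (Y i) R"
  using assms is_coproductD(2) unfolding stage_def by auto

lemma stage_fix:
  assumes P: "cellular P I Y \<iota>" and R: "stage P I Y \<iota> J R \<kappa> c r" and h: "in_hom h x P" "supported I Y P \<iota> J' h" "J' \<subseteq> J"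
  shows "c \<cdot> (r \<cdot> h) = h"
  using supportedD[OF cellularD(2)[OF P] stageD(7)[OF R] h] stageD(3,5)[OF R] h(1)
  by (simp add: in_hom_iff comp_assoc)

lemma cellular_support:
  assumes P: "cellular P I Y \<iota>" and x: "x \<in> A" and h: "in_hom h x P"
  obtains J where "J \<subseteq> I" "|J| <o \<alpha>" "supported I Y P \<iota> J h"
  using alpha_smallD[OF A_alpha_small[OF x] cellularD(1,2)[OF P] h] .

lemma stage_coproduct:
  assumes P: "cellular P I Y \<iota>" and J: "J \<subseteq> I" and R: "stage P I Y \<iota> J R \<kappa> c r"
  shows "is_coproduct TA J Y R \<kappa>"
  using TA_coproduct[OF stageD(1,2)[OF R]] cellularD(4)[OF P] J by blast

text \<open>
  A transformation on a stage \<open>R\<close> is an element of \<open>F(R)\<close> by Yoneda, and \<open>F\<close> takes the coproduct \<open>R\<close> to a product.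
\<close>

lemma cellular_ext:
  assumes P: "cellular P I Y \<iota>" and F: "F \<in> Ob Modules"
    and \<sigma>: "\<sigma> \<in> presheaf_Hom TA (S_alpha T P) F" and \<tau>: "\<tau> \<in> presheaf_Hom TA (S_alpha T P) F"
    and eq: "\<And>i. i \<in> I \<Longrightarrow> TA.component \<sigma> (Y i) (\<iota> i) = TA.component \<tau> (Y i) (\<iota> i)"
  shows "\<sigma> = \<tau>"
proof (rule S_Hom_ext[OF \<sigma> \<tau> cellularD(3)[OF P]])
  fix x h assume x: "x \<in> A" and h: "in_hom h x P"
  have FD: "ab_presheaf TYPE('u) TA F" "preserves_alpha_products \<alpha> TA F"
    using F by auto
  note P_Ob = cellularD(3)[OF P]
  obtain J where J: "J \<subseteq> I" "|J| <o \<alpha>" "supported I Y P \<iota> J h"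
    using cellular_support[OF P x h] .
  obtain R \<kappa> c r where R: "stage P I Y \<iota> J R \<kappa> c r"
    using stage_exists[OF P J(1,2)] by blast
  note c = stageD(3)[OF R] and RA = stageD(2)[OF R]
  have "TA.component \<sigma> R c = TA.component \<tau> R c"
  proof (rule TA.product_ext[OF FD J(2) stage_coproduct[OF P J(1) R] S_HomD(1)[OF \<sigma> P_Ob RA c] S_HomD(1)[OF \<tau> P_Ob RA c]])
    fix i assume i: "i \<in> J"
    then have Y: "Y i \<in> A" and "i \<in> I"
      using cellularD(4)[OF P] J(1) by auto
    then show "PA F (\<kappa> i) (TA.component \<sigma> R c) = PA F (\<kappa> i) (TA.component \<tau> R c)"
      using eq S_HomD(3)[OF \<sigma> P_Ob RA c Y stageD(8)[OF R i]] S_HomD(3)[OF \<tau> P_Ob RA c Y stageD(8)[OF R i]]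
        stageD(4)[OF R i] by simp
  qed
  moreover have "TA.component \<rho> x h = PA F (r \<cdot> h) (TA.component \<rho> R c)" if "\<rho> \<in> presheaf_Hom TA (S_alpha T P) F" for \<rho>
    using S_HomD(3)[OF that P_Ob RA c x comp_in_hom[OF stageD(5)[OF R] h]] stage_fix[OF P R h J(3)] by simp
  ultimately show "TA.component \<sigma> x h = TA.component \<tau> x h"
    using \<sigma> \<tau> by simp
qed

text \<open>
  On every stage \<open>R\<^sub>J\<close> the given values are the components of an element of \<open>F(R\<^sub>J)\<close>. A map \<open>h\<close> from \<open>T\<^sup>\<alpha>\<close> to the coproduct
  factors through a stage, where the value on \<open>h\<close> is prescribed by naturality. Any two stages are
  contained in a third, so that the value does not depend on the stage.
\<close>

lemma cellular_extend:
  assumes P: "cellular P I Y \<iota>" and F: "F \<in> Ob Modules" and m: "\<And>i. i \<in> I \<Longrightarrow> m i \<in> carrier (PO F (Y i))"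
  obtains \<tau> where "\<tau> \<in> presheaf_Hom TA (S_alpha T P) F" "\<And>i. i \<in> I \<Longrightarrow> TA.component \<tau> (Y i) (\<iota> i) = m i"
proof -
  have FD: "ab_presheaf TYPE('u) TA F" "preserves_alpha_products \<alpha> TA F"
    using F by auto
  note P_Ob = cellularD(3)[OF P] and Q = cellularD(2)[OF P]
  define \<J> where "\<J> = {J. J \<subseteq> I \<and> |J| <o \<alpha>}"
  have "\<exists>R \<kappa> c r y. stage P I Y \<iota> J R \<kappa> c r \<and> y \<in> carrier (PO F R) \<and> (\<forall>i\<in>J. PA F (\<kappa> i) y = m i)" if J: "J \<in> \<J>" for J
  proof -
    have J: "J \<subseteq> I" "|J| <o \<alpha>" using J by (auto simp: \<J>_def)
    obtain R \<kappa> c r where R: "stage P I Y \<iota> J R \<kappa> c r"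
      using stage_exists[OF P J] by blast
    have "m i \<in> carrier (PO F (Y i))" if "i \<in> J" for i
      using m J that by blast
    then obtain y where "y \<in> carrier (PO F R)" "\<And>i. i \<in> J \<Longrightarrow> PA F (\<kappa> i) y = m i"
      by (rule TA.product_exists[OF FD J(2) stage_coproduct[OF P J(1) R]]) (assumption, rule that)
    then show ?thesis
      using R by blast
  qed
  then have "\<forall>J\<in>\<J>. \<exists>R \<kappa> c r y. stage P I Y \<iota> J R \<kappa> c r \<and> y \<in> carrier (PO F R) \<and> (\<forall>i\<in>J. PA F (\<kappa> i) y = m i)" ..
  then obtain R \<kappa> c r y where D: "\<forall>J\<in>\<J>. stage P I Y \<iota> J (R J) (\<kappa> J) (c J) (r J) \<and> y J \<in> carrier (PO F (R J)) \<and>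
      (\<forall>i\<in>J. PA F (\<kappa> J i) (y J) = m i)"
    unfolding bchoice_iff by (elim exE)
  have R: "stage P I Y \<iota> J (R J) (\<kappa> J) (c J) (r J)" and y: "y J \<in> carrier (PO F (R J))"
    and ym: "\<And>i. i \<in> J \<Longrightarrow> PA F (\<kappa> J i) (y J) = m i" if "J \<in> \<J>" for J
    using D that by auto
  have TAr: "TA.in_hom (r J \<cdot> h) x (R J)" if "J \<in> \<J>" "x \<in> A" "in_hom h x P" for J x h
    by (rule in_TA[OF comp_in_hom[OF stageD(5)[OF R[OF that(1)]] that(3)] that(2) stageD(2)[OF R[OF that(1)]]])
  have mono: "PA F (r K \<cdot> h) (y K) = PA F (r J \<cdot> h) (y J)"
    if J: "J \<in> \<J>" and K: "K \<in> \<J>" "J \<subseteq> K" and x: "x \<in> A" and h: "in_hom h x P" and supp: "supported I Y P \<iota> J h" for J K x h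
  proof -
    note RJ = stageD[OF R[OF J]] and RK = stageD[OF R[OF K(1)]]
    note [simp] = in_homD(1-5)[OF RJ(3)] in_homD(1-5)[OF RJ(5)] in_homD(1-5)[OF RK(3)] in_homD(1-5)[OF RK(5)]
      in_homD(1-5)[OF h] in_homD(1-4)[OF RJ(8)] in_homD(1-4)[OF RK(8)]
    have J': "J \<subseteq> I" "|J| <o \<alpha>" using J by (auto simp: \<J>_def)
    let ?a = "r K \<cdot> c J"
    have a: "TA.in_hom ?a (R J) (R K)"
      using in_TA[OF comp_in_hom[OF RK(5) RJ(3)] RJ(2) RK(2)] .
    have "PA F ?a (y K) = y J"
    proof (rule TA.product_ext[OF FD J'(2) stage_coproduct[OF P J'(1) R[OF J]] TA.PA_closed[OF FD(1) a y[OF K(1)]] y[OF J]])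
      fix i assume i: "i \<in> J"
      then have iK: "i \<in> K" and Yi: "Y i \<in> A"
        using K(2) cellularD(4)[OF P] J'(1) by auto
      have "c K \<cdot> \<kappa> K i = c J \<cdot> \<kappa> J i"
        using RK(4)[OF iK] RJ(4)[OF i] by simp
      then have "?a \<cdot> \<kappa> J i = (r K \<cdot> c K) \<cdot> \<kappa> K i"
        using i iK by (simp add: comp_assoc)
      then have "?a \<cdot> \<kappa> J i = \<kappa> K i"
        using iK by (simp add: RK(6))
      then show "PA F (\<kappa> J i) (PA F ?a (y K)) = PA F (\<kappa> J i) (y J)"
        using TA.ab_presheafD(5)[OF FD(1) in_TA[OF RJ(8)[OF i] Yi RJ(2)] a y[OF K(1)]] ym[OF K(1) iK] ym[OF J i] by simp
    qed
    moreover have "r K \<cdot> h = ?a \<cdot> (r J \<cdot> h)"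
      using stage_fix[OF P R[OF J] h supp] by (simp add: comp_assoc)
    ultimately show ?thesis
      using TA.ab_presheafD(5)[OF FD(1) TAr[OF J x h] a y[OF K(1)]] by simp
  qed
  define val where "val h = (let J = (SOME J. J \<in> \<J> \<and> supported I Y P \<iota> J h) in PA F (r J \<cdot> h) (y J))" for h
  have val: "val h = PA F (r J \<cdot> h) (y J)" if J: "J \<in> \<J>" "supported I Y P \<iota> J h" and x: "x \<in> A" and h: "in_hom h x P" for J x h
  proof -
    define J' where "J' = (SOME J. J \<in> \<J> \<and> supported I Y P \<iota> J h)"
    have J': "J' \<in> \<J>" "supported I Y P \<iota> J' h"
      using someI[of "\<lambda>J. J \<in> \<J> \<and> supported I Y P \<iota> J h", OF conjI[OF J]] unfolding J'_def by auto
    have K: "J \<union> J' \<in> \<J>"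
      using J(1) J'(1) less_Un by (auto simp: \<J>_def)
    show ?thesis
      using mono[OF J(1) K _ x h J(2)] mono[OF J'(1) K _ x h J'(2)] by (simp add: val_def J'_def Let_def)
  qed
  have supp: "\<exists>J\<in>\<J>. supported I Y P \<iota> J h" if "x \<in> A" "in_hom h x P" for x h
    using cellular_support[OF P that] unfolding \<J>_def by blast
  have supp_mono: "supported I Y P \<iota> K h" if "supported I Y P \<iota> J h" "J \<subseteq> K" "in_hom h x P" for J K h x
  proof -
    obtain e where e: "coproduct_projection I Y P \<iota> K e"
      using projection_exists[OF Q] .
    then show ?thesis
      using supportedD[OF Q e that(3,1,2)] unfolding supported_def by blast
  qed
  have \<tau>: "TA.presheaf_map (S_alpha T P) (\<lambda>_. val) F \<in> presheaf_Hom TA (S_alpha T P) F"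
  proof (rule TA.presheaf_HomI[OF S_presheaf[OF P_Ob]])
    fix x assume "x \<in> Ob TA"
    then have x: "x \<in> A" by simp
    show "val \<in> hom (PO (S_alpha T P) x) (PO F x)"
      unfolding hom_def
    proof (intro CollectI conjI ballI funcsetI)
      fix h assume "h \<in> carrier (PO (S_alpha T P) x)"
      then have h: "in_hom h x P"
        using x P_Ob by (simp add: S_carrier)
      obtain J where J: "J \<in> \<J>" "supported I Y P \<iota> J h"
        using supp[OF x h] by blast
      show "val h \<in> carrier (PO F x)"
        unfolding val[OF J x h] by (rule TA.PA_closed[OF FD(1) TAr[OF J(1) x h] y[OF J(1)]])
      fix k assume "k \<in> carrier (PO (S_alpha T P) x)"
      then have k: "in_hom k x P"
        using x P_Ob by (simp add: S_carrier)
      obtain J' where J': "J' \<in> \<J>" "supported I Y P \<iota> J' k"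
        using supp[OF x k] by blast
      let ?K = "J \<union> J'"
      have K: "?K \<in> \<J>"
        using J(1) J'(1) less_Un by (auto simp: \<J>_def)
      have sh: "supported I Y P \<iota> ?K h" and sk: "supported I Y P \<iota> ?K k"
        using supp_mono[OF J(2) _ h] supp_mono[OF J'(2) _ k] by auto
      obtain e where e: "coproduct_projection I Y P \<iota> ?K e"
        using projection_exists[OF Q] .
      then have e_in: "in_hom e P P"
        by (simp add: coproduct_projection_def)
      note [simp] = in_homD(1-5)[OF h] in_homD(1-5)[OF k] in_homD(1-5)[OF e_in] in_homD(1-5)[OF stageD(5)[OF R[OF K]]]
      have "e \<cdot> (h \<^bold>+ k) = h \<^bold>+ k"
        using supportedD[OF Q e h sh order_refl] supportedD[OF Q e k sk order_refl] by (simp add: comp_distrib)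
      then have s: "supported I Y P \<iota> ?K (h \<^bold>+ k)"
        using e unfolding supported_def by blast
      have rhk: "r ?K \<cdot> (h \<^bold>+ k) = r ?K \<cdot> h \<^bold>+ r ?K \<cdot> k"
        by (simp add: comp_distrib)
      have "val (h \<^bold>+ k) = val h \<otimes>\<^bsub>PO F x\<^esub> val k"
        unfolding val[OF K s x add_in_hom[OF h k]] val[OF K sh x h] val[OF K sk x k] rhk
        using TAr[OF K x h] TAr[OF K x k] by (intro PA_add[OF F x stageD(2)[OF R[OF K]] _ _ y[OF K]]) (auto simp: TA_in_hom)
      then show "val (h \<otimes>\<^bsub>PO (S_alpha T P) x\<^esub> k) = val h \<otimes>\<^bsub>PO F x\<^esub> val k"
        by simp
    qed
  next
    fix f x z h assume f: "TA.in_hom f x z" and "h \<in> carrier (PO (S_alpha T P) z)"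
    then have x: "x \<in> A" "z \<in> A" and f': "in_hom f x z" and h: "in_hom h z P"
      using P_Ob by (auto simp: TA_in_hom S_carrier)
    obtain J where J: "J \<in> \<J>" "supported I Y P \<iota> J h"
      using supp[OF x(2) h] by blast
    obtain e where e: "coproduct_projection I Y P \<iota> J e" "e \<cdot> h = h"
      using J(2) unfolding supported_def by blast
    then have e_in: "in_hom e P P"
      by (simp add: coproduct_projection_def)
    note [simp] = in_homD(1-5)[OF h] in_homD(1-5)[OF f'] in_homD(1-5)[OF e_in] in_homD(1-5)[OF stageD(5)[OF R[OF J(1)]]]
    have "e \<cdot> (h \<cdot> f) = h \<cdot> f"
      using e(2) by (simp flip: comp_assoc)
    then have s: "supported I Y P \<iota> J (h \<cdot> f)"
      using e(1) unfolding supported_def by blast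
    have "val (h \<cdot> f) = PA F ((r J \<cdot> h) \<cdot>\<^bsub>TA\<^esub> f) (y J)"
      unfolding val[OF J(1) s x(1) comp_in_hom[OF h f']] by (simp add: comp_assoc)
    also have "\<dots> = PA F f (val h)"
      unfolding val[OF J x(2) h] by (rule TA.ab_presheafD(5)[OF FD(1) f TAr[OF J(1) x(2) h] y[OF J(1)]])
    finally show "val (PA (S_alpha T P) f h) = PA F f (val h)"
      by simp
  qed
  show ?thesis
  proof (rule that[OF \<tau>])
    fix i assume i: "i \<in> I"
    note Yi = cellularD(4)[OF P i] and \<iota>i = cellularD(5)[OF P i]
    have J: "{i} \<in> \<J>"
      unfolding \<J>_def using i less_finite[of "{i}"] by simp
    note RJ = stageD[OF R[OF J]]
    note [simp] = in_homD(1-5)[OF RJ(3)] in_homD(1-5)[OF RJ(5)] in_homD(1-5)[OF RJ(8)[OF singletonI]]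
    have s: "supported I Y P \<iota> {i} (\<iota> i)"
      using RJ(7) i unfolding supported_def coproduct_projection_def by auto
    have "r {i} \<cdot> \<iota> i = (r {i} \<cdot> c {i}) \<cdot> \<kappa> {i} i"
      using RJ(4)[OF singletonI] by (simp add: comp_assoc)
    then have "r {i} \<cdot> \<iota> i = \<kappa> {i} i"
      by (simp add: RJ(6))
    then have "val (\<iota> i) = m i"
      unfolding val[OF J s Yi \<iota>i] using ym[OF J singletonI] by simp
    then show "TA.component (TA.presheaf_map (S_alpha T P) (\<lambda>_. val) F) (Y i) (\<iota> i) = m i"
      using Yi \<iota>i P_Ob by (simp add: S_carrier)
  qed
qed

text \<open>
  A map out of \<open>S\<^sub>\<alpha>(\<Coprod> Y\<^sub>i)\<close> is a family of elements of the \<open>M(Y\<^sub>i)\<close>, and epimorphisms are surjective on elements.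
\<close>

lemma cellular_projective:
  assumes P: "cellular P I Y \<iota>" shows "projective Modules (S_alpha T P)"
  unfolding projective_def
proof (intro conjI ballI allI impI)
  show SP: "S_alpha T P \<in> Ob Modules"
    by (rule S_Mod[OF cellularD(3)[OF P]])
  fix M N e f assume M: "M \<in> Ob Modules" and N: "N \<in> Ob Modules" and e: "is_epi Modules M N e"
    and "f \<in> Hom Modules (S_alpha T P) N"
  then have f: "f \<in> presheaf_Hom TA (S_alpha T P) N" and e_in: "e \<in> presheaf_Hom TA M N"
    by (auto simp: is_epi_def)
  note P_Ob = cellularD(3)[OF P] and Y = cellularD(4)[OF P] and \<iota> = cellularD(5)[OF P]
  have "\<exists>m\<in>carrier (PO M (Y i)). TA.component e (Y i) m = TA.component f (Y i) (\<iota> i)" if i: "i \<in> I" for i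
    using TA.epi_surjective[OF e M N, of "Y i"] S_HomD(1)[OF f P_Ob Y[OF i] \<iota>[OF i]] Y[OF i] by simp
  then obtain m where m: "\<And>i. i \<in> I \<Longrightarrow> m i \<in> carrier (PO M (Y i))"
      "\<And>i. i \<in> I \<Longrightarrow> TA.component e (Y i) (m i) = TA.component f (Y i) (\<iota> i)"
    by metis
  obtain g where g: "g \<in> presheaf_Hom TA (S_alpha T P) M" "\<And>i. i \<in> I \<Longrightarrow> TA.component g (Y i) (\<iota> i) = m i"
    by (rule cellular_extend[OF P M m(1)]) (assumption, rule that)
  have "e \<cdot>\<^bsub>Modules\<^esub> g = f"
  proof (rule cellular_ext[OF P N TA.Mod_Cmp_in[OF S_presheaf[OF P_Ob] g(1) e_in] f])
    show "TA.component (e \<cdot>\<^bsub>Modules\<^esub> g) (Y i) (\<iota> i) = TA.component f (Y i) (\<iota> i)" if i: "i \<in> I" for i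
      using Y[OF i] \<iota>[OF i] P_Ob by (simp add: TA.component_Cmp[OF g(1) e_in] S_carrier g(2)[OF i] m(2)[OF i])
  qed
  then show "\<exists>g\<in>Hom Modules (S_alpha T P) M. e \<cdot>\<^bsub>Modules\<^esub> g = f"
    using g(1) by auto
qed

text \<open>
  The values of \<open>\<tau>\<close> at the coproduct inclusions are maps \<open>Y\<^sub>i \<rightarrow> X\<close>, which combine to the map \<open>t\<close>.
\<close>

lemma cellular_full:
  assumes P: "cellular P I Y \<iota>" and X: "X \<in> Ob T" and \<tau>: "\<tau> \<in> presheaf_Hom TA (S_alpha T P) (S_alpha T X)"
  obtains t where "in_hom t P X" "\<And>x h. x \<in> A \<Longrightarrow> in_hom h x P \<Longrightarrow> TA.component \<tau> x h = t \<cdot> h"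
proof -
  note P_Ob = cellularD(3)[OF P] and Y = cellularD(4)[OF P] and \<iota> = cellularD(5)[OF P]
  have "in_hom (TA.component \<tau> (Y i) (\<iota> i)) (Y i) X" if i: "i \<in> I" for i
    using S_HomD(1)[OF \<tau> P_Ob Y[OF i] \<iota>[OF i]] Y[OF i] X by (simp add: S_carrier)
  then obtain t where t: "in_hom t P X" "\<And>i. i \<in> I \<Longrightarrow> t \<cdot> \<iota> i = TA.component \<tau> (Y i) (\<iota> i)"
    by (rule copair_exists[OF cellularD(2)[OF P] X]) (assumption, rule that)
  have "\<tau> = S_map P X t"
    by (rule cellular_ext[OF P S_Mod[OF X] \<tau> S_map_in[OF t(1)]])
      (use Y \<iota> t(2) in \<open>simp add: S_map_component\<close>)
  then show ?thesis
    using that[OF t(1)] S_map_component by metis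
qed

subsection \<open>Short exact sequences\<close>

lemma A_injective_eq:
  assumes tri: "exact_triangle T K P X k p v" "surjective_on A p" and x: "x \<in> A"
    and t: "in_hom t x K" "in_hom t' x K" and eq: "k \<cdot> t = k \<cdot> t'"
  shows "t = t'"
proof -
  note [simp] = in_homD(1-5)[OF t(1)] in_homD(1-5)[OF t(2)] in_homD(1-5)[OF triD(1)[OF tri(1)]]
  have "in_hom (t \<^bold>- t') x K" "k \<cdot> (t \<^bold>- t') = Zero T x P"
    using eq by (auto simp: in_hom_iff comp_distrib)
  then have "t \<^bold>- t' = Zero T x K"
    using A_surjective_phantom(2)[OF tri x] by blast
  then show ?thesis
    using diff_eq_zero[of t t'] by simp
qed

text \<open>
  The map \<open>S\<^sub>\<alpha> p\<close> is surjective with kernel the image of \<open>S\<^sub>\<alpha> k\<close>, both objectwise, so whatever kills \<open>S\<^sub>\<alpha> k\<close> factors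
  through \<open>S\<^sub>\<alpha> p\<close>.
\<close>

lemma cover_descent:
  assumes tri: "exact_triangle T K P X k p v" and surj: "surjective_on A p" and F: "ab_presheaf TYPE('u) TA F"
    and g: "g \<in> presheaf_Hom TA (S_alpha T P) F"
    and zero: "\<And>x t. x \<in> A \<Longrightarrow> in_hom t x K \<Longrightarrow> TA.component g x (k \<cdot> t) = \<one>\<^bsub>PO F x\<^esub>"
  obtains \<tau> where "\<tau> \<in> presheaf_Hom TA (S_alpha T X) F"
    "\<And>x s. x \<in> A \<Longrightarrow> in_hom s x P \<Longrightarrow> TA.component \<tau> x (p \<cdot> s) = TA.component g x s"
proof -
  note k = triD(1)[OF tri] and p = triD(2)[OF tri]
  note [simp] = in_homD(1-5)[OF k] in_homD(1-5)[OF p]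
  have P_Ob: "P \<in> Ob T" and X_Ob: "X \<in> Ob T" by simp_all
  note gD = S_HomD[OF g P_Ob]
  define s where "s x h = (SOME s. in_hom s x P \<and> p \<cdot> s = h)" for x h
  have s: "in_hom (s x h) x P" "p \<cdot> s x h = h" if "x \<in> A" "in_hom h x X" for x h
  proof -
    have ex: "\<exists>s. in_hom s x P \<and> p \<cdot> s = h"
      by (rule surjective_onD[OF surj p that]) blast
    show "in_hom (s x h) x P" "p \<cdot> s x h = h"
      unfolding s_def using someI_ex[OF ex] by simp_all
  qed
  have indep: "TA.component g x s = TA.component g x s'"
    if x: "x \<in> A" and ss: "in_hom s x P" "in_hom s' x P" "p \<cdot> s = p \<cdot> s'" for x s s'
  proof -
    note [simp] = in_homD(1-5)[OF ss(1)] in_homD(1-5)[OF ss(2)]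
    interpret comm_group "PO F x" using TA.ab_presheafD(1)[OF F] x by simp
    have d: "in_hom (s \<^bold>- s') x P" "p \<cdot> (s \<^bold>- s') = Zero T x X"
      using ss(3) by (auto simp: in_hom_iff comp_distrib)
    obtain t where t: "in_hom t x K" "s \<^bold>- s' = k \<cdot> t"
      using tri_lift[OF tri d] .
    have "s = (s \<^bold>- s') \<^bold>+ s'"
      using add_diff_cancel(2)[of s s'] by simp
    then have "TA.component g x s = TA.component g x (s \<^bold>- s') \<otimes>\<^bsub>PO F x\<^esub> TA.component g x s'"
      using gD(2)[OF x d(1) ss(2)] by simp
    then show ?thesis
      using zero[OF x t(1)] t(2) gD(1)[OF x ss(2)] by simp
  qed
  have \<tau>: "TA.presheaf_map (S_alpha T X) (\<lambda>x h. TA.component g x (s x h)) F \<in> presheaf_Hom TA (S_alpha T X) F"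
  proof (rule TA.presheaf_HomI[OF S_presheaf[OF X_Ob]])
    fix x assume "x \<in> Ob TA"
    then have x: "x \<in> A" by simp
    show "(\<lambda>h. TA.component g x (s x h)) \<in> hom (PO (S_alpha T X) x) (PO F x)"
      unfolding hom_def
    proof (intro CollectI conjI ballI funcsetI)
      fix h assume "h \<in> carrier (PO (S_alpha T X) x)"
      then have h: "in_hom h x X" using x by (simp add: S_carrier)
      show "TA.component g x (s x h) \<in> carrier (PO F x)"
        using gD(1)[OF x s(1)[OF x h]] .
      fix h' assume "h' \<in> carrier (PO (S_alpha T X) x)"
      then have h': "in_hom h' x X" using x by (simp add: S_carrier)
      note hh = add_in_hom[OF h h']
      note [simp] = in_homD(1-5)[OF s(1)[OF x h]] in_homD(1-5)[OF s(1)[OF x h']]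
      have "p \<cdot> (s x h \<^bold>+ s x h') = h \<^bold>+ h'"
        using s(2)[OF x h] s(2)[OF x h'] by (simp add: comp_distrib)
      then have "TA.component g x (s x (h \<^bold>+ h')) = TA.component g x (s x h \<^bold>+ s x h')"
        using s(2)[OF x hh] by (intro indep[OF x s(1)[OF x hh] add_in_hom[OF s(1)[OF x h] s(1)[OF x h']]]) simp
      then show "TA.component g x (s x (h \<otimes>\<^bsub>PO (S_alpha T X) x\<^esub> h')) =
          TA.component g x (s x h) \<otimes>\<^bsub>PO F x\<^esub> TA.component g x (s x h')"
        using gD(2)[OF x s(1)[OF x h] s(1)[OF x h']] by simp
    qed
  next
    fix f x y h assume f: "TA.in_hom f x y" and "h \<in> carrier (PO (S_alpha T X) y)"
    then have xy: "x \<in> A" "y \<in> A" and f': "in_hom f x y" and h: "in_hom h y X"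
      by (auto simp: TA_in_hom S_carrier)
    note hf = comp_in_hom[OF h f'] and sf = comp_in_hom[OF s(1)[OF xy(2) h] f']
    note [simp] = in_homD(1-5)[OF f'] in_homD(1-5)[OF s(1)[OF xy(2) h]]
    have "p \<cdot> (s y h \<cdot> f) = (p \<cdot> s y h) \<cdot> f"
      by (simp add: comp_assoc)
    then have "TA.component g x (s x (h \<cdot> f)) = TA.component g x (s y h \<cdot> f)"
      using s(2)[OF xy(1) hf] s(2)[OF xy(2) h] by (intro indep[OF xy(1) s(1)[OF xy(1) hf] sf]) simp
    then show "TA.component g x (s x (PA (S_alpha T X) f h)) = PA F f (TA.component g y (s y h))"
      using gD(3)[OF xy(2) s(1)[OF xy(2) h] xy(1) f'] by simp
  qed
  show ?thesis
  proof (rule that[OF \<tau>])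
    fix x u assume x: "x \<in> A" and u: "in_hom u x P"
    note pu = comp_in_hom[OF p u]
    have "p \<cdot> u \<in> Hom T x X"
      using in_homD(6)[OF pu] .
    then show "TA.component (TA.presheaf_map (S_alpha T X) (\<lambda>x h. TA.component g x (s x h)) F) x (p \<cdot> u) = TA.component g x u"
      using x indep[OF x s(1)[OF x pu] u s(2)[OF x pu]] by simp
  qed
qed

text \<open>
  Exactness in the middle is that of a triangle; at the left it holds because \<open>T\<^sup>\<alpha>\<close> is closed under suspension, and
  at the right by surjectivity of \<open>p\<close>. Objectwise exactness yields the universal properties.
\<close>

lemma S_short_exact:
  assumes tri: "exact_triangle T K P X k p v" and surj: "surjective_on A p"
  shows "short_exact Modules (S_alpha T K) (S_map K P k) (S_alpha T P) (S_map P X p) (S_alpha T X)"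
proof -
  note k = triD(1)[OF tri] and p = triD(2)[OF tri]
  note [simp] = in_homD(1-5)[OF k] in_homD(1-5)[OF p]
  note Sk = S_map_in[OF k] and Sp = S_map_in[OF p]
  have Ob: "S_alpha T K \<in> Ob Modules" "S_alpha T P \<in> Ob Modules" "S_alpha T X \<in> Ob Modules"
    and psh: "ab_presheaf TYPE('u) TA (S_alpha T K)" "ab_presheaf TYPE('u) TA (S_alpha T P)" "ab_presheaf TYPE('u) TA (S_alpha T X)"
    using S_Mod S_presheaf by auto
  have zero: "S_map P X p \<cdot>\<^bsub>Modules\<^esub> S_map K P k = Zero Modules (S_alpha T K) (S_alpha T X)"
    unfolding TA.Mod_Zero
  proof (rule S_Hom_ext[OF TA.Mod_Cmp_in[OF psh(1) Sk Sp] TA.Mod_Zero_in[OF psh(1,3)]])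
    fix x h assume x: "x \<in> A" and h: "in_hom h x K"
    note [simp] = in_homD(1-5)[OF h] in_homD(6)[OF h]
    have "p \<cdot> (k \<cdot> h) = (p \<cdot> k) \<cdot> h"
      by (simp add: comp_assoc)
    then show "TA.component (S_map P X p \<cdot>\<^bsub>Modules\<^esub> S_map K P k) x h =
        TA.component (TA.presheaf_map (S_alpha T K) (\<lambda>x _. \<one>\<^bsub>PO (S_alpha T X) x\<^esub>) (S_alpha T X)) x h"
      using x h comp_in_hom[OF k h]
      by (simp add: TA.component_Cmp[OF Sk Sp] S_map_component tri_comp_zero[OF tri])
  qed simp
  have ker: "\<exists>!h. h \<in> Hom Modules W (S_alpha T K) \<and> S_map K P k \<cdot>\<^bsub>Modules\<^esub> h = g"
    if W: "W \<in> Ob Modules" and g: "g \<in> Hom Modules W (S_alpha T P)"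
      and pg: "S_map P X p \<cdot>\<^bsub>Modules\<^esub> g = Zero Modules W (S_alpha T X)" for W g
  proof -
    have Wp: "ab_presheaf TYPE('u) TA W" and g: "g \<in> presheaf_Hom TA W (S_alpha T P)"
      using W g by auto
    have gx: "in_hom (TA.component g x w) x P" if "x \<in> A" "w \<in> carrier (PO W x)" for x w
      using TA.presheaf_HomD(2)[OF g, of x w] that by (simp add: S_carrier)
    have "\<exists>t. in_hom t x K \<and> k \<cdot> t = TA.component g x w" if x: "x \<in> A" "w \<in> carrier (PO W x)" for x w
    proof -
      have "TA.component (S_map P X p \<cdot>\<^bsub>Modules\<^esub> g) x w = Zero T x X"
        unfolding pg TA.Mod_Zero using x by simp
      then have "p \<cdot> TA.component g x w = Zero T x X"
        using x gx[OF x] by (simp add: TA.component_Cmp[OF g Sp] S_map_component)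
      then show ?thesis
        by (rule tri_lift[OF tri gx[OF x]]) auto
    qed
    then obtain t where t: "\<And>x w. x \<in> A \<Longrightarrow> w \<in> carrier (PO W x) \<Longrightarrow> in_hom (t x w) x K"
        "\<And>x w. x \<in> A \<Longrightarrow> w \<in> carrier (PO W x) \<Longrightarrow> k \<cdot> t x w = TA.component g x w"
      by metis
    note inj = A_injective_eq[OF tri surj]
    have h: "TA.presheaf_map W t (S_alpha T K) \<in> presheaf_Hom TA W (S_alpha T K)"
    proof (rule TA.presheaf_HomI[OF Wp])
      fix x assume "x \<in> Ob TA"
      then have x: "x \<in> A" by simp
      interpret comm_group "PO W x" using TA.ab_presheafD(1)[OF Wp] x by simp
      show "t x \<in> hom (PO W x) (PO (S_alpha T K) x)"
        unfolding hom_def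
      proof (intro CollectI conjI ballI funcsetI)
        fix w assume w: "w \<in> carrier (PO W x)"
        show "t x w \<in> carrier (PO (S_alpha T K) x)"
          using in_homD(6)[OF t(1)[OF x w]] by simp
        fix w' assume w': "w' \<in> carrier (PO W x)"
        note [simp] = in_homD(1-5)[OF t(1)[OF x w]] in_homD(1-5)[OF t(1)[OF x w']]
        note ww = m_closed[OF w w']
        have "t x (w \<otimes>\<^bsub>PO W x\<^esub> w') = t x w \<^bold>+ t x w'"
          using TA.presheaf_HomD(3)[OF g, of x w w'] x w w'
          by (intro inj[OF x t(1)[OF x ww] add_in_hom[OF t(1)[OF x w] t(1)[OF x w']]])
            (simp add: comp_distrib t(2)[OF x w] t(2)[OF x w'] t(2)[OF x ww])
        then show "t x (w \<otimes>\<^bsub>PO W x\<^esub> w') = t x w \<otimes>\<^bsub>PO (S_alpha T K) x\<^esub> t x w'"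
          by simp
      qed
    next
      fix f x y w assume f: "TA.in_hom f x y" and w: "w \<in> carrier (PO W y)"
      then have xy: "x \<in> A" "y \<in> A" and f': "in_hom f x y"
        by (auto simp: TA_in_hom)
      note fw = TA.PA_closed[OF Wp f w]
      note [simp] = in_homD(1-5)[OF f'] in_homD(1-5)[OF t(1)[OF xy(2) w]]
      have "k \<cdot> (t y w \<cdot> f) = (k \<cdot> t y w) \<cdot> f"
        by (simp add: comp_assoc)
      then have "t x (PA W f w) = t y w \<cdot> f"
        using TA.presheaf_HomD(4)[OF g f w]
        by (intro inj[OF xy(1) t(1)[OF xy(1) fw] comp_in_hom[OF t(1)[OF xy(2) w] f']])
          (simp add: t(2)[OF xy(1) fw] t(2)[OF xy(2) w])
      then show "t x (PA W f w) = PA (S_alpha T K) f (t y w)"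
        by simp
    qed
    have comp: "TA.component (S_map K P k \<cdot>\<^bsub>Modules\<^esub> h) x w = k \<cdot> TA.component h x w \<and> in_hom (TA.component h x w) x K"
      if "h \<in> presheaf_Hom TA W (S_alpha T K)" "x \<in> A" "w \<in> carrier (PO W x)" for h x w
      using TA.presheaf_HomD(2)[OF that(1), of x w] that by (simp add: TA.component_Cmp[OF that(1) Sk] S_carrier S_map_component)
    show ?thesis
    proof (rule ex1I[of _ "TA.presheaf_map W t (S_alpha T K)"])
      have "S_map K P k \<cdot>\<^bsub>Modules\<^esub> TA.presheaf_map W t (S_alpha T K) = g"
        by (rule TA.presheaf_Hom_ext[OF TA.Mod_Cmp_in[OF Wp h Sk] g]) (use comp[OF h] t(2) in simp)
      then show "TA.presheaf_map W t (S_alpha T K) \<in> Hom Modules W (S_alpha T K) \<and>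
          S_map K P k \<cdot>\<^bsub>Modules\<^esub> TA.presheaf_map W t (S_alpha T K) = g"
        using h by simp
      fix h' assume "h' \<in> Hom Modules W (S_alpha T K) \<and> S_map K P k \<cdot>\<^bsub>Modules\<^esub> h' = g"
      then have h': "h' \<in> presheaf_Hom TA W (S_alpha T K)" "S_map K P k \<cdot>\<^bsub>Modules\<^esub> h' = g"
        by auto
      show "h' = TA.presheaf_map W t (S_alpha T K)"
      proof (rule TA.presheaf_Hom_ext[OF h'(1) h])
        fix x w assume x: "x \<in> Ob TA" and w: "w \<in> carrier (PO W x)"
        then have x: "x \<in> A" by simp
        show "TA.component h' x w = TA.component (TA.presheaf_map W t (S_alpha T K)) x w"
          using comp[OF h'(1) x w] x w t(2)[OF x w] h'(2) by (simp add: inj[OF x _ t(1)[OF x w]])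
      qed
    qed
  qed
  have coker: "\<exists>!h. h \<in> Hom Modules (S_alpha T X) W \<and> h \<cdot>\<^bsub>Modules\<^esub> S_map P X p = g"
    if W: "W \<in> Ob Modules" and g: "g \<in> Hom Modules (S_alpha T P) W"
      and gk: "g \<cdot>\<^bsub>Modules\<^esub> S_map K P k = Zero Modules (S_alpha T K) W" for W g
  proof -
    have Wp: "ab_presheaf TYPE('u) TA W" and g: "g \<in> presheaf_Hom TA (S_alpha T P) W"
      using W g by auto
    have "TA.component g x (k \<cdot> t) = \<one>\<^bsub>PO W x\<^esub>" if x: "x \<in> A" and t: "in_hom t x K" for x t
    proof -
      have "TA.component (g \<cdot>\<^bsub>Modules\<^esub> S_map K P k) x t = \<one>\<^bsub>PO W x\<^esub>"
        unfolding gk TA.Mod_Zero using x in_homD(6)[OF t] by simp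
      then show ?thesis
        using x t in_homD(6)[OF t] by (simp add: TA.component_Cmp[OF Sk g] S_map_component)
    qed
    then obtain \<tau> where \<tau>: "\<tau> \<in> presheaf_Hom TA (S_alpha T X) W"
        "\<And>x s. x \<in> A \<Longrightarrow> in_hom s x P \<Longrightarrow> TA.component \<tau> x (p \<cdot> s) = TA.component g x s"
      by (rule cover_descent[OF tri surj Wp g]) (assumption, assumption, rule that)
    have comp: "TA.component (h \<cdot>\<^bsub>Modules\<^esub> S_map P X p) x s = TA.component h x (p \<cdot> s)"
      if "h \<in> presheaf_Hom TA (S_alpha T X) W" "x \<in> A" "in_hom s x P" for h x s
      using that in_homD(6)[OF that(3)] by (simp add: TA.component_Cmp[OF Sp that(1)] S_map_component)
    show ?thesis
    proof (rule ex1I[of _ \<tau>])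
      have "\<tau> \<cdot>\<^bsub>Modules\<^esub> S_map P X p = g"
        by (rule S_Hom_ext[OF TA.Mod_Cmp_in[OF psh(2) Sp \<tau>(1)] g]) (use comp[OF \<tau>(1)] \<tau>(2) in simp_all)
      then show "\<tau> \<in> Hom Modules (S_alpha T X) W \<and> \<tau> \<cdot>\<^bsub>Modules\<^esub> S_map P X p = g"
        using \<tau>(1) by simp
      fix h assume "h \<in> Hom Modules (S_alpha T X) W \<and> h \<cdot>\<^bsub>Modules\<^esub> S_map P X p = g"
      then have h: "h \<in> presheaf_Hom TA (S_alpha T X) W" "h \<cdot>\<^bsub>Modules\<^esub> S_map P X p = g"
        by auto
      show "h = \<tau>"
      proof (rule S_Hom_ext[OF h(1) \<tau>(1)])
        fix x u assume x: "x \<in> A" and u: "in_hom u x X"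
        obtain s where s: "in_hom s x P" "p \<cdot> s = u"
          using surjective_onD[OF surj p x u] .
        show "TA.component h x u = TA.component \<tau> x u"
          using comp[OF h(1) x s(1)] \<tau>(2)[OF x s(1)] h(2) s(2) by simp
      qed simp
    qed
  qed
  show ?thesis
    unfolding short_exact_def is_kernel_def is_cokernel_def
    using Ob Sk Sp zero ker coker by simp
qed

subsection \<open>Fullness implies projective dimension at most one\<close>

text \<open>
  By fullness the transformation on \<open>S\<^sub>\<alpha> X\<close> induced by \<open>u\<close> comes from a map \<open>f\<close>. The difference \<open>f \<cdot> p - u\<close> is
  phantom, and it vanishes because it starts in a cellular object.
\<close>

lemma full_extension:
  assumes ARM: "ARM \<alpha> T" and P: "cellular P I Y \<iota>"
    and tri: "exact_triangle T K P X k p v" and surj: "surjective_on A p"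
    and u: "in_hom u P Z" and uk: "\<And>x t. x \<in> A \<Longrightarrow> in_hom t x K \<Longrightarrow> u \<cdot> (k \<cdot> t) = Zero T x Z"
  obtains f where "in_hom f X Z" "f \<cdot> p = u"
proof -
  note k = triD(1)[OF tri] and p = triD(2)[OF tri]
  note [simp] = in_homD(1-5)[OF k] in_homD(1-5)[OF p] in_homD(1-5)[OF u]
  have XZ: "X \<in> Ob T" "Z \<in> Ob T" by simp_all
  have "TA.component (S_map P Z u) x (k \<cdot> t) = \<one>\<^bsub>PO (S_alpha T Z) x\<^esub>" if "x \<in> A" "in_hom t x K" for x t
    using uk[OF that] comp_in_hom[OF k that(2)] that(1) by (simp add: S_map_component)
  then obtain \<tau> where \<tau>: "\<tau> \<in> presheaf_Hom TA (S_alpha T X) (S_alpha T Z)"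
      "\<And>x s. x \<in> A \<Longrightarrow> in_hom s x P \<Longrightarrow> TA.component \<tau> x (p \<cdot> s) = TA.component (S_map P Z u) x s"
    by (rule cover_descent[OF tri surj S_presheaf[OF XZ(2)] S_map_in[OF u]]) (assumption, assumption, rule that)
  obtain f where "f \<in> Hom T X Z" and \<tau>f: "\<tau> = S_map X Z f"
    using ARM XZ \<tau>(1) unfolding ARM_def by blast
  then have f: "in_hom f X Z"
    by (simp add: in_hom_def)
  note [simp] = in_homD(1-5)[OF f]
  have "phantom (f \<cdot> p \<^bold>- u)"
    unfolding phantom_def
  proof (intro ballI allI impI)
    fix x s assume x: "x \<in> A" and "in_hom s x (dom (f \<cdot> p \<^bold>- u))"
    then have s: "in_hom s x P" by simp
    note [simp] = in_homD(1-5)[OF s]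
    have "f \<cdot> (p \<cdot> s) = u \<cdot> s"
      using \<tau>(2)[OF x s] x s comp_in_hom[OF p s] by (simp add: \<tau>f S_map_component)
    then show "(f \<cdot> p \<^bold>- u) \<cdot> s = Zero T x (cod (f \<cdot> p \<^bold>- u))"
      by (simp add: comp_distrib comp_assoc)
  qed
  moreover have "in_hom (f \<cdot> p \<^bold>- u) P Z"
    by (simp add: in_hom_iff)
  ultimately have "f \<cdot> p \<^bold>- u = Zero T P Z"
    using phantom_cellular[OF P] by blast
  then have "f \<cdot> p = u"
    using diff_eq_zero[of "f \<cdot> p" u] by simp
  then show ?thesis
    using that f by blast
qed

text \<open>
  Let \<open>\<phi> : K \<rightarrow> \<Sigma>L\<close> be the phantom map in the triangle on a cover \<open>\<pi> : P\<^sub>2 \<rightarrow> K\<close> of the fibre \<open>K\<close> of a cover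
  \<open>p : P\<^sub>1 \<rightarrow> X\<close>. In the cone \<open>Y\<close> of \<open>P\<^sub>2 \<rightarrow> P\<^sub>1\<close>, fullness extends \<open>P\<^sub>1 \<rightarrow> Y\<close> to \<open>X\<close>. This splits \<open>Y \<rightarrow> X\<close>, so that the
  composite phantom \<open>X \<rightarrow> \<Sigma>K \<rightarrow> \<Sigma>\<^sup>2L\<close> vanishes and \<open>\<phi>\<close> extends to \<open>P\<^sub>1\<close>. Fullness then extends the
  map \<open>P\<^sub>1 \<rightarrow> \<Sigma>L\<close> to \<open>X\<close>, whence \<open>\<phi> = 0\<close> and \<open>\<pi>\<close> splits.
\<close>

lemma full_section:
  assumes ARM: "ARM \<alpha> T" and P\<^sub>1: "cellular P\<^sub>1 I Y\<^sub>1 \<iota>"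
    and tri: "exact_triangle T K P\<^sub>1 X k p v" and p: "surjective_on A p"
    and L: "exact_triangle T L P\<^sub>2 K l \<pi> \<phi>" and \<pi>: "surjective_on A \<pi>"
  obtains s where "in_hom s K P\<^sub>2" "\<pi> \<cdot> s = Idt T K"
proof -
  note k_in = triD(1)[OF tri] and p_in = triD(2)[OF tri] and v_in = triD(3)[OF tri]
  note l_in = triD(1)[OF L] and \<pi>_in = triD(2)[OF L] and \<phi>_in = triD(3)[OF L]
  note [simp] = in_homD(1-5)[OF k_in] in_homD(1-5)[OF p_in] in_homD(1-5)[OF v_in] in_homD(1-5)[OF l_in]
    in_homD(1-5)[OF \<pi>_in] in_homD(1-5)[OF \<phi>_in]
  obtain Y u w where Y: "exact_triangle T P\<^sub>2 P\<^sub>1 Y (k \<cdot> \<pi>) u w"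
    using cone_exists[OF comp_in_hom[OF k_in \<pi>_in]] .
  note u_in = triD(2)[OF Y]
  note [simp] = in_homD(1-5)[OF u_in]
  \<comment> \<open>The cone of \<open>Y \<rightarrow> X\<close> is \<open>\<Sigma>\<Sigma>L\<close>, with \<open>\<Sigma>\<phi> \<cdot> v\<close> as the map from \<open>X\<close>.\<close>
  obtain a b where ab: "exact_triangle T (ShO T L) Y X a b (ShA T \<phi> \<cdot> v)" and bu: "b \<cdot> u = p"
    using octahedral[OF rotate[OF L] tri Y] by blast
  note b_in = triD(2)[OF ab]
  note [simp] = in_homD(1-5)[OF b_in]
  have "u \<cdot> (k \<cdot> t) = Zero T x Y" if x: "x \<in> A" and t: "in_hom t x K" for x t
  proof -
    obtain t' where t': "in_hom t' x P\<^sub>2" "\<pi> \<cdot> t' = t"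
      using surjective_onD[OF \<pi> \<pi>_in x t] .
    note [simp] = in_homD(1-5)[OF t'(1)]
    have "u \<cdot> (k \<cdot> t) = (u \<cdot> (k \<cdot> \<pi>)) \<cdot> t'"
      by (simp add: comp_assoc t'(2))
    then show ?thesis
      by (simp add: tri_comp_zero[OF Y])
  qed
  then obtain g where g: "in_hom g X Y" "g \<cdot> p = u"
    by (rule full_extension[OF ARM P\<^sub>1 tri p u_in]) (assumption, assumption, rule that)
  note [simp] = in_homD(1-5)[OF g(1)]
  \<comment> \<open>\<open>b \<cdot> g\<close> is the identity on maps from \<open>T\<^sup>\<alpha>\<close>, hence an isomorphism, and \<open>b\<close> has a right inverse.\<close>
  have bgp: "(b \<cdot> g) \<cdot> p = p"
    by (simp add: comp_assoc g(2) bu)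
  have bg: "(b \<cdot> g) \<cdot> h = h" if x: "x \<in> A" and h: "in_hom h x X" for x h
  proof -
    obtain s where s: "in_hom s x P\<^sub>1" "p \<cdot> s = h"
      using surjective_onD[OF p p_in x h] .
    note [simp] = in_homD(1-5)[OF s(1)]
    have "(b \<cdot> g) \<cdot> (p \<cdot> s) = ((b \<cdot> g) \<cdot> p) \<cdot> s"
      by (simp add: comp_assoc)
    then show ?thesis
      by (simp only: bgp s(2))
  qed
  have "is_iso T X X (b \<cdot> g)"
  proof (rule A_bijective_iso[OF comp_in_hom[OF b_in g(1)]])
    show "surjective_on A (b \<cdot> g)"
      by (rule surjective_onI[OF comp_in_hom[OF b_in g(1)]]) (use bg in blast)
    show "t = Zero T x X" if "x \<in> A" "in_hom t x X" "(b \<cdot> g) \<cdot> t = Zero T x X" for x t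
      using bg[OF that(1,2)] that(3) by simp
  qed
  then obtain g' where g': "in_hom g' X X" "(b \<cdot> g) \<cdot> g' = Idt T X"
    by (rule is_isoE) auto
  note [simp] = in_homD(1-5)[OF g'(1)]
  have "(ShA T \<phi> \<cdot> v) \<cdot> ((b \<cdot> g) \<cdot> g') = ((ShA T \<phi> \<cdot> v) \<cdot> b) \<cdot> (g \<cdot> g')"
    by (simp add: comp_assoc)
  then have "ShA T \<phi> \<cdot> v = Zero T X (ShO T (ShO T L))"
    using tri_comp_zero3[OF ab] by (simp add: g'(2))
  \<comment> \<open>\<open>\<Sigma>\<phi>\<close> vanishes on the image of \<open>v\<close>, so \<open>\<phi>\<close> extends along \<open>k\<close>.\<close>
  then obtain z where z: "in_hom z (ShO T P\<^sub>1) (ShO T (ShO T L))" "ShA T \<phi> = z \<cdot> ShA T k"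
    by (rule tri_extS[OF tri ShA_in_hom[OF \<phi>_in]]) (rule that)
  obtain w\<^sub>0 where w\<^sub>0: "in_hom w\<^sub>0 P\<^sub>1 (ShO T L)" "ShA T w\<^sub>0 = z"
    using ShA_full[OF z(1)] by auto
  note [simp] = in_homD(1-5)[OF w\<^sub>0(1)]
  have "ShA T \<phi> = ShA T (w\<^sub>0 \<cdot> k)"
    by (simp add: z(2) w\<^sub>0(2))
  then have \<phi>: "\<phi> = w\<^sub>0 \<cdot> k"
    by (rule ShA_eqD[OF _ \<phi>_in comp_in_hom[OF w\<^sub>0(1) k_in]])
  have "w\<^sub>0 \<cdot> (k \<cdot> t) = Zero T x (ShO T L)" if x: "x \<in> A" and t: "in_hom t x K" for x t
    using phantomD[OF A_surjective_phantom(1)[OF L \<pi>] \<phi>_in x t] in_homD(1-5)[OF t] by (simp add: \<phi> comp_assoc)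
  then obtain f where f: "in_hom f X (ShO T L)" "f \<cdot> p = w\<^sub>0"
    by (rule full_extension[OF ARM P\<^sub>1 tri p w\<^sub>0(1)]) (assumption, assumption, rule that)
  note [simp] = in_homD(1-5)[OF f(1)]
  have "\<phi> = f \<cdot> (p \<cdot> k)"
    by (simp add: \<phi> comp_assoc flip: f(2))
  then have "\<phi> = Zero T K (ShO T L)"
    by (simp add: tri_comp_zero[OF tri])
  then have "\<phi> \<cdot> Idt T K = Zero T K (ShO T L)"
    by simp
  then obtain s where "in_hom s K P\<^sub>2" "Idt T K = \<pi> \<cdot> s"
    by (rule tri_lift3[OF L, rotated]) (auto simp: in_hom_iff intro: that)
  then show ?thesis
    using that by simp
qed

lemma S_map_Cmp:
  assumes f: "in_hom f X Y" and g: "in_hom g Y Z"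
  shows "S_map Y Z g \<cdot>\<^bsub>Modules\<^esub> S_map X Y f = S_map X Z (g \<cdot> f)"
proof (rule S_Hom_ext[OF TA.Mod_Cmp_in[OF S_presheaf S_map_in[OF f] S_map_in[OF g]] S_map_in[OF comp_in_hom[OF g f]]])
  show "X \<in> Ob T" "X \<in> Ob T"
    using in_homD(4)[OF f] by auto
  fix x h assume x: "x \<in> A" and h: "in_hom h x X"
  show "TA.component (S_map Y Z g \<cdot>\<^bsub>Modules\<^esub> S_map X Y f) x h = TA.component (S_map X Z (g \<cdot> f)) x h"
    using x h in_homD(6)[OF h] comp_in_hom[OF f h] f g
    by (simp add: TA.component_Cmp[OF S_map_in[OF f] S_map_in[OF g]] S_map_component comp_assoc in_hom_iff)
qed

lemma S_map_Idt:
  assumes "X \<in> Ob T" shows "S_map X X (Idt T X) = Idt Modules (S_alpha T X)"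
proof (rule S_Hom_ext)
  have f: "in_hom (Idt T X) X X"
    using assms by (simp add: in_hom_iff)
  show "S_map X X (Idt T X) \<in> presheaf_Hom TA (S_alpha T X) (S_alpha T X)"
    by (rule S_map_in[OF f])
  show "Idt Modules (S_alpha T X) \<in> presheaf_Hom TA (S_alpha T X) (S_alpha T X)"
    unfolding TA.Mod_Idt by (rule TA.Mod_Idt_in[OF S_presheaf[OF assms]])
  show "X \<in> Ob T"
    by (rule assms)
  fix x h assume x: "x \<in> A" and h: "in_hom h x X"
  have "h \<in> carrier (PO (S_alpha T X) x)"
    using x assms in_homD(6)[OF h] by (simp add: S_carrier)
  then have "TA.component (Idt Modules (S_alpha T X)) x h = h"
    unfolding TA.Mod_Idt using x by simp
  then show "TA.component (S_map X X (Idt T X)) x h = TA.component (Idt Modules (S_alpha T X)) x h"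
    using in_homD(1-5)[OF h] by (simp add: S_map_component[OF x h])
qed

lemma Modules_preadditive: "preadditive Modules"
  by (rule TA.Mod_preadditive)

text \<open>
  The fibre \<open>K\<close> of a cellular cover of \<open>X\<close> is a retract of its own cellular cover, so \<open>S\<^sub>\<alpha> K\<close> is projective.
\<close>

lemma full_imp_projdim:
  assumes ARM: "ARM \<alpha> T" and X: "X \<in> Ob T"
  shows "projdim_le Modules 1 (S_alpha T X)"
proof -
  interpret M: preadditive Modules by (rule Modules_preadditive)
  obtain P\<^sub>1 I Y\<^sub>1 \<iota> p where P\<^sub>1: "cellular P\<^sub>1 I Y\<^sub>1 \<iota>" and p: "in_hom p P\<^sub>1 X" "surjective_on A p"
    using cellular_cover[OF X] .
  obtain K k v where K: "exact_triangle T K P\<^sub>1 X k p v"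
    using fibre_exists[OF p(1)] .
  have K_Ob: "K \<in> Ob T"
    using in_homD(4)[OF triD(1)[OF K]] .
  obtain P\<^sub>2 I\<^sub>2 Y\<^sub>2 \<iota>\<^sub>2 \<pi> where P\<^sub>2: "cellular P\<^sub>2 I\<^sub>2 Y\<^sub>2 \<iota>\<^sub>2" and \<pi>: "in_hom \<pi> P\<^sub>2 K" "surjective_on A \<pi>"
    using cellular_cover[OF K_Ob] .
  obtain L l \<phi> where L: "exact_triangle T L P\<^sub>2 K l \<pi> \<phi>"
    using fibre_exists[OF \<pi>(1)] .
  obtain s where s: "in_hom s K P\<^sub>2" "\<pi> \<cdot> s = Idt T K"
    using full_section[OF ARM P\<^sub>1 K p(2) L \<pi>(2)] .
  have "projective Modules (S_alpha T K)"
  proof (rule M.projective_retract[OF cellular_projective[OF P\<^sub>2]])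
    show "M.in_hom (S_map K P\<^sub>2 s) (S_alpha T K) (S_alpha T P\<^sub>2)" "M.in_hom (S_map P\<^sub>2 K \<pi>) (S_alpha T P\<^sub>2) (S_alpha T K)"
      using S_map_in[OF s(1)] S_map_in[OF \<pi>(1)] S_Mod[OF K_Ob] S_Mod[OF cellularD(3)[OF P\<^sub>2]]
      by (auto intro!: M.in_homI simp del: TA.Mod_simps(1))
    show "S_map P\<^sub>2 K \<pi> \<cdot>\<^bsub>Modules\<^esub> S_map K P\<^sub>2 s = Idt Modules (S_alpha T K)"
      unfolding S_map_Cmp[OF s(1) \<pi>(1)] s(2) using S_map_Idt[OF K_Ob] .
  qed
  then show ?thesis
    unfolding One_nat_def projdim_le.simps
    using S_Mod[OF X] cellular_projective[OF P\<^sub>1] S_short_exact[OF K p(2)] by blast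
qed

subsection \<open>Projective dimension at most one implies fullness\<close>

text \<open>
  By Schanuel's lemma \<open>S\<^sub>\<alpha>\<pi>\<close> has a section. The resulting idempotent of \<open>S\<^sub>\<alpha>P\<^sub>2\<close> is the image of an idempotent
  of \<open>P\<^sub>2\<close>, which splits in \<open>T\<close>, and its image is isomorphic to \<open>K\<close>.
\<close>

lemma projdim_section:
  assumes pd: "projdim_le Modules 1 (S_alpha T X)" and P\<^sub>1: "cellular P\<^sub>1 I Y\<^sub>1 \<iota>"
    and tri: "exact_triangle T K P\<^sub>1 X k p v" and p: "surjective_on A p"
    and P\<^sub>2: "cellular P\<^sub>2 I\<^sub>2 Y\<^sub>2 \<iota>\<^sub>2" and \<pi>_in: "in_hom \<pi> P\<^sub>2 K" and \<pi>: "surjective_on A \<pi>"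
  obtains s where "in_hom s K P\<^sub>2" "\<pi> \<cdot> s = Idt T K"
proof -
  interpret M: preadditive Modules by (rule Modules_preadditive)
  obtain P K' i p' where res: "projective Modules P" "short_exact Modules K' i P p' (S_alpha T X)" "projective Modules K'"
    using pd unfolding One_nat_def projdim_le.simps by blast
  have K_Ob: "K \<in> Ob T" and P\<^sub>2_Ob: "P\<^sub>2 \<in> Ob T"
    using in_homD(4,5)[OF \<pi>_in] by auto
  obtain L l \<phi> where L: "exact_triangle T L P\<^sub>2 K l \<pi> \<phi>"
    using fibre_exists[OF \<pi>_in] .
  have coker: "is_cokernel Modules (S_alpha T L) (S_map L P\<^sub>2 l) (S_alpha T P\<^sub>2) (S_map P\<^sub>2 K \<pi>) (S_alpha T K)"
    using S_short_exact[OF L \<pi>] unfolding short_exact_def by blast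
  have epi: "is_epi Modules (S_alpha T P\<^sub>2) (S_alpha T K) (S_map P\<^sub>2 K \<pi>)"
    by (rule M.cokernel_epi[OF coker S_Mod[OF in_homD(4)[OF triD(1)[OF L]]] S_Mod[OF P\<^sub>2_Ob]])
  obtain \<sigma> where "M.in_hom \<sigma> (S_alpha T K) (S_alpha T P\<^sub>2)" and \<pi>\<sigma>: "S_map P\<^sub>2 K \<pi> \<cdot>\<^bsub>Modules\<^esub> \<sigma> = Idt Modules (S_alpha T K)"
    using M.schanuel_section[OF res(2,1,3) S_short_exact[OF tri p] cellular_projective[OF P\<^sub>1] epi S_Mod[OF P\<^sub>2_Ob]] .
  then have \<sigma>: "\<sigma> \<in> presheaf_Hom TA (S_alpha T K) (S_alpha T P\<^sub>2)"
    by (simp add: M.in_hom_def)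
  note S\<pi> = S_map_in[OF \<pi>_in]
  note [simp] = in_homD(1-5)[OF \<pi>_in]
  have \<sigma>_in: "in_hom (TA.component \<sigma> x h) x P\<^sub>2" if "x \<in> A" "in_hom h x K" for x h
    using S_HomD(1)[OF \<sigma> K_Ob that] that P\<^sub>2_Ob by (simp add: S_carrier)
  have \<pi>\<sigma>x: "\<pi> \<cdot> TA.component \<sigma> x h = h" if x: "x \<in> A" and h: "in_hom h x K" for x h
  proof -
    have "TA.component (S_map P\<^sub>2 K \<pi> \<cdot>\<^bsub>Modules\<^esub> \<sigma>) x h = h"
      unfolding \<pi>\<sigma> TA.Mod_Idt using x in_homD(6)[OF h] by simp
    then show ?thesis
      using x in_homD(6)[OF h] \<sigma>_in[OF x h] by (simp add: TA.component_Cmp[OF \<sigma> S\<pi>] S_map_component)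
  qed
  \<comment> \<open>\<open>S\<^sub>\<alpha> e = \<sigma> \<cdot> S\<^sub>\<alpha> \<pi>\<close>; as this is idempotent and \<open>P\<^sub>2\<close> is cellular, \<open>e\<close> is idempotent.\<close>
  obtain e where e: "in_hom e P\<^sub>2 P\<^sub>2" "\<And>x h. x \<in> A \<Longrightarrow> in_hom h x P\<^sub>2 \<Longrightarrow>
      TA.component (\<sigma> \<cdot>\<^bsub>Modules\<^esub> S_map P\<^sub>2 K \<pi>) x h = e \<cdot> h"
    by (rule cellular_full[OF P\<^sub>2 P\<^sub>2_Ob TA.Mod_Cmp_in[OF S_presheaf[OF P\<^sub>2_Ob] S\<pi> \<sigma>]]) (rule that)
  note [simp] = in_homD(1-5)[OF e(1)]
  have ex: "e \<cdot> h = TA.component \<sigma> x (\<pi> \<cdot> h)" if x: "x \<in> A" and h: "in_hom h x P\<^sub>2" for x h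
    using e(2)[OF x h] x h in_homD(6)[OF h] by (simp add: TA.component_Cmp[OF S\<pi> \<sigma>] S_map_component)
  have "phantom (e \<cdot> e \<^bold>- e)"
    unfolding phantom_def
  proof (intro ballI allI impI)
    fix x h assume x: "x \<in> A" and "in_hom h x (dom (e \<cdot> e \<^bold>- e))"
    then have h: "in_hom h x P\<^sub>2" by simp
    note [simp] = in_homD(1-5)[OF h]
    note \<pi>h = comp_in_hom[OF \<pi>_in h]
    have "e \<cdot> (e \<cdot> h) = e \<cdot> h"
      unfolding ex[OF x comp_in_hom[OF e(1) h]] using ex[OF x h] \<pi>\<sigma>x[OF x \<pi>h] by simp
    then show "(e \<cdot> e \<^bold>- e) \<cdot> h = Zero T x (cod (e \<cdot> e \<^bold>- e))"
      by (simp add: comp_distrib comp_assoc)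
  qed
  moreover have "in_hom (e \<cdot> e \<^bold>- e) P\<^sub>2 P\<^sub>2"
    by (simp add: in_hom_iff)
  ultimately have "e \<cdot> e \<^bold>- e = Zero T P\<^sub>2 P\<^sub>2"
    using phantom_cellular[OF P\<^sub>2] by blast
  then have ee: "e \<cdot> e = e"
    using diff_eq_zero[of "e \<cdot> e" e] by simp
  obtain Q \<kappa> where Q: "is_coproduct T (UNIV :: nat set) (\<lambda>_. P\<^sub>2) Q \<kappa>"
    by (rule coproduct_exists[OF small_countable[OF universe, of "UNIV :: nat set"], of "\<lambda>_. P\<^sub>2"])
      (simp, rule P\<^sub>2_Ob, rule that)
  obtain B a q where a: "in_hom a P\<^sub>2 B" and q: "in_hom q B P\<^sub>2" and aq: "a \<cdot> q = Idt T B" and qa: "q \<cdot> a = e"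
    using idempotent_splits[OF e(1) ee Q] .
  note [simp] = in_homD(1-5)[OF a] in_homD(1-5)[OF q]
  \<comment> \<open>\<open>\<pi>\<close> and \<open>\<sigma>\<close> identify \<open>S\<^sub>\<alpha> K\<close> with the image of \<open>S\<^sub>\<alpha> e\<close>, which is \<open>S\<^sub>\<alpha> B\<close>.\<close>
  have "is_iso T B K (\<pi> \<cdot> q)"
  proof (rule A_bijective_iso[OF comp_in_hom[OF \<pi>_in q]])
    show "surjective_on A (\<pi> \<cdot> q)"
    proof (rule surjective_onI[OF comp_in_hom[OF \<pi>_in q]])
      fix x h assume x: "x \<in> A" and h: "in_hom h x K"
      note \<sigma>h = \<sigma>_in[OF x h]
      note [simp] = in_homD(1-5)[OF \<sigma>h]
      have "(\<pi> \<cdot> q) \<cdot> (a \<cdot> TA.component \<sigma> x h) = \<pi> \<cdot> ((q \<cdot> a) \<cdot> TA.component \<sigma> x h)"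
        by (simp add: comp_assoc)
      also have "\<dots> = h"
        by (simp add: qa ex[OF x \<sigma>h] \<pi>\<sigma>x[OF x h])
      finally show "\<exists>t. in_hom t x B \<and> (\<pi> \<cdot> q) \<cdot> t = h"
        using comp_in_hom[OF a \<sigma>h] by blast
    qed
    fix x t assume x: "x \<in> A" and t: "in_hom t x B" and zero: "(\<pi> \<cdot> q) \<cdot> t = Zero T x K"
    note [simp] = in_homD(1-5)[OF t] A_Ob[OF x]
    note qt = comp_in_hom[OF q t]
    have "\<pi> \<cdot> (q \<cdot> t) = Zero T x K"
      using zero by (simp add: comp_assoc)
    then have "e \<cdot> (q \<cdot> t) = TA.component \<sigma> x (Zero T x K)"
      unfolding ex[OF x qt] by simp
    also have "\<dots> = TA.component \<sigma> x (\<pi> \<cdot> Zero T x P\<^sub>2)"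
      by simp
    also have "\<dots> = Zero T x P\<^sub>2"
      unfolding ex[OF x zero_in_hom[OF A_Ob[OF x] P\<^sub>2_Ob], symmetric] by simp
    finally have "(a \<cdot> (q \<cdot> a)) \<cdot> (q \<cdot> t) = Zero T x B"
      by (simp add: comp_assoc qa)
    moreover have "(a \<cdot> (q \<cdot> a)) \<cdot> (q \<cdot> t) = (a \<cdot> q) \<cdot> ((a \<cdot> q) \<cdot> t)"
      by (simp add: comp_assoc)
    ultimately show "t = Zero T x B"
      by (simp add: aq)
  qed
  then obtain r where r: "in_hom r K B" "(\<pi> \<cdot> q) \<cdot> r = Idt T K"
    by (rule is_isoE) (auto simp: K_Ob)
  have "\<pi> \<cdot> (q \<cdot> r) = Idt T K"
    using r in_homD(1-5)[OF r(1)] by (simp add: comp_assoc)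
  then show ?thesis
    using that comp_in_hom[OF q r(1)] by blast
qed

text \<open>
  A transformation \<open>\<tau>\<close> from \<open>S\<^sub>\<alpha> X\<close> restricts along a cover \<open>P\<^sub>1 \<rightarrow> X\<close> to one that is induced by some \<open>g : P\<^sub>1 \<rightarrow> Y\<close>. The
  restriction of \<open>g\<close> to the fibre \<open>K\<close> is phantom. It is zero because \<open>K\<close> is a retract of a cellular object, so
  \<open>g\<close> factors through \<open>X\<close>, and the factor induces \<open>\<tau>\<close>.
\<close>

lemma projdim_imp_full:
  assumes pd: "\<And>X. X \<in> Ob T \<Longrightarrow> projdim_le Modules 1 (S_alpha T X)"
  shows "ARM \<alpha> T"
  unfolding ARM_def
proof (intro ballI)
  fix X Y \<tau> assume X: "X \<in> Ob T" and Y: "Y \<in> Ob T" and \<tau>: "\<tau> \<in> presheaf_Hom TA (S_alpha T X) (S_alpha T Y)"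
  obtain P\<^sub>1 I Y\<^sub>1 \<iota> p where P\<^sub>1: "cellular P\<^sub>1 I Y\<^sub>1 \<iota>" and p: "in_hom p P\<^sub>1 X" "surjective_on A p"
    using cellular_cover[OF X] .
  obtain K k v where K: "exact_triangle T K P\<^sub>1 X k p v"
    using fibre_exists[OF p(1)] .
  note k = triD(1)[OF K]
  note [simp] = in_homD(1-5)[OF p(1)] in_homD(1-5)[OF k]
  have K_Ob: "K \<in> Ob T" and P\<^sub>1_Ob: "P\<^sub>1 \<in> Ob T" by simp_all
  obtain P\<^sub>2 I\<^sub>2 Y\<^sub>2 \<iota>\<^sub>2 \<pi> where P\<^sub>2: "cellular P\<^sub>2 I\<^sub>2 Y\<^sub>2 \<iota>\<^sub>2" and \<pi>: "in_hom \<pi> P\<^sub>2 K" "surjective_on A \<pi>"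
    using cellular_cover[OF K_Ob] .
  obtain s where s: "in_hom s K P\<^sub>2" "\<pi> \<cdot> s = Idt T K"
    using projdim_section[OF pd[OF X] P\<^sub>1 K p(2) P\<^sub>2 \<pi>] .
  note Sp = S_map_in[OF p(1)]
  obtain g where g: "in_hom g P\<^sub>1 Y" "\<And>x h. x \<in> A \<Longrightarrow> in_hom h x P\<^sub>1 \<Longrightarrow>
      TA.component (\<tau> \<cdot>\<^bsub>Modules\<^esub> S_map P\<^sub>1 X p) x h = g \<cdot> h"
    by (rule cellular_full[OF P\<^sub>1 Y TA.Mod_Cmp_in[OF S_presheaf[OF P\<^sub>1_Ob] Sp \<tau>]]) (rule that)
  have gx: "g \<cdot> h = TA.component \<tau> x (p \<cdot> h)" if x: "x \<in> A" and h: "in_hom h x P\<^sub>1" for x h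
    using g(2)[OF x h] x h in_homD(6)[OF h] by (simp add: TA.component_Cmp[OF Sp \<tau>] S_map_component)
  note [simp] = in_homD(1-5)[OF g(1)] in_homD(1-5)[OF \<pi>(1)] in_homD(1-5)[OF s(1)]
  have gk: "g \<cdot> (k \<cdot> t) = Zero T x Y" if x: "x \<in> A" and t: "in_hom t x K" for x t
  proof -
    note [simp] = in_homD(1-5)[OF t] A_Ob[OF x]
    have "p \<cdot> (k \<cdot> t) = (p \<cdot> k) \<cdot> t"
      by (simp add: comp_assoc)
    also have "\<dots> = p \<cdot> Zero T x P\<^sub>1"
      by (simp add: tri_comp_zero[OF K])
    finally have "g \<cdot> (k \<cdot> t) = g \<cdot> Zero T x P\<^sub>1"
      using gx[OF x comp_in_hom[OF k t]] gx[OF x zero_in_hom[OF A_Ob[OF x] P\<^sub>1_Ob]] by simp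
    then show ?thesis by simp
  qed
  have "phantom (g \<cdot> (k \<cdot> \<pi>))"
    unfolding phantom_def
  proof (intro ballI allI impI)
    fix x t assume x: "x \<in> A" and "in_hom t x (dom (g \<cdot> (k \<cdot> \<pi>)))"
    then have t: "in_hom t x P\<^sub>2" by simp
    show "(g \<cdot> (k \<cdot> \<pi>)) \<cdot> t = Zero T x (cod (g \<cdot> (k \<cdot> \<pi>)))"
      using gk[OF x comp_in_hom[OF \<pi>(1) t]] in_homD(1-5)[OF t] by (simp add: comp_assoc)
  qed
  then have gk\<pi>: "g \<cdot> (k \<cdot> \<pi>) = Zero T P\<^sub>2 Y"
    using phantom_cellular[OF P\<^sub>2 comp_in_hom[OF g(1) comp_in_hom[OF k \<pi>(1)]]] by blast
  have "g \<cdot> k = (g \<cdot> (k \<cdot> \<pi>)) \<cdot> s"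
    by (simp add: comp_assoc s(2))
  then have "g \<cdot> k = Zero T K Y"
    using Y by (simp add: gk\<pi>)
  then obtain f where f: "in_hom f X Y" "g = f \<cdot> p"
    using tri_ext[OF K g(1)] by blast
  have "\<tau> = S_map X Y f"
  proof (rule S_Hom_ext[OF \<tau> S_map_in[OF f(1)] X])
    fix x h assume x: "x \<in> A" and h: "in_hom h x X"
    obtain u where u: "in_hom u x P\<^sub>1" "p \<cdot> u = h"
      using surjective_onD[OF p(2,1) x h] .
    have "g \<cdot> u = f \<cdot> h"
      using u(2) in_homD(1-5)[OF u(1)] in_homD(1-5)[OF f(1)] by (simp add: f(2) comp_assoc)
    then show "TA.component \<tau> x h = TA.component (S_map X Y f) x h"
      using gx[OF x u(1)] u(2) x h by (simp add: S_map_component)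
  qed
  then show "\<exists>f\<in>Hom T X Y. \<tau> = S_map X Y f"
    using in_homD(6)[OF f(1)] by blast
qed

end

theorem corollary2p6:
  fixes T :: "('o, 'm) triangulated" and \<alpha> :: "'u rel"
  assumes "universe TYPE('u)"
    and "regular_cardinal \<alpha>" and "small TYPE('u) (Field \<alpha>)"
    and "triangulated T" and "locally_small TYPE('u) T" and "has_small_coproducts TYPE('u) T"
    and "\<exists>X\<in>Ob T. \<not> is_zero_object T X"
    and "alpha_compactly_generated \<alpha> T"
  shows "ARM \<alpha> T \<longleftrightarrow>
    (\<forall>X\<in>Ob T. projdim_le (Mod_alpha \<alpha> (alpha_subcategory \<alpha> T)) 1 (S_alpha T X))"
proof -
  interpret well_generated T \<alpha>
    using assms by (intro well_generated.intro regular.intro well_generated_axioms.intro)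
  show ?thesis
    using full_imp_projdim projdim_imp_full by blast
qed

end
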